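(* Let $r_1,r_2>0$, $\lambda_0>1$, $a,b>0$, let $\Omega=R_2\setminus\overline{R_1}$ be the rectangular annulus defined in the context, and let $u$ be the weak solution of the mixed problem (given in the context) in $\Omega$ with data $a,b$. Then Berg's effect holds for $(\Omega,a,b)$ if and only if $u\in C^1(\overline{\Omega})$.
   Context: For $r_1,r_2>0$ and $\lambda_0>1$ set $R_1=(-r_1,r_1)\times(-r_2,r_2)$, $R_2=\lambda_0R_1=(-\lambda_0r_1,\lambda_0r_1)\times(-\lambda_0r_2,\lambda_0r_2)$, $\Omega=R_2\setminus\overline{R_1}\subset\mathbb{R}^2$, $\Gamma=\partial R_1$, $\widetilde\Gamma=\partial R_2$. Points of the plane are written $(x,y)=(x_1,x_2)$. The top side of the inner rectangle is $\Gamma_1=\{(t,r_2): t\in(-r_1,r_1)\}$ and the right side is $\Gamma_4=\{(r_1,t): t\in(-r_2,r_2)\}$. Mixed problem: for numbers $a,b$, consider $$\Delta u=0\ \text{in }\Omega,\qquad u=0\ \text{on }\widetilde\Gamma,\qquad \frac{\partial u}{\partial \mathbf n}=u_n\ \text{on }\Gamma,$$ where $\mathbf n$ is the unit normal to $\partial\Omega$ pointing out of $\Omega$, and $u_n=a$ on the part of $\Gamma$ where $|x_2|=r_2$, $u_n=b$ on the part of $\Gamma$ where $|x_1|=r_1$. The weak solution is the unique $u\in H^1(\Omega)$ with zero trace on $\widetilde\Gamma$ such that $\int_\Omega\nabla u\cdot\nabla\varphi=\int_\Gamma u_n\varphi$ for all $\varphi\in H^1(\Omega)$ with zero trace on $\widetilde\Gamma$.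 (It is smooth up to the open sides of $\Gamma$, so $u_x,u_y$ make sense there.) Berg's effect: for $a,b>0$, one says that Berg's effect holds for $(\Omega,a,b)$ if the weak solution $u$ satisfies $x\,u_x\le 0$ on $\Gamma_1$ and $y\,u_y\le 0$ on $\Gamma_4$. *)

theory Defs
  imports "HOL-Analysis.Analysis"
begin

subsection \<open>Smooth functions and Sobolev functions\<close>

primrec Ck :: "nat \<Rightarrow> ('a::euclidean_space \<Rightarrow> real) \<Rightarrow> bool" where
  "Ck 0 f \<longleftrightarrow> continuous_on UNIV f"
| "Ck (Suc k) f \<longleftrightarrow>
     (\<exists>G. (\<forall>x. GDERIV f x :> G x) \<and> (\<forall>e\<in>Basis. Ck k (\<lambda>x. G x \<bullet> e)))"

definition smooth :: "('a::euclidean_space \<Rightarrow> real) \<Rightarrow> bool" where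
  "smooth f \<longleftrightarrow> (\<forall>k. Ck k f)"

definition test_function :: "'a::euclidean_space set \<Rightarrow> ('a \<Rightarrow> real) \<Rightarrow> bool" where
  "test_function \<Omega> \<phi> \<longleftrightarrow>
     smooth \<phi> \<and> compact (closure {x. \<phi> x \<noteq> 0}) \<and> closure {x. \<phi> x \<noteq> 0} \<subseteq> \<Omega>"

definition L2 :: "'a measure \<Rightarrow> ('a \<Rightarrow> 'b::euclidean_space) \<Rightarrow> bool" where
  "L2 M f \<longleftrightarrow> f \<in> borel_measurable M \<and> integrable M (\<lambda>x. (norm (f x))\<^sup>2)"

definition L2_tendsto ::
  "'a measure \<Rightarrow> (nat \<Rightarrow> 'a \<Rightarrow> 'b::euclidean_space) \<Rightarrow> ('a \<Rightarrow> 'b) \<Rightarrow> bool" where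
  "L2_tendsto M F f \<longleftrightarrow> (\<forall>n. L2 M (F n)) \<and> L2 M f \<and>
     (\<lambda>n. \<integral>x. (norm (F n x - f x))\<^sup>2 \<partial>M) \<longlonglongrightarrow> 0"

text \<open>\<open>H1 \<Omega> u g\<close>: \<open>u\<close> lies in the Sobolev space of order one on the open set \<open>\<Omega>\<close>, and
  \<open>g\<close> is its weak gradient there. Functions stand for their classes modulo null sets of \<open>\<Omega>\<close>;
  values outside \<open>\<Omega>\<close> are irrelevant.\<close>

definition H1 ::
  "'a::euclidean_space set \<Rightarrow> ('a \<Rightarrow> real) \<Rightarrow> ('a \<Rightarrow> 'a) \<Rightarrow> bool" where
  "H1 \<Omega> u g \<longleftrightarrow> L2 (lebesgue_on \<Omega>) u \<and> L2 (lebesgue_on \<Omega>) g \<and>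
     (\<forall>\<phi> d\<phi>. test_function \<Omega> \<phi> \<and> (\<forall>x. GDERIV \<phi> x :> d\<phi> x) \<longrightarrow>
        (\<integral>x. u x *\<^sub>R d\<phi> x \<partial>lebesgue_on \<Omega>) = - (\<integral>x. \<phi> x *\<^sub>R g x \<partial>lebesgue_on \<Omega>))"

text \<open>\<open>has_trace \<Omega> \<sigma> u \<tau>\<close>, where \<open>\<sigma>\<close> is the surface measure on (a part of) the boundary of the
  bounded Lipschitz domain \<open>\<Omega>\<close>: the trace of \<open>u\<close> on that part is \<open>\<tau>\<close>. The trace operator
  is the continuous extension, from the functions smooth up to the boundary to all Sobolev
  functions, of the restriction to the boundary; the relation below is the graph of that
  extension.\<close>

definition has_trace ::
  "'a::euclidean_space set \<Rightarrow> 'a measure \<Rightarrow> ('a \<Rightarrow> real) \<Rightarrow> ('a \<Rightarrow> real) \<Rightarrow> bool" where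
  "has_trace \<Omega> \<sigma> u \<tau> \<longleftrightarrow>
     (\<exists>g \<psi> d\<psi>. H1 \<Omega> u g \<and>
        (\<forall>n. smooth (\<psi> n) \<and> (\<forall>x. GDERIV (\<psi> n) x :> d\<psi> n x)) \<and>
        L2_tendsto (lebesgue_on \<Omega>) \<psi> u \<and>
        L2_tendsto (lebesgue_on \<Omega>) d\<psi> g \<and>
        L2_tendsto \<sigma> \<psi> \<tau>)"

text \<open>\<open>C1_extension \<Omega> T u v g\<close>, for \<open>\<Omega>\<close> open and \<open>T\<close> between \<open>\<Omega>\<close> and its closure: \<open>v\<close> is the
  representative of the class of \<open>u\<close> that is continuously differentiable in \<open>\<Omega>\<close>, and \<open>v\<close> and
  its gradient \<open>g\<close> extend continuously to \<open>T\<close>; on \<open>T - \<Omega>\<close> the values of \<open>v\<close> and \<open>g\<close> are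
  those of the (unique) continuous extensions.\<close>

definition C1_extension ::
  "'a::euclidean_space set \<Rightarrow> 'a set \<Rightarrow> ('a \<Rightarrow> real) \<Rightarrow> ('a \<Rightarrow> real) \<Rightarrow> ('a \<Rightarrow> 'a) \<Rightarrow> bool" where
  "C1_extension \<Omega> T u v g \<longleftrightarrow>
     (AE x in lebesgue_on \<Omega>. u x = v x) \<and> (\<forall>x\<in>\<Omega>. GDERIV v x :> g x) \<and>
     continuous_on T v \<and> continuous_on T g"

definition C1_closure :: "'a::euclidean_space set \<Rightarrow> ('a \<Rightarrow> real) \<Rightarrow> bool" where
  "C1_closure \<Omega> u \<longleftrightarrow> (\<exists>v g. C1_extension \<Omega> (closure \<Omega>) u v g)"


subsection \<open>The rectangular annulus\<close>

definition rect :: "real \<Rightarrow> real \<Rightarrow> (real \<times> real) set" where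
  "rect r1 r2 = {-r1<..<r1} \<times> {-r2<..<r2}"

definition annulus :: "real \<Rightarrow> real \<Rightarrow> real \<Rightarrow> (real \<times> real) set" where
  "annulus r1 r2 lam = ((\<lambda>z. lam *\<^sub>R z) ` rect r1 r2) - closure (rect r1 r2)"

definition top_side :: "real \<Rightarrow> real \<Rightarrow> (real \<times> real) set" where
  "top_side r1 r2 = {(t, r2) | t. t \<in> {-r1<..<r1}}"

definition right_side :: "real \<Rightarrow> real \<Rightarrow> (real \<times> real) set" where
  "right_side r1 r2 = {(r1, t) | t. t \<in> {-r2<..<r2}}"

definition hseg_measure :: "real \<Rightarrow> real \<Rightarrow> (real \<times> real) measure" where
  "hseg_measure r c = distr (restrict_space lborel {-r<..<r}) borel (\<lambda>t. (t, c))"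

definition vseg_measure :: "real \<Rightarrow> real \<Rightarrow> (real \<times> real) measure" where
  "vseg_measure r c = distr (restrict_space lborel {-r<..<r}) borel (\<lambda>t. (c, t))"

text \<open>Arc length on the boundary of \<open>rect r1 r2\<close>, as a Borel measure on the plane: the sum of
  the length measures of the four open sides (the corners form a null set).\<close>

definition bdry_measure :: "real \<Rightarrow> real \<Rightarrow> (real \<times> real) measure" where
  "bdry_measure r1 r2 = measure_of UNIV (sets borel)
     (\<lambda>A. emeasure (hseg_measure r1 r2) A + emeasure (hseg_measure r1 (- r2)) A
        + emeasure (vseg_measure r2 r1) A + emeasure (vseg_measure r2 (- r1)) A)"

lemma sets_bdry_measure [simp, measurable_cong]: "sets (bdry_measure r1 r2) = sets borel"
  using sets.sigma_sets_eq[of "borel :: (real \<times> real) measure"]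
  by (simp add: bdry_measure_def)

lemma space_bdry_measure [simp]: "space (bdry_measure r1 r2) = UNIV"
  by (simp add: bdry_measure_def)

text \<open>The set function in the definition is countably additive, so \<open>measure_of\<close> keeps it.\<close>

lemma emeasure_bdry_measure:
  assumes "A \<in> sets borel"
  shows "emeasure (bdry_measure r1 r2) A =
     emeasure (hseg_measure r1 r2) A + emeasure (hseg_measure r1 (- r2)) A
        + emeasure (vseg_measure r2 r1) A + emeasure (vseg_measure r2 (- r1)) A"
proof (rule emeasure_measure_of[OF bdry_measure_def])
  show "countably_additive (sets (bdry_measure r1 r2))
     (\<lambda>A. emeasure (hseg_measure r1 r2) A + emeasure (hseg_measure r1 (- r2)) A
        + emeasure (vseg_measure r2 r1) A + emeasure (vseg_measure r2 (- r1)) A)"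
  proof (rule countably_additiveI)
    fix B :: "nat \<Rightarrow> (real \<times> real) set"
    assume B: "range B \<subseteq> sets (bdry_measure r1 r2)" "disjoint_family B"
    have *: "(\<Sum>i. emeasure N (B i)) = emeasure N (\<Union>i. B i)" if "sets N = sets borel" for N
      using suminf_emeasure[of B N] B that by simp
    show "(\<Sum>i. emeasure (hseg_measure r1 r2) (B i) + emeasure (hseg_measure r1 (- r2)) (B i)
          + emeasure (vseg_measure r2 r1) (B i) + emeasure (vseg_measure r2 (- r1)) (B i))
      = emeasure (hseg_measure r1 r2) (\<Union>i. B i) + emeasure (hseg_measure r1 (- r2)) (\<Union>i. B i)
          + emeasure (vseg_measure r2 r1) (\<Union>i. B i) + emeasure (vseg_measure r2 (- r1)) (\<Union>i. B i)"
      by (simp add: suminf_add[symmetric] * hseg_measure_def vseg_measure_def)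
  qed
qed (use assms in \<open>auto simp: positive_def\<close>)


subsection \<open>The mixed problem and Berg's effect\<close>

definition flux :: "real \<Rightarrow> real \<Rightarrow> real \<Rightarrow> real \<times> real \<Rightarrow> real" where
  "flux r2 a b z = (if \<bar>snd z\<bar> = r2 then a else b)"

definition weak_solution ::
  "real \<Rightarrow> real \<Rightarrow> real \<Rightarrow> real \<Rightarrow> real \<Rightarrow> (real \<times> real \<Rightarrow> real) \<Rightarrow> bool" where
  "weak_solution r1 r2 lam a b u \<longleftrightarrow>
     has_trace (annulus r1 r2 lam) (bdry_measure (lam * r1) (lam * r2)) u (\<lambda>_. 0) \<and>
     (\<exists>g. H1 (annulus r1 r2 lam) u g \<and>
        (\<forall>\<phi> h \<tau>.
           H1 (annulus r1 r2 lam) \<phi> h \<and>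
           has_trace (annulus r1 r2 lam) (bdry_measure (lam * r1) (lam * r2)) \<phi> (\<lambda>_. 0) \<and>
           has_trace (annulus r1 r2 lam) (bdry_measure r1 r2) \<phi> \<tau> \<longrightarrow>
           (\<integral>z. g z \<bullet> h z \<partial>lebesgue_on (annulus r1 r2 lam)) =
             (\<integral>z. flux r2 a b z * \<tau> z \<partial>bdry_measure r1 r2)))"

text \<open>On the two open sides, the partial derivatives of the solution are the components of the
  continuous extension of its gradient.\<close>

definition bergs_effect :: "real \<Rightarrow> real \<Rightarrow> real \<Rightarrow> real \<Rightarrow> real \<Rightarrow> bool" where
  "bergs_effect r1 r2 lam a b \<longleftrightarrow>
     (\<exists>u v g. weak_solution r1 r2 lam a b u \<and>
        C1_extension (annulus r1 r2 lam)
          (annulus r1 r2 lam \<union> top_side r1 r2 \<union> right_side r1 r2) u v g \<and>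
        (\<forall>z\<in>top_side r1 r2. fst z * fst (g z) \<le> 0) \<and>
        (\<forall>z\<in>right_side r1 r2. snd z * snd (g z) \<le> 0))"

end

theory Submission
  imports Defs "HOL-Complex_Analysis.Complex_Analysis" "HOL-Real_Asymp.Real_Asymp"
begin

text \<open>A solution of class \<open>C\<^sup>1\<close> up to the relevant sides gives the holomorphic function \<open>h = u_x - i u_y\<close>.
  Its integrability makes \<open>|h|\<close> times the distance to the boundary tend to zero, so that after reflection \<open>h\<close>
  extends to the outer sides and, in the variable \<open>q\<close> with \<open>z = c - q\<close> at an outer corner or
  \<open>z = c - i q\<^sup>3\<close> at an inner corner \<open>c\<close>, one gets \<open>(h - h0) dz/d(q\<^sup>2) = l + O(q\<^sup>2)\<close>, where \<open>h0\<close> is the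
  value prescribed by the data and \<open>l\<close> is a constant. At an outer corner this suffices for continuity of \<open>h\<close>; at an
  inner corner continuity means \<open>l = 0\<close>, and Berg's inequalities on the two adjacent sides say that the real number
  \<open>l\<close> is both nonpositive and nonnegative.
  Conversely, if \<open>h\<close> is continuous, the maximum principle for \<open>u_x\<close> on the right half and for \<open>u_y\<close> on
  the upper half of the annulus gives Berg's effect.\<close>

text \<open>At an inner corner the opening angle is 3pi/2, where a harmonic function with zero
  Neumann data generically behaves like r^(2/3) and its gradient like r^(-1/3). Such a gradient is
  square integrable, so finite energy cannot exclude it; \<open>l\<close> is the coefficient of this
  singular term. Substituting \<zeta> = q^2 opens either kind of corner to a half-disc on whose
  diameter the pulled-back derivative is real, up to a factor \<i> for Dirichlet data. Reflection
  leaves an isolated singularity at the corner. The difficulty is to remove it, because finite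
  energy only gives a bound o(1) / |Im \<zeta>|, which degenerates along the diameter. At an inner
  corner dz/d\<zeta> vanishes, so the contributions of a and b to the edge values tend to 0 and only
  the signs of the tangential derivatives decide the sign of \<open>l\<close>. Uniqueness of the
  weak solution serves twice: \<open>bergs_effect\<close> speaks of some weak solution, and
  uniqueness makes the solution invariant under reflections in the axes, which leaves a single
  quadrant to be studied.\<close>

lemmas HK_integral_add = Henstock_Kurzweil_Integration.integral_add
lemmas HK_integral_cong = Henstock_Kurzweil_Integration.integral_cong
lemmas HK_integral_diff = Henstock_Kurzweil_Integration.integral_diff
lemmas HK_integral_nonneg = Henstock_Kurzweil_Integration.integral_nonneg

subsection \<open>Smooth functions\<close>

lemma GDERIV_imp_isCont: "GDERIV f x :> d \<Longrightarrow> isCont f x"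
  unfolding gderiv_def by (rule has_derivative_continuous)

lemma Ck_Suc_imp_Ck: "Ck (Suc k) f \<Longrightarrow> Ck k f"
proof (induction k arbitrary: f)
  case 0
  then show ?case
    by (metis Ck.simps GDERIV_imp_isCont continuous_at_imp_continuous_on)
next
  case (Suc k)
  from Suc.prems obtain G where "\<forall>x. GDERIV f x :> G x" "\<forall>e\<in>Basis. Ck (Suc k) (\<lambda>x. G x \<bullet> e)"
    by auto
  with Suc.IH show ?case by (auto simp del: Ck.simps(2) simp: Ck.simps(2)[of k f])
qed

lemma Ck_const: "Ck k (\<lambda>x. c)"
proof (induction k arbitrary: c)
  case (Suc k)
  then show ?case by (auto intro!: exI[of _ "\<lambda>x. 0"] GDERIV_const)
qed auto

lemma Ck_add: "Ck k f \<Longrightarrow> Ck k g \<Longrightarrow> Ck k (\<lambda>x. f x + g x)"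
proof (induction k arbitrary: f g)
  case (Suc k)
  from Suc.prems obtain G H where "\<forall>x. GDERIV f x :> G x" "\<forall>e\<in>Basis. Ck k (\<lambda>x. G x \<bullet> e)"
    "\<forall>x. GDERIV g x :> H x" "\<forall>e\<in>Basis. Ck k (\<lambda>x. H x \<bullet> e)"
    by auto
  with Suc.IH show ?case
    by (auto intro!: exI[of _ "\<lambda>x. G x + H x"] GDERIV_add simp: inner_add_left)
qed (auto intro: continuous_intros)

lemma Ck_mult: "Ck k f \<Longrightarrow> Ck k g \<Longrightarrow> Ck k (\<lambda>x. f x * g x)"
proof (induction k arbitrary: f g)
  case (Suc k)
  from Suc.prems obtain G H where *: "\<forall>x. GDERIV f x :> G x" "\<forall>e\<in>Basis. Ck k (\<lambda>x. G x \<bullet> e)"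
    "\<forall>x. GDERIV g x :> H x" "\<forall>e\<in>Basis. Ck k (\<lambda>x. H x \<bullet> e)"
    by auto
  have "Ck k f" "Ck k g" using Suc.prems Ck_Suc_imp_Ck by blast+
  with * Suc.IH show ?case
    by (auto intro!: exI[of _ "\<lambda>x. f x *\<^sub>R H x + g x *\<^sub>R G x"] GDERIV_mult Ck_add simp: inner_add_left)
qed (auto intro: continuous_intros)

lemma Ck_sum: "finite I \<Longrightarrow> (\<And>i. i \<in> I \<Longrightarrow> Ck k (f i)) \<Longrightarrow> Ck k (\<lambda>x. \<Sum>i\<in>I. f i x)"
  by (induction I rule: finite_induct) (auto intro: Ck_const Ck_add)

lemma Ck_exp: "Ck k f \<Longrightarrow> Ck k (\<lambda>x. exp (f x))"
proof (induction k arbitrary: f)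
  case (Suc k)
  from Suc.prems obtain G where *: "\<forall>x. GDERIV f x :> G x" "\<forall>e\<in>Basis. Ck k (\<lambda>x. G x \<bullet> e)"
    by auto
  have "Ck k f" using Suc.prems Ck_Suc_imp_Ck by blast
  with * Suc.IH show ?case
    by (auto intro!: exI[of _ "\<lambda>x. exp (f x) *\<^sub>R G x"] GDERIV_DERIV_compose[OF _ DERIV_exp] Ck_mult)
qed (auto intro: continuous_intros)

text \<open>The gradient of the composite is the adjoint of \<open>L\<close> applied to the old
  gradient. Expanded in \<open>Basis\<close>, each of its components is a finite sum of constants
  times composites of the same shape, so the induction closes.\<close>

lemma Ck_compose_affine:
  fixes L :: "'a::euclidean_space \<Rightarrow> 'b::euclidean_space"
  assumes L: "linear L"
  shows "Ck k f \<Longrightarrow> Ck k (\<lambda>x. f (L x + c))"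
proof (induction k arbitrary: f)
  case 0
  have "continuous_on UNIV (\<lambda>x. L x + c)"
    using L by (intro continuous_on_add linear_continuous_on continuous_on_const)
      (simp add: linear_conv_bounded_linear)
  then have "continuous_on UNIV (\<lambda>x. f (L x + c))"
    using 0 by (intro continuous_on_compose2[of UNIV f UNIV "\<lambda>x. L x + c"]) auto
  then show ?case by simp
next
  case (Suc k)
  from Suc.prems obtain G where *: "\<forall>x. GDERIV f x :> G x" "\<forall>e\<in>Basis. Ck k (\<lambda>x. G x \<bullet> e)"
    by auto
  have d: "GDERIV (\<lambda>x. f (L x + c)) x :> adjoint L (G (L x + c))" for x
  proof -
    have 1: "((\<lambda>x. L x + c) has_derivative L) (at x)"
      using L by (auto intro!: derivative_eq_intros linear_imp_has_derivative)
    have 2: "(f has_derivative (\<lambda>h. h \<bullet> G (L x + c))) (at (L x + c))"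
      using * by (simp add: gderiv_def)
    show ?thesis
      using diff_chain_at[OF 1 2] adjoint_works[OF L] by (simp add: gderiv_def o_def)
  qed
  have "Ck k (\<lambda>x. adjoint L (G (L x + c)) \<bullet> e)" for e
  proof -
    have "adjoint L (G (L x + c)) \<bullet> e = (\<Sum>b\<in>Basis. (G (L x + c) \<bullet> b) * (L e \<bullet> b))" for x
      by (metis adjoint_works[OF L] euclidean_inner inner_commute)
    then show ?thesis using * Suc.IH by (auto intro!: Ck_sum Ck_mult Ck_const)
  qed
  with d show ?case
    unfolding Ck.simps by (intro exI[of _ "\<lambda>x. adjoint L (G (L x + c))"]) simp
qed

lemma smooth_const: "smooth (\<lambda>x. c)"
  by (simp add: smooth_def Ck_const)

lemma smooth_add: "smooth f \<Longrightarrow> smooth g \<Longrightarrow> smooth (\<lambda>x. f x + g x)"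
  by (simp add: smooth_def Ck_add)

lemma smooth_mult: "smooth f \<Longrightarrow> smooth g \<Longrightarrow> smooth (\<lambda>x. f x * g x)"
  by (simp add: smooth_def Ck_mult)

lemma smooth_exp: "smooth f \<Longrightarrow> smooth (\<lambda>x. exp (f x))"
  by (simp add: smooth_def Ck_exp)

lemma smooth_diff: "smooth f \<Longrightarrow> smooth g \<Longrightarrow> smooth (\<lambda>x. f x - g x)"
  using smooth_add[of f "\<lambda>x. (-1) * g x"] smooth_mult[OF smooth_const[of "-1"], of g] by simp

lemma smooth_compose_affine: "linear L \<Longrightarrow> smooth f \<Longrightarrow> smooth (\<lambda>x. f (L x + c))"
  by (simp add: smooth_def Ck_compose_affine)

lemma smooth_fst_mult_snd:
  fixes A :: "'a::euclidean_space \<Rightarrow> real" and B :: "'b::euclidean_space \<Rightarrow> real"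
  shows "smooth A \<Longrightarrow> smooth B \<Longrightarrow> smooth (\<lambda>z. A (fst z) * B (snd z))"
  using smooth_compose_affine[of fst A 0] smooth_compose_affine[of snd B 0]
  by (auto intro!: smooth_mult linear_fst linear_snd)

lemma smooth_obtain_gderiv:
  assumes "smooth f"
  obtains G where "\<And>x. GDERIV f x :> G x" "continuous_on UNIV G"
proof -
  have "Ck (Suc 0) f" using assms by (simp add: smooth_def del: Ck.simps)
  then obtain G where "\<forall>x. GDERIV f x :> G x" "\<forall>e\<in>Basis. continuous_on UNIV (\<lambda>x. G x \<bullet> e)"
    by auto
  then show ?thesis using that continuous_on_componentwise[of UNIV G] by blast
qed

lemma GDERIV_unique: "GDERIV f x :> a \<Longrightarrow> GDERIV f x :> b \<Longrightarrow> a = b"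
  unfolding gderiv_def by (drule (1) has_derivative_unique) (metis vector_eq_ldot)

lemma smooth_continuous_gderiv:
  assumes "smooth f" "\<And>x. GDERIV f x :> df x"
  shows "continuous_on S df"
proof -
  obtain G where G: "\<And>x. GDERIV f x :> G x" "continuous_on UNIV G"
    using smooth_obtain_gderiv[OF assms(1)] by blast
  then have "df = G" using assms(2) GDERIV_unique by blast
  then show ?thesis using G(2) continuous_on_subset by blast
qed

lemma smooth_imp_continuous: "smooth f \<Longrightarrow> continuous_on S f"
  unfolding smooth_def by (metis Ck.simps(1) continuous_on_subset subset_UNIV)

lemma GDERIV_real_iff: "GDERIV f x :> d \<longleftrightarrow> (f has_real_derivative d) (at x)"
  by (simp add: gderiv_def has_field_derivative_def mult.commute[of d])

lemma smooth_antiderivative: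
  fixes F :: "real \<Rightarrow> real"
  assumes "smooth f" "\<And>x. (F has_real_derivative f x) (at x)"
  shows "smooth F"
  unfolding smooth_def
proof
  fix k
  have "Ck (Suc k) F"
    using assms by (auto simp: smooth_def GDERIV_real_iff)
  then show "Ck k F" by (rule Ck_Suc_imp_Ck)
qed

lemma smooth_real_continuous:
  fixes A :: "real \<Rightarrow> real"
  assumes "smooth A" "\<And>x. (A has_real_derivative A' x) (at x)"
  shows "continuous_on T A" "continuous_on T A'"
  using smooth_imp_continuous[OF assms(1)] smooth_continuous_gderiv[OF assms(1), of A'] assms(2)
  by (auto simp: GDERIV_real_iff)

subsection \<open>Bump functions\<close>

text \<open>The family p(1/x) exp(-1/x), extended by 0, is closed under differentiation. One
  induction over all polynomials at once therefore gives the smoothness of exp(-1/x).\<close>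

definition flat_exp :: "real poly \<Rightarrow> real \<Rightarrow> real" where
  "flat_exp p x = (if 0 < x then poly p (1 / x) * exp (- (1 / x)) else 0)"

lemma poly_mult_exp_minus_tendsto_0:
  "((\<lambda>t::real. poly p t * exp (- t)) \<longlongrightarrow> 0) at_top"
proof -
  have "((\<lambda>t::real. \<Sum>i\<le>degree p. coeff p i * (t ^ i / exp t)) \<longlongrightarrow> (\<Sum>i\<le>degree p. coeff p i * 0)) at_top"
    by (intro tendsto_sum tendsto_mult tendsto_const tendsto_power_div_exp_0)
  then show ?thesis
    by (simp add: poly_altdef exp_minus field_simps sum_distrib_left sum_divide_distrib)
qed

text \<open>In the variable t = 1/x, differentiation sends p(t) exp(-t) to t^2 (p - p')(t) exp(-t);
  the polynomial \<open>[:0, 0, 1:]\<close> is t^2. At 0 the exponential beats every power.\<close>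

lemma flat_exp_has_derivative:
  "(flat_exp p has_real_derivative flat_exp ([:0, 0, 1:] * (p - pderiv p)) x) (at x)"
proof -
  consider "x > 0" | "x < 0" | "x = 0" by linarith
  then show ?thesis
  proof cases
    case 1
    have i: "((\<lambda>x. 1 / x) has_real_derivative - 1 / x^2) (at x)"
      using 1 by (auto intro!: derivative_eq_intros simp: power2_eq_square)
    have "((\<lambda>x. poly p (1 / x) * exp (- (1 / x))) has_real_derivative
        poly p (1 / x) * (exp (- (1 / x)) * - (- 1 / x^2))
          + (poly (pderiv p) (1 / x) * (- 1 / x^2)) * exp (- (1 / x))) (at x)"
      by (intro DERIV_mult' DERIV_chain2[OF poly_DERIV i] DERIV_chain2[OF DERIV_exp DERIV_minus[OF i]])
    moreover have "poly p (1 / x) * (exp (- (1 / x)) * - (- 1 / x^2))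
          + (poly (pderiv p) (1 / x) * (- 1 / x^2)) * exp (- (1 / x))
        = flat_exp ([:0, 0, 1:] * (p - pderiv p)) x"
      using 1 by (simp add: flat_exp_def field_simps power2_eq_square)
    ultimately have "((\<lambda>x. poly p (1 / x) * exp (- (1 / x))) has_real_derivative
        flat_exp ([:0, 0, 1:] * (p - pderiv p)) x) (at x)"
      by simp
    then show ?thesis
      by (rule has_field_derivative_transform_within_open[of _ _ _ "{0<..}"])
         (use 1 in \<open>auto simp: flat_exp_def\<close>)
  next
    case 2
    have "((\<lambda>x. 0) has_real_derivative flat_exp ([:0, 0, 1:] * (p - pderiv p)) x) (at x)"
      using 2 by (simp add: flat_exp_def)
    then show ?thesis
      by (rule has_field_derivative_transform_within_open[of _ _ _ "{..<0}"])
         (use 2 in \<open>auto simp: flat_exp_def\<close>)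
  next
    case 3
    have "((\<lambda>h. flat_exp p h / h) \<longlongrightarrow> 0) (at_left 0)"
      by (rule tendsto_eventually) (auto simp: eventually_at_filter flat_exp_def)
    moreover have "((\<lambda>h. flat_exp p h / h) \<longlongrightarrow> 0) (at_right 0)"
    proof -
      \<comment> \<open>\<open>pCons 0 p\<close> is t p(t): the difference quotient at 0, written in
        t = 1/h.\<close>
      have "((\<lambda>t::real. poly (pCons 0 p) t * exp (- t)) \<longlongrightarrow> 0) at_top"
        by (rule poly_mult_exp_minus_tendsto_0)
      then have "((\<lambda>h::real. poly (pCons 0 p) (inverse h) * exp (- inverse h)) \<longlongrightarrow> 0) (at_right 0)"
        by (rule filterlim_compose[OF _ filterlim_inverse_at_top_right])
      then show ?thesis
        by (rule Lim_transform_eventually)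
           (auto simp: eventually_at_filter flat_exp_def field_simps)
    qed
    ultimately have "((\<lambda>h. flat_exp p h / h) \<longlongrightarrow> 0) (at 0)"
      by (simp add: filterlim_split_at)
    then show ?thesis using 3 by (simp add: DERIV_def flat_exp_def)
  qed
qed

lemma smooth_flat_exp: "smooth (flat_exp p)"
  unfolding smooth_def
proof
  fix k show "Ck k (flat_exp p)"
  proof (induction k arbitrary: p)
    case 0
    then show ?case
      by (auto intro!: continuous_at_imp_continuous_on DERIV_isCont[OF flat_exp_has_derivative])
  next
    case (Suc k)
    then show ?case using flat_exp_has_derivative[of p] by (auto simp: GDERIV_real_iff)
  qed
qed

definition bump :: "real \<Rightarrow> real \<Rightarrow> real \<Rightarrow> real" where
  "bump a b x = flat_exp 1 (x - a) * flat_exp 1 (b - x)"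

lemma smooth_bump: "smooth (bump a b)"
proof -
  have "smooth (\<lambda>x. flat_exp 1 (1 * x + - a))" "smooth (\<lambda>x. flat_exp 1 ((-1) * x + b))"
    by (intro smooth_compose_affine smooth_flat_exp linear_times)+
  from smooth_mult[OF this] show ?thesis
    by (simp add: bump_def[abs_def])
qed

lemma bump_nonneg: "0 \<le> bump a b x"
  by (simp add: bump_def flat_exp_def)

lemma bump_pos: "a < x \<Longrightarrow> x < b \<Longrightarrow> 0 < bump a b x"
  by (simp add: bump_def flat_exp_def)

lemma bump_eq_0: "\<not> (a < x \<and> x < b) \<Longrightarrow> bump a b x = 0"
  by (auto simp: bump_def flat_exp_def)

lemma continuous_on_bump: "continuous_on S (bump a b)"
  by (rule smooth_imp_continuous[OF smooth_bump])

text \<open>Two translates of such a step differ by a compactly supported test function whose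
  derivative is a difference of two bumps. This is the probe used in
  \<open>du_Bois_Reymond\<close>.\<close>

lemma smooth_step_exists:
  fixes a b :: real
  assumes "a < b"
  obtains S where "smooth S" "\<And>x. (S has_real_derivative bump a b x) (at x)"
    "\<And>x. x \<le> a \<Longrightarrow> S x = 0" "\<And>x. b \<le> x \<Longrightarrow> S x = S b" "0 < S b" "\<And>x. 0 \<le> S x"
    "\<And>x y. x \<le> y \<Longrightarrow> S x \<le> S y"
proof -
  \<comment> \<open>The lower limit lies strictly below \<open>a\<close>, so that every x with a
    \<le> x is interior to an interval on which the fundamental theorem of calculus applies.\<close>
  define S where "S = (\<lambda>x. integral {a - 1..x} (bump a b))"
  have S0: "S x = 0" if "x \<le> a" for x
    unfolding S_def using that by (subst integral_cong[of _ _ "\<lambda>_. 0"]) (auto intro: bump_eq_0)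
  have d: "(S has_real_derivative bump a b x) (at x)" for x
  proof (cases "x < a")
    case True
    then have "((\<lambda>x. 0) has_real_derivative bump a b x) (at x)"
      by (simp add: bump_eq_0)
    then show ?thesis
      by (rule has_field_derivative_transform_within_open[of _ _ _ "{..<a}"])
         (use True S0 in auto)
  next
    case False
    have "(S has_real_derivative bump a b x) (at x within {a - 1..x + 1})"
      unfolding S_def
      by (rule integral_has_real_derivative[OF continuous_on_bump]) (use False in auto)
    moreover have "x \<in> interior {a - 1..x + 1}" using False by simp
    ultimately show ?thesis using at_within_interior[of x "{a - 1..x + 1}"] by argo
  qed
  have mono: "S x \<le> S y" if "x \<le> y" for x y
    by (rule DERIV_nonneg_imp_nondecreasing[OF that]) (meson d bump_nonneg)
  have nn: "0 \<le> S x" for x using mono[of a x] S0[of a] S0[of x] by linarith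
  have c: "S x = S b" if "b \<le> x" for x
  proof (cases "b = x")
    case False
    then have bx: "b < x" using that by simp
    obtain z where "b < z" "z < x" "S x - S b = (x - b) * bump a b z"
      using MVT2[OF bx, of S "bump a b", OF d] by auto
    then show ?thesis by (simp add: bump_eq_0)
  qed simp
  have p: "0 < S b"
  proof -
    define m where "m = (a + b) / 2"
    have am: "a < m" "m < b" using assms by (auto simp: m_def)
    obtain z where z: "a < z" "z < m" "S m - S a = (m - a) * bump a b z"
      using MVT2[OF am(1), of S "bump a b", OF d] by auto
    have "bump a b z > 0" using z am by (intro bump_pos) auto
    then have "S m - S a > 0" using z(3) am by simp
    then have "S m > 0" using S0[of a] by simp
    with mono[of m b] am have ?thesis by linarith
    then show ?thesis .
  qed
  show ?thesis
    by (rule that[OF smooth_antiderivative[OF smooth_bump d] d S0 c p nn mono])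
qed

subsection \<open>Weak gradients\<close>

lemma GDERIV_partial_fst:
  assumes "GDERIV P (x, y) :> d"
  shows "((\<lambda>t. P (t, y)) has_real_derivative fst d) (at x)"
proof -
  have 1: "((\<lambda>t. (t, y)) has_derivative (\<lambda>h. (h, 0))) (at x)"
    by (auto intro!: derivative_eq_intros)
  from diff_chain_at[OF 1 assms[unfolded gderiv_def]] show ?thesis
    by (simp add: has_field_derivative_def o_def inner_prod_def mult_commute_abs)
qed

lemma GDERIV_partial_snd:
  assumes "GDERIV P (x, y) :> d"
  shows "((\<lambda>t. P (x, t)) has_real_derivative snd d) (at y)"
proof -
  have 1: "((\<lambda>t. (x, t)) has_derivative (\<lambda>h. (0, h))) (at y)"
    by (auto intro!: derivative_eq_intros)
  from diff_chain_at[OF 1 assms[unfolded gderiv_def]] show ?thesis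
    by (simp add: has_field_derivative_def o_def inner_prod_def mult_commute_abs)
qed

lemma GDERIV_transform_within_open:
  assumes "GDERIV f x :> d" "open S" "x \<in> S" "\<And>y. y \<in> S \<Longrightarrow> f y = g y"
  shows "GDERIV g x :> d"
  using assms has_derivative_transform_within_open[of f "\<lambda>h. h \<bullet> d" x UNIV S g]
  by (simp add: gderiv_def)

text \<open>A bridge between the Bochner integral over an open set, in which weak gradients are
  expressed, and the gauge integral over a compact set, for which the fundamental theorem of
  calculus and Fubini are used.\<close>

lemma lebesgue_integral_compact_support:
  fixes f :: "'a::euclidean_space \<Rightarrow> 'b::euclidean_space"
  assumes "W \<in> sets lebesgue" "compact K" "K \<subseteq> W" "continuous_on K f"
    and zero: "\<And>x. x \<in> W \<Longrightarrow> x \<notin> K \<Longrightarrow> f x = 0"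
  shows "integrable (lebesgue_on W) f" "integral\<^sup>L (lebesgue_on W) f = integral K f"
proof -
  have 1: "set_integrable lborel K f"
    unfolding set_integrable_def by (rule borel_integrable_compact[OF assms(2,4)])
  then have 2: "set_integrable lebesgue K f"
    by (simp add: set_integrable_def integrable_completion borel_measurable_integrable)
  have eq: "indicator W x *\<^sub>R f x = indicator K x *\<^sub>R f x" for x
    using zero[of x] assms(3) by (auto simp: indicator_def)
  show "integrable (lebesgue_on W) f"
    using 2 assms(1) by (simp add: integrable_restrict_space eq set_integrable_def)
  have "integral\<^sup>L (lebesgue_on W) f = (LINT x:K|lebesgue. f x)"
    using assms(1) by (simp add: integral_restrict_space eq set_lebesgue_integral_def)
  also have "... = integral K f"
    by (rule set_lebesgue_integral_eq_integral(2)[OF 2])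
  finally show "integral\<^sup>L (lebesgue_on W) f = integral K f" .
qed

text \<open>By Fubini each partial derivative may be integrated first in its own direction, where
  the fundamental theorem of calculus leaves two boundary values of \<open>P\<close>, both
  zero.\<close>

lemma integral_gderiv_compact_support:
  fixes P :: "real \<times> real \<Rightarrow> real"
  assumes d: "\<And>z. GDERIV P z :> G z" and c: "continuous_on UNIV G" and "0 < M"
    and zero: "\<And>x y. M \<le> \<bar>x\<bar> \<or> M \<le> \<bar>y\<bar> \<Longrightarrow> P (x, y) = 0"
  shows "integral (cbox (-M, -M) (M, M)) G = 0"
proof -
  have Gi: "G integrable_on cbox (-M, -M) (M, M)"
    using c by (intro integrable_continuous) (rule continuous_on_subset, auto)
  have cf: "continuous_on S (\<lambda>z. fst (G z))" and cs: "continuous_on S (\<lambda>z. snd (G z))" for S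
    using c by (auto intro!: continuous_intros intro: continuous_on_subset)
  have Px: "integral {-M..M} (\<lambda>x. fst (G (x, y))) = 0" for y
  proof -
    have "((\<lambda>x. fst (G (x, y))) has_integral P (M, y) - P (-M, y)) {-M..M}"
      using GDERIV_partial_fst[OF d] \<open>0 < M\<close>
      by (intro fundamental_theorem_of_calculus)
         (auto simp: has_real_derivative_iff_has_vector_derivative intro: has_vector_derivative_at_within)
    then show ?thesis using zero \<open>0 < M\<close> by (simp add: integral_unique)
  qed
  have Py: "integral {-M..M} (\<lambda>y. snd (G (x, y))) = 0" for x
  proof -
    have "((\<lambda>y. snd (G (x, y))) has_integral P (x, M) - P (x, -M)) {-M..M}"
      using GDERIV_partial_snd[OF d] \<open>0 < M\<close>
      by (intro fundamental_theorem_of_calculus)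
         (auto simp: has_real_derivative_iff_has_vector_derivative intro: has_vector_derivative_at_within)
    then show ?thesis using zero \<open>0 < M\<close> by (simp add: integral_unique)
  qed
  have "integral (cbox (-M, -M) (M, M)) (\<lambda>z. snd (G z)) = 0"
    using integral_prod_continuous[of "-M" "-M" M M "\<lambda>z. snd (G z)"] cs Py by simp
  moreover have "integral (cbox (-M, -M) (M, M)) (\<lambda>z. fst (G z)) = 0"
  proof -
    have "integral (cbox (-M, -M) (M, M)) (\<lambda>z. fst (G z))
        = integral {-M..M} (\<lambda>x. integral {-M..M} (\<lambda>y. fst (G (x, y))))"
      using integral_prod_continuous[of "-M" "-M" M M "\<lambda>z. fst (G z)"] cf by simp
    also have "... = integral {-M..M} (\<lambda>y. integral {-M..M} (\<lambda>x. fst (G (x, y))))"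
      using integral_swap_continuous[of "-M" "-M" M M "\<lambda>x y. fst (G (x, y))"] cf
      by (simp add: case_prod_unfold)
    finally show ?thesis using Px by simp
  qed
  moreover have "fst (integral (cbox (-M, -M) (M, M)) G) = integral (cbox (-M, -M) (M, M)) (\<lambda>z. fst (G z))"
    "snd (integral (cbox (-M, -M) (M, M)) G) = integral (cbox (-M, -M) (M, M)) (\<lambda>z. snd (G z))"
    using integral_linear[OF Gi bounded_linear_fst] integral_linear[OF Gi bounded_linear_snd]
    by (simp_all add: o_def)
  ultimately show ?thesis by (simp add: prod_eq_iff)
qed

text \<open>The product of \<open>v\<close> and the test function, extended by zero, is continuously
  differentiable on the whole plane with compact support, so its gradient integrates to zero.
  Nothing is assumed about \<open>v\<close> near the boundary of \<open>W\<close>.\<close>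

lemma test_function_integration_by_parts:
  fixes v :: "real \<times> real \<Rightarrow> real"
  assumes W: "open W" and v: "\<And>z. z \<in> W \<Longrightarrow> GDERIV v z :> g z" and g: "continuous_on W g"
    and \<eta>: "test_function W \<eta>" "\<And>z. GDERIV \<eta> z :> d\<eta> z"
  shows "integrable (lebesgue_on W) (\<lambda>z. v z *\<^sub>R d\<eta> z)" "integrable (lebesgue_on W) (\<lambda>z. \<eta> z *\<^sub>R g z)"
    "(\<integral>z. v z *\<^sub>R d\<eta> z \<partial>lebesgue_on W) = - (\<integral>z. \<eta> z *\<^sub>R g z \<partial>lebesgue_on W)"
proof -
  define K where "K = closure {z. \<eta> z \<noteq> 0}"
  have K: "compact K" "K \<subseteq> W" and sm: "smooth \<eta>"
    using \<eta>(1) by (auto simp: test_function_def K_def)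
  have \<eta>0: "\<eta> z = 0" if "z \<notin> K" for z
    using that closure_subset[of "{z. \<eta> z \<noteq> 0}"] by (auto simp: K_def)
  have oK: "open (- K)" using K(1) by (simp add: compact_imp_closed open_Compl)
  have d\<eta>0: "d\<eta> z = 0" if "z \<notin> K" for z
  proof -
    have "GDERIV (\<lambda>z. 0) z :> d\<eta> z"
      by (rule GDERIV_transform_within_open[OF \<eta>(2) oK]) (use that \<eta>0 in auto)
    then show ?thesis using GDERIV_unique GDERIV_const by blast
  qed
  have vc: "continuous_on W v"
    using v GDERIV_imp_isCont by (blast intro: continuous_at_imp_continuous_on)
  have \<eta>c: "continuous_on S \<eta>" "continuous_on S d\<eta>" for S
    using smooth_imp_continuous[OF sm] smooth_continuous_gderiv[OF sm \<eta>(2)] by auto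
  have L: "W \<in> sets lebesgue" using W by auto
  have c1: "continuous_on W (\<lambda>z. v z *\<^sub>R d\<eta> z)" and c2: "continuous_on W (\<lambda>z. \<eta> z *\<^sub>R g z)"
    by (intro continuous_intros vc g \<eta>c)+
  note I1 = lebesgue_integral_compact_support[OF L K continuous_on_subset[OF c1 K(2)]]
  note I2 = lebesgue_integral_compact_support[OF L K continuous_on_subset[OF c2 K(2)]]
  show i1: "integrable (lebesgue_on W) (\<lambda>z. v z *\<^sub>R d\<eta> z)" by (rule I1) (simp add: d\<eta>0)
  show i2: "integrable (lebesgue_on W) (\<lambda>z. \<eta> z *\<^sub>R g z)" by (rule I2) (simp add: \<eta>0)
  define G where "G = (\<lambda>z. if z \<in> W then v z *\<^sub>R d\<eta> z + \<eta> z *\<^sub>R g z else 0)"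
  define P where "P = (\<lambda>z. if z \<in> W then v z * \<eta> z else 0)"
  have G0: "G z = 0" if "z \<notin> K" for z using that by (simp add: G_def \<eta>0 d\<eta>0)
  have P0: "P z = 0" if "z \<notin> K" for z using that by (simp add: P_def \<eta>0)
  have PG: "GDERIV P z :> G z" for z
  proof (cases "z \<in> W")
    case True
    have "GDERIV (\<lambda>z. v z * \<eta> z) z :> v z *\<^sub>R d\<eta> z + \<eta> z *\<^sub>R g z"
      by (rule GDERIV_mult[OF v[OF True] \<eta>(2)])
    then have "GDERIV P z :> v z *\<^sub>R d\<eta> z + \<eta> z *\<^sub>R g z"
      by (rule GDERIV_transform_within_open[OF _ W True]) (simp add: P_def)
    then show ?thesis using True by (simp add: G_def)
  next
    case False
    then have z: "z \<notin> K" using K by blast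
    have "GDERIV P z :> 0"
      by (rule GDERIV_transform_within_open[OF GDERIV_const[of 0] oK]) (use z P0 in auto)
    then show ?thesis using G0[OF z] by simp
  qed
  have Gc: "continuous_on UNIV G"
  proof -
    have "continuous_on W G"
      by (rule continuous_on_eq[OF continuous_on_add[OF c1 c2]]) (simp add: G_def)
    moreover have "continuous_on (- K) G"
      by (rule continuous_on_eq[OF continuous_on_const[of _ 0]]) (simp add: G0)
    ultimately have "continuous_on (W \<union> - K) G"
      by (rule continuous_on_open_Un[OF W oK])
    moreover have "W \<union> - K = UNIV" using K by blast
    ultimately show ?thesis by simp
  qed
  obtain M where M: "0 < M" "\<And>z. z \<in> K \<Longrightarrow> norm z < M"
    using compact_imp_bounded[OF K(1)] bounded_pos_less by metis
  have Kbox: "K \<subseteq> cbox (-M, -M) (M, M)"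
  proof
    fix z assume "z \<in> K"
    then have "norm z < M" by (rule M)
    then show "z \<in> cbox (-M, -M) (M, M)"
      using norm_fst_le[of "fst z" "snd z"] norm_snd_le[of "snd z" "fst z"] by (cases z) (auto simp: cbox_Pair_eq)
  qed
  have "integral (cbox (-M, -M) (M, M)) G = 0"
  proof (rule integral_gderiv_compact_support[OF PG Gc M(1)])
    fix x y assume xy: "M \<le> \<bar>x\<bar> \<or> M \<le> \<bar>y\<bar>"
    have "(x, y) \<notin> K"
      using xy M(2)[of "(x, y)"] norm_fst_le[of x y] norm_snd_le[of y x] by auto
    then show "P (x, y) = 0" by (rule P0)
  qed
  moreover have "integral (cbox (-M, -M) (M, M)) G = integral K G"
  proof -
    have "integral (cbox (-M, -M) (M, M)) (\<lambda>z. if z \<in> K then G z else 0) = integral K G"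
      using Kbox by (simp add: integral_restrict_Int Int_absorb2)
    moreover have "(\<lambda>z. if z \<in> K then G z else 0) = G" using G0 by auto
    ultimately show ?thesis by simp
  qed
  ultimately have KG: "integral K G = 0" by simp
  have "(\<integral>z. v z *\<^sub>R d\<eta> z \<partial>lebesgue_on W) + (\<integral>z. \<eta> z *\<^sub>R g z \<partial>lebesgue_on W)
     = (\<integral>z. v z *\<^sub>R d\<eta> z + \<eta> z *\<^sub>R g z \<partial>lebesgue_on W)"
    using i1 i2 by simp
  also have "... = integral K (\<lambda>z. v z *\<^sub>R d\<eta> z + \<eta> z *\<^sub>R g z)"
    by (rule lebesgue_integral_compact_support(2)[OF L K])
       (use continuous_on_subset[OF continuous_on_add[OF c1 c2] K(2)] in \<open>auto simp: \<eta>0 d\<eta>0\<close>)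
  also have "... = integral K G"
    using K(2) by (intro HK_integral_cong) (auto simp: G_def)
  finally show "(\<integral>z. v z *\<^sub>R d\<eta> z \<partial>lebesgue_on W) = - (\<integral>z. \<eta> z *\<^sub>R g z \<partial>lebesgue_on W)"
    using KG by (simp add: eq_neg_iff_add_eq_0)
qed

text \<open>The positive and negative part of \<open>f\<close> are densities of two measures that
  agree on open boxes. Boxes form an intersection-stable generator of the Borel sets, so the
  measures coincide, and so do their densities almost everywhere.\<close>

lemma AE_zero_of_integral_boxes:
  fixes f :: "'a::euclidean_space \<Rightarrow> real"
  assumes f: "integrable lebesgue f"
    and box: "\<And>c d. (\<integral>x. indicator (box c d) x * f x \<partial>lebesgue) = 0"
  shows "AE x in lebesgue. f x = 0"
proof -
  \<comment> \<open>A Borel representative, so that densities with respect to \<open>lborel\<close>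
    can be formed.\<close>
  obtain f' where f': "f' \<in> borel_measurable lborel" "AE x in lborel. f x = f' x"
    using completion_ex_borel_measurable_real[of f lborel] f borel_measurable_integrable by blast
  have ae: "AE x in lebesgue. f x = f' x" using f'(2) by (rule AE_completion)
  have f'l: "f' \<in> borel_measurable lebesgue" using f'(1) measurable_completion by blast
  have "integrable lebesgue f'"
    using integrable_cong_AE_imp[OF f f'l] ae by (auto simp: eq_commute)
  then have int: "integrable lborel f'" using f'(1) by (simp add: integrable_completion)
  have box': "(\<integral>x. indicator (box c d) x * f' x \<partial>lborel) = 0" for c d
  proof -
    have "(\<integral>x. indicator (box c d) x * f' x \<partial>lborel) = (\<integral>x. indicator (box c d) x * f' x \<partial>lebesgue)"
      using f'(1) by (intro integral_completion[symmetric]) auto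
    also have "... = (\<integral>x. indicator (box c d) x * f x \<partial>lebesgue)"
      using ae f'l borel_measurable_integrable[OF f]
      by (intro integral_cong_AE) (auto intro!: borel_measurable_times borel_measurable_indicator)
    finally show ?thesis using box by simp
  qed
  define M1 where "M1 = density lborel (\<lambda>x. ennreal (f' x))"
  define M2 where "M2 = density lborel (\<lambda>x. ennreal (- f' x))"
  have nn: "(\<integral>\<^sup>+x. ennreal (f' x) * indicator A x \<partial>lborel) = ennreal (\<integral>x. max (f' x) 0 * indicator A x \<partial>lborel)"
       "(\<integral>\<^sup>+x. ennreal (- f' x) * indicator A x \<partial>lborel) = ennreal (\<integral>x. max (- f' x) 0 * indicator A x \<partial>lborel)"
       "integrable lborel (\<lambda>x. max (f' x) 0 * indicator A x)" "integrable lborel (\<lambda>x. max (- f' x) 0 * indicator A x)"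
    if A: "A \<in> sets borel" for A
  proof -
    show i: "integrable lborel (\<lambda>x. max (f' x) 0 * indicator A x)" "integrable lborel (\<lambda>x. max (- f' x) 0 * indicator A x)"
      using A int by (auto intro!: integrable_real_mult_indicator integrable_max)
    have "(\<integral>\<^sup>+x. ennreal (f' x) * indicator A x \<partial>lborel) = (\<integral>\<^sup>+x. ennreal (max (f' x) 0 * indicator A x) \<partial>lborel)"
      by (intro nn_integral_cong) (auto simp: indicator_def max_def ennreal_neg)
    also have "... = ennreal (\<integral>x. max (f' x) 0 * indicator A x \<partial>lborel)"
      by (rule nn_integral_eq_integral[OF i(1)]) auto
    finally show "(\<integral>\<^sup>+x. ennreal (f' x) * indicator A x \<partial>lborel) = ennreal (\<integral>x. max (f' x) 0 * indicator A x \<partial>lborel)" .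
    have "(\<integral>\<^sup>+x. ennreal (- f' x) * indicator A x \<partial>lborel) = (\<integral>\<^sup>+x. ennreal (max (- f' x) 0 * indicator A x) \<partial>lborel)"
      by (intro nn_integral_cong) (auto simp: indicator_def max_def ennreal_neg)
    also have "... = ennreal (\<integral>x. max (- f' x) 0 * indicator A x \<partial>lborel)"
      by (rule nn_integral_eq_integral[OF i(2)]) auto
    finally show "(\<integral>\<^sup>+x. ennreal (- f' x) * indicator A x \<partial>lborel) = ennreal (\<integral>x. max (- f' x) 0 * indicator A x \<partial>lborel)" .
  qed
  have em1: "emeasure M1 A = (\<integral>\<^sup>+x. ennreal (f' x) * indicator A x \<partial>lborel)"
    and em2: "emeasure M2 A = (\<integral>\<^sup>+x. ennreal (- f' x) * indicator A x \<partial>lborel)" if "A \<in> sets borel" for A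
    using that f'(1) by (auto simp: M1_def M2_def emeasure_density)
  have eqbox: "emeasure M1 (box c d) = emeasure M2 (box c d)" for c d
  proof -
    have "(\<integral>x. max (f' x) 0 * indicator (box c d) x \<partial>lborel) - (\<integral>x. max (- f' x) 0 * indicator (box c d) x \<partial>lborel)
      = (\<integral>x. max (f' x) 0 * indicator (box c d) x - max (- f' x) 0 * indicator (box c d) x \<partial>lborel)"
      using nn(3,4)[of "box c d"] by simp
    also have "... = (\<integral>x. indicator (box c d) x * f' x \<partial>lborel)"
      by (intro Bochner_Integration.integral_cong) (auto simp: indicator_def)
    finally show ?thesis using box'[of c d] nn(1,2)[of "box c d"] by (simp add: em1 em2)
  qed
  have "M1 = M2"
  proof (rule measure_eqI_generator_eq[where E = "range (\<lambda>(a, b). box a b)" and \<Omega> = UNIV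
        and A = "\<lambda>n. box (- (real n *\<^sub>R One)) (real n *\<^sub>R One)"])
    show "Int_stable (range (\<lambda>(a, b). box a b) :: 'a set set)"
      by (rule Int_stableI_image) (clarsimp simp: box_Int_box, blast)
    show "sets M1 = sigma_sets UNIV (range (\<lambda>(a, b). box a b))" "sets M2 = sigma_sets UNIV (range (\<lambda>(a, b). box a b))"
      by (simp_all add: M1_def M2_def borel_eq_box)
    show "(\<Union>i. box (- (real i *\<^sub>R One)) (real i *\<^sub>R One)) = (UNIV :: 'a set)"
      by (rule UN_box_eq_UNIV)
    show "emeasure M1 (box (- (real i *\<^sub>R One)) (real i *\<^sub>R One)) \<noteq> \<infinity>" for i
      by (simp add: em1 nn)
  qed (auto simp: eqbox)
  then have "AE x in lborel. ennreal (f' x) = ennreal (- f' x)"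
    unfolding M1_def M2_def using f'(1) by (intro sigma_finite_measure.density_unique[OF sigma_finite_lborel]) auto
  \<comment> \<open>\<open>ennreal\<close> cuts off negative values, so the equation compares the
    positive with the negative part, and at each point one of the two is zero.\<close>
  then have "AE x in lborel. f' x = 0"
  proof eventually_elim
    case (elim x)
    then show ?case by (cases "f' x \<ge> 0") (auto simp: ennreal_neg ennreal_eq_0_iff)
  qed
  then have "AE x in lebesgue. f' x = 0" by (rule AE_completion)
  with ae show ?thesis by eventually_elim simp
qed

text \<open>If B is a bump that is positive exactly on the box, then 1 - exp(-k B) increases to the
  indicator of the box and vanishes wherever B does.\<close>

lemma box_test_functions:
  fixes a b :: "real \<times> real"
  assumes "cbox a b \<subseteq> W"
  obtains \<phi> where "\<And>k::nat. test_function W (\<phi> k)" "\<And>k z. 0 \<le> \<phi> k z" "\<And>k z. \<phi> k z \<le> 1"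
    "\<And>k z. z \<notin> box a b \<Longrightarrow> \<phi> k z = 0" "\<And>z. (\<lambda>k. \<phi> k z) \<longlonglongrightarrow> indicator (box a b) z"
proof -
  define B where "B = (\<lambda>z::real \<times> real. bump (fst a) (fst b) (fst z) * bump (snd a) (snd b) (snd z))"
  define \<phi> where "\<phi> = (\<lambda>(k::nat) z. 1 - exp ((- real k) * B z))"
  have bx: "z \<in> box a b \<longleftrightarrow> (fst a < fst z \<and> fst z < fst b \<and> snd a < snd z \<and> snd z < snd b)" for z
    by (cases a; cases b; cases z) (auto simp: mem_box Basis_prod_def)
  have B0: "0 \<le> B z" for z by (simp add: B_def bump_nonneg)
  have Bz: "B z = 0" if "z \<notin> box a b" for z
    using that bump_eq_0 unfolding B_def bx by (metis mult_zero_left mult_zero_right)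
  have Bp: "0 < B z" if "z \<in> box a b" for z
    using that unfolding B_def bx by (intro mult_pos_pos bump_pos) auto
  have "smooth B" unfolding B_def by (intro smooth_fst_mult_snd smooth_bump)
  then have sm: "smooth (\<phi> k)" for k
    unfolding \<phi>_def by (intro smooth_diff smooth_exp smooth_mult smooth_const)
  have z: "\<phi> k z = 0" if "z \<notin> box a b" for k z using Bz[OF that] by (simp add: \<phi>_def)
  have cl: "closure {z. \<phi> k z \<noteq> 0} \<subseteq> cbox a b" for k
    using z box_subset_cbox by (intro closure_minimal) (auto, blast)
  have "test_function W (\<phi> k)" for k
    unfolding test_function_def
    using sm cl[of k] assms bounded_subset[OF bounded_cbox cl[of k]] by (auto simp: compact_eq_bounded_closed)
  moreover have "0 \<le> \<phi> k z" "\<phi> k z \<le> 1" for k z using B0[of z] by (auto simp: \<phi>_def)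
  moreover have "(\<lambda>k. \<phi> k z) \<longlonglongrightarrow> indicator (box a b) z" for z
  proof (cases "z \<in> box a b")
    case True
    have p: "B z > 0" by (rule Bp[OF True])
    have "(\<lambda>k. 1 - exp (- real k * B z)) \<longlonglongrightarrow> 1" using p by real_asymp
    then show ?thesis using True by (simp add: \<phi>_def)
  next
    case False
    then show ?thesis using z by simp
  qed
  ultimately show ?thesis using that[of \<phi>] z by blast
qed

text \<open>The fundamental lemma of the calculus of variations. Dominated convergence along
  \<open>box_test_functions\<close> gives zero integrals over the open boxes of closed boxes inside
  \<open>W\<close>; cutting off to one closed box makes \<open>AE_zero_of_integral_boxes\<close>
  applicable there.\<close>

lemma AE_zero_of_test_functions:
  fixes f :: "real \<times> real \<Rightarrow> real"
  assumes W: "open W" and f: "f \<in> borel_measurable (lebesgue_on W)"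
    and loc: "\<And>a b. cbox a b \<subseteq> W \<Longrightarrow> integrable (lebesgue_on W) (\<lambda>x. indicator (cbox a b) x * f x)"
    and test: "\<And>\<phi>. test_function W \<phi> \<Longrightarrow> (\<integral>x. \<phi> x * f x \<partial>lebesgue_on W) = 0"
  shows "AE x in lebesgue_on W. f x = 0"
proof -
  have L: "W \<in> sets lebesgue" using W by auto
  have box0: "(\<integral>x. indicator (box a b) x * f x \<partial>lebesgue_on W) = 0" if ab: "cbox a b \<subseteq> W" for a b
  proof -
    obtain \<phi> where \<phi>: "\<And>k::nat. test_function W (\<phi> k)" "\<And>k z. 0 \<le> \<phi> k z" "\<And>k z. \<phi> k z \<le> 1"
      "\<And>k z. z \<notin> box a b \<Longrightarrow> \<phi> k z = 0" "\<And>z. (\<lambda>k. \<phi> k z) \<longlonglongrightarrow> indicator (box a b) z"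
      using box_test_functions[OF ab] by metis
    have m: "\<phi> k \<in> borel_measurable (lebesgue_on W)" for k
    proof -
      have "continuous_on UNIV (\<phi> k)" using \<phi>(1)[of k] by (auto simp: test_function_def intro: smooth_imp_continuous)
      then have "\<phi> k \<in> borel_measurable borel" by (rule borel_measurable_continuous_onI)
      then show ?thesis by (intro measurable_restrict_space1 measurable_completion) simp
    qed
    have "(\<lambda>k. \<integral>x. \<phi> k x * f x \<partial>lebesgue_on W) \<longlonglongrightarrow> (\<integral>x. indicator (box a b) x * f x \<partial>lebesgue_on W)"
    proof (rule integral_dominated_convergence[where w = "\<lambda>x. norm (indicator (cbox a b) x * f x)"])
      show "integrable (lebesgue_on W) (\<lambda>x. norm (indicator (cbox a b) x * f x))"
        using loc[OF ab] by (rule integrable_norm)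
      show "(\<lambda>x. \<phi> k x * f x) \<in> borel_measurable (lebesgue_on W)" for k
        using m f by (rule borel_measurable_times)
      show "(\<lambda>x. indicator (box a b) x * f x) \<in> borel_measurable (lebesgue_on W)"
      proof (intro borel_measurable_times borel_measurable_indicator f)
        show "box a b \<in> sets (lebesgue_on W)"
          using L ab box_subset_cbox[of a b] by (auto simp: sets_restrict_space_iff)
      qed
      show "AE x in lebesgue_on W. (\<lambda>k. \<phi> k x * f x) \<longlonglongrightarrow> indicator (box a b) x * f x"
        by (intro AE_I2 tendsto_mult tendsto_const \<phi>(5))
      show "AE x in lebesgue_on W. norm (\<phi> k x * f x) \<le> norm (indicator (cbox a b) x * f x)" for k
      proof (rule AE_I2)
        fix x
        show "norm (\<phi> k x * f x) \<le> norm (indicator (cbox a b) x * f x)"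
          using \<phi>(2,3)[of k x] \<phi>(4)[of x k] box_subset_cbox[of a b]
          by (cases "x \<in> box a b") (auto simp: abs_mult mult_left_le_one_le indicator_def)
      qed
    qed
    then show ?thesis using test[OF \<phi>(1)] by (simp add: LIMSEQ_const_iff)
  qed
  have loc0: "AE x in lebesgue. x \<in> cbox a b \<longrightarrow> f x = 0" if ab: "cbox a b \<subseteq> W" for a b
  proof -
    define F where "F = (\<lambda>x. indicator (cbox a b) x * f x)"
    have eq: "indicator W x * (indicator (cbox a b) x * f x) = F x" for x
      using ab by (auto simp: indicator_def F_def)
    have Fi: "integrable lebesgue F"
      using loc[OF ab] L by (simp add: integrable_restrict_space eq)
    have "AE x in lebesgue. F x = 0"
    proof (rule AE_zero_of_integral_boxes[OF Fi])
      fix c d :: "real \<times> real"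
      obtain p q where pq: "box a b \<inter> box c d = box p q" using box_Int_box by blast
      have sub: "box p q \<subseteq> box a b" using pq by blast
      show "(\<integral>x. indicator (box c d) x * F x \<partial>lebesgue) = 0"
      proof (cases "box p q = {}")
        case True
        have "AE x in lebesgue. indicator (box c d) x * F x = 0"
        proof -
          have "AE x in lebesgue. x \<notin> cbox a b - box a b"
            by (intro AE_not_in) (simp only: negligible_iff_null_sets[symmetric] negligible_frontier_interval)
          then show ?thesis
          proof eventually_elim
            case (elim x)
            then show ?case using True pq by (auto simp: F_def indicator_def)
          qed
        qed
        then show ?thesis by (simp add: integral_eq_zero_AE)
      next
        case False
        then have "cbox p q \<subseteq> cbox a b"
          using sub by (metis box_subset_cbox closure_box closure_cbox closure_mono order_trans subset_box(4) subset_box(3))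
        then have "(\<integral>x. indicator (box p q) x * f x \<partial>lebesgue_on W) = 0" using ab by (intro box0) auto
        then have "(\<integral>x. indicator (box p q) x * f x \<partial>lebesgue) = 0"
        proof -
          have "indicator W x * (indicator (box p q) x * f x) = indicator (box p q) x * f x" for x
            using sub ab box_subset_cbox[of a b] by (auto simp: indicator_def)
          then have "(\<lambda>x. indicator W x * (indicator (box p q) x * f x)) = (\<lambda>x. indicator (box p q) x * f x)" by blast
          then show ?thesis using \<open>(\<integral>x. indicator (box p q) x * f x \<partial>lebesgue_on W) = 0\<close> L
            by (simp add: integral_restrict_space)
        qed
        moreover have "(\<integral>x. indicator (box c d) x * F x \<partial>lebesgue) = (\<integral>x. indicator (box p q) x * f x \<partial>lebesgue)"
        proof (rule integral_cong_AE)
          have "f \<in> borel_measurable (lebesgue_on W)" by fact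
          show "(\<lambda>x. indicator (box c d) x * F x) \<in> borel_measurable lebesgue"
            using borel_measurable_integrable[OF Fi] by (intro borel_measurable_times borel_measurable_indicator) auto
          have e: "indicator (box p q) x * f x = indicator (box p q) x * F x" for x
            using sub box_subset_cbox[of a b] by (auto simp: F_def indicator_def)
          show "(\<lambda>x. indicator (box p q) x * f x) \<in> borel_measurable lebesgue"
            unfolding e using borel_measurable_integrable[OF Fi] by (intro borel_measurable_times borel_measurable_indicator) auto
          have "AE x in lebesgue. x \<notin> cbox a b - box a b"
            by (intro AE_not_in) (simp only: negligible_iff_null_sets[symmetric] negligible_frontier_interval)
          then show "AE x in lebesgue. indicator (box c d) x * F x = indicator (box p q) x * f x"
          proof eventually_elim
            case (elim x)
            then show ?case using pq box_subset_cbox[of a b] by (auto simp: F_def indicator_def)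
          qed
        qed
        ultimately show ?thesis by simp
      qed
    qed
    then show ?thesis by (auto simp: F_def indicator_def elim!: eventually_mono)
  qed
  \<comment> \<open>Countably many closed boxes exhaust \<open>W\<close>, so the exceptional null
    sets can be united.\<close>
  obtain D where D: "countable D" "\<And>X. X \<in> D \<Longrightarrow> X \<subseteq> W \<and> (\<exists>a b. X = cbox a b)" "\<Union>D = W"
    using open_countable_Union_open_cbox[OF W] by (metis Pow_iff subsetD)
  have "AE x in lebesgue. \<forall>X\<in>D. x \<in> X \<longrightarrow> f x = 0"
  proof (rule AE_ball_countable'[OF _ D(1)])
    fix X assume "X \<in> D"
    then show "AE x in lebesgue. x \<in> X \<longrightarrow> f x = 0" using D(2)[of X] loc0 by metis
  qed
  then have "AE x in lebesgue. x \<in> W \<longrightarrow> f x = 0"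
    by eventually_elim (use D(3) in blast)
  then show ?thesis using L by (simp add: AE_restrict_space_iff)
qed

subsection \<open>Holomorphic functions near a segment or a corner\<close>

text \<open>\<open>linepath\<close> runs over the unit interval; the substitution t = 2 s x - s
  passes to arc length measured from the midpoint \<open>m\<close>.\<close>

lemma contour_integral_linepath_bound:
  fixes m e :: complex
  assumes "0 < s" and e: "norm e = 1"
    and g: "continuous_on (closed_segment (m - of_real s * e) (m + of_real s * e)) g"
  shows "norm (contour_integral (linepath (m - of_real s * e) (m + of_real s * e)) g)
    \<le> integral {-s..s} (\<lambda>t. norm (g (m + of_real t * e)))"
proof -
  define a b where "a = m - of_real s * e" and "b = m + of_real s * e"
  define k where "k = (\<lambda>t. norm (g (m + of_real t * e)))"
  have lp: "linepath a b x = m + of_real (2 * s * x - s) * e" for x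
    by (simp add: a_def b_def linepath_def scaleR_conv_of_real algebra_simps)
  have seg: "m + of_real t * e \<in> closed_segment a b" if "t \<in> {-s..s}" for t
  proof -
    have "linepath a b ((t + s) / (2 * s)) \<in> closed_segment a b"
      using that \<open>0 < s\<close> by (intro linepath_in_path) (auto simp: field_simps)
    then show ?thesis using \<open>0 < s\<close> by (simp add: lp)
  qed
  have kc: "continuous_on {-s..s} k"
    unfolding k_def using seg g
    by (intro continuous_intros continuous_on_compose2[OF g]) (auto simp: a_def b_def)
  have gi: "(\<lambda>x. g (linepath a b x) * (b - a)) integrable_on {0..1}"
    using g contour_integrable_continuous_linepath[of a b g]
    by (simp add: a_def b_def contour_integrable_on_def has_contour_integral_linepath integrable_on_def)
  have sub: "((\<lambda>x. (2 * s) *\<^sub>R k (2 * s * x - s)) has_integral integral {2 * s * 0 - s..2 * s * 1 - s} k) {0..1}"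
  proof (rule has_integral_substitution[where c = "-s" and d = s])
    show "(\<lambda>x. 2 * s * x - s) ` {0..1} \<subseteq> {-s..s}"
      using \<open>0 < s\<close> by (auto simp: field_simps mult_left_le)
    show "((\<lambda>x. 2 * s * x - s) has_real_derivative 2 * s) (at x within {0..1})" for x
      by (auto intro!: derivative_eq_intros)
  qed (use \<open>0 < s\<close> kc in auto)
  have nba: "norm (b - a) = 2 * s"
    using \<open>0 < s\<close> e by (simp add: a_def b_def norm_mult flip: mult_2)
  have "norm (contour_integral (linepath a b) g) = norm (integral {0..1} (\<lambda>x. g (linepath a b x) * (b - a)))"
    by (simp add: contour_integral_integral)
  also have "... \<le> integral {0..1} (\<lambda>x. (2 * s) *\<^sub>R k (2 * s * x - s))"
  proof (rule integral_norm_bound_integral[OF gi])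
    show "(\<lambda>x. (2 * s) *\<^sub>R k (2 * s * x - s)) integrable_on {0..1}" using sub by blast
  qed (simp add: norm_mult lp k_def nba)
  also have "... = integral {-s..s} k" using integral_unique[OF sub] by simp
  finally show ?thesis by (simp add: a_def b_def k_def)
qed

text \<open>Cauchy's integral formula on the boundary of a square, where the distance to the centre
  is at least \<open>s\<close>. Keeping the factor \<open>s\<close> on the left makes the estimate
  ready for integration in \<open>s\<close>.\<close>

lemma Cauchy_square_bound:
  assumes S: "open S" "convex S" "f holomorphic_on S" and "0 < s"
    and sub: "cbox (p - Complex s s) (p + Complex s s) \<subseteq> S"
  shows "2 * pi * s * norm (f p) \<le>
      integral {-s..s} (\<lambda>t. norm (f (p + Complex s t))) + integral {-s..s} (\<lambda>t. norm (f (p + Complex (- s) t)))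
    + integral {-s..s} (\<lambda>t. norm (f (p + Complex t s))) + integral {-s..s} (\<lambda>t. norm (f (p + Complex t (- s))))"
proof -
  define a1 a2 a3 a4 where "a1 = p - Complex s s" and "a2 = p + Complex s (-s)"
    and "a3 = p + Complex s s" and "a4 = p + Complex (-s) s"
  define g where "g = (\<lambda>w. f w / (w - p))"
  define \<gamma> where "\<gamma> = rectpath a1 a3"
  have \<gamma>: "\<gamma> = linepath a1 a2 +++ linepath a2 a3 +++ linepath a3 a4 +++ linepath a4 a1"
  proof -
    have "a2 = Complex (Re a3) (Im a1)" "a4 = Complex (Re a1) (Im a3)"
      by (simp_all add: a1_def a2_def a3_def a4_def complex_eq_iff)
    then show ?thesis by (simp add: \<gamma>_def rectpath_def Let_def)
  qed
  have pin: "p \<in> box a1 a3"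
    using \<open>0 < s\<close> by (simp add: in_box_complex_iff a1_def a3_def)
  have sub': "cbox a1 a3 \<subseteq> S" using sub by (simp add: a1_def a3_def)
  have im: "path_image \<gamma> = cbox a1 a3 - box a1 a3"
    unfolding \<gamma>_def using \<open>0 < s\<close> by (intro path_image_rectpath_cbox_minus_box) (auto simp: a1_def a3_def)
  have imS: "path_image \<gamma> \<subseteq> S - {p}" using im pin sub' by blast
  have "(g has_contour_integral (2 * pi * \<i> * winding_number \<gamma> p * f p)) \<gamma>"
    unfolding g_def
  proof (rule Cauchy_integral_formula_convex_simple[OF S(2,3)])
    show "p \<in> interior S" using S(1) pin sub' box_subset_cbox by (metis interior_open subsetD)
  qed (use imS in \<open>simp_all add: \<gamma>_def\<close>)
  moreover have "winding_number \<gamma> p = 1"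
    unfolding \<gamma>_def by (rule winding_number_rectpath[OF pin])
  ultimately have hci: "(g has_contour_integral (2 * pi * \<i> * f p)) \<gamma>" by simp
  have gc: "continuous_on (S - {p}) g"
    unfolding g_def using holomorphic_on_imp_continuous_on[OF S(3)]
    by (intro continuous_intros) (auto intro: continuous_on_subset)
  have segs: "closed_segment a1 a2 \<subseteq> S - {p}" "closed_segment a2 a3 \<subseteq> S - {p}"
      "closed_segment a3 a4 \<subseteq> S - {p}" "closed_segment a4 a1 \<subseteq> S - {p}"
    using imS by (auto simp: \<gamma> path_image_join)
  note gcs = segs[THEN continuous_on_subset[OF gc]]
  have gis: "g contour_integrable_on linepath a1 a2" "g contour_integrable_on linepath a2 a3"
     "g contour_integrable_on linepath a3 a4" "g contour_integrable_on linepath a4 a1"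
    using gcs by (auto intro: contour_integrable_continuous_linepath)
  have "2 * pi * \<i> * f p = contour_integral \<gamma> g"
    using hci contour_integral_unique by metis
  also have "... = contour_integral (linepath a1 a2) g + (contour_integral (linepath a2 a3) g
      + (contour_integral (linepath a3 a4) g + contour_integral (linepath a4 a1) g))"
    using gis by (simp add: \<gamma>)
  finally have "norm (2 * pi * \<i> * f p) \<le> norm (contour_integral (linepath a1 a2) g)
      + (norm (contour_integral (linepath a2 a3) g)
      + (norm (contour_integral (linepath a3 a4) g) + norm (contour_integral (linepath a4 a1) g)))"
    by (metis (no_types, lifting) add_left_mono norm_triangle_ineq norm_triangle_le norm_triangle_mono order_refl)
  then have main: "2 * pi * norm (f p) \<le> norm (contour_integral (linepath a1 a2) g)
      + (norm (contour_integral (linepath a2 a3) g)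
      + (norm (contour_integral (linepath a3 a4) g) + norm (contour_integral (linepath a4 a1) g)))"
    by (simp add: norm_mult)
  have fb: "continuous_on {-s..s} (\<lambda>t. norm (f (p + Complex (u t) (v t))))"
    if "continuous_on {-s..s} u" "continuous_on {-s..s} v" "\<And>t. t \<in> {-s..s} \<Longrightarrow> \<bar>u t\<bar> \<le> s \<and> \<bar>v t\<bar> \<le> s" for u v
  proof (intro continuous_on_norm continuous_on_compose2[OF holomorphic_on_imp_continuous_on[OF S(3)]])
    show "continuous_on {-s..s} (\<lambda>t. p + Complex (u t) (v t))"
      unfolding Complex_eq using that by (intro continuous_intros)
    show "(\<lambda>t. p + Complex (u t) (v t)) ` {-s..s} \<subseteq> S"
    proof clarify
      fix t assume "t \<in> {-s..s}"
      then have "p + Complex (u t) (v t) \<in> cbox a1 a3"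
        using that(3)[of t] by (auto simp: a1_def a3_def in_cbox_complex_iff)
      then show "p + Complex (u t) (v t) \<in> S" using sub' by blast
    qed
  qed
  have fbs: "continuous_on {-s..s} (\<lambda>t. norm (f (p + Complex s t)))"
    "continuous_on {-s..s} (\<lambda>t. norm (f (p + Complex (-s) t)))"
    "continuous_on {-s..s} (\<lambda>t. norm (f (p + Complex t s)))"
    "continuous_on {-s..s} (\<lambda>t. norm (f (p + Complex t (-s))))"
    using fb[of "\<lambda>t. s" "\<lambda>t. t"] fb[of "\<lambda>t. -s" "\<lambda>t. t"] fb[of "\<lambda>t. t" "\<lambda>t. s"] fb[of "\<lambda>t. t" "\<lambda>t. -s"] \<open>0 < s\<close>
    by (auto simp: abs_le_iff)
  have side: "norm (contour_integral (linepath (p + c - of_real s * e) (p + c + of_real s * e)) g)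
      \<le> integral {-s..s} (\<lambda>t. norm (f (p + (c + of_real t * e)))) / s"
    if e: "norm e = 1" and gi: "continuous_on (closed_segment (p + c - of_real s * e) (p + c + of_real s * e)) g"
      and c: "\<And>t. s \<le> norm (c + of_real t * e)"
      and fi: "continuous_on {-s..s} (\<lambda>t. norm (f (p + (c + of_real t * e))))" for c e
  proof -
    have "norm (contour_integral (linepath (p + c - of_real s * e) (p + c + of_real s * e)) g)
       \<le> integral {-s..s} (\<lambda>t. norm (g (p + c + of_real t * e)))"
      by (rule contour_integral_linepath_bound[OF \<open>0 < s\<close> e gi])
    also have "... \<le> integral {-s..s} (\<lambda>t. norm (f (p + (c + of_real t * e))) / s)"
    proof (rule integral_le)
      have "p + c + of_real t * e \<in> closed_segment (p + c - of_real s * e) (p + c + of_real s * e)"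
        if "t \<in> {-s..s}" for t
      proof -
        have "p + c + of_real t * e = linepath (p + c - of_real s * e) (p + c + of_real s * e) ((t + s) / (2 * s))"
          using \<open>0 < s\<close> by (simp add: linepath_def scaleR_conv_of_real field_simps)
        then show ?thesis using that \<open>0 < s\<close> by (auto intro!: linepath_in_path simp: field_simps)
      qed
      then show "(\<lambda>t. norm (g (p + c + of_real t * e))) integrable_on {-s..s}"
        by (intro integrable_continuous_real continuous_intros continuous_on_compose2[OF gi]) auto
      show "(\<lambda>t. norm (f (p + (c + of_real t * e))) / s) integrable_on {-s..s}"
        using \<open>0 < s\<close> by (intro integrable_continuous_real continuous_intros fi) auto
      show "norm (g (p + c + of_real t * e)) \<le> norm (f (p + (c + of_real t * e))) / s" for t
      proof -
        have "0 < norm (c + of_real t * e)" using c[of t] \<open>0 < s\<close> by linarith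
        then have "norm (f (p + (c + of_real t * e))) / norm (c + of_real t * e) \<le> norm (f (p + (c + of_real t * e))) / s"
          using c[of t] \<open>0 < s\<close> by (intro divide_left_mono mult_pos_pos) auto
        then show ?thesis by (simp add: g_def norm_divide add.assoc)
      qed
    qed
    also have "... = integral {-s..s} (\<lambda>t. norm (f (p + (c + of_real t * e)))) / s" by simp
    finally show ?thesis .
  qed
  have cst: "s \<le> norm (Complex x y)" if "\<bar>x\<bar> = s \<or> \<bar>y\<bar> = s" for x y
    using that abs_Re_le_cmod[of "Complex x y"] abs_Im_le_cmod[of "Complex x y"] by auto
  have 1: "norm (contour_integral (linepath a1 a2) g) \<le> integral {-s..s} (\<lambda>t. norm (f (p + Complex t (- s)))) / s"
  proof -
    have eq: "Complex 0 (-s) + of_real t * 1 = Complex t (-s)" for t by (simp add: complex_eq_iff)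
    have ends: "p + Complex 0 (-s) - of_real s * 1 = a1" "p + Complex 0 (-s) + of_real s * 1 = a2"
      by (simp_all add: a1_def a2_def complex_eq_iff)
    show ?thesis
      using side[of 1 "Complex 0 (-s)", unfolded ends eq] gcs(1) \<open>0 < s\<close> fbs(4)
      by (simp add: cst)
  qed
  have 2: "norm (contour_integral (linepath a2 a3) g) \<le> integral {-s..s} (\<lambda>t. norm (f (p + Complex s t))) / s"
  proof -
    have eq: "Complex s 0 + of_real t * \<i> = Complex s t" for t by (simp add: complex_eq_iff)
    have ends: "p + Complex s 0 - of_real s * \<i> = a2" "p + Complex s 0 + of_real s * \<i> = a3"
      by (simp_all add: a2_def a3_def complex_eq_iff)
    show ?thesis
      using side[of \<i> "Complex s 0", unfolded ends eq] gcs(2) \<open>0 < s\<close> fbs(1)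
      by (simp add: cst)
  qed
  have 3: "norm (contour_integral (linepath a3 a4) g) \<le> integral {-s..s} (\<lambda>t. norm (f (p + Complex t s))) / s"
  proof -
    have eq: "Complex 0 s + of_real t * 1 = Complex t s" for t by (simp add: complex_eq_iff)
    have ends: "p + Complex 0 s - of_real s * 1 = a4" "p + Complex 0 s + of_real s * 1 = a3"
      by (simp_all add: a4_def a3_def complex_eq_iff)
    have "contour_integral (linepath a3 a4) g = - contour_integral (linepath a4 a3) g"
      using contour_integral_reversepath[of "linepath a4 a3" g] by simp
    then show ?thesis
      using side[of 1 "Complex 0 s", unfolded ends eq] gcs(3) \<open>0 < s\<close> fbs(3)
      by (simp add: cst closed_segment_commute)
  qed
  have 4: "norm (contour_integral (linepath a4 a1) g) \<le> integral {-s..s} (\<lambda>t. norm (f (p + Complex (-s) t))) / s"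
  proof -
    have eq: "Complex (-s) 0 + of_real t * \<i> = Complex (-s) t" for t by (simp add: complex_eq_iff)
    have ends: "p + Complex (-s) 0 - of_real s * \<i> = a1" "p + Complex (-s) 0 + of_real s * \<i> = a4"
      by (simp_all add: a1_def a4_def complex_eq_iff)
    have "contour_integral (linepath a4 a1) g = - contour_integral (linepath a1 a4) g"
      using contour_integral_reversepath[of "linepath a1 a4" g] by simp
    then show ?thesis
      using side[of \<i> "Complex (-s) 0", unfolded ends eq] gcs(4) \<open>0 < s\<close> fbs(2)
      by (simp add: cst closed_segment_commute)
  qed
  have "2 * pi * norm (f p) \<le>
     (integral {-s..s} (\<lambda>t. norm (f (p + Complex s t))) + integral {-s..s} (\<lambda>t. norm (f (p + Complex (- s) t)))
    + integral {-s..s} (\<lambda>t. norm (f (p + Complex t s))) + integral {-s..s} (\<lambda>t. norm (f (p + Complex t (- s))))) / s"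
    using main 1 2 3 4 by (simp add: add_divide_distrib)
  then show ?thesis using \<open>0 < s\<close> by (simp add: pos_le_divide_eq algebra_simps)
qed

lemma integral_symmetric_split:
  fixes \<phi> :: "real \<Rightarrow> real"
  assumes "0 \<le> d" "continuous_on {c - d..c + d} \<phi>"
  shows "integral {0..d} (\<lambda>s. \<phi> (c + s) + \<phi> (c - s)) = integral {c - d..c + d} \<phi>"
proof -
  have 1: "integral {0..d} (\<lambda>s. \<phi> (c + s)) = integral {c..c + d} \<phi>"
    using integral_shift_Icc_real[of 0 d \<phi> c] by (simp add: o_def add.commute)
  have "integral {0..d} (\<lambda>s. \<phi> (c - s)) = integral {-d..0} (\<lambda>s. \<phi> (c + s))"
    using Henstock_Kurzweil_Integration.integral_reflect_real[where a = "-d" and b = 0 and f = "\<lambda>s. \<phi> (c + s)"] by simp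
  then have 2: "integral {0..d} (\<lambda>s. \<phi> (c - s)) = integral {c - d..c} \<phi>"
    using integral_shift_Icc_real[of "-d" 0 \<phi> c] by (simp add: o_def add.commute)
  have "integral {0..d} (\<lambda>s. \<phi> (c + s) + \<phi> (c - s))
     = integral {0..d} (\<lambda>s. \<phi> (c + s)) + integral {0..d} (\<lambda>s. \<phi> (c - s))"
    by (intro HK_integral_add integrable_continuous_real
        continuous_on_compose2[OF assms(2)] continuous_intros) (use assms(1) in auto)
  also have "... = integral {c - d..c + d} \<phi>"
    unfolding 1 2 using assms
    by (subst add.commute, intro Henstock_Kurzweil_Integration.integral_combine integrable_continuous_real) auto
  finally show ?thesis .
qed

text \<open>Integrating \<open>Cauchy_square_bound\<close> over the half-side s from 0 to d lets the
  vertical sides sweep the square once and the horizontal sides once more, hence the factor 2. With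
  squares in place of discs the swept area is an iterated integral.\<close>

lemma square_mean_square_bound:
  assumes S: "open S" "convex S" "f holomorphic_on S" and "0 < d"
    and sub: "cbox (p - Complex d d) (p + Complex d d) \<subseteq> S"
  shows "pi * d^2 * (norm (f p))^2 \<le>
    2 * integral (cbox (Re p - d, Im p - d) (Re p + d, Im p + d)) (\<lambda>z. (norm (f (Complex (fst z) (snd z))))^2)"
proof -
  define K where "K = (\<lambda>x y. (norm (f (Complex x y)))^2)"
  define X where "X = {Re p - d..Re p + d}"
  define Y where "Y = {Im p - d..Im p + d}"
  have K: "continuous_on (X \<times> Y) (\<lambda>(x, y). K x y)"
    unfolding K_def case_prod_unfold
  proof (intro continuous_on_power continuous_on_norm continuous_on_compose2[OF holomorphic_on_imp_continuous_on[OF S(3)]])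
    show "continuous_on (X \<times> Y) (\<lambda>z. Complex (fst z) (snd z))"
      by (auto simp: Complex_eq intro!: continuous_intros)
    show "(\<lambda>z. Complex (fst z) (snd z)) ` (X \<times> Y) \<subseteq> S"
      using sub by (force simp: in_cbox_complex_iff X_def Y_def)
  qed
  have K': "continuous_on (Y \<times> X) (\<lambda>(y, x). K x y)"
  proof -
    have "continuous_on (Y \<times> X) (\<lambda>z. case (snd z, fst z) of (x, y) \<Rightarrow> K x y)"
      by (rule continuous_on_compose2[OF K]) (auto intro!: continuous_intros)
    then show ?thesis by (simp add: case_prod_unfold)
  qed
  have K0: "0 \<le> K x y" for x y by (simp add: K_def)
  have nn: "0 \<le> integral T k" if "\<And>x. 0 \<le> k x" for T :: "real set" and k :: "real \<Rightarrow> real"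
    by (cases "k integrable_on T")
       (use that in \<open>auto simp: not_integrable_integral intro: HK_integral_nonneg\<close>)
  define \<phi> where "\<phi> = (\<lambda>x. integral Y (K x))"
  define \<psi> where "\<psi> = (\<lambda>y. integral X (\<lambda>x. K x y))"
  have \<phi>c: "continuous_on X \<phi>"
    using integral_continuous_on_param[of X "Im p - d" "Im p + d" K] K by (simp add: \<phi>_def Y_def)
  have \<psi>c: "continuous_on Y \<psi>"
    using integral_continuous_on_param[of Y "Re p - d" "Re p + d" "\<lambda>y x. K x y"] K' by (simp add: \<psi>_def X_def)
  have step: "2 * pi * s * (norm (f p))^2 \<le> \<phi> (Re p + s) + \<phi> (Re p - s) + (\<psi> (Im p + s) + \<psi> (Im p - s))"
    if s: "s \<in> {0..d}" for s
  proof (cases "s = 0")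
    case True
    have "0 \<le> \<phi> x" "0 \<le> \<psi> x" for x unfolding \<phi>_def \<psi>_def by (intro nn K0)+
    then show ?thesis using True by (simp add: add_nonneg_nonneg)
  next
    case False
    then have s0: "0 < s" using s by simp
    \<comment> \<open>Cauchy's formula is applied to the square of f, which yields |f|^2 at the
      centre without Cauchy-Schwarz.\<close>
    have hol: "(\<lambda>w. (f w)^2) holomorphic_on S" using S(3) by (intro holomorphic_intros)
    have sub1: "cbox (p - Complex s s) (p + Complex s s) \<subseteq> S"
      using s by (intro order_trans[OF _ sub]) (auto simp: in_cbox_complex_iff)
    note C = Cauchy_square_bound[OF S(1,2) hol s0 sub1]
    have Kx: "continuous_on Y (K x)" if "x \<in> X" for x
    proof -
      have "continuous_on Y (\<lambda>y. case (x, y) of (x, y) \<Rightarrow> K x y)"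
        by (rule continuous_on_compose2[OF K continuous_on_Pair[OF continuous_on_const continuous_on_id]])
           (use that in auto)
      then show ?thesis by simp
    qed
    have Ky: "continuous_on X (\<lambda>x. K x y)" if "y \<in> Y" for y
    proof -
      have "continuous_on X (\<lambda>x. case (x, y) of (x, y) \<Rightarrow> K x y)"
        by (rule continuous_on_compose2[OF K continuous_on_Pair[OF continuous_on_id continuous_on_const]])
           (use that in auto)
      then show ?thesis by simp
    qed
    have a: "integral {-s..s} (\<lambda>t. norm ((f (p + Complex u t))^2)) \<le> \<phi> (Re p + u)" if u: "\<bar>u\<bar> \<le> s" for u
    proof -
      have eq: "norm ((f (p + Complex u t))^2) = (K (Re p + u) \<circ> (+) (Im p)) t" for t
        by (simp add: K_def norm_power plus_complex.code)
      have "integral {-s..s} (\<lambda>t. norm ((f (p + Complex u t))^2)) = integral {-s + Im p..s + Im p} (K (Re p + u))"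
        unfolding eq by (rule integral_shift_Icc_real)
      also have "... \<le> \<phi> (Re p + u)"
        unfolding \<phi>_def using s u
        by (intro integral_subset_le integrable_continuous_real Kx[unfolded Y_def] continuous_on_subset[OF Kx])
           (auto simp: Y_def X_def K0 abs_le_iff intro!: Kx[unfolded Y_def] integrable_continuous_real)
      finally show ?thesis .
    qed
    have b: "integral {-s..s} (\<lambda>t. norm ((f (p + Complex t u))^2)) \<le> \<psi> (Im p + u)" if u: "\<bar>u\<bar> \<le> s" for u
    proof -
      have eq: "norm ((f (p + Complex t u))^2) = ((\<lambda>x. K x (Im p + u)) \<circ> (+) (Re p)) t" for t
        by (simp add: K_def norm_power plus_complex.code)
      have "integral {-s..s} (\<lambda>t. norm ((f (p + Complex t u))^2)) = integral {-s + Re p..s + Re p} (\<lambda>x. K x (Im p + u))"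
        unfolding eq by (rule integral_shift_Icc_real)
      also have "... \<le> \<psi> (Im p + u)"
        unfolding \<psi>_def using s u
        by (intro integral_subset_le integrable_continuous_real Ky[unfolded X_def] continuous_on_subset[OF Ky])
           (auto simp: Y_def X_def K0 abs_le_iff intro!: Ky[unfolded X_def] integrable_continuous_real)
      finally show ?thesis .
    qed
    show ?thesis
      using C a[of s] a[of "-s"] b[of s] b[of "-s"] s0 by (simp add: norm_power)
  qed
  have "pi * d^2 * (norm (f p))^2 = integral {0..d} (\<lambda>s. 2 * pi * s * (norm (f p))^2)"
  proof -
    have "((\<lambda>s. 2 * pi * s * (norm (f p))^2) has_integral (pi * d^2 * (norm (f p))^2 - pi * 0^2 * (norm (f p))^2)) {0..d}"
      by (rule fundamental_theorem_of_calculus)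
         (use \<open>0 < d\<close> in \<open>auto intro!: derivative_eq_intros simp flip: has_real_derivative_iff_has_vector_derivative\<close>)
    from integral_unique[OF this]
    have "integral {0..d} (\<lambda>s. 2 * pi * s * (norm (f p))^2) = pi * d^2 * (norm (f p))^2" by simp
    then show ?thesis by (rule sym)
  qed
  also have "... \<le> integral {0..d} (\<lambda>s. (\<phi> (Re p + s) + \<phi> (Re p - s)) + (\<psi> (Im p + s) + \<psi> (Im p - s)))"
    by (intro integral_le integrable_continuous_real step continuous_intros
        continuous_on_compose2[OF \<phi>c] continuous_on_compose2[OF \<psi>c])
       (auto simp: X_def Y_def)
  also have "... = integral {0..d} (\<lambda>s. \<phi> (Re p + s) + \<phi> (Re p - s)) + integral {0..d} (\<lambda>s. \<psi> (Im p + s) + \<psi> (Im p - s))"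
    by (intro HK_integral_add integrable_continuous_real continuous_intros
        continuous_on_compose2[OF \<phi>c] continuous_on_compose2[OF \<psi>c])
       (auto simp: X_def Y_def)
  also have "... = integral X \<phi> + integral Y \<psi>"
    using \<phi>c \<psi>c \<open>0 < d\<close> by (simp add: integral_symmetric_split X_def Y_def)
  also have "integral Y \<psi> = integral X \<phi>"
    unfolding \<phi>_def \<psi>_def X_def Y_def
    using integral_swap_continuous[of "Re p - d" "Im p - d" "Re p + d" "Im p + d" K] K
    by (simp add: X_def Y_def cbox_Pair_eq)
  also have "integral X \<phi> = integral (cbox (Re p - d, Im p - d) (Re p + d, Im p + d)) (\<lambda>z. (norm (f (Complex (fst z) (snd z))))^2)"
    using integral_prod_continuous[of "Re p - d" "Im p - d" "Re p + d" "Im p + d" "\<lambda>(x, y). K x y"] K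
    by (simp add: X_def Y_def cbox_Pair_eq \<phi>_def K_def case_prod_unfold)
  finally show ?thesis by simp
qed

lemma deriv_real_on_reals:
  assumes "open S" "f holomorphic_on S" "\<And>z. z \<in> S \<Longrightarrow> Im z = 0 \<Longrightarrow> Im (f z) = 0"
    and z: "z \<in> S" "Im z = 0"
  shows "Im (deriv f z) = 0"
proof -
  define x where "x = Re z"
  have zx: "z = of_real x" using z(2) by (simp add: x_def complex_eq_iff)
  have "(f has_field_derivative deriv f z) (at z)"
    using assms holomorphic_derivI by blast
  then have "((\<lambda>t. f (of_real t)) has_vector_derivative deriv f z) (at x)"
    unfolding zx by (rule has_vector_derivative_real_field)
  then have 1: "((\<lambda>t. Im (f (of_real t))) has_real_derivative Im (deriv f z)) (at x)"
    unfolding has_real_derivative_iff_has_vector_derivative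
    by (rule bounded_linear.has_vector_derivative[OF bounded_linear_Im])
  obtain r where r: "0 < r" "ball z r \<subseteq> S" using assms(1) z(1) openE by blast
  have "((\<lambda>t. 0) has_real_derivative Im (deriv f z)) (at x)"
  proof (rule has_field_derivative_transform_within_open[OF 1, of "ball x r"])
    fix t assume "t \<in> ball x r"
    then have "of_real t \<in> ball z r" by (simp add: zx dist_of_real)
    then show "Im (f (of_real t)) = 0" using r assms(3) by auto
  qed (use r in auto)
  then show ?thesis using DERIV_const[of 0 "at x"] DERIV_unique by blast
qed

text \<open>The second antiderivative of \<open>\<i> * H\<close> is continuous up to the real line, although \<open>H\<close>
  itself may a priori blow up there; its imaginary part is constant on the line.\<close>

lemma holomorphic_extension_across_zero_set:
  fixes H :: "complex \<Rightarrow> complex" and V :: "complex \<Rightarrow> real"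
  assumes "0 < \<rho>" and D: "D = {z. \<bar>Re z\<bar> < \<rho> \<and> 0 < Im z \<and> Im z < \<rho>}"
    and H: "H holomorphic_on D"
    and V: "\<And>z. z \<in> D \<Longrightarrow> (V has_derivative (\<lambda>k. Re (H z * k))) (at z)"
    and bound: "\<And>z. z \<in> D \<Longrightarrow> norm (H z) * Im z \<le> C"
    and lim: "\<And>x0 x1. -\<rho> < x0 \<Longrightarrow> x0 < x1 \<Longrightarrow> x1 < \<rho> \<Longrightarrow>
      ((\<lambda>s. integral {x0..x1} (\<lambda>x. V (Complex x s))) \<longlongrightarrow> 0) (at_right 0)"
  obtains \<delta> K where "0 < \<delta>" "K holomorphic_on ball 0 \<delta>"
    "\<And>z. z \<in> ball 0 \<delta> \<Longrightarrow> 0 < Im z \<Longrightarrow> K z = H z"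
    "\<And>z. z \<in> ball 0 \<delta> \<Longrightarrow> Im z = 0 \<Longrightarrow> Re (K z) = 0"
proof -
  have Deq: "D = {z. Re z < \<rho>} \<inter> {z. - \<rho> < Re z} \<inter> {z. 0 < Im z} \<inter> {z. Im z < \<rho>}"
    unfolding D by auto
  have oD: "open D"
    unfolding Deq by (intro open_Int open_halfspace_Re_lt open_halfspace_Re_gt open_halfspace_Im_lt open_halfspace_Im_gt)
  have cD: "convex D"
    unfolding Deq by (intro convex_Int convex_halfspace_Re_lt convex_halfspace_Re_gt convex_halfspace_Im_lt convex_halfspace_Im_gt)
  define s0 where "s0 = \<rho> / 2"
  have s0: "0 < s0" "s0 < \<rho>" using \<open>0 < \<rho>\<close> by (auto simp: s0_def)
  obtain \<Phi>0 where \<Phi>0: "\<And>z. z \<in> D \<Longrightarrow> (\<Phi>0 has_field_derivative H z) (at z)"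
    using holomorphic_convex_primitive'[OF cD oD H] at_within_open[OF _ oD] by metis
  have "\<exists>c. \<forall>z\<in>D. V z - Re (\<Phi>0 z) = c"
  proof (rule has_derivative_zero_constant[OF cD])
    fix z assume z: "z \<in> D"
    have "((\<lambda>z. Re (\<Phi>0 z)) has_derivative (\<lambda>k. Re (H z * k))) (at z)"
      using has_derivative_Re[OF \<Phi>0[OF z, unfolded has_field_derivative_def]] .
    from has_derivative_diff[OF V[OF z] this]
    have "((\<lambda>z. V z - Re (\<Phi>0 z)) has_derivative (\<lambda>k. 0)) (at z)" by simp
    then show "((\<lambda>z. V z - Re (\<Phi>0 z)) has_derivative (\<lambda>k. 0)) (at z within D)"
      by (rule has_derivative_at_withinI)
  qed
  then obtain c where c: "\<And>z. z \<in> D \<Longrightarrow> V z = Re (\<Phi>0 z) + c"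
    by (metis diff_add_cancel add.commute)
  \<comment> \<open>The real part of a primitive of H has the same differential as V; the constant
    makes V equal to it.\<close>
  define \<Phi> where "\<Phi> = (\<lambda>z. \<Phi>0 z + of_real c)"
  have \<Phi>: "(\<Phi> has_field_derivative H z) (at z)" if "z \<in> D" for z
    unfolding \<Phi>_def using \<Phi>0[OF that] by (auto intro!: derivative_eq_intros)
  have V\<Phi>: "V z = Re (\<Phi> z)" if "z \<in> D" for z
    using c[OF that] by (simp add: \<Phi>_def)
  have \<Phi>hol: "\<Phi> holomorphic_on D"
    using \<Phi> oD by (auto simp: holomorphic_on_open)
  \<comment> \<open>With the factor \<i>, the imaginary part of the second primitive
    \<open>G\<close> changes along a horizontal segment by the integral of V, which is the quantity
    that \<open>lim\<close> controls.\<close>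
  then have "(\<lambda>z. \<i> * \<Phi> z) holomorphic_on D" by (intro holomorphic_intros)
  then obtain G where G: "\<And>z. z \<in> D \<Longrightarrow> (G has_field_derivative \<i> * \<Phi> z) (at z)"
    using holomorphic_convex_primitive'[OF cD oD] at_within_open[OF _ oD] by metis
  have Gcont: "continuous_on D G"
    using G DERIV_isCont by (intro continuous_at_imp_continuous_on) blast
  have C0: "0 \<le> C"
  proof -
    have "Complex 0 s0 \<in> D" using s0 \<open>0 < \<rho>\<close> by (simp add: D)
    from bound[OF this] show ?thesis
      using s0 by (metis complex.sel(2) mult_nonneg_nonneg norm_ge_zero order_trans less_imp_le)
  qed
  have inD: "Complex x t \<in> D" if "\<bar>x\<bar> \<le> s0" "0 < t" "t \<le> s0" for x t
    using that s0 by (auto simp: D)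
  have vert: "((\<lambda>t. F (Complex x t)) has_vector_derivative \<i> * F') (at t)"
    if "(F has_field_derivative F') (at (Complex x t))" for F F' x t
  proof -
    have "((\<lambda>t. Complex x t) has_vector_derivative \<i>) (at t)"
      unfolding Complex_eq has_vector_derivative_def
      by (auto intro!: derivative_eq_intros simp: scaleR_conv_of_real mult.commute)
    from field_vector_diff_chain_at[OF this that] show ?thesis by (simp add: o_def)
  qed
  have horiz: "((\<lambda>t. F (Complex t y)) has_vector_derivative F') (at t)"
    if "(F has_field_derivative F') (at (Complex t y))" for F F' y t
  proof -
    have "((\<lambda>t. Complex t y) has_vector_derivative 1) (at t)"
      unfolding Complex_eq has_vector_derivative_def
      by (auto intro!: derivative_eq_intros simp: scaleR_conv_of_real mult.commute)
    from field_vector_diff_chain_at[OF this that] show ?thesis by (simp add: o_def)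
  qed
  obtain M where M: "\<And>x. \<bar>x\<bar> \<le> s0 \<Longrightarrow> norm (\<Phi> (Complex x s0)) \<le> M" "0 \<le> M"
  proof -
    have "compact ((\<lambda>x. \<Phi> (Complex x s0)) ` {-s0..s0})"
    proof (intro compact_continuous_image continuous_on_compose2[OF holomorphic_on_imp_continuous_on[OF \<Phi>hol]])
      show "continuous_on {-s0..s0} (\<lambda>x. Complex x s0)" unfolding Complex_eq by (intro continuous_intros)
      show "(\<lambda>x. Complex x s0) ` {-s0..s0} \<subseteq> D" using s0 inD by auto
    qed simp
    then obtain M where "\<And>x. x \<in> {-s0..s0} \<Longrightarrow> norm (\<Phi> (Complex x s0)) \<le> M"
      using compact_imp_bounded bounded_iff by (metis (no_types, lifting) imageI)
    then have "norm (\<Phi> (Complex x s0)) \<le> max M 0" if "\<bar>x\<bar> \<le> s0" for x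
      using that by (simp add: abs_le_iff le_max_iff_disj)
    then show ?thesis using that[of "max M 0"] by simp
  qed
  \<comment> \<open>The bound C/t on H is weakened to a multiple of t^(-3/2), so that \<Phi> is
    bounded by \<open>L / sqrt s\<close> instead of a logarithm. This is still integrable at 0 and
    makes \<open>G\<close> uniformly 1/2-Hoelder along vertical lines.\<close>
  define L where "L = M * sqrt s0 + 2 * C * sqrt s0"
  have L0: "0 \<le> L" using M(2) C0 s0 by (simp add: L_def)
  have \<Phi>b: "norm (\<Phi> (Complex x s)) \<le> L / sqrt s" if x: "\<bar>x\<bar> \<le> s0" and s: "0 < s" "s \<le> s0" for x s
  proof (cases "s = s0")
    case True
    have "L / sqrt s = M + 2 * C" using True s0 by (simp add: L_def field_simps)
    then show ?thesis using M(1)[OF x] C0 True by simp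
  next
    case False
    then have lt: "s < s0" using s by simp
    have "norm (\<Phi> (Complex x s0) - \<Phi> (Complex x s)) \<le> - (2 * C * sqrt s0) / sqrt s0 - - (2 * C * sqrt s0) / sqrt s"
    proof (rule differentiable_bound_general[OF lt])
      show "continuous_on {s..s0} (\<lambda>t. \<Phi> (Complex x t))"
        using s x by (intro continuous_at_imp_continuous_on ballI has_vector_derivative_continuous[OF vert[OF \<Phi>]] inD) auto
      show "continuous_on {s..s0} (\<lambda>t. - (2 * C * sqrt s0) / sqrt t)"
        using s by (intro continuous_intros) auto
      fix t assume t: "s < t" "t < s0"
      then have tD: "Complex x t \<in> D" using s x by (intro inD) auto
      show "((\<lambda>t. \<Phi> (Complex x t)) has_vector_derivative \<i> * H (Complex x t)) (at t)"
        by (rule vert[OF \<Phi>[OF tD]])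
      show "((\<lambda>t. - (2 * C * sqrt s0) / sqrt t) has_vector_derivative C * sqrt s0 / (t * sqrt t)) (at t)"
        unfolding has_real_derivative_iff_has_vector_derivative[symmetric]
        using t s by (auto intro!: derivative_eq_intros simp: field_simps power2_eq_square real_sqrt_mult_self)
      have "norm (H (Complex x t)) \<le> C / t"
        using bound[OF tD] t s by (simp add: field_simps)
      also have "... \<le> C / t * (sqrt s0 / sqrt t)"
        using t s C0 mult_left_mono[of 1 "sqrt s0 / sqrt t" "C / t"] by simp
      finally show "norm (\<i> * H (Complex x t)) \<le> C * sqrt s0 / (t * sqrt t)"
        by (simp add: norm_mult)
    qed
    then have "norm (\<Phi> (Complex x s)) \<le> M - 2 * C + 2 * C * sqrt s0 / sqrt s"
      using M(1)[OF x] norm_triangle_sub[of "\<Phi> (Complex x s)" "\<Phi> (Complex x s0)"] s0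
      by (simp add: norm_minus_commute)
    also have "... \<le> M * (sqrt s0 / sqrt s) + 2 * C * sqrt s0 / sqrt s"
      using M(2) C0 s lt mult_left_mono[of 1 "sqrt s0 / sqrt s" M] by simp
    also have "... = L / sqrt s" by (simp add: L_def add_divide_distrib)
    finally show ?thesis .
  qed
  have Gb: "norm (G (Complex x t) - G (Complex x s)) \<le> 2 * L * (sqrt t - sqrt s)"
    if x: "\<bar>x\<bar> \<le> s0" and st: "0 < s" "s \<le> t" "t \<le> s0" for x s t
  proof (cases "s = t")
    case False
    then have lt: "s < t" using st by simp
    have "norm (G (Complex x t) - G (Complex x s)) \<le> 2 * L * sqrt t - 2 * L * sqrt s"
    proof (rule differentiable_bound_general[OF lt])
      show "continuous_on {s..t} (\<lambda>t. G (Complex x t))"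
        using st x by (intro continuous_at_imp_continuous_on ballI has_vector_derivative_continuous[OF vert[OF G]] inD) auto
      show "continuous_on {s..t} (\<lambda>t. 2 * L * sqrt t)" by (intro continuous_intros)
      fix \<tau> assume t: "s < \<tau>" "\<tau> < t"
      then have tD: "Complex x \<tau> \<in> D" using st x by (intro inD) auto
      show "((\<lambda>t. G (Complex x t)) has_vector_derivative \<i> * (\<i> * \<Phi> (Complex x \<tau>))) (at \<tau>)"
        by (rule vert[OF G[OF tD]])
      show "((\<lambda>t. 2 * L * sqrt t) has_vector_derivative L / sqrt \<tau>) (at \<tau>)"
        unfolding has_real_derivative_iff_has_vector_derivative[symmetric]
        using t st by (auto intro!: derivative_eq_intros simp: field_simps)
      show "norm (\<i> * (\<i> * \<Phi> (Complex x \<tau>))) \<le> L / sqrt \<tau>"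
        using \<Phi>b[of x \<tau>] x t st by (simp add: norm_mult)
    qed
    then show ?thesis by (simp add: algebra_simps)
  qed simp
  \<comment> \<open>Upward shifts tending to 0. They are at most s0/2, so that points of height
    below s0/2 remain in the region where the bounds hold.\<close>
  define \<sigma> where "\<sigma> = (\<lambda>n. s0 / (2 * real (Suc n)))"
  have \<sigma>: "0 < \<sigma> n" "\<sigma> n \<le> s0 / 2" for n
    using s0 by (auto simp: \<sigma>_def field_simps)
  have \<sigma>lim: "\<sigma> \<longlonglongrightarrow> 0"
    unfolding \<sigma>_def by real_asymp
  define T where "T = {z. \<bar>Re z\<bar> < s0 \<and> 0 \<le> Im z \<and> Im z < s0 / 2}"
  define Gn where "Gn = (\<lambda>n z. G (z + \<i> * of_real (\<sigma> n)))"
  have TD: "z + \<i> * of_real (\<sigma> n) \<in> D" if "z \<in> T" for z n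
    using that \<sigma>[of n] s0 by (auto simp: T_def D)
  have Gn_cont: "continuous_on T (Gn n)" for n
    unfolding Gn_def using TD by (intro continuous_on_compose2[OF Gcont] continuous_intros) auto
  have Gn_eq: "Gn n z = G (Complex (Re z) (Im z + \<sigma> n))" for n z
    unfolding Gn_def by (rule arg_cong[of _ _ G]) (simp add: complex_eq_iff)
  have diff_sqrt: "sqrt b - sqrt a \<le> sqrt (b - a)" if "0 \<le> a" "a \<le> b" for a b :: real
    using sqrt_add_le_add_sqrt[of a "b - a"] that by simp
  have Gn_diff: "norm (Gn n z - Gn m z) \<le> 2 * L * sqrt \<bar>\<sigma> n - \<sigma> m\<bar>" if z: "z \<in> T" for n m z
  proof -
    have *: "norm (Gn n z - Gn m z) \<le> 2 * L * sqrt \<bar>\<sigma> n - \<sigma> m\<bar>" if "\<sigma> m \<le> \<sigma> n" for n m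
    proof -
      have "norm (Gn n z - Gn m z) \<le> 2 * L * (sqrt (Im z + \<sigma> n) - sqrt (Im z + \<sigma> m))"
        unfolding Gn_eq using z \<sigma>[of n] \<sigma>[of m] that by (intro Gb) (auto simp: T_def)
      also have "... \<le> 2 * L * sqrt \<bar>\<sigma> n - \<sigma> m\<bar>"
        using diff_sqrt[of "Im z + \<sigma> m" "Im z + \<sigma> n"] z \<sigma>[of m] that L0
        by (intro mult_left_mono) (auto simp: T_def)
      finally show ?thesis .
    qed
    show ?thesis
      using *[of m n] *[of n m] by (cases "\<sigma> m \<le> \<sigma> n") (auto simp: norm_minus_commute abs_minus_commute)
  qed
  have "uniformly_Cauchy_on T Gn"
    unfolding uniformly_Cauchy_on_def
  proof (intro allI impI)
    fix e :: real assume e: "0 < e"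
    have "(\<lambda>n. 2 * L * sqrt (\<sigma> n)) \<longlonglongrightarrow> 2 * L * sqrt 0"
      by (intro tendsto_intros \<sigma>lim)
    then have "eventually (\<lambda>n. 2 * L * sqrt (\<sigma> n) < e) sequentially"
      using e by (intro order_tendstoD) auto
    then obtain N where N: "\<And>n. n \<ge> N \<Longrightarrow> 2 * L * sqrt (\<sigma> n) < e"
      by (auto simp: eventually_sequentially)
    have "dist (Gn m z) (Gn n z) < e" if "z \<in> T" "m \<ge> N" "n \<ge> N" for z m n
    proof -
      have "\<bar>\<sigma> m - \<sigma> n\<bar> \<le> max (\<sigma> m) (\<sigma> n)" using \<sigma>(1)[of m] \<sigma>(1)[of n] by (simp add: abs_le_iff max_def)
      then have "2 * L * sqrt \<bar>\<sigma> m - \<sigma> n\<bar> \<le> 2 * L * sqrt (max (\<sigma> m) (\<sigma> n))"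
        using L0 by (intro mult_left_mono) auto
      also have "... < e" using N[of m] N[of n] that by (simp add: max_def)
      finally show ?thesis using Gn_diff[OF that(1), of m n] by (simp add: dist_norm)
    qed
    then show "\<exists>M. \<forall>x\<in>T. \<forall>m\<ge>M. \<forall>n\<ge>M. dist (Gn m x) (Gn n x) < e" by blast
  qed
  then have "uniformly_convergent_on T Gn"
    by (simp add: uniformly_convergent_eq_Cauchy)
  then obtain G1 where G1: "uniform_limit T Gn G1 sequentially"
    by (auto simp: uniformly_convergent_on_def)
  have G1cont: "continuous_on T G1"
    by (rule uniform_limit_theorem[OF _ G1]) (intro always_eventually allI Gn_cont, simp)
  have G1lim: "(\<lambda>n. Gn n z) \<longlonglongrightarrow> G1 z" if "z \<in> T" for z
    by (rule tendsto_uniform_limitI[OF G1 that])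
  have G1G: "G1 z = G z" if z: "z \<in> T" "0 < Im z" for z
  proof -
    have "z \<in> D" using z s0 by (auto simp: T_def D)
    then have "isCont G z" using G DERIV_isCont by blast
    moreover have "(\<lambda>n. z + \<i> * of_real (\<sigma> n)) \<longlonglongrightarrow> z + \<i> * of_real 0"
      by (intro tendsto_intros \<sigma>lim)
    ultimately have "(\<lambda>n. Gn n z) \<longlonglongrightarrow> G z"
      unfolding Gn_def by (intro isCont_tendsto_compose[of z G]) auto
    then show ?thesis using G1lim[OF z(1)] LIMSEQ_unique by blast
  qed
  \<comment> \<open>On the real line the increment of Im G1 is the limit of the integrals of V along
    the shifted segments, which is zero by \<open>lim\<close>.\<close>
  have ImG1_aux: "Im (G1 (of_real x1)) = Im (G1 (of_real x0))" if x: "-s0 < x0" "x0 < x1" "x1 < s0" for x0 x1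
  proof -
    have int: "Im (Gn n (of_real x1)) - Im (Gn n (of_real x0)) = integral {x0..x1} (\<lambda>x. V (Complex x (\<sigma> n)))" for n
    proof -
      have "((\<lambda>x. Re (\<Phi> (Complex x (\<sigma> n)))) has_integral
          (Im (G (Complex x1 (\<sigma> n))) - Im (G (Complex x0 (\<sigma> n))))) {x0..x1}"
      proof (rule fundamental_theorem_of_calculus)
        fix t assume "t \<in> {x0..x1}"
        then have tD: "Complex t (\<sigma> n) \<in> D" using x \<sigma>[of n] s0 by (intro inD) auto
        from bounded_linear.has_vector_derivative[OF bounded_linear_Im horiz[OF G[OF tD]]]
        show "((\<lambda>t. Im (G (Complex t (\<sigma> n)))) has_vector_derivative Re (\<Phi> (Complex t (\<sigma> n)))) (at t within {x0..x1})"
          by (simp add: has_vector_derivative_at_within)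
      qed (use x in simp)
      from integral_unique[OF this] have
        "Im (Gn n (of_real x1)) - Im (Gn n (of_real x0)) = integral {x0..x1} (\<lambda>x. Re (\<Phi> (Complex x (\<sigma> n))))"
        by (simp add: Gn_eq)
      also have "... = integral {x0..x1} (\<lambda>x. V (Complex x (\<sigma> n)))"
        using x \<sigma>[of n] s0 by (intro HK_integral_cong V\<Phi>[symmetric] inD) auto
      finally show ?thesis .
    qed
    have "filterlim \<sigma> (at_right 0) sequentially"
      using \<sigma>lim \<sigma>(1) by (intro tendsto_imp_filterlim_at_right) auto
    then have "(\<lambda>n. integral {x0..x1} (\<lambda>x. V (Complex x (\<sigma> n)))) \<longlonglongrightarrow> 0"
      using x s0 by (intro filterlim_compose[OF lim]) auto
    moreover have "(\<lambda>n. Im (Gn n (of_real x1)) - Im (Gn n (of_real x0))) \<longlonglongrightarrow> Im (G1 (of_real x1)) - Im (G1 (of_real x0))"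
      using x s0 by (intro tendsto_intros G1lim) (auto simp: T_def)
    ultimately have "Im (G1 (of_real x1)) - Im (G1 (of_real x0)) = 0"
      unfolding int using LIMSEQ_unique by blast
    then show ?thesis by simp
  qed
  define \<kappa> where "\<kappa> = Im (G1 0)"
  have ImG1: "Im (G1 (of_real x)) = \<kappa>" if "\<bar>x\<bar> < s0" for x
    using ImG1_aux[of 0 x] ImG1_aux[of x 0] that s0 by (cases x "0::real" rule: linorder_cases) (auto simp: \<kappa>_def)
  \<comment> \<open>Subtracting the constant boundary value of the imaginary part makes F real on
    the line, as Schwarz reflection requires; the later derivatives remove the constant
    again.\<close>
  define F where "F = (\<lambda>z. G1 z - \<i> * of_real \<kappa>)"
  define S where "S = ball (0::complex) (s0 / 2)"
  have ST: "S \<inter> {z. 0 \<le> Im z} \<subseteq> T"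
  proof
    fix z assume z: "z \<in> S \<inter> {z. 0 \<le> Im z}"
    then show "z \<in> T"
      using abs_Re_le_cmod[of z] abs_Im_le_cmod[of z] s0 by (simp add: S_def T_def)
  qed
  define F' where "F' = (\<lambda>z. if 0 \<le> Im z then F z else cnj (F (cnj z)))"
  have F'hol: "F' holomorphic_on S"
    unfolding F'_def
  proof (rule Schwarz_reflection)
    have "G holomorphic_on D" using G oD by (auto simp: holomorphic_on_open)
    moreover have sub: "S \<inter> {z. 0 < Im z} \<subseteq> D" using ST s0 by (auto simp: T_def D)
    ultimately have "(\<lambda>z. G z - \<i> * of_real \<kappa>) holomorphic_on (S \<inter> {z. 0 < Im z})"
      by (intro holomorphic_intros) (auto intro: holomorphic_on_subset)
    then show "F holomorphic_on (S \<inter> {z. 0 < Im z})"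
      by (rule holomorphic_transform) (use ST G1G in \<open>auto simp: F_def\<close>)
    show "continuous_on (S \<inter> {z. 0 \<le> Im z}) F"
      unfolding F_def by (intro continuous_intros continuous_on_subset[OF G1cont ST])
    show "F z \<in> \<real>" if "z \<in> S" "z \<in> \<real>" for z
    proof -
      from that(2) obtain x where x: "z = of_real x" by (auto elim: Reals_cases)
      have "\<bar>x\<bar> < s0" using that(1) s0 by (simp add: S_def x)
      then have "Im (F z) = 0" using ImG1[of x] by (simp add: F_def x)
      then show ?thesis by (simp add: complex_is_Real_iff)
    qed
  qed (auto simp: S_def)
  \<comment> \<open>Two derivatives undo the two primitives: F'' is \<i> H above the line. Since F
    is real on the line, so is its second derivative, and -\<i> times it is imaginary there.\<close>
  define K where "K = (\<lambda>z. - \<i> * deriv (deriv F') z)"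
  have oS: "open S" by (simp add: S_def)
  have d1: "deriv F' z = \<i> * \<Phi> z" if z: "z \<in> S" "0 < Im z" for z
  proof -
    have zD: "z \<in> D" using z ST s0 by (auto simp: T_def D)
    have o: "open (S \<inter> {z. 0 < Im z})" using oS by (intro open_Int open_halfspace_Im_gt)
    have "((\<lambda>z. G z - \<i> * of_real \<kappa>) has_field_derivative \<i> * \<Phi> z) (at z)"
      using G[OF zD] by (auto intro!: derivative_eq_intros)
    then have "(F' has_field_derivative \<i> * \<Phi> z) (at z)"
      by (rule has_field_derivative_transform_within_open[OF _ o])
         (use z ST G1G in \<open>auto simp: F'_def F_def\<close>)
    then show ?thesis by (rule DERIV_imp_deriv)
  qed
  have d2: "K z = H z" if z: "z \<in> S" "0 < Im z" for z
  proof -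
    have zD: "z \<in> D" using z ST s0 by (auto simp: T_def D)
    have o: "open (S \<inter> {z. 0 < Im z})" using oS by (intro open_Int open_halfspace_Im_gt)
    have "((\<lambda>z. \<i> * \<Phi> z) has_field_derivative \<i> * H z) (at z)"
      using \<Phi>[OF zD] by (auto intro!: derivative_eq_intros)
    then have "(deriv F' has_field_derivative \<i> * H z) (at z)"
      by (rule has_field_derivative_transform_within_open[OF _ o]) (use z d1 in auto)
    then have "deriv (deriv F') z = \<i> * H z" by (rule DERIV_imp_deriv)
    then show ?thesis by (simp add: K_def)
  qed
  have F'real: "Im (F' z) = 0" if "z \<in> S" "Im z = 0" for z
  proof -
    have "\<bar>Re z\<bar> < s0" using that abs_Re_le_cmod[of z] s0 by (simp add: S_def)
    moreover have "z = of_real (Re z)" using that by (simp add: complex_eq_iff)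
    ultimately show ?thesis using ImG1[of "Re z"] that by (simp add: F'_def F_def)
  qed
  have d1hol: "deriv F' holomorphic_on S" using F'hol oS by (rule holomorphic_deriv)
  have "Re (K z) = 0" if z: "z \<in> S" "Im z = 0" for z
  proof -
    have "Im (deriv (deriv F') z) = 0"
      by (rule deriv_real_on_reals[OF oS d1hol _ z]) (rule deriv_real_on_reals[OF oS F'hol F'real])
    then show ?thesis by (simp add: K_def)
  qed
  moreover have "K holomorphic_on S"
    unfolding K_def by (rule holomorphic_on_mult[OF holomorphic_on_const holomorphic_deriv[OF d1hol oS]])
  ultimately show ?thesis
    using that[of "s0 / 2" K] d2 s0 by (auto simp: S_def)
qed

text \<open>On the circle of radius \<open>r\<close> around a real point \<open>w0\<close> one has
  \<open>\<bar>(w - w0)^2 - r^2\<bar> = 2 * r * \<bar>Im w\<bar>\<close>, so this factor absorbs a blow-up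
  of order \<open>1 / \<bar>Im w\<bar>\<close> at the real line.\<close>

lemma holomorphic_corner_expansion:
  fixes f :: "complex \<Rightarrow> complex"
  assumes "0 < \<rho>"
    and hol: "f holomorphic_on {z. norm z < \<rho> \<and> 0 < Im z}"
    and cont: "continuous_on {z. norm z < \<rho> \<and> 0 \<le> Im z \<and> z \<noteq> 0} f"
    and real: "\<And>z. norm z < \<rho> \<Longrightarrow> Im z = 0 \<Longrightarrow> z \<noteq> 0 \<Longrightarrow> Im (f z) = 0"
    and small: "\<And>e. 0 < e \<Longrightarrow> \<exists>\<delta>>0. \<forall>z. norm z < \<delta> \<and> 0 < Im z \<longrightarrow> norm (f z) * Im z \<le> e"
  obtains l :: real and C \<delta> where "0 < \<delta>" "\<delta> \<le> \<rho>"
    "\<And>z. norm z < \<delta> \<Longrightarrow> 0 \<le> Im z \<Longrightarrow> z \<noteq> 0 \<Longrightarrow> norm (f z - of_real l) \<le> C * norm z"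
proof -
  define S where "S = ball (0::complex) \<rho> - {0}"
  have oS: "open S" by (simp add: S_def open_delete)
  define F where "F = (\<lambda>z. if 0 \<le> Im z then f z else cnj (f (cnj z)))"
  have Fhol: "F holomorphic_on S"
    unfolding F_def
  proof (rule Schwarz_reflection[OF oS])
    show "f holomorphic_on (S \<inter> {z. 0 < Im z})"
      by (rule holomorphic_on_subset[OF hol]) (auto simp: S_def)
    show "continuous_on (S \<inter> {z. 0 \<le> Im z}) f"
      by (rule continuous_on_subset[OF cont]) (auto simp: S_def)
    show "f z \<in> \<real>" if "z \<in> S" "z \<in> \<real>" for z
      using real[of z] that by (auto simp: S_def complex_is_Real_iff)
  qed (auto simp: S_def)
  have lim0: "((\<lambda>z. (z - 0) * F z) \<longlongrightarrow> 0) (at 0)"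
  proof (rule tendstoI)
    fix e :: real assume "0 < e"
    \<comment> \<open>\<open>key\<close> below loses a factor 11: 8 in the sector away from the real
      axis and 32/3 near the axis.\<close>
    define e' where "e' = e / 12"
    have e': "0 < e'" using \<open>0 < e\<close> by (simp add: e'_def)
    obtain \<delta> where \<delta>: "0 < \<delta>" "\<And>z. norm z < \<delta> \<Longrightarrow> 0 < Im z \<Longrightarrow> norm (f z) * Im z \<le> e'"
      using small[OF e'] by blast
    have Fs: "norm (F z) * \<bar>Im z\<bar> \<le> e'" if "norm z < \<delta>" for z
      using \<delta>(2)[of z] \<delta>(2)[of "cnj z"] that e' by (cases "Im z" "0::real" rule: linorder_cases) (auto simp: F_def)
    \<comment> \<open>Discs of radius |Re z|/2 about Re z reach out to at most 3|z|/2, which stays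
      below both \<delta> and \<rho>.\<close>
    define \<eta> where "\<eta> = min \<delta> \<rho> / 2"
    have \<eta>: "0 < \<eta>" using \<delta> \<open>0 < \<rho>\<close> by (simp add: \<eta>_def)
    have key: "norm (F z) * norm z \<le> 11 * e'" if z: "norm z < \<eta>" "z \<noteq> 0" for z
    proof (cases "\<bar>Im z\<bar> \<ge> norm z / 8")
      case True
      have "norm (F z) * (norm z / 8) \<le> norm (F z) * \<bar>Im z\<bar>" using True by (intro mult_left_mono) auto
      also have "... \<le> e'" using Fs[of z] z \<delta> by (auto simp: \<eta>_def)
      finally show ?thesis using e' by simp
    next
      case False
      \<comment> \<open>Near the real axis the estimate is taken from the circle about the
        projection of z to the axis. Half of |Re z| as radius keeps the puncture outside the disc
        while z lies well inside it.\<close>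
      define w0 :: complex where "w0 = of_real (Re z)"
      define r where "r = \<bar>Re z\<bar> / 2"
      have nz: "norm z \<le> 2 * \<bar>Re z\<bar>" using False cmod_le[of z] by simp
      have r: "0 < r" using nz z by (auto simp: r_def)
      define P where "P = (\<lambda>w. ((w - w0)^2 - of_real (r^2)) * F w)"
      have cb: "cball w0 r \<subseteq> S"
      proof
        fix w assume "w \<in> cball w0 r"
        then have "norm (w - w0) \<le> r" by (simp add: dist_norm norm_minus_commute)
        moreover have "norm w0 = 2 * r" by (simp add: w0_def r_def)
        ultimately have "norm w \<le> 3 * r" "r \<le> norm w"
          using norm_triangle_ineq[of w0 "w - w0"] norm_triangle_ineq2[of w0 "w0 - w"] by (simp_all add: norm_minus_commute)
        moreover have "3 * r < \<rho>" using z abs_Re_le_cmod[of z] by (auto simp: r_def \<eta>_def)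
        ultimately show "w \<in> S" using r by (auto simp: S_def)
      qed
      have Phol: "P holomorphic_on cball w0 r"
        unfolding P_def by (intro holomorphic_intros holomorphic_on_subset[OF Fhol cb])
      have "norm (P z) \<le> 2 * r * e'"
      proof (rule maximum_modulus_frontier[of P "cball w0 r"])
        show "P holomorphic_on interior (cball w0 r)"
          using Phol by (rule holomorphic_on_subset) (rule interior_subset)
        show "continuous_on (closure (cball w0 r)) P"
          using holomorphic_on_imp_continuous_on[OF Phol] by simp
        show "z \<in> cball w0 r"
        proof -
          have "norm (z - w0) = \<bar>Im z\<bar>"
            by (simp add: w0_def cmod_def)
          then show ?thesis using False nz by (simp add: dist_norm norm_minus_commute r_def)
        qed
        fix w assume "w \<in> frontier (cball w0 r)"
        then have w: "norm (w - w0) = r" using r by (simp add: dist_norm norm_minus_commute)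
        have "of_real (r^2) = (w - w0) * cnj (w - w0)"
          using w complex_norm_square[of "w - w0"] by simp
        then have "(w - w0)^2 - of_real (r^2) = (w - w0) * ((w - w0) - cnj (w - w0))"
          by (simp add: power2_eq_square algebra_simps)
        also have "(w - w0) - cnj (w - w0) = of_real (2 * Im w) * \<i>"
          by (simp add: w0_def complex_eq_iff)
        finally have "norm ((w - w0)^2 - of_real (r^2)) = 2 * r * \<bar>Im w\<bar>"
          using w by (simp add: norm_mult)
        then have "norm (P w) = 2 * r * (norm (F w) * \<bar>Im w\<bar>)"
          by (simp add: P_def norm_mult)
        moreover have "norm w < \<delta>"
        proof -
          have "norm w0 = 2 * r" by (simp add: w0_def r_def)
          then have "norm w \<le> 3 * r" using w norm_triangle_ineq[of w0 "w - w0"] by simp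
          then show ?thesis using z abs_Re_le_cmod[of z] by (auto simp: r_def \<eta>_def)
        qed
        ultimately show "norm (P w) \<le> 2 * r * e'"
          using Fs[of w] r by (simp add: mult_left_mono)
      qed simp
      \<comment> \<open>At z itself the difference z - w0 is purely imaginary, so its square and
        -r^2 have the same sign and the factor is bounded below by a multiple of r^2.\<close>
      moreover have "norm (P z) \<ge> (3 * r^2 / 4) * norm (F z)"
      proof -
        have zw: "z - w0 = of_real (Im z) * \<i>" by (simp add: w0_def complex_eq_iff)
        have "(z - w0)^2 - of_real (r^2) = of_real (- ((Im z)^2 + r^2))"
          by (simp add: zw power_mult_distrib)
        then have "norm ((z - w0)^2 - of_real (r^2)) = (Im z)^2 + r^2"
          by (simp only: norm_of_real) simp
        then have "norm (P z) = ((Im z)^2 + r^2) * norm (F z)" by (simp add: P_def norm_mult)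
        also have "... \<ge> (3 * r^2 / 4) * norm (F z)"
          by (intro mult_right_mono) (auto simp: add_increasing)
        finally show ?thesis .
      qed
      ultimately have "(3 * r^2 / 4) * norm (F z) \<le> 2 * r * e'" by linarith
      then have "r * (3 * r * norm (F z)) \<le> r * (8 * e')" by (simp add: power2_eq_square)
      then have "3 * r * norm (F z) \<le> 8 * e'" using r by simp
      moreover have "norm (F z) * norm z \<le> norm (F z) * (4 * r)"
        using nz by (intro mult_left_mono) (auto simp: r_def)
      ultimately show ?thesis using e' by (simp add: algebra_simps)
    qed
    have "dist ((z - 0) * F z) 0 < e" if "z \<noteq> 0" "dist z 0 < \<eta>" for z
      using key[of z] that \<open>0 < e\<close> by (simp add: norm_mult mult.commute e'_def)
    then show "eventually (\<lambda>z. dist ((z - 0) * F z) 0 < e) (at 0)"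
      using \<eta> by (auto simp: eventually_at)
  qed
  have "F holomorphic_on ball 0 \<rho> - {0}" using Fhol by (simp add: S_def)
  then have "\<exists>g. g holomorphic_on ball 0 \<rho> \<and> (\<forall>z\<in>ball 0 \<rho> - {0}. g z = F z)"
    using holomorphic_on_extend_lim[of F "ball 0 \<rho>" 0] lim0 \<open>0 < \<rho>\<close> by simp
  then obtain g where g: "g holomorphic_on ball 0 \<rho>" "\<And>z. z \<in> ball 0 \<rho> \<Longrightarrow> z \<noteq> 0 \<Longrightarrow> g z = F z"
    by auto
  have gd: "(g has_field_derivative deriv g 0) (at 0)"
    using g(1) \<open>0 < \<rho>\<close> by (intro holomorphic_derivI[of g "ball 0 \<rho>"]) auto
  have Img: "Im (g 0) = 0"
  proof -
    have "isCont g 0" using gd DERIV_isCont by blast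
    then have "(\<lambda>n. g (of_real (inverse (real (Suc n))))) \<longlonglongrightarrow> g 0"
    proof (intro isCont_tendsto_compose[of 0 g])
      have "(\<lambda>n. complex_of_real (inverse (real (Suc n)))) \<longlonglongrightarrow> of_real 0"
        by (intro tendsto_of_real LIMSEQ_inverse_real_of_nat)
      then show "(\<lambda>n. complex_of_real (inverse (real (Suc n)))) \<longlonglongrightarrow> 0" by simp
    qed
    then have "(\<lambda>n. Im (g (of_real (inverse (real (Suc n)))))) \<longlonglongrightarrow> Im (g 0)"
      by (rule tendsto_Im)
    moreover have "eventually (\<lambda>n. Im (g (of_real (inverse (real (Suc n))))) = 0) sequentially"
    proof -
      have "eventually (\<lambda>n. inverse (real (Suc n)) < \<rho>) sequentially"
        using LIMSEQ_inverse_real_of_nat \<open>0 < \<rho>\<close> by (rule order_tendstoD(2))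
      then show ?thesis
      proof eventually_elim
        case (elim n)
        define t where "t = inverse (real (Suc n))"
        have t: "0 < t" "t < \<rho>" using elim by (simp_all add: t_def)
        then have "Im (F (of_real t)) = 0" using real[of "of_real t"] by (simp add: F_def)
        moreover have "g (of_real t) = F (of_real t)" using t by (intro g(2)) auto
        ultimately have "Im (g (of_real t)) = 0" by simp
        then show ?case unfolding t_def .
      qed
    qed
    ultimately show ?thesis
      by (metis tendsto_eventually tendsto_unique trivial_limit_sequentially)
  qed
  have "((\<lambda>z. (g z - g 0) / (z - 0)) \<longlongrightarrow> deriv g 0) (at 0)"
    using gd by (simp add: has_field_derivative_iff)
  then have "eventually (\<lambda>z. dist ((g z - g 0) / (z - 0)) (deriv g 0) < 1) (at 0)"
    by (rule tendstoD) simp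
  then obtain d where d: "0 < d" "\<And>z. z \<noteq> 0 \<Longrightarrow> dist z 0 < d \<Longrightarrow> dist ((g z - g 0) / (z - 0)) (deriv g 0) < 1"
    by (auto simp: eventually_at)
  show ?thesis
  proof (rule that[of "min d \<rho>" "Re (g 0)" "norm (deriv g 0) + 1"])
    fix z :: complex assume z: "norm z < min d \<rho>" "0 \<le> Im z" "z \<noteq> 0"
    have "norm ((g z - g 0) / z) \<le> norm (deriv g 0) + 1"
      using d(2)[of z] z norm_triangle_ineq2[of "(g z - g 0) / z" "deriv g 0"] by (simp add: dist_norm)
    then have "norm (g z - g 0) \<le> (norm (deriv g 0) + 1) * norm z"
      using z by (simp add: norm_divide pos_divide_le_eq)
    moreover have "g z = f z" using z g(2)[of z] by (simp add: F_def)
    moreover have "g 0 = of_real (Re (g 0))" using Img by (simp add: complex_eq_iff)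
    ultimately show "norm (f z - of_real (Re (g 0))) \<le> (norm (deriv g 0) + 1) * norm z" by simp
  qed (use d \<open>0 < \<rho>\<close> in auto)
qed

subsection \<open>Square integrable functions\<close>

lemma norm_diff_square_le:
  fixes x y :: "'a::real_inner"
  shows "(norm (x - y))^2 \<le> 2 * (norm x)^2 + 2 * (norm y)^2"
proof -
  have "0 \<le> (norm (x + y))^2" by simp
  then show ?thesis
    by (simp add: power2_norm_eq_inner inner_diff_left inner_diff_right inner_add_left inner_add_right inner_commute)
qed

lemma abs_inner_le_squares:
  fixes x y :: "'a::real_inner"
  shows "\<bar>x \<bullet> y\<bar> \<le> (norm x)^2 + (norm y)^2"
proof -
  have "\<bar>x \<bullet> y\<bar> \<le> norm x * norm y" by (rule Cauchy_Schwarz_ineq2)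
  also have "... \<le> (norm x)^2 + (norm y)^2"
  proof -
    have "0 \<le> norm x * norm y" by simp
    moreover have "2 * (norm x * norm y) \<le> (norm x)^2 + (norm y)^2"
      using sum_squares_bound[of "norm x" "norm y"] by (simp add: mult.assoc)
    ultimately show ?thesis by linarith
  qed
  finally show ?thesis .
qed

lemma L2_measurable: "L2 M f \<Longrightarrow> f \<in> borel_measurable M"
  and L2_integrable: "L2 M f \<Longrightarrow> integrable M (\<lambda>x. (norm (f x))^2)"
  by (auto simp: L2_def)

lemma L2_diff:
  assumes "L2 M f" "L2 M g"
  shows "L2 M (\<lambda>x. f x - g x)"
  unfolding L2_def
proof
  note [measurable] = L2_measurable[OF assms(1)] L2_measurable[OF assms(2)]
  show "(\<lambda>x. f x - g x) \<in> borel_measurable M" by measurable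
  show "integrable M (\<lambda>x. (norm (f x - g x))^2)"
  proof (rule Bochner_Integration.integrable_bound)
    show "integrable M (\<lambda>x. 2 * (norm (f x))^2 + 2 * (norm (g x))^2)"
      using assms by (simp add: L2_integrable)
  qed (use norm_diff_square_le in auto)
qed

lemma L2_inner_integrable:
  assumes "L2 M f" "L2 M g"
  shows "integrable M (\<lambda>x. f x \<bullet> g x)"
proof (rule Bochner_Integration.integrable_bound)
  note [measurable] = L2_measurable[OF assms(1)] L2_measurable[OF assms(2)]
  show "(\<lambda>x. f x \<bullet> g x) \<in> borel_measurable M" by measurable
  show "integrable M (\<lambda>x. (norm (f x))^2 + (norm (g x))^2)" using assms by (simp add: L2_integrable)
  show "AE x in M. norm (f x \<bullet> g x) \<le> norm ((norm (f x))^2 + (norm (g x))^2)"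
    using abs_inner_le_squares by auto
qed

lemma L2_scaleR_integrable:
  fixes g :: "'a \<Rightarrow> 'b::euclidean_space"
  assumes "L2 M f" "L2 M g"
  shows "integrable M (\<lambda>x. f x *\<^sub>R g x)"
proof (rule Bochner_Integration.integrable_bound)
  note [measurable] = L2_measurable[OF assms(1)] L2_measurable[OF assms(2)]
  show "(\<lambda>x. f x *\<^sub>R g x) \<in> borel_measurable M" by measurable
  show "integrable M (\<lambda>x. (norm (f x))^2 + (norm (g x))^2)"
    by (intro Bochner_Integration.integrable_add L2_integrable assms)
  show "AE x in M. norm (f x *\<^sub>R g x) \<le> norm ((norm (f x))^2 + (norm (g x))^2)"
    using abs_inner_le_squares[of "norm (f _)" "norm (g _)"] by (auto simp: abs_mult)
qed

lemma L2_Cauchy_Schwarz: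
  assumes f: "L2 M f" and g: "L2 M g"
  shows "(\<integral>x. f x \<bullet> g x \<partial>M)^2 \<le> (\<integral>x. (norm (f x))^2 \<partial>M) * (\<integral>x. (norm (g x))^2 \<partial>M)"
proof -
  define a b c where "a = (\<integral>x. (norm (f x))^2 \<partial>M)" and "b = (\<integral>x. (norm (g x))^2 \<partial>M)"
    and "c = (\<integral>x. f x \<bullet> g x \<partial>M)"
  have b0: "0 \<le> b" unfolding b_def by (rule integral_nonneg_AE) simp
  have q: "0 \<le> a - 2 * t * c + t^2 * b" for t
  proof -
    have "(\<integral>x. (norm (f x - t *\<^sub>R g x))^2 \<partial>M) = (\<integral>x. (norm (f x))^2 - 2 * t * (f x \<bullet> g x) + t^2 * (norm (g x))^2 \<partial>M)"
      by (intro Bochner_Integration.integral_cong refl)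
         (simp only: power2_norm_eq_inner, simp add: inner_diff_left inner_diff_right inner_commute power2_eq_square algebra_simps)
    also have "... = a - 2 * t * c + t^2 * b"
      using L2_integrable[OF f] L2_integrable[OF g] L2_inner_integrable[OF f g]
      by (simp add: a_def b_def c_def)
    finally have "(\<integral>x. (norm (f x - t *\<^sub>R g x))^2 \<partial>M) = a - 2 * t * c + t^2 * b" .
    moreover have "0 \<le> (\<integral>x. (norm (f x - t *\<^sub>R g x))^2 \<partial>M)" by (rule integral_nonneg_AE) simp
    ultimately show ?thesis by simp
  qed
  have "c^2 \<le> a * b"
  proof (cases "b = 0")
    case True
    have "c = 0"
    proof (rule ccontr)
      assume "c \<noteq> 0"
      \<comment> \<open>This t makes a - 2 t c equal to -1, contradicting the nonnegativity of the
        quadratic when b = 0.\<close>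
      then show False using q[of "(a + 1) / (2 * c)"] True by (simp add: field_simps)
    qed
    then show ?thesis using True by simp
  next
    case False
    then show ?thesis using q[of "c / b"] b0 by (simp add: power2_eq_square field_simps)
  qed
  then show ?thesis by (simp add: a_def b_def c_def)
qed

lemma L2_tendsto_diff:
  assumes F: "L2_tendsto M F f" and G: "L2_tendsto M G g"
  shows "L2_tendsto M (\<lambda>n x. F n x - G n x) (\<lambda>x. f x - g x)"
proof -
  have L: "L2 M (F n)" "L2 M f" "L2 M (G n)" "L2 M g" for n using assms by (auto simp: L2_tendsto_def)
  note LD = L2_diff[OF L(1,2)] L2_diff[OF L(3,4)]
  have "(\<lambda>n. \<integral>x. (norm (F n x - G n x - (f x - g x)))^2 \<partial>M) \<longlonglongrightarrow> 0"
  proof (rule tendsto_sandwich[OF _ _ tendsto_const])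
    show "(\<lambda>n. 2 * (\<integral>x. (norm (F n x - f x))^2 \<partial>M) + 2 * (\<integral>x. (norm (G n x - g x))^2 \<partial>M)) \<longlonglongrightarrow> 0"
      using assms unfolding L2_tendsto_def by (auto intro!: tendsto_eq_intros)
    show "eventually (\<lambda>n. (\<integral>x. (norm (F n x - G n x - (f x - g x)))^2 \<partial>M)
       \<le> 2 * (\<integral>x. (norm (F n x - f x))^2 \<partial>M) + 2 * (\<integral>x. (norm (G n x - g x))^2 \<partial>M)) sequentially"
    proof (intro always_eventually allI)
      fix n
      have "(\<integral>x. (norm (F n x - G n x - (f x - g x)))^2 \<partial>M)
        \<le> (\<integral>x. 2 * (norm (F n x - f x))^2 + 2 * (norm (G n x - g x))^2 \<partial>M)"
      proof (rule integral_mono)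
        show "integrable M (\<lambda>x. (norm (F n x - G n x - (f x - g x)))^2)"
          using L2_integrable[OF L2_diff[OF LD(1)[of n] LD(2)[of n]]] by (simp add: algebra_simps)
        show "integrable M (\<lambda>x. 2 * (norm (F n x - f x))^2 + 2 * (norm (G n x - g x))^2)"
          using LD[THEN L2_integrable] by auto
        show "(norm (F n x - G n x - (f x - g x)))^2 \<le> 2 * (norm (F n x - f x))^2 + 2 * (norm (G n x - g x))^2" for x
          using norm_diff_square_le[of "F n x - f x" "G n x - g x"] by (simp add: algebra_simps)
      qed
      also have "... = 2 * (\<integral>x. (norm (F n x - f x))^2 \<partial>M) + 2 * (\<integral>x. (norm (G n x - g x))^2 \<partial>M)"
        using LD[THEN L2_integrable] by simp
      finally show "(\<integral>x. (norm (F n x - G n x - (f x - g x)))^2 \<partial>M)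
        \<le> 2 * (\<integral>x. (norm (F n x - f x))^2 \<partial>M) + 2 * (\<integral>x. (norm (G n x - g x))^2 \<partial>M)" .
    qed
    show "eventually (\<lambda>n. 0 \<le> (\<integral>x. (norm (F n x - G n x - (f x - g x)))^2 \<partial>M)) sequentially"
      by (intro always_eventually allI integral_nonneg_AE) simp
  qed
  then show ?thesis using L by (auto simp: L2_tendsto_def intro: L2_diff)
qed

lemma L2_tendsto_inner:
  assumes F: "L2_tendsto M F f" and h: "L2 M h"
  shows "(\<lambda>n. \<integral>x. F n x \<bullet> h x \<partial>M) \<longlonglongrightarrow> (\<integral>x. f x \<bullet> h x \<partial>M)"
proof -
  have L: "L2 M (F n)" "L2 M f" for n using assms by (auto simp: L2_tendsto_def)
  define H where "H = (\<integral>x. (norm (h x))^2 \<partial>M)"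
  have "(\<lambda>n. ((\<integral>x. F n x \<bullet> h x \<partial>M) - (\<integral>x. f x \<bullet> h x \<partial>M))^2) \<longlonglongrightarrow> 0"
  proof (rule tendsto_sandwich[OF _ _ tendsto_const])
    show "(\<lambda>n. (\<integral>x. (norm (F n x - f x))^2 \<partial>M) * H) \<longlonglongrightarrow> 0"
      using F unfolding L2_tendsto_def by (auto intro!: tendsto_eq_intros)
    show "eventually (\<lambda>n. ((\<integral>x. F n x \<bullet> h x \<partial>M) - (\<integral>x. f x \<bullet> h x \<partial>M))^2 \<le> (\<integral>x. (norm (F n x - f x))^2 \<partial>M) * H) sequentially"
    proof (intro always_eventually allI)
      fix n
      have "(\<integral>x. F n x \<bullet> h x \<partial>M) - (\<integral>x. f x \<bullet> h x \<partial>M) = (\<integral>x. (F n x - f x) \<bullet> h x \<partial>M)"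
        using L2_inner_integrable[OF L(1) h] L2_inner_integrable[OF L(2) h]
        by (simp add: inner_diff_left)
      then show "((\<integral>x. F n x \<bullet> h x \<partial>M) - (\<integral>x. f x \<bullet> h x \<partial>M))^2 \<le> (\<integral>x. (norm (F n x - f x))^2 \<partial>M) * H"
        using L2_Cauchy_Schwarz[OF L2_diff[OF L] h] by (simp add: H_def)
    qed
  qed (simp add: always_eventually)
  then have "(\<lambda>n. (\<integral>x. F n x \<bullet> h x \<partial>M) - (\<integral>x. f x \<bullet> h x \<partial>M)) \<longlonglongrightarrow> 0"
    using tendsto_real_sqrt by (force simp: tendsto_rabs_zero_iff)
  then show ?thesis by (rule LIM_zero_cancel)
qed

lemma L2_tendsto_norm:
  assumes F: "L2_tendsto M F f"
  shows "(\<lambda>n. \<integral>x. (norm (F n x))^2 \<partial>M) \<longlonglongrightarrow> (\<integral>x. (norm (f x))^2 \<partial>M)"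
proof -
  have L: "L2 M (F n)" "L2 M f" for n using assms by (auto simp: L2_tendsto_def)
  have "(\<integral>x. (norm (F n x))^2 \<partial>M) = (\<integral>x. (norm (F n x - f x))^2 \<partial>M) + 2 * (\<integral>x. F n x \<bullet> f x \<partial>M) - (\<integral>x. (norm (f x))^2 \<partial>M)" for n
  proof -
    have "(\<integral>x. (norm (F n x))^2 \<partial>M) = (\<integral>x. (norm (F n x - f x))^2 + 2 * (F n x \<bullet> f x) - (norm (f x))^2 \<partial>M)"
      by (intro Bochner_Integration.integral_cong refl)
         (simp add: power2_norm_eq_inner inner_diff_left inner_diff_right inner_commute)
    also have "... = (\<integral>x. (norm (F n x - f x))^2 \<partial>M) + 2 * (\<integral>x. F n x \<bullet> f x \<partial>M) - (\<integral>x. (norm (f x))^2 \<partial>M)"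
      using L2_integrable[OF L2_diff[OF L]] L2_inner_integrable[OF L] L2_integrable[OF L(2)] by simp
    finally show ?thesis .
  qed
  moreover have "(\<lambda>n. (\<integral>x. (norm (F n x - f x))^2 \<partial>M) + 2 * (\<integral>x. F n x \<bullet> f x \<partial>M) - (\<integral>x. (norm (f x))^2 \<partial>M))
     \<longlonglongrightarrow> 0 + 2 * (\<integral>x. f x \<bullet> f x \<partial>M) - (\<integral>x. (norm (f x))^2 \<partial>M)"
    using F L2_tendsto_inner[OF F L(2)] unfolding L2_tendsto_def by (intro tendsto_intros) auto
  ultimately show ?thesis by (simp add: power2_norm_eq_inner)
qed

lemma L2_imp_integrable:
  fixes f :: "'a \<Rightarrow> 'b::euclidean_space"
  assumes "finite_measure M" "L2 M f"
  shows "integrable M f"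
proof -
  interpret finite_measure M by fact
  show ?thesis
  proof (rule Bochner_Integration.integrable_bound)
    show "integrable M (\<lambda>x. 1 + (norm (f x))^2)" using L2_integrable[OF assms(2)] by simp
    show "AE x in M. norm (f x) \<le> norm (1 + (norm (f x))^2)"
    proof (rule AE_I2)
      fix x show "norm (f x) \<le> norm (1 + (norm (f x))^2)"
        using sum_squares_bound[of "norm (f x)" 1] norm_ge_zero[of "f x"] by (simp del: norm_ge_zero)
    qed
  qed (rule L2_measurable[OF assms(2)])
qed

text \<open>The Riesz-Fischer argument: a rapidly Cauchy subsequence converges almost everywhere
  because its increments have summable integrals, and Fatou's lemma transfers the Cauchy estimates
  to the limit for the whole sequence.\<close>

lemma L2_complete:
  fixes F :: "nat \<Rightarrow> 'a \<Rightarrow> real"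
  assumes M: "finite_measure M" and L: "\<And>n. L2 M (F n)"
    and Cauchy: "\<And>e. 0 < e \<Longrightarrow> \<exists>N. \<forall>m\<ge>N. \<forall>n\<ge>N. (\<integral>x. (F m x - F n x)^2 \<partial>M) \<le> e"
  obtains f where "L2_tendsto M F f"
proof -
  interpret finite_measure M by fact
  have [measurable]: "F n \<in> borel_measurable M" for n using L by (rule L2_measurable)
  have LD: "integrable M (\<lambda>x. (F m x - F n x)^2)" for m n
    using L2_integrable[OF L2_diff[OF L L]] by simp
  \<comment> \<open>The rate 4^(-k) leaves 2^(-k) after multiplication by the weight 2^k used for
    the increments below.\<close>
  obtain N where N: "\<And>k m n. N k \<le> m \<Longrightarrow> N k \<le> n \<Longrightarrow> (\<integral>x. (F m x - F n x)^2 \<partial>M) \<le> (1 / 4) ^ k" for k :: nat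
  proof -
    have "\<forall>k. \<exists>N. \<forall>m\<ge>N. \<forall>n\<ge>N. (\<integral>x. (F m x - F n x)^2 \<partial>M) \<le> (1 / 4) ^ k"
      by (intro allI Cauchy) simp
    then show ?thesis using that by (auto dest!: choice)
  qed
  define r where "r = rec_nat (N 0) (\<lambda>k m. max (Suc m) (N (Suc k)))"
  have rS: "r (Suc k) = max (Suc (r k)) (N (Suc k))" for k by (simp add: r_def)
  have rN: "N k \<le> r k" for k by (cases k) (auto simp: r_def)
  have r_mono: "strict_mono r" by (rule strict_monoI_Suc) (simp add: rS)
  define d where "d = (\<lambda>k x. \<bar>F (r (Suc k)) x - F (r k) x\<bar>)"
  have [measurable]: "d k \<in> borel_measurable M" for k by (simp add: d_def)
  define \<mu> where "\<mu> = measure M (space M)"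
  have dint: "(\<integral>\<^sup>+x. ennreal (d k x) \<partial>M) \<le> ennreal ((1 + \<mu>) * (1 / 2) ^ k)" for k
  proof -
    have i: "integrable M (\<lambda>x. 2 ^ k * (F (r (Suc k)) x - F (r k) x)^2 + (1 / 2) ^ k)"
      using LD[of "r (Suc k)" "r k"] by simp
    have "(\<integral>\<^sup>+x. ennreal (d k x) \<partial>M) \<le> (\<integral>\<^sup>+x. ennreal (2 ^ k * (F (r (Suc k)) x - F (r k) x)^2 + (1 / 2) ^ k) \<partial>M)"
    proof (intro nn_integral_mono ennreal_leI)
      fix x
      define t where "t = d k x"
      \<comment> \<open>This is a weighted form of t \<le> 2^k t^2 + 2^(-k), which trades the
        integral of |t| for that of t^2 plus a constant; the constant is integrable because the
        measure is finite.\<close>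
      have "0 \<le> (2 ^ k * t - 1)^2 + 2 ^ k * t" by (auto simp: t_def d_def)
      then have "t * 2 ^ k \<le> (2 ^ k * t^2 + (1 / 2) ^ k) * 2 ^ k"
        by (simp add: power2_eq_square algebra_simps power_one_over)
      then have "t \<le> 2 ^ k * t^2 + (1 / 2) ^ k" by (rule mult_right_le_imp_le) simp
      then show "d k x \<le> 2 ^ k * (F (r (Suc k)) x - F (r k) x)^2 + (1 / 2) ^ k"
        by (simp add: t_def d_def)
    qed
    also have "... = ennreal (\<integral>x. 2 ^ k * (F (r (Suc k)) x - F (r k) x)^2 + (1 / 2) ^ k \<partial>M)"
      by (rule nn_integral_eq_integral[OF i]) auto
    also have "(\<integral>x. 2 ^ k * (F (r (Suc k)) x - F (r k) x)^2 + (1 / 2) ^ k \<partial>M)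
        = 2 ^ k * (\<integral>x. (F (r (Suc k)) x - F (r k) x)^2 \<partial>M) + (1 / 2) ^ k * \<mu>"
      using LD[of "r (Suc k)" "r k"] by (simp add: \<mu>_def)
    also have "ennreal ... \<le> ennreal ((1 + \<mu>) * (1 / 2) ^ k)"
    proof (rule ennreal_leI)
      have "(\<integral>x. (F (r (Suc k)) x - F (r k) x)^2 \<partial>M) \<le> (1 / 4) ^ k"
        using rN[of k] r_mono by (intro N) (auto simp: rS)
      then have "2 ^ k * (\<integral>x. (F (r (Suc k)) x - F (r k) x)^2 \<partial>M) \<le> 2 ^ k * (1 / 4) ^ k"
        by (intro mult_left_mono) auto
      also have "2 ^ k * (1 / 4) ^ k = (1 / 2 :: real) ^ k"
        by (simp flip: power_mult_distrib)
      finally show "2 ^ k * (\<integral>x. (F (r (Suc k)) x - F (r k) x)^2 \<partial>M) + (1 / 2) ^ k * \<mu> \<le> (1 + \<mu>) * (1 / 2) ^ k"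
        by (simp add: algebra_simps)
    qed
    finally show ?thesis .
  qed
  have "(\<integral>\<^sup>+x. (\<Sum>k. ennreal (d k x)) \<partial>M) = (\<Sum>k. \<integral>\<^sup>+x. ennreal (d k x) \<partial>M)"
    by (rule nn_integral_suminf) measurable
  also have "... \<le> (\<Sum>k. ennreal ((1 + \<mu>) * (1 / 2) ^ k))"
    by (intro suminf_le dint) auto
  also have "... = ennreal (\<Sum>k. (1 + \<mu>) * (1 / 2) ^ k)"
    by (rule suminf_ennreal2) (auto simp: \<mu>_def intro!: summable_mult summable_geometric)
  also have "... < \<infinity>" by simp
  finally have "(\<integral>\<^sup>+x. (\<Sum>k. ennreal (d k x)) \<partial>M) \<noteq> \<infinity>" by simp
  then have "AE x in M. (\<Sum>k. ennreal (d k x)) \<noteq> \<infinity>"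
    by (intro nn_integral_PInf_AE) auto
  then have conv: "AE x in M. convergent (\<lambda>k. F (r k) x)"
  proof eventually_elim
    case (elim x)
    then have "summable (\<lambda>k. d k x)"
      by (intro summable_suminf_not_top) (auto simp: d_def)
    then have "summable (\<lambda>k. F (r (Suc k)) x - F (r k) x)"
      unfolding d_def by (rule summable_rabs_cancel)
    then have "convergent (\<lambda>n. \<Sum>k<n. F (r (Suc k)) x - F (r k) x)"
      by (simp add: summable_iff_convergent)
    then have "convergent (\<lambda>n. F (r n) x - F (r 0) x)"
      by (simp only: sum_lessThan_telescope[of "\<lambda>k. F (r k) x"])
    then have "convergent (\<lambda>n. (F (r n) x - F (r 0) x) + F (r 0) x)"
      by (intro convergent_add convergent_const)
    then show ?case by simp
  qed
  define f where "f = (\<lambda>x. lim (\<lambda>k. F (r k) x))"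
  have [measurable]: "f \<in> borel_measurable M" unfolding f_def by measurable
  have lim: "AE x in M. (\<lambda>k. F (r k) x) \<longlonglongrightarrow> f x"
    using conv by eventually_elim (simp add: f_def convergent_LIMSEQ_iff)
  \<comment> \<open>Fatou's lemma in the first index of the Cauchy estimate, along the
    subsequence.\<close>
  have fat: "(\<integral>\<^sup>+x. ennreal ((F n x - f x)^2) \<partial>M) \<le> ennreal e"
    if e: "0 < e" and K: "\<And>m. K \<le> m \<Longrightarrow> (\<integral>x. (F m x - F n x)^2 \<partial>M) \<le> e" for n K e
  proof -
    have "(\<integral>\<^sup>+x. ennreal ((F n x - f x)^2) \<partial>M) = (\<integral>\<^sup>+x. liminf (\<lambda>k. ennreal ((F (r k) x - F n x)^2)) \<partial>M)"
    proof (rule nn_integral_cong_AE)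
      show "AE x in M. ennreal ((F n x - f x)^2) = liminf (\<lambda>k. ennreal ((F (r k) x - F n x)^2))"
        using lim
      proof eventually_elim
        case (elim x)
        then have "(\<lambda>k. ennreal ((F (r k) x - F n x)^2)) \<longlonglongrightarrow> ennreal ((f x - F n x)^2)"
          by (intro tendsto_ennrealI tendsto_intros)
        from lim_imp_Liminf[OF _ this] have e1: "liminf (\<lambda>k. ennreal ((F (r k) x - F n x)^2)) = ennreal ((f x - F n x)^2)"
          by simp
        have e2: "(F n x - f x)^2 = (f x - F n x)^2" by (rule power2_commute)
        show ?case unfolding e1 e2 ..
      qed
    qed
    also have "... \<le> liminf (\<lambda>k. \<integral>\<^sup>+x. ennreal ((F (r k) x - F n x)^2) \<partial>M)"
      by (rule nn_integral_liminf) measurable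
    also have "... \<le> liminf (\<lambda>k::nat. ennreal e)"
    proof (rule Liminf_mono)
      show "eventually (\<lambda>k. (\<integral>\<^sup>+x. ennreal ((F (r k) x - F n x)^2) \<partial>M) \<le> ennreal e) sequentially"
        using eventually_ge_at_top[of K]
      proof eventually_elim
        case (elim k)
        have "(\<integral>\<^sup>+x. ennreal ((F (r k) x - F n x)^2) \<partial>M) = ennreal (\<integral>x. (F (r k) x - F n x)^2 \<partial>M)"
          by (rule nn_integral_eq_integral[OF LD]) auto
        then show ?case using K[of "r k"] elim seq_suble[OF r_mono, of k] by (auto intro!: ennreal_leI)
      qed
    qed
    also have "... = ennreal e" by (simp add: Liminf_const)
    finally show ?thesis .
  qed
  have diffint: "integrable M (\<lambda>x. (F n x - f x)^2)" if "0 < e" "\<And>m. K \<le> m \<Longrightarrow> (\<integral>x. (F m x - F n x)^2 \<partial>M) \<le> e" for n K e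
  proof (rule integrableI_bounded)
    have "(\<integral>\<^sup>+x. ennreal ((F n x - f x)^2) \<partial>M) < \<infinity>"
      using le_less_trans[OF fat[OF that] ennreal_less_top] by simp
    then show "(\<integral>\<^sup>+x. ennreal (norm ((F n x - f x)^2)) \<partial>M) < \<infinity>" by simp
  qed measurable
  obtain K0 where K0: "\<And>m n. K0 \<le> m \<Longrightarrow> K0 \<le> n \<Longrightarrow> (\<integral>x. (F m x - F n x)^2 \<partial>M) \<le> 1"
    using Cauchy[of 1] by auto
  have "L2 M (\<lambda>x. F K0 x - f x)"
    unfolding L2_def using diffint[of 1 K0 K0] K0 by simp
  from L2_diff[OF L[of K0] this] have Lf: "L2 M f" by simp
  have "(\<lambda>n. \<integral>x. (norm (F n x - f x))^2 \<partial>M) \<longlonglongrightarrow> 0"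
  proof (rule LIMSEQ_I)
    fix e :: real assume e: "0 < e"
    obtain K where K: "\<And>m n. K \<le> m \<Longrightarrow> K \<le> n \<Longrightarrow> (\<integral>x. (F m x - F n x)^2 \<partial>M) \<le> e / 2"
      using Cauchy[of "e / 2"] e by auto
    have "norm ((\<integral>x. (norm (F n x - f x))^2 \<partial>M) - 0) < e" if "K \<le> n" for n
    proof -
      have "ennreal (\<integral>x. (F n x - f x)^2 \<partial>M) = (\<integral>\<^sup>+x. ennreal ((F n x - f x)^2) \<partial>M)"
        using diffint[of "e / 2" K n] K e that by (intro nn_integral_eq_integral[symmetric]) auto
      also have "... \<le> ennreal (e / 2)" using K e that by (intro fat[of "e / 2" K n]) auto
      finally have "(\<integral>x. (F n x - f x)^2 \<partial>M) \<le> e / 2" using e by simp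
      moreover have "0 \<le> (\<integral>x. (F n x - f x)^2 \<partial>M)" by (rule integral_nonneg_AE) simp
      ultimately show ?thesis using e by simp
    qed
    then show "\<exists>no. \<forall>n\<ge>no. norm ((\<integral>x. (norm (F n x - f x))^2 \<partial>M) - 0) < e" by blast
  qed
  then have "L2_tendsto M F f" using L Lf by (simp add: L2_tendsto_def)
  then show ?thesis by (rule that)
qed

lemma L2_measure_preserving:
  fixes f :: "'a \<Rightarrow> 'b::euclidean_space"
  assumes T: "T \<in> measurable M M" "distr M M T = M" and f: "L2 M f"
  shows "L2 M (\<lambda>x. f (T x))"
  unfolding L2_def
proof
  note [measurable] = T(1) L2_measurable[OF f]
  show "(\<lambda>x. f (T x)) \<in> borel_measurable M" by measurable
  have "integrable (distr M M T) (\<lambda>x. (norm (f x))^2)" using T(2) L2_integrable[OF f] by simp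
  then show "integrable M (\<lambda>x. (norm (f (T x)))^2)" by (subst (asm) integrable_distr_eq) auto
qed

lemma integral_measure_preserving:
  fixes f :: "'a \<Rightarrow> 'b::{banach, second_countable_topology}"
  assumes T: "T \<in> measurable M M" "distr M M T = M" and f: "f \<in> borel_measurable M"
  shows "(\<integral>x. f (T x) \<partial>M) = (\<integral>x. f x \<partial>M)"
  using integral_distr[OF T(1) f] T(2) by simp

lemma L2_tendsto_measure_preserving:
  fixes f :: "'a \<Rightarrow> 'b::euclidean_space"
  assumes T: "T \<in> measurable M M" "distr M M T = M" and F: "L2_tendsto M F f"
  shows "L2_tendsto M (\<lambda>n x. F n (T x)) (\<lambda>x. f (T x))"
proof -
  have L: "L2 M (F n)" "L2 M f" for n using F by (auto simp: L2_tendsto_def)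
  have "(\<integral>x. (norm (F n (T x) - f (T x)))^2 \<partial>M) = (\<integral>x. (norm (F n x - f x))^2 \<partial>M)" for n
    using L2_measurable[OF L(1)] L2_measurable[OF L(2)]
    by (intro integral_measure_preserving[OF T, of "\<lambda>x. (norm (F n x - f x))^2"]) measurable
  then show ?thesis
    using F L2_measure_preserving[OF T L(1)] L2_measure_preserving[OF T L(2)] by (simp add: L2_tendsto_def)
qed

subsection \<open>Sobolev functions and traces\<close>

lemma test_function_L2:
  fixes \<phi> :: "'a::euclidean_space \<Rightarrow> real"
  assumes W: "open W" and \<phi>: "test_function W \<phi>" "\<And>x. GDERIV \<phi> x :> d\<phi> x"
  shows "L2 (lebesgue_on W) \<phi>" "L2 (lebesgue_on W) d\<phi>"
proof -
  define K where "K = closure {z. \<phi> z \<noteq> 0}"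
  have K: "compact K" "K \<subseteq> W" and sm: "smooth \<phi>"
    using \<phi>(1) by (auto simp: test_function_def K_def)
  have \<phi>0: "\<phi> z = 0" if "z \<notin> K" for z
    using that closure_subset[of "{z. \<phi> z \<noteq> 0}"] by (auto simp: K_def)
  have oK: "open (- K)" using K(1) by (simp add: compact_imp_closed open_Compl)
  have d\<phi>0: "d\<phi> z = 0" if "z \<notin> K" for z
  proof -
    have "GDERIV (\<lambda>z. 0) z :> d\<phi> z"
      by (rule GDERIV_transform_within_open[OF \<phi>(2) oK]) (use that \<phi>0 in auto)
    then show ?thesis using GDERIV_unique GDERIV_const by blast
  qed
  have c: "continuous_on S \<phi>" "continuous_on S d\<phi>" for S
    using smooth_imp_continuous[OF sm] smooth_continuous_gderiv[OF sm \<phi>(2)] by auto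
  have L: "W \<in> sets lebesgue" using W by auto
  show "L2 (lebesgue_on W) \<phi>" unfolding L2_def
    by (intro conjI lebesgue_integral_compact_support(1)[OF L K] continuous_imp_measurable_on_sets_lebesgue
        continuous_intros c L) (simp add: \<phi>0)
  show "L2 (lebesgue_on W) d\<phi>" unfolding L2_def
    by (intro conjI lebesgue_integral_compact_support(1)[OF L K] continuous_imp_measurable_on_sets_lebesgue
        continuous_intros c L) (simp add: d\<phi>0)
qed

lemma H1_diff:
  fixes u u' :: "'a::euclidean_space \<Rightarrow> real"
  assumes W: "open W" and u: "H1 W u g" and u': "H1 W u' g'"
  shows "H1 W (\<lambda>x. u x - u' x) (\<lambda>x. g x - g' x)"
  unfolding H1_def
proof (intro conjI allI impI)
  have L: "L2 (lebesgue_on W) u" "L2 (lebesgue_on W) g" "L2 (lebesgue_on W) u'" "L2 (lebesgue_on W) g'"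
    using u u' by (auto simp: H1_def)
  show "L2 (lebesgue_on W) (\<lambda>x. u x - u' x)" "L2 (lebesgue_on W) (\<lambda>x. g x - g' x)"
    using L by (auto intro: L2_diff)
  fix \<phi> d\<phi> assume \<phi>: "test_function W \<phi> \<and> (\<forall>x. GDERIV \<phi> x :> d\<phi> x)"
  then have L\<phi>: "L2 (lebesgue_on W) \<phi>" "L2 (lebesgue_on W) d\<phi>"
    using test_function_L2[OF W] by auto
  have "(\<integral>x. (u x - u' x) *\<^sub>R d\<phi> x \<partial>lebesgue_on W)
      = (\<integral>x. u x *\<^sub>R d\<phi> x \<partial>lebesgue_on W) - (\<integral>x. u' x *\<^sub>R d\<phi> x \<partial>lebesgue_on W)"
    using L2_scaleR_integrable[OF L(1) L\<phi>(2)] L2_scaleR_integrable[OF L(3) L\<phi>(2)]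
    by (simp add: scaleR_diff_left)
  also have "... = - (\<integral>x. \<phi> x *\<^sub>R g x \<partial>lebesgue_on W) + (\<integral>x. \<phi> x *\<^sub>R g' x \<partial>lebesgue_on W)"
    using u u' \<phi> by (simp add: H1_def)
  also have "... = - (\<integral>x. \<phi> x *\<^sub>R (g x - g' x) \<partial>lebesgue_on W)"
    using L2_scaleR_integrable[OF L\<phi>(1) L(2)] L2_scaleR_integrable[OF L\<phi>(1) L(4)]
    by (simp add: scaleR_diff_right)
  finally show "(\<integral>x. (u x - u' x) *\<^sub>R d\<phi> x \<partial>lebesgue_on W) = - (\<integral>x. \<phi> x *\<^sub>R (g x - g' x) \<partial>lebesgue_on W)" .
qed

lemma has_trace_diff:
  fixes u u' :: "'a::euclidean_space \<Rightarrow> real"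
  assumes W: "open W" and u: "has_trace W \<sigma> u \<tau>" and u': "has_trace W \<sigma> u' \<tau>'"
  shows "has_trace W \<sigma> (\<lambda>x. u x - u' x) (\<lambda>x. \<tau> x - \<tau>' x)"
proof -
  obtain g \<psi> d\<psi> where 1: "H1 W u g" "\<And>n. smooth (\<psi> n)" "\<And>n x. GDERIV (\<psi> n) x :> d\<psi> n x"
    "L2_tendsto (lebesgue_on W) \<psi> u" "L2_tendsto (lebesgue_on W) d\<psi> g" "L2_tendsto \<sigma> \<psi> \<tau>"
    using u unfolding has_trace_def by blast
  obtain g' \<psi>' d\<psi>' where 2: "H1 W u' g'" "\<And>n. smooth (\<psi>' n)" "\<And>n x. GDERIV (\<psi>' n) x :> d\<psi>' n x"
    "L2_tendsto (lebesgue_on W) \<psi>' u'" "L2_tendsto (lebesgue_on W) d\<psi>' g'" "L2_tendsto \<sigma> \<psi>' \<tau>'"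
    using u' unfolding has_trace_def by blast
  show ?thesis
    unfolding has_trace_def
    by (rule exI[of _ "\<lambda>x. g x - g' x"], rule exI[of _ "\<lambda>n x. \<psi> n x - \<psi>' n x"],
        rule exI[of _ "\<lambda>n x. d\<psi> n x - d\<psi>' n x"])
       (use 1 2 W in \<open>auto intro!: H1_diff smooth_diff L2_tendsto_diff GDERIV_diff\<close>)
qed

lemma AE_zero_of_vector_test:
  fixes f :: "real \<times> real \<Rightarrow> real \<times> real"
  assumes W: "open W" and f: "f \<in> borel_measurable (lebesgue_on W)"
    and loc: "\<And>a b. cbox a b \<subseteq> W \<Longrightarrow> integrable (lebesgue_on W) (\<lambda>x. indicator (cbox a b) x *\<^sub>R f x)"
    and int: "\<And>\<phi>. test_function W \<phi> \<Longrightarrow> integrable (lebesgue_on W) (\<lambda>x. \<phi> x *\<^sub>R f x)"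
    and test: "\<And>\<phi>. test_function W \<phi> \<Longrightarrow> (\<integral>x. \<phi> x *\<^sub>R f x \<partial>lebesgue_on W) = 0"
  shows "AE x in lebesgue_on W. f x = 0"
proof -
  have c: "AE x in lebesgue_on W. f x \<bullet> e = 0" for e
  proof (rule AE_zero_of_test_functions[OF W])
    show "(\<lambda>x. f x \<bullet> e) \<in> borel_measurable (lebesgue_on W)" using f by measurable
    show "integrable (lebesgue_on W) (\<lambda>x. indicator (cbox a b) x * (f x \<bullet> e))" if "cbox a b \<subseteq> W" for a b
      using integrable_inner_left[OF loc[OF that], of e] by simp
    show "(\<integral>x. \<phi> x * (f x \<bullet> e) \<partial>lebesgue_on W) = 0" if "test_function W \<phi>" for \<phi>
      using integral_inner_left[OF int[OF that], of e] test[OF that] by simp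
  qed
  from c[of "(1, 0)"] c[of "(0, 1)"] show ?thesis
    by eventually_elim (auto simp: inner_prod_def prod_eq_iff)
qed

lemma weak_gradient_unique:
  fixes u u' :: "real \<times> real \<Rightarrow> real"
  assumes W: "open W" "bounded W" and u: "H1 W u g" and u': "H1 W u' g'"
    and eq: "AE x in lebesgue_on W. u x = u' x"
  shows "AE x in lebesgue_on W. g x = g' x"
proof -
  have D: "H1 W (\<lambda>x. u x - u' x) (\<lambda>x. g x - g' x)" by (rule H1_diff[OF W(1) u u'])
  have L: "L2 (lebesgue_on W) (\<lambda>x. g x - g' x)" using D by (simp add: H1_def)
  have fin: "finite_measure (lebesgue_on W)"
    using W by (intro finite_measure_lebesgue_on bounded_set_imp_lmeasurable) auto
  have "AE x in lebesgue_on W. g x - g' x = 0"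
  proof (rule AE_zero_of_vector_test[OF W(1) L2_measurable[OF L]])
    show "integrable (lebesgue_on W) (\<lambda>x. indicator (cbox a b) x *\<^sub>R (g x - g' x))" if "cbox a b \<subseteq> W" for a b
      using that W(1)
      by (intro integrable_mult_indicator L2_imp_integrable[OF fin L]) (auto simp: sets_restrict_space_iff)
    fix \<phi> assume \<phi>: "test_function W \<phi>"
    then have sm: "smooth \<phi>" by (simp add: test_function_def)
    obtain d\<phi> where d\<phi>: "\<And>x. GDERIV \<phi> x :> d\<phi> x"
      using smooth_obtain_gderiv[OF sm] by blast
    show "integrable (lebesgue_on W) (\<lambda>x. \<phi> x *\<^sub>R (g x - g' x))"
      by (rule L2_scaleR_integrable[OF test_function_L2(1)[OF W(1) \<phi> d\<phi>] L])
    have "(\<integral>x. (u x - u' x) *\<^sub>R d\<phi> x \<partial>lebesgue_on W) = - (\<integral>x. \<phi> x *\<^sub>R (g x - g' x) \<partial>lebesgue_on W)"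
      using D \<phi> d\<phi> unfolding H1_def by blast
    moreover have "(\<integral>x. (u x - u' x) *\<^sub>R d\<phi> x \<partial>lebesgue_on W) = 0"
    proof (rule integral_eq_zero_AE)
      show "AE x in lebesgue_on W. (u x - u' x) *\<^sub>R d\<phi> x = 0"
        using eq by eventually_elim simp
    qed
    ultimately show "(\<integral>x. \<phi> x *\<^sub>R (g x - g' x) \<partial>lebesgue_on W) = 0" by simp
  qed
  then show ?thesis by eventually_elim simp
qed

text \<open>Both gradients integrate to the same values against test functions. The classical one is
  only continuous in the open set, so integrability is checked on closed boxes and on supports of
  test functions; its square integrability is a consequence, drawn in
  \<open>integrable_g\<close>.\<close>

lemma weak_gradient_eq_gradient:
  fixes u v :: "real \<times> real \<Rightarrow> real"
  assumes W: "open W" "bounded W" and u: "H1 W u g"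
    and eq: "AE x in lebesgue_on W. u x = v x"
    and v: "\<And>z. z \<in> W \<Longrightarrow> GDERIV v z :> g' z" and g': "continuous_on W g'"
  shows "AE x in lebesgue_on W. g x = g' x"
proof -
  have Ls: "W \<in> sets lebesgue" using W by auto
  have Lu: "L2 (lebesgue_on W) u" and L: "L2 (lebesgue_on W) g" using u by (auto simp: H1_def)
  have fin: "finite_measure (lebesgue_on W)"
    using W by (intro finite_measure_lebesgue_on bounded_set_imp_lmeasurable) auto
  have g'm: "g' \<in> borel_measurable (lebesgue_on W)"
    by (rule continuous_imp_measurable_on_sets_lebesgue[OF g' Ls])
  have vc: "continuous_on W v"
    using v GDERIV_imp_isCont by (blast intro: continuous_at_imp_continuous_on)
  have vm: "v \<in> borel_measurable (lebesgue_on W)"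
    by (rule continuous_imp_measurable_on_sets_lebesgue[OF vc Ls])
  have "AE x in lebesgue_on W. g x - g' x = 0"
  proof (rule AE_zero_of_vector_test[OF W(1)])
    show "(\<lambda>x. g x - g' x) \<in> borel_measurable (lebesgue_on W)"
      using L2_measurable[OF L] g'm by (rule borel_measurable_diff)
    show "integrable (lebesgue_on W) (\<lambda>x. indicator (cbox a b) x *\<^sub>R (g x - g' x))" if "cbox a b \<subseteq> W" for a b
    proof -
      have "integrable (lebesgue_on W) (\<lambda>x. indicator (cbox a b) x *\<^sub>R g x)"
        using that W(1)
        by (intro integrable_mult_indicator L2_imp_integrable[OF fin L]) (auto simp: sets_restrict_space_iff)
      moreover have "integrable (lebesgue_on W) (\<lambda>x. indicator (cbox a b) x *\<^sub>R g' x)"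
      proof (rule lebesgue_integral_compact_support(1)[OF Ls compact_cbox that])
        show "continuous_on (cbox a b) (\<lambda>x. indicator (cbox a b) x *\<^sub>R g' x)"
          by (rule continuous_on_eq[OF continuous_on_subset[OF g' that]]) simp
      qed simp
      ultimately show ?thesis by (simp add: scaleR_diff_right)
    qed
    fix \<phi> assume \<phi>: "test_function W \<phi>"
    then have sm: "smooth \<phi>" by (simp add: test_function_def)
    obtain d\<phi> where d\<phi>: "\<And>x. GDERIV \<phi> x :> d\<phi> x"
      using smooth_obtain_gderiv[OF sm] by blast
    note P = test_function_integration_by_parts[OF W(1) v g' \<phi> d\<phi>]
    have i: "integrable (lebesgue_on W) (\<lambda>x. \<phi> x *\<^sub>R g x)"
      by (rule L2_scaleR_integrable[OF test_function_L2(1)[OF W(1) \<phi> d\<phi>] L])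
    show "integrable (lebesgue_on W) (\<lambda>x. \<phi> x *\<^sub>R (g x - g' x))"
      using i P(2) by (simp add: scaleR_diff_right)
    have "(\<integral>x. \<phi> x *\<^sub>R (g x - g' x) \<partial>lebesgue_on W) = (\<integral>x. \<phi> x *\<^sub>R g x \<partial>lebesgue_on W) - (\<integral>x. \<phi> x *\<^sub>R g' x \<partial>lebesgue_on W)"
      using i P(2) by (simp add: scaleR_diff_right)
    also have "(\<integral>x. \<phi> x *\<^sub>R g x \<partial>lebesgue_on W) = - (\<integral>x. u x *\<^sub>R d\<phi> x \<partial>lebesgue_on W)"
    proof -
      have "(\<integral>x. u x *\<^sub>R d\<phi> x \<partial>lebesgue_on W) = - (\<integral>x. \<phi> x *\<^sub>R g x \<partial>lebesgue_on W)"
        using u \<phi> d\<phi> unfolding H1_def by blast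
      then show ?thesis by simp
    qed
    also have "(\<integral>x. u x *\<^sub>R d\<phi> x \<partial>lebesgue_on W) = (\<integral>x. v x *\<^sub>R d\<phi> x \<partial>lebesgue_on W)"
    proof (intro integral_cong_AE borel_measurable_scaleR L2_measurable[OF Lu] vm
        L2_measurable[OF test_function_L2(2)[OF W(1) \<phi> d\<phi>]])
      show "AE x in lebesgue_on W. u x *\<^sub>R d\<phi> x = v x *\<^sub>R d\<phi> x"
        using eq by eventually_elim simp
    qed
    finally show "(\<integral>x. \<phi> x *\<^sub>R (g x - g' x) \<partial>lebesgue_on W) = 0" using P(3) by simp
  qed
  then show ?thesis by eventually_elim simp
qed

lemma H1_integration_by_parts:
  "H1 W u g \<Longrightarrow> test_function W \<phi> \<Longrightarrow> (\<And>x. GDERIV \<phi> x :> d\<phi> x) \<Longrightarrow>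
    (\<integral>x. u x *\<^sub>R d\<phi> x \<partial>lebesgue_on W) = - (\<integral>x. \<phi> x *\<^sub>R g x \<partial>lebesgue_on W)"
  unfolding H1_def by blast

subsection \<open>Reflections\<close>

text \<open>Applied with |s| = |t| = 1: the symmetry group of a rectangle centred at 0. Treating it
  as a diagonal map handles both axis reflections and the point reflection by one argument, and the
  map is its own adjoint.\<close>

definition mirror :: "real \<Rightarrow> real \<Rightarrow> real \<times> real \<Rightarrow> real \<times> real" where
  "mirror s t z = (s * fst z, t * snd z)"

lemma linear_mirror: "linear (mirror s t)"
  by (rule linearI) (auto simp: mirror_def algebra_simps)

lemma mirror_inner: "mirror s t z \<bullet> w = z \<bullet> mirror s t w"
  by (simp add: mirror_def inner_prod_def)

lemma mirror_mirror:
  assumes "\<bar>s\<bar> = 1" "\<bar>t\<bar> = 1"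
  shows "mirror s t (mirror s t z) = z"
proof -
  have "s * s = 1" "t * t = 1" using assms by (auto simp: abs_if split: if_splits)
  then show ?thesis by (simp add: mirror_def flip: mult.assoc)
qed

lemma mirror_inner_mirror:
  assumes "\<bar>s\<bar> = 1" "\<bar>t\<bar> = 1"
  shows "mirror s t z \<bullet> mirror s t w = z \<bullet> w"
  using assms by (simp add: mirror_inner mirror_mirror)

lemma continuous_mirror: "continuous_on S (mirror s t)"
  unfolding mirror_def by (intro continuous_intros)

lemma mirror_lebesgue:
  assumes st: "\<bar>s\<bar> = 1" "\<bar>t\<bar> = 1"
  shows "mirror s t \<in> lebesgue \<rightarrow>\<^sub>M lebesgue" "distr lebesgue lebesgue (mirror s t) = lebesgue"
proof -
  define c where "c = (\<lambda>j::real \<times> real. if j = (1, 0) then s else t)"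
  have B: "(Basis :: (real \<times> real) set) = {(1, 0), (0, 1)}" by (auto simp: Basis_prod_def)
  have eq: "(\<lambda>x. 0 + (\<Sum>j\<in>Basis. (c j * (x \<bullet> j)) *\<^sub>R j)) = mirror s t"
    by (auto simp: B c_def mirror_def fun_eq_iff)
  have c0: "\<And>j. j \<in> Basis \<Longrightarrow> c j \<noteq> 0" using st by (auto simp: c_def)
  have p: "(\<Prod>j\<in>Basis. \<bar>c j\<bar>) = 1" using st by (simp add: B c_def)
  show "mirror s t \<in> lebesgue \<rightarrow>\<^sub>M lebesgue"
    by (rule lebesgue_affine_measurable[of c 0, unfolded eq, OF c0])
  have "lebesgue = density (distr lebesgue lebesgue (mirror s t)) (\<lambda>_. (\<Prod>j\<in>Basis. \<bar>c j\<bar>))"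
    by (rule lebesgue_affine_euclidean[of c 0, unfolded eq, OF c0])
  then show "distr lebesgue lebesgue (mirror s t) = lebesgue"
    by (simp add: p density_1)
qed

lemma mirror_lebesgue_on:
  assumes st: "\<bar>s\<bar> = 1" "\<bar>t\<bar> = 1" and W: "W \<in> sets lebesgue" "\<And>z. mirror s t z \<in> W \<longleftrightarrow> z \<in> W"
  shows "mirror s t \<in> measurable (lebesgue_on W) (lebesgue_on W)"
    "distr (lebesgue_on W) (lebesgue_on W) (mirror s t) = lebesgue_on W"
proof -
  show m: "mirror s t \<in> measurable (lebesgue_on W) (lebesgue_on W)"
    using W by (intro measurable_restrict_space3[OF mirror_lebesgue(1)[OF st]]) auto
  show "distr (lebesgue_on W) (lebesgue_on W) (mirror s t) = lebesgue_on W"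
  proof (rule measure_eqI)
    fix A assume "A \<in> sets (distr (lebesgue_on W) (lebesgue_on W) (mirror s t))"
    then have A: "A \<in> sets (lebesgue_on W)" "A \<in> sets lebesgue" "A \<subseteq> W"
      using W(1) by (auto simp: sets_restrict_space_iff)
    have v: "mirror s t -` A \<inter> space (lebesgue_on W) = mirror s t -` A"
      using A(3) W(2) by (simp add: space_restrict_space) blast
    have "emeasure (distr (lebesgue_on W) (lebesgue_on W) (mirror s t)) A = emeasure (lebesgue_on W) (mirror s t -` A)"
      using emeasure_distr[OF m A(1)] by (simp only: v)
    also have "... = emeasure lebesgue (mirror s t -` A)"
    proof (rule emeasure_restrict_space)
      show "mirror s t -` A \<subseteq> W" using A(3) W(2) by blast
    qed (use W in simp)
    also have "... = emeasure (distr lebesgue lebesgue (mirror s t)) A"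
      using emeasure_distr[OF mirror_lebesgue(1)[OF st] A(2)] by simp
    also have "... = emeasure (lebesgue_on W) A"
      using A W by (simp add: mirror_lebesgue(2)[OF st] emeasure_restrict_space)
    finally show "emeasure (distr (lebesgue_on W) (lebesgue_on W) (mirror s t)) A = emeasure (lebesgue_on W) A" .
  qed simp
qed

lemma GDERIV_mirror:
  assumes "GDERIV f (mirror s t x) :> d"
  shows "GDERIV (\<lambda>z. f (mirror s t z)) x :> mirror s t d"
proof -
  have "(mirror s t has_derivative mirror s t) (at x)"
    by (rule linear_imp_has_derivative[OF linear_mirror])
  from diff_chain_at[OF this assms[unfolded gderiv_def]] show ?thesis
    by (simp add: gderiv_def o_def mirror_inner)
qed

lemma smooth_mirror: "smooth f \<Longrightarrow> smooth (\<lambda>z. f (mirror s t z))"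
  using smooth_compose_affine[OF linear_mirror, of f s t 0] by simp

lemma test_function_mirror:
  assumes st: "\<bar>s\<bar> = 1" "\<bar>t\<bar> = 1" and W: "\<And>z. mirror s t z \<in> W \<longleftrightarrow> z \<in> W"
    and \<phi>: "test_function W \<phi>"
  shows "test_function W (\<lambda>z. \<phi> (mirror s t z))"
proof -
  define K where "K = closure {z. \<phi> z \<noteq> 0}"
  have K: "compact K" "K \<subseteq> W" and sm: "smooth \<phi>"
    using \<phi> by (auto simp: test_function_def K_def)
  have K': "compact (mirror s t ` K)"
    by (rule compact_continuous_image[OF continuous_mirror K(1)])
  have sub: "closure {z. \<phi> (mirror s t z) \<noteq> 0} \<subseteq> mirror s t ` K"
  proof (rule closure_minimal[OF _ compact_imp_closed[OF K']], rule subsetI)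
    fix z assume "z \<in> {z. \<phi> (mirror s t z) \<noteq> 0}"
    then have "mirror s t z \<in> K" unfolding K_def by (intro subsetD[OF closure_subset]) simp
    then have "mirror s t (mirror s t z) \<in> mirror s t ` K" by (rule imageI)
    then show "z \<in> mirror s t ` K" by (simp only: mirror_mirror[OF st])
  qed
  have "compact (closure {z. \<phi> (mirror s t z) \<noteq> 0})"
    using bounded_subset[OF compact_imp_bounded[OF K'] sub] by (simp add: compact_eq_bounded_closed)
  moreover have "closure {z. \<phi> (mirror s t z) \<noteq> 0} \<subseteq> W"
  proof (rule order_trans[OF sub], rule image_subsetI)
    fix z assume "z \<in> K"
    then show "mirror s t z \<in> W" using K(2) W[of z] by (simp add: subsetD)
  qed
  ultimately show ?thesis using smooth_mirror[OF sm] by (simp add: test_function_def)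
qed

lemma L2_mirror_vector:
  assumes st: "\<bar>s\<bar> = 1" "\<bar>t\<bar> = 1" and f: "L2 M f"
  shows "L2 M (\<lambda>x. mirror s t (f x))"
proof -
  have n: "norm (mirror s t z) = norm z" for z
    using mirror_inner_mirror[OF st, of z z] by (simp add: norm_eq_sqrt_inner)
  have "mirror s t \<in> borel_measurable borel"
    by (rule borel_measurable_continuous_onI[OF continuous_mirror])
  then show ?thesis using f by (auto simp: L2_def n intro: measurable_compose)
qed

text \<open>The reflected test function is admissible for \<open>u\<close>. Changing variables on
  both sides of its weak identity and pulling the linear map out of the integral gives the identity
  for the reflected function.\<close>

lemma H1_mirror:
  assumes st: "\<bar>s\<bar> = 1" "\<bar>t\<bar> = 1" and W: "open W" "\<And>z. mirror s t z \<in> W \<longleftrightarrow> z \<in> W"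
    and u: "H1 W u g"
  shows "H1 W (\<lambda>z. u (mirror s t z)) (\<lambda>z. mirror s t (g (mirror s t z)))"
  unfolding H1_def
proof (intro conjI allI impI)
  let ?T = "mirror s t"
  have Ls: "W \<in> sets lebesgue" using W by auto
  note T = mirror_lebesgue_on[OF st Ls W(2)]
  have L: "L2 (lebesgue_on W) u" "L2 (lebesgue_on W) g" using u by (auto simp: H1_def)
  show "L2 (lebesgue_on W) (\<lambda>z. u (?T z))" by (rule L2_measure_preserving[OF T L(1)])
  show "L2 (lebesgue_on W) (\<lambda>z. ?T (g (?T z)))"
    by (rule L2_mirror_vector[OF st L2_measure_preserving[OF T L(2)]])
  fix \<phi> d\<phi> assume "test_function W \<phi> \<and> (\<forall>x. GDERIV \<phi> x :> d\<phi> x)"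
  then have \<phi>: "test_function W \<phi>" "\<And>x. GDERIV \<phi> x :> d\<phi> x" by auto
  have \<phi>': "test_function W (\<lambda>z. \<phi> (?T z))" by (rule test_function_mirror[OF st W(2) \<phi>(1)])
  have d\<phi>': "GDERIV (\<lambda>z. \<phi> (?T z)) x :> ?T (d\<phi> (?T x))" for x
    by (rule GDERIV_mirror[OF \<phi>(2)])
  note L\<phi>' = test_function_L2[OF W(1) \<phi>' d\<phi>'] and L\<phi> = test_function_L2[OF W(1) \<phi>]
  have bl: "bounded_linear ?T" using linear_mirror by (simp add: linear_conv_bounded_linear)
  have "(\<integral>z. u (?T z) *\<^sub>R d\<phi> z \<partial>lebesgue_on W) = (\<integral>z. u (?T z) *\<^sub>R ?T (?T (d\<phi> (?T (?T z)))) \<partial>lebesgue_on W)"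
    by (simp add: mirror_mirror[OF st])
  also have "... = (\<integral>z. u z *\<^sub>R ?T (?T (d\<phi> (?T z))) \<partial>lebesgue_on W)"
    using L2_measurable[OF L(1)] L2_measurable[OF L2_mirror_vector[OF st L\<phi>'(2)]]
    by (intro integral_measure_preserving[OF T, of "\<lambda>z. u z *\<^sub>R ?T (?T (d\<phi> (?T z)))"]) measurable
  also have "... = (\<integral>z. ?T (u z *\<^sub>R ?T (d\<phi> (?T z))) \<partial>lebesgue_on W)"
    by (simp add: linear_cmul[OF linear_mirror])
  also have "... = ?T (\<integral>z. u z *\<^sub>R ?T (d\<phi> (?T z)) \<partial>lebesgue_on W)"
    by (rule integral_bounded_linear[OF bl L2_scaleR_integrable[OF L(1) L\<phi>'(2)]])
  also have "(\<integral>z. u z *\<^sub>R ?T (d\<phi> (?T z)) \<partial>lebesgue_on W) = - (\<integral>z. \<phi> (?T z) *\<^sub>R g z \<partial>lebesgue_on W)"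
    by (rule H1_integration_by_parts[OF u \<phi>' d\<phi>'])
  also have "?T (- (\<integral>z. \<phi> (?T z) *\<^sub>R g z \<partial>lebesgue_on W)) = - ?T (\<integral>z. \<phi> (?T z) *\<^sub>R g z \<partial>lebesgue_on W)"
    by (rule linear_neg[OF linear_mirror])
  also have "?T (\<integral>z. \<phi> (?T z) *\<^sub>R g z \<partial>lebesgue_on W) = (\<integral>z. ?T (\<phi> (?T z) *\<^sub>R g z) \<partial>lebesgue_on W)"
    by (rule integral_bounded_linear[OF bl L2_scaleR_integrable[OF L\<phi>'(1) L(2)], symmetric])
  also have "... = (\<integral>z. \<phi> (?T z) *\<^sub>R ?T (g z) \<partial>lebesgue_on W)"
    by (simp add: linear_cmul[OF linear_mirror])
  also have "... = (\<integral>z. \<phi> (?T (?T z)) *\<^sub>R ?T (g (?T z)) \<partial>lebesgue_on W)"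
    using L2_measurable[OF L\<phi>'(1)] L2_measurable[OF L2_mirror_vector[OF st L(2)]]
    by (intro integral_measure_preserving[OF T, of "\<lambda>z. \<phi> (?T z) *\<^sub>R ?T (g z)", symmetric]) measurable
  finally show "(\<integral>z. u (?T z) *\<^sub>R d\<phi> z \<partial>lebesgue_on W) = - (\<integral>z. \<phi> z *\<^sub>R ?T (g (?T z)) \<partial>lebesgue_on W)"
    by (simp add: mirror_mirror[OF st])
qed

lemma L2_tendsto_mirror_vector:
  assumes st: "\<bar>s\<bar> = 1" "\<bar>t\<bar> = 1" and f: "L2_tendsto M F f"
  shows "L2_tendsto M (\<lambda>n x. mirror s t (F n x)) (\<lambda>x. mirror s t (f x))"
proof -
  have n: "norm (mirror s t z - mirror s t w) = norm (z - w)" for z w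
  proof -
    have "mirror s t z - mirror s t w = mirror s t (z - w)" using linear_diff[OF linear_mirror] by metis
    then show ?thesis using mirror_inner_mirror[OF st, of "z - w" "z - w"] by (simp add: norm_eq_sqrt_inner)
  qed
  show ?thesis using f by (auto simp: L2_tendsto_def n intro: L2_mirror_vector[OF st])
qed

lemma has_trace_mirror:
  assumes st: "\<bar>s\<bar> = 1" "\<bar>t\<bar> = 1" and W: "open W" "\<And>z. mirror s t z \<in> W \<longleftrightarrow> z \<in> W"
    and \<sigma>: "mirror s t \<in> measurable \<sigma> \<sigma>" "distr \<sigma> \<sigma> (mirror s t) = \<sigma>"
    and u: "has_trace W \<sigma> u \<tau>"
  shows "has_trace W \<sigma> (\<lambda>z. u (mirror s t z)) (\<lambda>z. \<tau> (mirror s t z))"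
proof -
  have Ls: "W \<in> sets lebesgue" using W by auto
  note T = mirror_lebesgue_on[OF st Ls W(2)]
  obtain g \<psi> d\<psi> where 1: "H1 W u g" "\<And>n. smooth (\<psi> n)" "\<And>n x. GDERIV (\<psi> n) x :> d\<psi> n x"
    "L2_tendsto (lebesgue_on W) \<psi> u" "L2_tendsto (lebesgue_on W) d\<psi> g" "L2_tendsto \<sigma> \<psi> \<tau>"
    using u unfolding has_trace_def by blast
  show ?thesis
    unfolding has_trace_def
  proof (intro exI conjI allI)
    show "H1 W (\<lambda>z. u (mirror s t z)) (\<lambda>z. mirror s t (g (mirror s t z)))"
      by (rule H1_mirror[OF st W 1(1)])
    show "smooth (\<lambda>z. \<psi> n (mirror s t z))" for n by (rule smooth_mirror[OF 1(2)])
    show "GDERIV (\<lambda>z. \<psi> n (mirror s t z)) x :> mirror s t (d\<psi> n (mirror s t x))" for n x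
      by (rule GDERIV_mirror[OF 1(3)])
    show "L2_tendsto (lebesgue_on W) (\<lambda>n z. \<psi> n (mirror s t z)) (\<lambda>z. u (mirror s t z))"
      by (rule L2_tendsto_measure_preserving[OF T 1(4)])
    show "L2_tendsto (lebesgue_on W) (\<lambda>n z. mirror s t (d\<psi> n (mirror s t z))) (\<lambda>z. mirror s t (g (mirror s t z)))"
      by (rule L2_tendsto_mirror_vector[OF st L2_tendsto_measure_preserving[OF T 1(5)]])
    show "L2_tendsto \<sigma> (\<lambda>n z. \<psi> n (mirror s t z)) (\<lambda>z. \<tau> (mirror s t z))"
      by (rule L2_tendsto_measure_preserving[OF \<sigma> 1(6)])
  qed
qed

subsection \<open>The boundary measure\<close>

lemma sets_hseg_measure [simp, measurable_cong]: "sets (hseg_measure r c) = sets borel"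
  and sets_vseg_measure [simp, measurable_cong]: "sets (vseg_measure r c) = sets borel"
  and space_hseg_measure [simp]: "space (hseg_measure r c) = UNIV"
  and space_vseg_measure [simp]: "space (vseg_measure r c) = UNIV"
  by (simp_all add: hseg_measure_def vseg_measure_def)

lemma measurable_side [measurable]:
  "(\<lambda>t. (t, c)) \<in> restrict_space lborel {-r<..<r::real} \<rightarrow>\<^sub>M (borel :: (real \<times> real) measure)"
  "(\<lambda>t. (c, t)) \<in> restrict_space lborel {-r<..<r::real} \<rightarrow>\<^sub>M (borel :: (real \<times> real) measure)"
  by (auto intro!: measurable_restrict_space1 borel_measurable_continuous_onI continuous_intros)

lemma emeasure_hseg_measure:
  "A \<in> sets borel \<Longrightarrow> emeasure (hseg_measure r c) A = emeasure lborel ({-r<..<r} \<inter> (\<lambda>t. (t, c)) -` A)"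
  and emeasure_vseg_measure:
  "A \<in> sets borel \<Longrightarrow> emeasure (vseg_measure r c) A = emeasure lborel ({-r<..<r} \<inter> (\<lambda>t. (c, t)) -` A)"
  by (simp_all add: hseg_measure_def vseg_measure_def emeasure_distr emeasure_restrict_space
      space_restrict_space Int_commute)

text \<open>\<open>bdry_measure\<close> is given by its values on sets, so the splitting into sides
  passes to integrals by induction over simple functions and monotone limits.\<close>

lemma nn_integral_bdry_measure:
  assumes "f \<in> borel_measurable borel"
  shows "(\<integral>\<^sup>+z. f z \<partial>bdry_measure r1 r2) = (\<integral>\<^sup>+z. f z \<partial>hseg_measure r1 r2) + (\<integral>\<^sup>+z. f z \<partial>hseg_measure r1 (- r2))
    + (\<integral>\<^sup>+z. f z \<partial>vseg_measure r2 r1) + (\<integral>\<^sup>+z. f z \<partial>vseg_measure r2 (- r1))"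
  using assms
proof (induction rule: borel_measurable_induct)
  case (cong f g)
  then have "f = g" by (auto simp: fun_eq_iff)
  then show ?case using cong by simp
next
  case (set A)
  then show ?case by (simp add: emeasure_bdry_measure)
next
  case (mult u c)
  then show ?case by (simp add: nn_integral_cmult distrib_left)
next
  case (add u v)
  then show ?case by (simp add: nn_integral_add ac_simps)
next
  case (seq U)
  have mono: "incseq (\<lambda>i. integral\<^sup>N M (U i))" for M
    using \<open>incseq U\<close> by (intro incseq_SucI nn_integral_mono) (auto simp: incseq_Suc_iff le_fun_def)
  have m: "U i \<in> borel_measurable M" if "sets M = sets borel" for i M
    using seq(1)[of i] measurable_cong_sets[OF that refl] by auto
  have S: "(\<integral>\<^sup>+z. (SUP i. U i) z \<partial>M) = (SUP i. integral\<^sup>N M (U i))" if "sets M = sets borel" for M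
    unfolding SUP_apply using \<open>incseq U\<close> m[OF that] by (intro nn_integral_monotone_convergence_SUP) auto
  have inc2: "incseq (\<lambda>i. f i + g i)" if "incseq f" "incseq g" for f g :: "nat \<Rightarrow> ennreal"
    using that by (auto simp: incseq_def intro: add_mono)
  define a b c d where "a = (\<lambda>i. integral\<^sup>N (hseg_measure r1 r2) (U i))"
    and "b = (\<lambda>i. integral\<^sup>N (hseg_measure r1 (- r2)) (U i))"
    and "c = (\<lambda>i. integral\<^sup>N (vseg_measure r2 r1) (U i))"
    and "d = (\<lambda>i. integral\<^sup>N (vseg_measure r2 (- r1)) (U i))"
  have inc: "incseq a" "incseq b" "incseq c" "incseq d" unfolding a_def b_def c_def d_def by (rule mono)+
  have "(\<integral>\<^sup>+z. (SUP i. U i) z \<partial>bdry_measure r1 r2) = (SUP i. a i + b i + c i + d i)"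
    unfolding S[OF sets_bdry_measure] seq.IH a_def b_def c_def d_def ..
  also have "... = (SUP i. a i + b i + c i) + (SUP i. d i)"
    by (rule ennreal_SUP_add[OF inc2[OF inc2[OF inc(1,2)] inc(3)] inc(4)])
  also have "(SUP i. a i + b i + c i) = (SUP i. a i + b i) + (SUP i. c i)"
    by (rule ennreal_SUP_add[OF inc2[OF inc(1,2)] inc(3)])
  also have "(SUP i. a i + b i) = (SUP i. a i) + (SUP i. b i)"
    by (rule ennreal_SUP_add[OF inc(1,2)])
  finally show ?case
    unfolding S[OF sets_hseg_measure] S[OF sets_vseg_measure] a_def b_def c_def d_def .
qed

lemma integrable_interval:
  fixes k :: "real \<Rightarrow> real"
  assumes k: "continuous_on {-r..r} k"
  shows "integrable (restrict_space lborel {-r<..<r}) k" "integral\<^sup>L (restrict_space lborel {-r<..<r}) k = integral {-r..r} k"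
proof -
  have "set_integrable lborel {-r..r} k"
    unfolding set_integrable_def by (rule borel_integrable_compact[OF _ k]) simp
  then have s: "set_integrable lborel {-r<..<r} k"
    by (rule set_integrable_subset) auto
  then show "integrable (restrict_space lborel {-r<..<r}) k"
    by (simp add: integrable_restrict_space set_integrable_def)
  have "integral\<^sup>L (restrict_space lborel {-r<..<r}) k = (LINT x:{-r<..<r}|lborel. k x)"
    by (simp add: integral_restrict_space set_lebesgue_integral_def)
  also have "... = integral {-r<..<r} k" by (rule set_borel_integral_eq_integral(2)[OF s])
  also have "... = integral {-r..r} k" by (rule integral_open_interval_real[symmetric])
  finally show "integral\<^sup>L (restrict_space lborel {-r<..<r}) k = integral {-r..r} k" .
qed

text \<open>The integrand is compared with continuous functions on the open sides only, because the
  boundary data jump at the corners.\<close>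

lemma integral_bdry_measure:
  fixes f :: "real \<times> real \<Rightarrow> real"
  assumes f: "f \<in> borel_measurable borel"
    and k: "continuous_on {-r1..r1} k1" "continuous_on {-r1..r1} k2" "continuous_on {-r2..r2} k3" "continuous_on {-r2..r2} k4"
    and fk: "\<And>t. -r1 < t \<Longrightarrow> t < r1 \<Longrightarrow> f (t, r2) = k1 t" "\<And>t. -r1 < t \<Longrightarrow> t < r1 \<Longrightarrow> f (t, - r2) = k2 t"
       "\<And>t. -r2 < t \<Longrightarrow> t < r2 \<Longrightarrow> f (r1, t) = k3 t" "\<And>t. -r2 < t \<Longrightarrow> t < r2 \<Longrightarrow> f (- r1, t) = k4 t"
  shows "integrable (bdry_measure r1 r2) f"
    "integral\<^sup>L (bdry_measure r1 r2) f = integral {-r1..r1} k1 + integral {-r1..r1} k2 + integral {-r2..r2} k3 + integral {-r2..r2} k4"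
proof -
  have h: "integrable (hseg_measure r c) f \<and> integral\<^sup>L (hseg_measure r c) f = integral {-r..r} k"
    if "continuous_on {-r..r} k" "\<And>t. -r < t \<Longrightarrow> t < r \<Longrightarrow> f (t, c) = k t" for r c k
  proof -
    have "integrable (restrict_space lborel {-r<..<r}) (\<lambda>t. f (t, c)) \<longleftrightarrow> integrable (restrict_space lborel {-r<..<r}) k"
      by (rule Bochner_Integration.integrable_cong) (auto simp: space_restrict_space that(2))
    moreover have "integral\<^sup>L (restrict_space lborel {-r<..<r}) (\<lambda>t. f (t, c)) = integral\<^sup>L (restrict_space lborel {-r<..<r}) k"
      by (rule Bochner_Integration.integral_cong) (auto simp: space_restrict_space that(2))
    ultimately show ?thesis
      using integrable_interval[OF that(1)] f
      by (simp add: hseg_measure_def integrable_distr_eq integral_distr)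
  qed
  have v: "integrable (vseg_measure r c) f \<and> integral\<^sup>L (vseg_measure r c) f = integral {-r..r} k"
    if "continuous_on {-r..r} k" "\<And>t. -r < t \<Longrightarrow> t < r \<Longrightarrow> f (c, t) = k t" for r c k
  proof -
    have "integrable (restrict_space lborel {-r<..<r}) (\<lambda>t. f (c, t)) \<longleftrightarrow> integrable (restrict_space lborel {-r<..<r}) k"
      by (rule Bochner_Integration.integrable_cong) (auto simp: space_restrict_space that(2))
    moreover have "integral\<^sup>L (restrict_space lborel {-r<..<r}) (\<lambda>t. f (c, t)) = integral\<^sup>L (restrict_space lborel {-r<..<r}) k"
      by (rule Bochner_Integration.integral_cong) (auto simp: space_restrict_space that(2))
    ultimately show ?thesis
      using integrable_interval[OF that(1)] f
      by (simp add: vseg_measure_def integrable_distr_eq integral_distr)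
  qed
  note I = h[OF k(1) fk(1)] h[OF k(2) fk(2)] v[OF k(3) fk(3)] v[OF k(4) fk(4)]
  have fm: "f \<in> borel_measurable M" if "sets M = sets borel" for M :: "(real \<times> real) measure"
    using f measurable_cong_sets[OF that refl] by auto
  have nn: "(\<integral>\<^sup>+z. ennreal (p (f z)) \<partial>bdry_measure r1 r2) = (\<integral>\<^sup>+z. ennreal (p (f z)) \<partial>hseg_measure r1 r2) + (\<integral>\<^sup>+z. ennreal (p (f z)) \<partial>hseg_measure r1 (- r2))
    + (\<integral>\<^sup>+z. ennreal (p (f z)) \<partial>vseg_measure r2 r1) + (\<integral>\<^sup>+z. ennreal (p (f z)) \<partial>vseg_measure r2 (- r1))"
    if "p \<in> borel_measurable borel" for p :: "real \<Rightarrow> real"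
  proof (rule nn_integral_bdry_measure)
    have "(\<lambda>z. p (f z)) \<in> borel_measurable borel" by (rule measurable_compose[OF f that])
    then show "(\<lambda>z. ennreal (p (f z))) \<in> borel_measurable borel" by measurable
  qed
  have "(\<integral>\<^sup>+z. ennreal (norm (f z)) \<partial>bdry_measure r1 r2) < \<infinity>"
    using I nn[of norm] by (simp add: integrable_iff_bounded)
  then show int: "integrable (bdry_measure r1 r2) f"
    using fm[of "bdry_measure r1 r2"] by (intro integrableI_bounded) auto
  note Ii = I[THEN conjunct1]
  have D: "integral\<^sup>L M f = enn2real (\<integral>\<^sup>+z. ennreal (f z) \<partial>M) - enn2real (\<integral>\<^sup>+z. ennreal (- f z) \<partial>M)"
    if "integrable M f" for M by (rule real_lebesgue_integral_def[OF that])
  have fin: "(\<integral>\<^sup>+z. ennreal (f z) \<partial>M) \<noteq> \<infinity>" "(\<integral>\<^sup>+z. ennreal (- f z) \<partial>M) \<noteq> \<infinity>" if "integrable M f" for M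
    using that by (auto simp: real_integrable_def)
  have "integral\<^sup>L (bdry_measure r1 r2) f = enn2real (\<integral>\<^sup>+z. ennreal (f z) \<partial>bdry_measure r1 r2) - enn2real (\<integral>\<^sup>+z. ennreal (- f z) \<partial>bdry_measure r1 r2)"
    by (rule real_lebesgue_integral_def[OF int])
  also have "... = integral\<^sup>L (hseg_measure r1 r2) f + integral\<^sup>L (hseg_measure r1 (-r2)) f
      + integral\<^sup>L (vseg_measure r2 r1) f + integral\<^sup>L (vseg_measure r2 (-r1)) f"
    using D[OF Ii(1)] D[OF Ii(2)] D[OF Ii(3)] D[OF Ii(4)] fin[OF Ii(1)] fin[OF Ii(2)] fin[OF Ii(3)] fin[OF Ii(4)] nn[of "\<lambda>x. x"] nn[of uminus]
    by (simp add: enn2real_plus less_top)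
  finally show "integral\<^sup>L (bdry_measure r1 r2) f = integral {-r1..r1} k1 + integral {-r1..r1} k2 + integral {-r2..r2} k3 + integral {-r2..r2} k4"
    using I by simp
qed

lemma finite_measure_bdry: "finite_measure (bdry_measure r1 r2)"
proof (rule finite_measureI)
  have "emeasure (hseg_measure r c) UNIV \<noteq> \<infinity>" "emeasure (vseg_measure r c) UNIV \<noteq> \<infinity>" for r c
    by (cases "r \<le> 0"; simp add: emeasure_hseg_measure emeasure_vseg_measure)+
  then show "emeasure (bdry_measure r1 r2) (space (bdry_measure r1 r2)) \<noteq> \<infinity>"
    by (simp add: emeasure_bdry_measure)
qed

text \<open>A reflection either exchanges two opposite sides or reverses a side, and length measure
  on a symmetric interval is invariant under reversal.\<close>

lemma mirror_bdry_measure: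
  assumes st: "\<bar>s\<bar> = 1" "\<bar>t\<bar> = 1"
  shows "mirror s t \<in> measurable (bdry_measure r1 r2) (bdry_measure r1 r2)"
    "distr (bdry_measure r1 r2) (bdry_measure r1 r2) (mirror s t) = bdry_measure r1 r2"
proof -
  have b: "mirror s t \<in> borel_measurable borel"
    by (rule borel_measurable_continuous_onI[OF continuous_mirror])
  then show m: "mirror s t \<in> measurable (bdry_measure r1 r2) (bdry_measure r1 r2)"
    using measurable_cong_sets[of "bdry_measure r1 r2" borel "bdry_measure r1 r2" borel] by auto
  have refl: "emeasure lborel ({-r<..<r} \<inter> (\<lambda>\<tau>. s * \<tau>) -` A) = emeasure lborel ({-r<..<r} \<inter> A)"
    if A: "A \<in> sets borel" and s: "\<bar>s\<bar> = 1" for r s and A :: "real set"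
  proof -
    consider "s = 1" | "s = -1" using s by (auto simp: abs_if split: if_splits)
    then show ?thesis
    proof cases
      case 2
      have "emeasure lborel ({-r<..<r} \<inter> A) = emeasure (distr lborel borel uminus) ({-r<..<r} \<inter> A)"
        by (simp add: lborel_distr_uminus)
      also have "... = emeasure lborel (uminus -` ({-r<..<r} \<inter> A))"
        using A by (subst emeasure_distr) auto
      also have "uminus -` ({-r<..<r} \<inter> A) = {-r<..<r} \<inter> (\<lambda>\<tau>. s * \<tau>) -` A"
        using 2 by auto
      finally show ?thesis by simp
    qed simp
  qed
  have h: "emeasure (hseg_measure r c) (mirror s t -` A) = emeasure (hseg_measure r (t * c)) A"
    and v: "emeasure (vseg_measure r c) (mirror s t -` A) = emeasure (vseg_measure r (s * c)) A"
    if A: "A \<in> sets borel" for r c A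
  proof -
    have mA: "mirror s t -` A \<in> sets borel" using b A by (simp add: measurable_sets_borel)
    have c: "continuous_on UNIV (\<lambda>\<tau>. (\<tau>, t * c))" "continuous_on UNIV (\<lambda>\<tau>. (s * c, \<tau>))"
      by (intro continuous_intros)+
    have "(\<lambda>\<tau>. (\<tau>, t * c)) -` A \<in> sets borel" "(\<lambda>\<tau>. (s * c, \<tau>)) -` A \<in> sets borel"
      using measurable_sets_borel[OF borel_measurable_continuous_onI[OF c(1)] A]
        measurable_sets_borel[OF borel_measurable_continuous_onI[OF c(2)] A] by auto
    note R = refl[OF this(1) st(1), of r] refl[OF this(2) st(2), of r]
    show "emeasure (hseg_measure r c) (mirror s t -` A) = emeasure (hseg_measure r (t * c)) A"
      using R(1) A mA by (simp add: emeasure_hseg_measure mirror_def vimage_def)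
    show "emeasure (vseg_measure r c) (mirror s t -` A) = emeasure (vseg_measure r (s * c)) A"
      using R(2) A mA by (simp add: emeasure_vseg_measure mirror_def vimage_def)
  qed
  show "distr (bdry_measure r1 r2) (bdry_measure r1 r2) (mirror s t) = bdry_measure r1 r2"
  proof (rule measure_eqI)
    fix A assume "A \<in> sets (distr (bdry_measure r1 r2) (bdry_measure r1 r2) (mirror s t))"
    then have A: "A \<in> sets borel" by simp
    have mA: "mirror s t -` A \<in> sets borel" using b A by (simp add: measurable_sets_borel)
    have s: "s = 1 \<or> s = -1" and t: "t = 1 \<or> t = -1" using st by (auto simp: abs_if split: if_splits)
    have "emeasure (distr (bdry_measure r1 r2) (bdry_measure r1 r2) (mirror s t)) A = emeasure (bdry_measure r1 r2) (mirror s t -` A)"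
      using emeasure_distr[OF m, of A] A by simp
    also have "... = emeasure (bdry_measure r1 r2) A"
      using s t by (auto simp: emeasure_bdry_measure[OF mA] emeasure_bdry_measure[OF A] h[OF A] v[OF A] ac_simps)
    finally show "emeasure (distr (bdry_measure r1 r2) (bdry_measure r1 r2) (mirror s t)) A = emeasure (bdry_measure r1 r2) A" .
  qed simp
qed

subsection \<open>The annulus and uniqueness of the weak solution\<close>

lemma mem_annulus_iff:
  assumes "0 < r1" "0 < r2" "1 < lam"
  shows "(x, y) \<in> annulus r1 r2 lam \<longleftrightarrow> \<bar>x\<bar> < lam * r1 \<and> \<bar>y\<bar> < lam * r2 \<and> \<not> (\<bar>x\<bar> \<le> r1 \<and> \<bar>y\<bar> \<le> r2)"
proof -
  have "closure (rect r1 r2) = {-r1..r1} \<times> {-r2..r2}"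
    using assms by (simp add: rect_def closure_Times)
  then have c: "(x, y) \<in> closure (rect r1 r2) \<longleftrightarrow> \<bar>x\<bar> \<le> r1 \<and> \<bar>y\<bar> \<le> r2" by auto
  have "(x, y) \<in> (\<lambda>z. lam *\<^sub>R z) ` rect r1 r2 \<longleftrightarrow> (x / lam, y / lam) \<in> rect r1 r2"
  proof
    assume "(x, y) \<in> (\<lambda>z. lam *\<^sub>R z) ` rect r1 r2"
    then show "(x / lam, y / lam) \<in> rect r1 r2" using assms by auto
  next
    assume "(x / lam, y / lam) \<in> rect r1 r2"
    then have "lam *\<^sub>R (x / lam, y / lam) \<in> (\<lambda>z. lam *\<^sub>R z) ` rect r1 r2" by (rule imageI)
    then show "(x, y) \<in> (\<lambda>z. lam *\<^sub>R z) ` rect r1 r2" using assms by simp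
  qed
  also have "... \<longleftrightarrow> \<bar>x\<bar> < lam * r1 \<and> \<bar>y\<bar> < lam * r2"
    using assms by (simp add: rect_def abs_less_iff field_simps) (auto simp: mult.commute)
  finally show ?thesis using c by (simp add: annulus_def)
qed

lemma open_annulus: "0 < lam \<Longrightarrow> open (annulus r1 r2 lam)"
  unfolding annulus_def rect_def by (intro open_Diff open_scaling open_Times) auto

lemma bounded_annulus: "bounded (annulus r1 r2 lam)"
proof -
  have "bounded (rect r1 r2)"
    using bounded_box[of "-r1" r1] bounded_box[of "-r2" r2] by (simp add: rect_def bounded_Times box_real)
  then have "bounded ((\<lambda>z. lam *\<^sub>R z) ` rect r1 r2)" by (rule bounded_scaling)
  then show ?thesis by (rule bounded_subset) (auto simp: annulus_def)
qed

lemma mirror_annulus: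
  assumes "0 < r1" "0 < r2" "1 < lam" "\<bar>s\<bar> = 1" "\<bar>t\<bar> = 1"
  shows "mirror s t z \<in> annulus r1 r2 lam \<longleftrightarrow> z \<in> annulus r1 r2 lam"
  using assms by (cases z) (simp add: mirror_def mem_annulus_iff abs_mult)

section \<open>Trace and Poincare inequalities across strips\<close>

lemma integral_square_le:
  fixes f :: "real \<Rightarrow> real"
  assumes "a \<le> b" and f: "continuous_on {a..b} f"
  shows "(integral {a..b} f)^2 \<le> (b - a) * integral {a..b} (\<lambda>x. (f x)^2)"
proof (cases "a = b")
  case False
  then have ab: "0 < b - a" using assms(1) by simp
  \<comment> \<open>With the mean value of f, nonnegativity of the variance is the desired
    inequality.\<close>
  define m where "m = integral {a..b} f / (b - a)"
  have i: "f integrable_on {a..b}" "(\<lambda>x. (f x)^2) integrable_on {a..b}"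
    using f by (auto intro!: integrable_continuous_real continuous_intros)
  have "0 \<le> integral {a..b} (\<lambda>x. (f x - m)^2)"
    using f by (intro HK_integral_nonneg integrable_continuous_real continuous_intros) auto
  also have "... = integral {a..b} (\<lambda>x. (f x)^2 - (2 * m) * f x + m^2)"
    by (simp add: power2_diff algebra_simps)
  also have "... = integral {a..b} (\<lambda>x. (f x)^2) - 2 * m * integral {a..b} f + m^2 * (b - a)"
  proof -
    have "((\<lambda>x. m^2) has_integral m^2 * (b - a)) {a..b}"
      using has_integral_const_real[of "m^2" a b] ab by (simp add: mult.commute)
    from has_integral_add[OF has_integral_diff[OF integrable_integral[OF i(2)] has_integral_mult_right[OF integrable_integral[OF i(1)], of "2 * m"]] this]
    show ?thesis by (rule integral_unique)
  qed
  finally have 1: "0 \<le> integral {a..b} (\<lambda>x. (f x)^2) - 2 * m * integral {a..b} f + m^2 * (b - a)" .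
  have m: "m * (b - a) = integral {a..b} f" using ab by (simp add: m_def)
  have "m^2 * (b - a) = m * integral {a..b} f" by (simp add: m[symmetric] power2_eq_square)
  with 1 have 2: "m * integral {a..b} f \<le> integral {a..b} (\<lambda>x. (f x)^2)" by simp
  have "(integral {a..b} f)^2 = (b - a) * (m * integral {a..b} f)"
    by (simp add: m[symmetric] power2_eq_square)
  also have "... \<le> (b - a) * integral {a..b} (\<lambda>x. (f x)^2)"
    using 2 ab by (intro mult_left_mono) auto
  finally show ?thesis .
qed simp

text \<open>On each line F(s, t) is F(s, d) minus the integral of the derivative from t to d;
  squaring, Cauchy-Schwarz and integration in s give both estimates. The level d will be an outer
  side and c an inner one, which is shorter, hence \<open>r \<le> R\<close>.\<close>

lemma strip_bounds:
  fixes F F' :: "real \<Rightarrow> real \<Rightarrow> real"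
  assumes cd: "c < d" and r: "r \<le> R"
    and F: "continuous_on UNIV (\<lambda>(s, t). F s t)" and F': "continuous_on UNIV (\<lambda>(s, t). F' s t)"
    and deriv: "\<And>s t. (F s has_real_derivative F' s t) (at t)"
  defines "E \<equiv> integral {-R..R} (\<lambda>s. integral {c..d} (\<lambda>t. (F' s t)^2))"
  shows "integral {-r..r} (\<lambda>s. (F s c)^2) \<le> 2 * integral {-R..R} (\<lambda>s. (F s d)^2) + 2 * (d - c) * E"
    "integral {-R..R} (\<lambda>s. integral {c..d} (\<lambda>t. (F s t)^2))
      \<le> (d - c) * (2 * integral {-R..R} (\<lambda>s. (F s d)^2) + 2 * (d - c) * E)"
proof -
  have Fs: "continuous_on S (\<lambda>s. F s t)" and F's: "continuous_on S (\<lambda>s. F' s t)" for S t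
    using continuous_on_compose2[OF F, of S "\<lambda>s. (s, t)"] continuous_on_compose2[OF F', of S "\<lambda>s. (s, t)"]
    by (simp_all add: continuous_on_Pair)
  have Ft: "continuous_on S (F s)" and F't: "continuous_on S (F' s)" for S s
  proof -
    have p: "continuous_on S (\<lambda>t. (s, t))" by (intro continuous_intros)
    show "continuous_on S (F s)" "continuous_on S (F' s)"
      using continuous_on_compose2[OF F p] continuous_on_compose2[OF F' p] by simp_all
  qed
  define e where "e = (\<lambda>s. integral {c..d} (\<lambda>t. (F' s t)^2))"
  have sq: "continuous_on A (\<lambda>(s, t). (F s t)^2)" "continuous_on A (\<lambda>(s, t). (F' s t)^2)" for A
    using F F' by (auto simp: case_prod_unfold intro!: continuous_intros intro: continuous_on_subset)
  have ec: "continuous_on S e" for S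
    unfolding e_def using integral_continuous_on_param[of S c d "\<lambda>s t. (F' s t)^2"] sq(2) by simp
  have e0: "0 \<le> e s" for s
    unfolding e_def by (intro HK_integral_nonneg integrable_continuous_real continuous_intros F't) auto
  have pt: "(F s t)^2 \<le> 2 * (F s d)^2 + 2 * (d - c) * e s" if t: "t \<in> {c..d}" for s t
  proof -
    have "(F' s has_integral F s d - F s t) {t..d}"
      using t deriv by (intro fundamental_theorem_of_calculus)
        (auto simp: has_real_derivative_iff_has_vector_derivative[symmetric] intro: has_field_derivative_at_within)
    then have I: "F s d - F s t = integral {t..d} (F' s)" by (simp add: integral_unique)
    have "(F s d - F s t)^2 \<le> (d - t) * integral {t..d} (\<lambda>x. (F' s x)^2)"
      unfolding I using t F't by (intro integral_square_le) auto
    also have "... \<le> (d - c) * e s"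
    proof (rule mult_mono)
      show "integral {t..d} (\<lambda>x. (F' s x)^2) \<le> e s"
        unfolding e_def using t
        by (intro integral_subset_le integrable_continuous_real continuous_intros F't) auto
      show "0 \<le> integral {t..d} (\<lambda>x. (F' s x)^2)"
        by (intro HK_integral_nonneg integrable_continuous_real continuous_intros F't) auto
    qed (use t cd in auto)
    finally have 1: "(F s d - F s t)^2 \<le> (d - c) * e s" .
    have "(F s t)^2 \<le> 2 * (F s d)^2 + 2 * (F s d - F s t)^2"
      using norm_diff_square_le[of "F s d" "F s d - F s t"] by simp
    with 1 show ?thesis unfolding mult.assoc by linarith
  qed
  have bc: "continuous_on S (\<lambda>s. 2 * (F s d)^2 + 2 * (d - c) * e s)" for S
    by (intro continuous_intros Fs ec)
  have bI: "integral {-R..R} (\<lambda>s. 2 * (F s d)^2 + 2 * (d - c) * e s) = 2 * integral {-R..R} (\<lambda>s. (F s d)^2) + 2 * (d - c) * E"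
  proof -
    have "integral {-R..R} (\<lambda>s. 2 * (F s d)^2 + (2 * (d - c)) * e s)
       = integral {-R..R} (\<lambda>s. 2 * (F s d)^2) + integral {-R..R} (\<lambda>s. (2 * (d - c)) * e s)"
      by (intro HK_integral_add integrable_continuous_real continuous_intros Fs ec)
    then show ?thesis by (simp add: E_def e_def)
  qed
  have "integral {-r..r} (\<lambda>s. (F s c)^2) \<le> integral {-r..r} (\<lambda>s. 2 * (F s d)^2 + 2 * (d - c) * e s)"
    using cd by (intro integral_le integrable_continuous_real continuous_intros Fs bc pt) auto
  also have "... \<le> integral {-R..R} (\<lambda>s. 2 * (F s d)^2 + 2 * (d - c) * e s)"
    using r cd e0 by (intro integral_subset_le integrable_continuous_real bc) auto
  finally show "integral {-r..r} (\<lambda>s. (F s c)^2) \<le> 2 * integral {-R..R} (\<lambda>s. (F s d)^2) + 2 * (d - c) * E"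
    unfolding bI .
  have "integral {-R..R} (\<lambda>s. integral {c..d} (\<lambda>t. (F s t)^2)) \<le> integral {-R..R} (\<lambda>s. (d - c) * (2 * (F s d)^2 + 2 * (d - c) * e s))"
  proof (rule integral_le)
    show "(\<lambda>s. integral {c..d} (\<lambda>t. (F s t)^2)) integrable_on {-R..R}"
      using integral_continuous_on_param[of "{-R..R}" c d "\<lambda>s t. (F s t)^2"] sq(1)
      by (intro integrable_continuous_real) simp
    show "(\<lambda>s. (d - c) * (2 * (F s d)^2 + 2 * (d - c) * e s)) integrable_on {-R..R}"
      by (intro integrable_continuous_real continuous_on_mult_left bc)
    fix s
    have "integral {c..d} (\<lambda>t. (F s t)^2) \<le> integral {c..d} (\<lambda>t. 2 * (F s d)^2 + 2 * (d - c) * e s)"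
      by (intro integral_le integrable_continuous_real continuous_intros Ft pt)
    also have "... = (d - c) * (2 * (F s d)^2 + 2 * (d - c) * e s)" using cd by simp
    finally show "integral {c..d} (\<lambda>t. (F s t)^2) \<le> (d - c) * (2 * (F s d)^2 + 2 * (d - c) * e s)" .
  qed
  then show "integral {-R..R} (\<lambda>s. integral {c..d} (\<lambda>t. (F s t)^2))
      \<le> (d - c) * (2 * integral {-R..R} (\<lambda>s. (F s d)^2) + 2 * (d - c) * E)"
    unfolding Henstock_Kurzweil_Integration.integral_mult_right bI .
qed

lemma lebesgue_integral_cbox:
  fixes h :: "'a::euclidean_space \<Rightarrow> real"
  assumes "continuous_on (cbox a b) h"
  shows "integrable lebesgue (\<lambda>x. indicator (cbox a b) x * h x)" "(\<integral>x. indicator (cbox a b) x * h x \<partial>lebesgue) = integral (cbox a b) h"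
proof -
  have "integrable (lebesgue_on (cbox a b)) h" "integral\<^sup>L (lebesgue_on (cbox a b)) h = integral (cbox a b) h"
    by (rule lebesgue_integral_compact_support[OF _ compact_cbox subset_refl assms]; simp)+
  then show "integrable lebesgue (\<lambda>x. indicator (cbox a b) x * h x)" "(\<integral>x. indicator (cbox a b) x * h x \<partial>lebesgue) = integral (cbox a b) h"
    by (simp_all add: integrable_restrict_space integral_restrict_space)
qed

lemma integral_cbox_le_lebesgue_integral:
  fixes h :: "'a::euclidean_space \<Rightarrow> real"
  assumes \<Omega>: "\<Omega> \<in> sets lebesgue" and sub: "box a b \<subseteq> \<Omega>" and c: "continuous_on (cbox a b) h"
    and nn: "\<And>x. 0 \<le> h x" and int: "integrable (lebesgue_on \<Omega>) h"
  shows "integral (cbox a b) h \<le> (\<integral>x. h x \<partial>lebesgue_on \<Omega>)"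
proof -
  have "integral (cbox a b) h = (\<integral>x. indicator (cbox a b) x * h x \<partial>lebesgue)"
    by (rule lebesgue_integral_cbox(2)[OF c, symmetric])
  also have "... \<le> (\<integral>x. indicator \<Omega> x * h x \<partial>lebesgue)"
  proof (rule integral_mono_AE)
    show "integrable lebesgue (\<lambda>x. indicator (cbox a b) x * h x)" by (rule lebesgue_integral_cbox(1)[OF c])
    show "integrable lebesgue (\<lambda>x. indicator \<Omega> x * h x)" using int \<Omega> by (simp add: integrable_restrict_space)
    have "AE x in lebesgue. x \<notin> cbox a b - box a b"
      by (intro AE_not_in) (simp only: negligible_iff_null_sets[symmetric] negligible_frontier_interval)
    then show "AE x in lebesgue. indicator (cbox a b) x * h x \<le> indicator \<Omega> x * h x"
    proof eventually_elim
      case (elim x)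
      then show ?case using sub nn[of x] by (cases "x \<in> cbox a b"; cases "x \<in> \<Omega>") auto
    qed
  qed
  also have "... = (\<integral>x. h x \<partial>lebesgue_on \<Omega>)" using \<Omega> by (simp add: integral_restrict_space)
  finally show ?thesis .
qed

lemma lebesgue_integral_le_sum_cbox:
  fixes h :: "'a::euclidean_space \<Rightarrow> real"
  assumes \<Omega>: "\<Omega> \<in> sets lebesgue" and I: "finite I" "\<Omega> \<subseteq> (\<Union>i\<in>I. cbox (a i) (b i))"
    and c: "\<And>i. i \<in> I \<Longrightarrow> continuous_on (cbox (a i) (b i)) h"
    and nn: "\<And>x. 0 \<le> h x" and int: "integrable (lebesgue_on \<Omega>) h"
  shows "(\<integral>x. h x \<partial>lebesgue_on \<Omega>) \<le> (\<Sum>i\<in>I. integral (cbox (a i) (b i)) h)"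
proof -
  have "(\<integral>x. h x \<partial>lebesgue_on \<Omega>) = (\<integral>x. indicator \<Omega> x * h x \<partial>lebesgue)"
    using \<Omega> by (simp add: integral_restrict_space)
  also have "... \<le> (\<integral>x. (\<Sum>i\<in>I. indicator (cbox (a i) (b i)) x * h x) \<partial>lebesgue)"
  proof (rule integral_mono)
    show "integrable lebesgue (\<lambda>x. indicator \<Omega> x * h x)" using int \<Omega> by (simp add: integrable_restrict_space)
    show "integrable lebesgue (\<lambda>x. \<Sum>i\<in>I. indicator (cbox (a i) (b i)) x * h x)"
      by (intro Bochner_Integration.integrable_sum lebesgue_integral_cbox(1) c)
    fix x
    show "indicator \<Omega> x * h x \<le> (\<Sum>i\<in>I. indicator (cbox (a i) (b i)) x * h x)"
    proof (cases "x \<in> \<Omega>")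
      case True
      then obtain i where i: "i \<in> I" "x \<in> cbox (a i) (b i)" using I(2) by blast
      have "indicator \<Omega> x * h x = indicator (cbox (a i) (b i)) x * h x" using True i by simp
      also have "... \<le> (\<Sum>i\<in>I. indicator (cbox (a i) (b i)) x * h x)"
        using I(1) i(1) nn by (intro member_le_sum) auto
      finally show ?thesis .
    next
      case False
      then show ?thesis using nn by (simp add: sum_nonneg)
    qed
  qed
  also have "... = (\<Sum>i\<in>I. \<integral>x. indicator (cbox (a i) (b i)) x * h x \<partial>lebesgue)"
    by (intro Bochner_Integration.integral_sum lebesgue_integral_cbox(1) c)
  also have "... = (\<Sum>i\<in>I. integral (cbox (a i) (b i)) h)"
    by (intro sum.cong refl lebesgue_integral_cbox(2) c)
  finally show ?thesis .
qed

lemma integral_bdry_measure_continuous: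
  fixes f :: "real \<times> real \<Rightarrow> real"
  assumes f: "continuous_on UNIV f"
  shows "integrable (bdry_measure r1 r2) f"
    "integral\<^sup>L (bdry_measure r1 r2) f = integral {-r1..r1} (\<lambda>t. f (t, r2)) + integral {-r1..r1} (\<lambda>t. f (t, - r2))
       + integral {-r2..r2} (\<lambda>t. f (r1, t)) + integral {-r2..r2} (\<lambda>t. f (- r1, t))"
proof -
  have c: "continuous_on S (\<lambda>t. f (t, k))" "continuous_on S (\<lambda>t. f (k, t))" for S and k :: real
    by (rule continuous_on_compose2[OF f]; auto intro!: continuous_intros)+
  note * = integral_bdry_measure[OF borel_measurable_continuous_onI[OF f] c(1) c(1) c(2) c(2) refl refl refl refl]
  show "integrable (bdry_measure r1 r2) f" by (rule *)
  show "integral\<^sup>L (bdry_measure r1 r2) f = integral {-r1..r1} (\<lambda>t. f (t, r2)) + integral {-r1..r1} (\<lambda>t. f (t, - r2))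
       + integral {-r2..r2} (\<lambda>t. f (r1, t)) + integral {-r2..r2} (\<lambda>t. f (- r1, t))" by (rule *)
qed

lemma iterated_integral_continuous:
  fixes f :: "real \<times> real \<Rightarrow> real"
  assumes "continuous_on (cbox (a, c) (b, d)) f"
  shows "integral {a..b} (\<lambda>s. integral {c..d} (\<lambda>t. f (s, t))) = integral (cbox (a, c) (b, d)) f"
    "integral {c..d} (\<lambda>t. integral {a..b} (\<lambda>s. f (s, t))) = integral (cbox (a, c) (b, d)) f"
  using integral_prod_continuous[of a c b d f] integral_swap_continuous[of a c b d "\<lambda>x y. f (x, y)"] assms by simp_all

locale annulus_geometry =
  fixes r1 r2 lam :: real
  assumes r: "0 < r1" "0 < r2" "1 < lam"
begin

abbreviation "\<Omega> \<equiv> annulus r1 r2 lam"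

definition "R1 = lam * r1"
definition "R2 = lam * r2"

lemma R: "r1 < R1" "r2 < R2" using r by (simp_all add: R1_def R2_def)

lemma op: "open \<Omega>" using r by (intro open_annulus) simp

lemma Ls: "\<Omega> \<in> sets lebesgue" using op by auto

lemma mem: "(x, y) \<in> \<Omega> \<longleftrightarrow> \<bar>x\<bar> < R1 \<and> \<bar>y\<bar> < R2 \<and> \<not> (\<bar>x\<bar> \<le> r1 \<and> \<bar>y\<bar> \<le> r2)"
  unfolding R1_def R2_def by (rule mem_annulus_iff[OF r])

text \<open>\<open>strip_bounds\<close> started at the top and right outer sides, with the inner
  level c left free. For smooth functions with small outer trace the area bounds are quadratic in
  the width of the strip, and this rate recovers the Dirichlet condition in
  \<open>strip_limit\<close>.\<close>

lemma outer_strip_bounds: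
  assumes \<psi>: "smooth \<psi>" "\<And>z. GDERIV \<psi> z :> d\<psi> z" and L: "L2 (lebesgue_on \<Omega>) d\<psi>"
  defines "B \<equiv> (\<integral>z. (\<psi> z)^2 \<partial>bdry_measure R1 R2)" and "E \<equiv> (\<integral>z. (norm (d\<psi> z))^2 \<partial>lebesgue_on \<Omega>)"
  shows "r2 \<le> c \<Longrightarrow> c < R2 \<Longrightarrow> integral {-r1..r1} (\<lambda>t. (\<psi> (t, c))^2) \<le> 2 * B + 2 * (R2 - c) * E"
    "r2 \<le> c \<Longrightarrow> c < R2 \<Longrightarrow> integral (cbox (-R1, c) (R1, R2)) (\<lambda>z. (\<psi> z)^2) \<le> (R2 - c) * (2 * B + 2 * (R2 - c) * E)"
    "r1 \<le> c \<Longrightarrow> c < R1 \<Longrightarrow> integral {-r2..r2} (\<lambda>t. (\<psi> (c, t))^2) \<le> 2 * B + 2 * (R1 - c) * E"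
    "r1 \<le> c \<Longrightarrow> c < R1 \<Longrightarrow> integral (cbox (c, -R2) (R1, R2)) (\<lambda>z. (\<psi> z)^2) \<le> (R1 - c) * (2 * B + 2 * (R1 - c) * E)"
proof -
  have \<psi>c: "continuous_on S \<psi>" and d\<psi>c: "continuous_on S d\<psi>" for S
    using smooth_imp_continuous[OF \<psi>(1)] smooth_continuous_gderiv[OF \<psi>] by auto
  define h where "h = (\<lambda>z. (norm (d\<psi> z))^2)"
  define k where "k = (\<lambda>z. (\<psi> z)^2)"
  have hc: "continuous_on S h" and kc: "continuous_on S k" for S
    unfolding h_def k_def by (intro continuous_intros \<psi>c d\<psi>c)+
  have fc: "continuous_on S (\<lambda>z. (fst (d\<psi> z))^2)" and sc: "continuous_on S (\<lambda>z. (snd (d\<psi> z))^2)" for S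
    by (intro continuous_intros d\<psi>c)+
  have hle: "(fst (d\<psi> z))^2 \<le> h z" "(snd (d\<psi> z))^2 \<le> h z" for z
    by (simp_all add: h_def norm_prod_def)
  have kint: "0 \<le> integral {a..b} (\<lambda>t. k (p t))" if "continuous_on UNIV p" for a b and p :: "real \<Rightarrow> real \<times> real"
    by (intro HK_integral_nonneg integrable_continuous_real
        continuous_on_compose2[OF kc[of UNIV]] continuous_on_subset[OF that]) (auto simp: k_def)
  have Beq: "B = integral {-R1..R1} (\<lambda>t. k (t, R2)) + integral {-R1..R1} (\<lambda>t. k (t, - R2))
      + integral {-R2..R2} (\<lambda>t. k (R1, t)) + integral {-R2..R2} (\<lambda>t. k (- R1, t))"
    using integral_bdry_measure_continuous(2)[OF kc, of R1 R2] by (simp add: B_def k_def)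
  have B1: "integral {-R1..R1} (\<lambda>t. k (t, R2)) \<le> B" "integral {-R2..R2} (\<lambda>t. k (R1, t)) \<le> B"
  proof -
    have cc: "continuous_on UNIV (\<lambda>t. (t, c))" "continuous_on UNIV (\<lambda>t. (c, t))" for c :: real
      by (intro continuous_intros)+
    show "integral {-R1..R1} (\<lambda>t. k (t, R2)) \<le> B" "integral {-R2..R2} (\<lambda>t. k (R1, t)) \<le> B"
      using kint[OF cc(1), of "-R1" R1 R2] kint[OF cc(1), of "-R1" R1 "-R2"]
        kint[OF cc(2), of "-R2" R2 R1] kint[OF cc(2), of "-R2" R2 "-R1"]
      unfolding Beq by linarith+
  qed
  have hbox: "integral (cbox p q) f \<le> E" if "box p q \<subseteq> \<Omega>" "\<And>z. f z \<le> h z" "continuous_on (cbox p q) f" for p q f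
  proof -
    have "integral (cbox p q) f \<le> integral (cbox p q) h"
      by (intro integral_le integrable_continuous that hc)
    also have "... \<le> E" unfolding E_def h_def[symmetric]
      by (rule integral_cbox_le_lebesgue_integral[OF Ls that(1) hc]) (use L2_integrable[OF L] in \<open>simp_all add: h_def\<close>)
    finally show ?thesis .
  qed
  have aux: "x \<le> 2 * B + 2 * w * E" if "x \<le> 2 * b + 2 * w * e" "0 < w" "e \<le> E" "b \<le> B" for x b w e
    using mult_left_mono[OF that(3), of w] that by linarith
  have aux2: "x \<le> w * (2 * B + 2 * w * E)" if "x \<le> w * (2 * b + 2 * w * e)" "0 < w" "e \<le> E" "b \<le> B" for x b w e
    by (rule order_trans[OF that(1) mult_left_mono[OF aux[OF order_refl that(2-4)]]]) (use that in simp)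
  have c1: "continuous_on UNIV (\<lambda>(s, t). \<psi> (s, t))" "continuous_on UNIV (\<lambda>(s, t). snd (d\<psi> (s, t)))"
    unfolding case_prod_unfold prod.collapse by (intro continuous_intros \<psi>c d\<psi>c)+
  have c2: "continuous_on UNIV (\<lambda>(s, t). \<psi> (t, s))" "continuous_on UNIV (\<lambda>(s, t). fst (d\<psi> (t, s)))"
    unfolding case_prod_unfold
    by (intro continuous_intros continuous_on_compose2[OF \<psi>c[of UNIV]] continuous_on_compose2[OF d\<psi>c[of UNIV]]; simp)+
  have rR: "r1 \<le> R1" "r2 \<le> R2" using R by auto
  {
    assume c: "r2 \<le> c" "c < R2"
    have b: "box (-R1, c) (R1, R2) \<subseteq> \<Omega>"
    proof
      fix z assume "z \<in> box (-R1, c) (R1, R2)"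
      then show "z \<in> \<Omega>" using c R r by (cases z) (auto simp: mem_box Basis_prod_def mem abs_less_iff)
    qed
    note S = strip_bounds[OF c(2) rR(1) c1 GDERIV_partial_snd[OF \<psi>(2)],
        unfolded iterated_integral_continuous(1)[OF sc] iterated_integral_continuous(1)[OF kc[unfolded k_def]]]
    show "integral {-r1..r1} (\<lambda>t. (\<psi> (t, c))^2) \<le> 2 * B + 2 * (R2 - c) * E"
      by (rule aux[OF S(1) _ hbox[OF b hle(2) sc] B1(1)[unfolded k_def]]) (use c in auto)
    show "integral (cbox (-R1, c) (R1, R2)) (\<lambda>z. (\<psi> z)^2) \<le> (R2 - c) * (2 * B + 2 * (R2 - c) * E)"
      by (rule aux2[OF S(2) _ hbox[OF b hle(2) sc] B1(1)[unfolded k_def]]) (use c in auto)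
  }
  assume c: "r1 \<le> c" "c < R1"
  have b: "box (c, -R2) (R1, R2) \<subseteq> \<Omega>"
  proof
    fix z assume "z \<in> box (c, -R2) (R1, R2)"
    then show "z \<in> \<Omega>" using c R r by (cases z) (auto simp: mem_box Basis_prod_def mem abs_less_iff)
  qed
  note S = strip_bounds[OF c(2) rR(2) c2 GDERIV_partial_fst[OF \<psi>(2)],
      unfolded iterated_integral_continuous(2)[OF fc] iterated_integral_continuous(2)[OF kc[unfolded k_def]]]
  show "integral {-r2..r2} (\<lambda>t. (\<psi> (c, t))^2) \<le> 2 * B + 2 * (R1 - c) * E"
    by (rule aux[OF S(1) _ hbox[OF b hle(1) fc] B1(2)[unfolded k_def]]) (use c in auto)
  show "integral (cbox (c, -R2) (R1, R2)) (\<lambda>z. (\<psi> z)^2) \<le> (R1 - c) * (2 * B + 2 * (R1 - c) * E)"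
    by (rule aux2[OF S(2) _ hbox[OF b hle(1) fc] B1(2)[unfolded k_def]]) (use c in auto)
qed

end

text \<open>The energy and the outer trace control everything else: four strips, each reaching from
  an outer side to the line of an inner side, cover the annulus. Here \<rho> exceeds the width of
  each strip.\<close>

lemma annulus_energy_bounds:
  assumes r: "0 < r1" "0 < r2" "1 < lam"
    and \<psi>: "smooth \<psi>" "\<And>z. GDERIV \<psi> z :> d\<psi> z"
    and L: "L2 (lebesgue_on (annulus r1 r2 lam)) \<psi>" "L2 (lebesgue_on (annulus r1 r2 lam)) d\<psi>"
  defines "\<rho> \<equiv> lam * r1 + lam * r2"
  defines "B \<equiv> (\<integral>z. (\<psi> z)^2 \<partial>bdry_measure (lam * r1) (lam * r2))"
    and "E \<equiv> (\<integral>z. (norm (d\<psi> z))^2 \<partial>lebesgue_on (annulus r1 r2 lam))"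
  shows "(\<integral>z. (\<psi> z)^2 \<partial>bdry_measure r1 r2) \<le> 8 * B + 8 * \<rho> * E"
    "(\<integral>z. (\<psi> z)^2 \<partial>lebesgue_on (annulus r1 r2 lam)) \<le> \<rho> * (8 * B + 8 * \<rho> * E)"
proof -
  interpret annulus_geometry r1 r2 lam using r by unfold_locales
  have B: "B = (\<integral>z. (\<psi> z)^2 \<partial>bdry_measure R1 R2)" by (simp add: B_def R1_def R2_def)
  have \<rho>: "R2 - r2 \<le> \<rho>" "R1 - r1 \<le> \<rho>" "0 < \<rho>" using r R by (auto simp: \<rho>_def simp flip: R1_def R2_def)
  define k where "k = (\<lambda>z. (\<psi> z)^2)"
  have \<psi>c: "continuous_on S \<psi>" and kc: "continuous_on S k" for S
    unfolding k_def by (intro continuous_intros smooth_imp_continuous[OF \<psi>(1)])+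
  have E0: "0 \<le> E" unfolding E_def by (rule integral_nonneg_AE) simp
  have B0: "0 \<le> B" unfolding B_def by (rule integral_nonneg_AE) simp
  have aux: "x \<le> 2 * B + 2 * \<rho> * E" if "x \<le> 2 * B + 2 * w * E" "w \<le> \<rho>" for x w
    using mult_right_mono[OF that(2) E0] that by linarith
  have aux2: "x \<le> \<rho> * (2 * B + 2 * \<rho> * E)" if "x \<le> w * (2 * B + 2 * w * E)" "0 < w" "w \<le> \<rho>" for x w
  proof (rule order_trans[OF that(1) mult_mono[OF that(3) aux[OF order_refl that(3)]]])
    show "0 \<le> 2 * B + 2 * w * E" using B0 E0 that by simp
  qed (use \<rho> in simp)
  have half: "integral {-r1..r1} (\<lambda>t. (\<eta> (t, r2))^2) \<le> 2 * B + 2 * \<rho> * E"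
      "integral (cbox (-R1, r2) (R1, R2)) (\<lambda>z. (\<eta> z)^2) \<le> \<rho> * (2 * B + 2 * \<rho> * E)"
      "integral {-r2..r2} (\<lambda>t. (\<eta> (r1, t))^2) \<le> 2 * B + 2 * \<rho> * E"
      "integral (cbox (r1, -R2) (R1, R2)) (\<lambda>z. (\<eta> z)^2) \<le> \<rho> * (2 * B + 2 * \<rho> * E)"
    if \<eta>: "smooth \<eta>" "\<And>z. GDERIV \<eta> z :> d\<eta> z" "L2 (lebesgue_on \<Omega>) d\<eta>"
      and eq: "(\<integral>z. (\<eta> z)^2 \<partial>bdry_measure R1 R2) = B" "(\<integral>z. (norm (d\<eta> z))^2 \<partial>lebesgue_on \<Omega>) = E" for \<eta> d\<eta>
  proof -
    note S = outer_strip_bounds[OF \<eta>, unfolded eq]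
    have w: "0 < R1 - r1" "0 < R2 - r2" using R by auto
    show "integral {-r1..r1} (\<lambda>t. (\<eta> (t, r2))^2) \<le> 2 * B + 2 * \<rho> * E"
      by (rule aux[OF S(1)[OF order_refl R(2)] \<rho>(1)])
    show "integral (cbox (-R1, r2) (R1, R2)) (\<lambda>z. (\<eta> z)^2) \<le> \<rho> * (2 * B + 2 * \<rho> * E)"
      by (rule aux2[OF S(2)[OF order_refl R(2)] w(2) \<rho>(1)])
    show "integral {-r2..r2} (\<lambda>t. (\<eta> (r1, t))^2) \<le> 2 * B + 2 * \<rho> * E"
      by (rule aux[OF S(3)[OF order_refl R(1)] \<rho>(2)])
    show "integral (cbox (r1, -R2) (R1, R2)) (\<lambda>z. (\<eta> z)^2) \<le> \<rho> * (2 * B + 2 * \<rho> * E)"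
      by (rule aux2[OF S(4)[OF order_refl R(1)] w(1) \<rho>(2)])
  qed
  note H = half[OF \<psi> L(2) B[symmetric] E_def[THEN meta_eq_to_obj_eq, symmetric]]
  \<comment> \<open>The bounds for the bottom and left strips are those for the top and right strips
    of the point-reflected function.\<close>
  have m: "mirror (- 1) (- 1) z = - z" for z by (simp add: mirror_def prod_eq_iff)
  have st: "\<bar>- 1 :: real\<bar> = 1" by simp
  have inv: "mirror (- 1) (- 1) z \<in> \<Omega> \<longleftrightarrow> z \<in> \<Omega>" for z by (rule mirror_annulus[OF r st st])
  note T = mirror_lebesgue_on[OF st st Ls inv]
  have Bm: "(\<integral>z. (\<psi> (mirror (- 1) (- 1) z))^2 \<partial>bdry_measure R1 R2) = B"
    unfolding B
  proof (rule integral_measure_preserving[OF mirror_bdry_measure[OF st st]])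
    show "(\<lambda>z. (\<psi> z)^2) \<in> borel_measurable (bdry_measure R1 R2)"
      using integral_bdry_measure_continuous(1)[OF kc] unfolding k_def by blast
  qed
  have "(\<integral>z. (norm (d\<psi> (mirror (- 1) (- 1) z)))^2 \<partial>lebesgue_on \<Omega>) = E"
    unfolding E_def by (rule integral_measure_preserving[OF T borel_measurable_integrable[OF L2_integrable[OF L(2)]]])
  then have Em: "(\<integral>z. (norm (mirror (- 1) (- 1) (d\<psi> (mirror (- 1) (- 1) z))))^2 \<partial>lebesgue_on \<Omega>) = E"
    by (simp add: m)
  note H' = half[OF smooth_mirror[OF \<psi>(1)] GDERIV_mirror[OF \<psi>(2)]
      L2_mirror_vector[OF st st L2_measure_preserving[OF T L(2)]] Bm Em]
  have I: "integral {-r1..r1} (\<lambda>t. k (t, - r2)) \<le> 2 * B + 2 * \<rho> * E"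
    "integral {-r2..r2} (\<lambda>t. k (- r1, t)) \<le> 2 * B + 2 * \<rho> * E"
    "integral (cbox (-R1, -R2) (R1, -r2)) k \<le> \<rho> * (2 * B + 2 * \<rho> * E)"
    "integral (cbox (-R1, -R2) (-r1, R2)) k \<le> \<rho> * (2 * B + 2 * \<rho> * E)"
    using H' integral_reflect[of "(R1, -r2)" "(-R1, -R2)" k] integral_reflect[of "(-r1, R2)" "(-R1, -R2)" k]
      Henstock_Kurzweil_Integration.integral_reflect_real[of r1 "-r1" "\<lambda>t. k (t, - r2)"]
      Henstock_Kurzweil_Integration.integral_reflect_real[of r2 "-r2" "\<lambda>t. k (- r1, t)"]
    unfolding m k_def by simp_all
  have "(\<integral>z. (\<psi> z)^2 \<partial>bdry_measure r1 r2) = integral {-r1..r1} (\<lambda>t. k (t, r2)) + integral {-r1..r1} (\<lambda>t. k (t, - r2))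
       + integral {-r2..r2} (\<lambda>t. k (r1, t)) + integral {-r2..r2} (\<lambda>t. k (- r1, t))"
    using integral_bdry_measure_continuous(2)[OF kc] by (simp add: k_def)
  then show "(\<integral>z. (\<psi> z)^2 \<partial>bdry_measure r1 r2) \<le> 8 * B + 8 * \<rho> * E"
    using H(1,3)[folded k_def] I(1,2) unfolding k_def by linarith
  \<comment> \<open>Corners of the top, bottom, right and left strip. They overlap in the corner
    regions, which is harmless for an upper bound on a nonnegative integrand.\<close>
  define p where "p = (\<lambda>i::nat. [(-R1, r2), (-R1, -R2), (r1, -R2), (-R1, -R2)] ! i)"
  define q where "q = (\<lambda>i::nat. [(R1, R2), (R1, -r2), (R1, R2), (-r1, R2)] ! i)"
  have I4: "{..<4} = {0, 1, 2, 3::nat}" by auto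
  have "(\<integral>z. k z \<partial>lebesgue_on \<Omega>) \<le> (\<Sum>i\<in>{..<4}. integral (cbox (p i) (q i)) k)"
  proof (rule lebesgue_integral_le_sum_cbox[OF Ls _ _ kc])
    show "\<Omega> \<subseteq> (\<Union>i\<in>{..<4}. cbox (p i) (q i))"
      unfolding I4 by (rule subrelI) (auto simp: p_def q_def cbox_Pair_eq mem)
    show "integrable (lebesgue_on \<Omega>) k" using L2_integrable[OF L(1)] by (simp add: k_def)
  qed (auto simp: k_def)
  also have "... = integral (cbox (-R1, r2) (R1, R2)) k + integral (cbox (-R1, -R2) (R1, -r2)) k
      + integral (cbox (r1, -R2) (R1, R2)) k + integral (cbox (-R1, -R2) (-r1, R2)) k"
    unfolding I4 by (simp add: p_def q_def numeral_2_eq_2 numeral_3_eq_3)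
  also have "... \<le> \<rho> * (2 * B + 2 * \<rho> * E) + \<rho> * (2 * B + 2 * \<rho> * E) + \<rho> * (2 * B + 2 * \<rho> * E) + \<rho> * (2 * B + 2 * \<rho> * E)"
    using H(2,4) I(3,4) unfolding k_def by (intro add_mono)
  also have "... = \<rho> * (8 * B + 8 * \<rho> * E)" by (simp add: algebra_simps)
  finally show "(\<integral>z. (\<psi> z)^2 \<partial>lebesgue_on \<Omega>) \<le> \<rho> * (8 * B + 8 * \<rho> * E)" by (simp add: k_def)
qed

section \<open>Inner trace, uniqueness and reflection invariance of weak solutions\<close>

lemma L2_tendsto_Cauchy:
  assumes F: "L2_tendsto M F f" and "0 < e"
  shows "\<exists>N. \<forall>m\<ge>N. \<forall>n\<ge>N. (\<integral>x. (norm (F m x - F n x))^2 \<partial>M) \<le> e"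
proof -
  have L: "L2 M (F n)" "L2 M f" for n using F by (auto simp: L2_tendsto_def)
  have "(\<lambda>n. \<integral>x. (norm (F n x - f x))^2 \<partial>M) \<longlonglongrightarrow> 0" using F by (simp add: L2_tendsto_def)
  then have "eventually (\<lambda>n. (\<integral>x. (norm (F n x - f x))^2 \<partial>M) < e / 4) sequentially"
    by (rule order_tendstoD(2)) (use \<open>0 < e\<close> in simp)
  then obtain N where N: "\<And>n. N \<le> n \<Longrightarrow> (\<integral>x. (norm (F n x - f x))^2 \<partial>M) < e / 4"
    by (auto simp: eventually_sequentially)
  have "(\<integral>x. (norm (F m x - F n x))^2 \<partial>M) \<le> e" if "N \<le> m" "N \<le> n" for m n
  proof -
    have "(\<integral>x. (norm (F m x - F n x))^2 \<partial>M) \<le> (\<integral>x. 2 * (norm (F m x - f x))^2 + 2 * (norm (F n x - f x))^2 \<partial>M)"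
    proof (rule integral_mono)
      show "integrable M (\<lambda>x. (norm (F m x - F n x))^2)" by (rule L2_integrable[OF L2_diff[OF L(1) L(1)]])
      show "integrable M (\<lambda>x. 2 * (norm (F m x - f x))^2 + 2 * (norm (F n x - f x))^2)"
        using L2_integrable[OF L2_diff[OF L]] by simp
      show "(norm (F m x - F n x))^2 \<le> 2 * (norm (F m x - f x))^2 + 2 * (norm (F n x - f x))^2" for x
        using norm_diff_square_le[of "F m x - f x" "F n x - f x"] by simp
    qed
    also have "... = 2 * (\<integral>x. (norm (F m x - f x))^2 \<partial>M) + 2 * (\<integral>x. (norm (F n x - f x))^2 \<partial>M)"
      using L2_integrable[OF L2_diff[OF L]] by simp
    finally show ?thesis using N[OF that(1)] N[OF that(2)] by simp
  qed
  then show ?thesis by blast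
qed

lemma L2_bdry_measure_continuous:
  fixes f :: "real \<times> real \<Rightarrow> real"
  assumes "continuous_on UNIV f"
  shows "L2 (bdry_measure r1 r2) f"
  unfolding L2_def
proof
  have "f \<in> borel_measurable borel" by (rule borel_measurable_continuous_onI[OF assms])
  then show "f \<in> borel_measurable (bdry_measure r1 r2)"
    using measurable_cong_sets[OF sets_bdry_measure refl] by blast
  have "continuous_on UNIV (\<lambda>x. (norm (f x))^2)" by (intro continuous_intros assms)
  then show "integrable (bdry_measure r1 r2) (\<lambda>x. (norm (f x))^2)"
    by (rule integral_bdry_measure_continuous(1))
qed

text \<open>The weak equation tests only with functions that possess an inner trace. For functions
  with zero outer trace it exists: by \<open>annulus_energy_bounds\<close> applied to differences,
  the approximating sequence is Cauchy on the inner boundary as well.\<close>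

lemma inner_trace_exists:
  assumes r: "0 < r1" "0 < r2" "1 < lam"
    and u: "has_trace (annulus r1 r2 lam) (bdry_measure (lam * r1) (lam * r2)) u (\<lambda>_. 0)"
  obtains \<tau> where "has_trace (annulus r1 r2 lam) (bdry_measure r1 r2) u \<tau>"
proof -
  let ?W = "annulus r1 r2 lam"
  define \<rho> where "\<rho> = lam * r1 + lam * r2"
  have \<rho>: "0 < \<rho>" using r by (simp add: \<rho>_def add_pos_pos)
  obtain g \<psi> d\<psi> where 1: "H1 ?W u g" "\<And>n. smooth (\<psi> n)" "\<And>n x. GDERIV (\<psi> n) x :> d\<psi> n x"
    "L2_tendsto (lebesgue_on ?W) \<psi> u" "L2_tendsto (lebesgue_on ?W) d\<psi> g"
    "L2_tendsto (bdry_measure (lam * r1) (lam * r2)) \<psi> (\<lambda>_. 0)"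
    using u unfolding has_trace_def by blast
  have L: "L2 (lebesgue_on ?W) (\<psi> n)" "L2 (lebesgue_on ?W) (d\<psi> n)" for n
    using 1 by (auto simp: L2_tendsto_def)
  obtain \<tau> where "L2_tendsto (bdry_measure r1 r2) \<psi> \<tau>"
  proof (rule L2_complete[OF finite_measure_bdry, of r1 r2 \<psi>])
    show "L2 (bdry_measure r1 r2) (\<psi> n)" for n
      by (rule L2_bdry_measure_continuous[OF smooth_imp_continuous[OF 1(2)]])
    fix e :: real assume e: "0 < e"
    obtain N1 where N1: "\<And>m n. N1 \<le> m \<Longrightarrow> N1 \<le> n \<Longrightarrow>
        (\<integral>x. (norm (\<psi> m x - \<psi> n x))^2 \<partial>bdry_measure (lam * r1) (lam * r2)) \<le> e / 16"
      using L2_tendsto_Cauchy[OF 1(6), of "e / 16"] e by auto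
    obtain N2 where N2: "\<And>m n. N2 \<le> m \<Longrightarrow> N2 \<le> n \<Longrightarrow>
        (\<integral>x. (norm (d\<psi> m x - d\<psi> n x))^2 \<partial>lebesgue_on ?W) \<le> e / (16 * \<rho>)"
      using L2_tendsto_Cauchy[OF 1(5), of "e / (16 * \<rho>)"] e \<rho> by auto
    show "\<exists>N. \<forall>m\<ge>N. \<forall>n\<ge>N. (\<integral>x. (\<psi> m x - \<psi> n x)^2 \<partial>bdry_measure r1 r2) \<le> e"
    proof (intro exI allI impI)
      fix m n assume mn: "max N1 N2 \<le> m" "max N1 N2 \<le> n"
      have "(\<integral>x. (\<psi> m x - \<psi> n x)^2 \<partial>bdry_measure r1 r2)
         \<le> 8 * (\<integral>x. (\<psi> m x - \<psi> n x)^2 \<partial>bdry_measure (lam * r1) (lam * r2))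
           + 8 * \<rho> * (\<integral>x. (norm (d\<psi> m x - d\<psi> n x))^2 \<partial>lebesgue_on ?W)"
        unfolding \<rho>_def
        by (rule annulus_energy_bounds(1)[OF r smooth_diff[OF 1(2) 1(2)] GDERIV_diff[OF 1(3) 1(3)]
            L2_diff[OF L(1) L(1)] L2_diff[OF L(2) L(2)]])
      also have "... \<le> 8 * (e / 16) + 8 * \<rho> * (e / (16 * \<rho>))"
        using N1[of m n] N2[of m n] mn \<rho> by (intro add_mono mult_left_mono) auto
      also have "... = e" using \<rho> by simp
      finally show "(\<integral>x. (\<psi> m x - \<psi> n x)^2 \<partial>bdry_measure r1 r2) \<le> e" .
    qed
  qed
  then have "has_trace ?W (bdry_measure r1 r2) u \<tau>"
    unfolding has_trace_def using 1(1-5) by blast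
  then show ?thesis by (rule that)
qed

text \<open>The Poincare bound of \<open>annulus_energy_bounds\<close>, passed to the limit along
  the sequence that realises the zero trace; both terms on its right tend to 0.\<close>

lemma zero_of_zero_gradient_zero_trace:
  assumes r: "0 < r1" "0 < r2" "1 < lam"
    and w: "has_trace (annulus r1 r2 lam) (bdry_measure (lam * r1) (lam * r2)) w (\<lambda>_. 0)"
    and h: "H1 (annulus r1 r2 lam) w h" "AE x in lebesgue_on (annulus r1 r2 lam). h x = 0"
  shows "AE x in lebesgue_on (annulus r1 r2 lam). w x = 0"
proof -
  let ?W = "annulus r1 r2 lam"
  define \<rho> where "\<rho> = lam * r1 + lam * r2"
  have op: "open ?W" using r by (intro open_annulus) simp
  obtain g \<psi> d\<psi> where 1: "H1 ?W w g" "\<And>n. smooth (\<psi> n)" "\<And>n x. GDERIV (\<psi> n) x :> d\<psi> n x"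
    "L2_tendsto (lebesgue_on ?W) \<psi> w" "L2_tendsto (lebesgue_on ?W) d\<psi> g"
    "L2_tendsto (bdry_measure (lam * r1) (lam * r2)) \<psi> (\<lambda>_. 0)"
    using w unfolding has_trace_def by blast
  have L: "L2 (lebesgue_on ?W) (\<psi> n)" "L2 (lebesgue_on ?W) (d\<psi> n)" "L2 (lebesgue_on ?W) w" for n
    using 1 by (auto simp: L2_tendsto_def)
  have "AE x in lebesgue_on ?W. g x = h x"
    by (rule weak_gradient_unique[OF op bounded_annulus 1(1) h(1)]) simp
  with h(2) have "AE x in lebesgue_on ?W. (norm (g x))^2 = 0" by eventually_elim simp
  then have g0: "(\<integral>x. (norm (g x))^2 \<partial>lebesgue_on ?W) = 0" by (rule integral_eq_zero_AE)
  have "(\<lambda>n. \<rho> * (8 * (\<integral>x. (norm (\<psi> n x))^2 \<partial>bdry_measure (lam * r1) (lam * r2))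
        + 8 * \<rho> * (\<integral>x. (norm (d\<psi> n x))^2 \<partial>lebesgue_on ?W)))
     \<longlonglongrightarrow> \<rho> * (8 * (\<integral>x. (norm (0::real))^2 \<partial>bdry_measure (lam * r1) (lam * r2)) + 8 * \<rho> * (\<integral>x. (norm (g x))^2 \<partial>lebesgue_on ?W))"
    by (intro tendsto_intros L2_tendsto_norm[OF 1(6)] L2_tendsto_norm[OF 1(5)])
  then have lim: "(\<lambda>n. \<rho> * (8 * (\<integral>x. (norm (\<psi> n x))^2 \<partial>bdry_measure (lam * r1) (lam * r2))
        + 8 * \<rho> * (\<integral>x. (norm (d\<psi> n x))^2 \<partial>lebesgue_on ?W))) \<longlonglongrightarrow> 0"
    by (simp add: g0)
  have le: "(\<integral>x. (norm (\<psi> n x))^2 \<partial>lebesgue_on ?W) \<le> \<rho> * (8 * (\<integral>x. (norm (\<psi> n x))^2 \<partial>bdry_measure (lam * r1) (lam * r2))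
        + 8 * \<rho> * (\<integral>x. (norm (d\<psi> n x))^2 \<partial>lebesgue_on ?W))" for n
    using annulus_energy_bounds(2)[OF r 1(2) 1(3) L(1) L(2), of n] by (simp add: \<rho>_def)
  have "(\<integral>x. (norm (w x))^2 \<partial>lebesgue_on ?W) \<le> 0"
    by (rule LIMSEQ_le[OF L2_tendsto_norm[OF 1(4)] lim]) (use le in blast)
  moreover have "0 \<le> (\<integral>x. (norm (w x))^2 \<partial>lebesgue_on ?W)" by (rule integral_nonneg_AE) simp
  ultimately have "(\<integral>x. (norm (w x))^2 \<partial>lebesgue_on ?W) = 0" by (rule antisym)
  then have "AE x in lebesgue_on ?W. (norm (w x))^2 = 0"
    using integral_nonneg_eq_0_iff_AE[OF L2_integrable[OF L(3)]] by simp
  then show ?thesis by eventually_elim simp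
qed

text \<open>The difference of two solutions is an admissible test function, because its inner trace
  exists. Testing both equations with it shows that its gradient has norm zero.\<close>

lemma weak_solution_unique:
  assumes r: "0 < r1" "0 < r2" "1 < lam"
    and u: "weak_solution r1 r2 lam a b u" and u': "weak_solution r1 r2 lam a b u'"
  shows "AE x in lebesgue_on (annulus r1 r2 lam). u x = u' x"
proof -
  let ?W = "annulus r1 r2 lam" and ?out = "bdry_measure (lam * r1) (lam * r2)" and ?in = "bdry_measure r1 r2"
  have op: "open ?W" using r by (intro open_annulus) simp
  obtain g where g: "H1 ?W u g" "\<And>\<phi> h \<tau>. H1 ?W \<phi> h \<Longrightarrow> has_trace ?W ?out \<phi> (\<lambda>_. 0) \<Longrightarrow> has_trace ?W ?in \<phi> \<tau> \<Longrightarrow>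
      (\<integral>z. g z \<bullet> h z \<partial>lebesgue_on ?W) = (\<integral>z. flux r2 a b z * \<tau> z \<partial>?in)"
    using u unfolding weak_solution_def by blast
  obtain g' where g': "H1 ?W u' g'" "\<And>\<phi> h \<tau>. H1 ?W \<phi> h \<Longrightarrow> has_trace ?W ?out \<phi> (\<lambda>_. 0) \<Longrightarrow> has_trace ?W ?in \<phi> \<tau> \<Longrightarrow>
      (\<integral>z. g' z \<bullet> h z \<partial>lebesgue_on ?W) = (\<integral>z. flux r2 a b z * \<tau> z \<partial>?in)"
    using u' unfolding weak_solution_def by blast
  have T: "has_trace ?W ?out u (\<lambda>_. 0)" "has_trace ?W ?out u' (\<lambda>_. 0)"
    using u u' unfolding weak_solution_def by blast+
  define w h where "w = (\<lambda>x. u x - u' x)" and "h = (\<lambda>x. g x - g' x)"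
  have w: "H1 ?W w h" unfolding w_def h_def by (rule H1_diff[OF op g(1) g'(1)])
  have wt: "has_trace ?W ?out w (\<lambda>_. 0)" using has_trace_diff[OF op T] by (simp add: w_def)
  obtain \<tau> where \<tau>: "has_trace ?W ?in w \<tau>" using inner_trace_exists[OF r wt] .
  have L: "L2 (lebesgue_on ?W) g" "L2 (lebesgue_on ?W) g'" "L2 (lebesgue_on ?W) h"
    using g(1) g'(1) w by (auto simp: H1_def)
  have "(\<integral>z. (norm (h z))^2 \<partial>lebesgue_on ?W) = (\<integral>z. g z \<bullet> h z - g' z \<bullet> h z \<partial>lebesgue_on ?W)"
    by (simp add: power2_norm_eq_inner h_def inner_diff_left)
  also have "... = (\<integral>z. g z \<bullet> h z \<partial>lebesgue_on ?W) - (\<integral>z. g' z \<bullet> h z \<partial>lebesgue_on ?W)"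
    by (rule Bochner_Integration.integral_diff[OF L2_inner_integrable[OF L(1) L(3)] L2_inner_integrable[OF L(2) L(3)]])
  also have "... = 0" by (simp add: g(2)[OF w wt \<tau>] g'(2)[OF w wt \<tau>])
  finally have "AE x in lebesgue_on ?W. (norm (h x))^2 = 0"
    using integral_nonneg_eq_0_iff_AE[OF L2_integrable[OF L(3)]] by simp
  then have "AE x in lebesgue_on ?W. h x = 0" by eventually_elim simp
  from zero_of_zero_gradient_zero_trace[OF r wt w this] show ?thesis
    by eventually_elim (simp add: w_def)
qed

text \<open>A change of variables moves the reflection to the test function; the boundary data
  depend on |x_2| only and are therefore invariant.\<close>

lemma weak_solution_mirror:
  assumes r: "0 < r1" "0 < r2" "1 < lam" and st: "\<bar>s\<bar> = 1" "\<bar>t\<bar> = 1"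
    and u: "weak_solution r1 r2 lam a b u"
  shows "weak_solution r1 r2 lam a b (\<lambda>z. u (mirror s t z))"
proof -
  let ?W = "annulus r1 r2 lam" and ?out = "bdry_measure (lam * r1) (lam * r2)" and ?in = "bdry_measure r1 r2"
  let ?T = "mirror s t"
  have op: "open ?W" using r by (intro open_annulus) simp
  have Ls: "?W \<in> sets lebesgue" using op by auto
  have inv: "?T z \<in> ?W \<longleftrightarrow> z \<in> ?W" for z by (rule mirror_annulus[OF r st])
  note M = mirror_lebesgue_on[OF st Ls inv]
  obtain g where g: "H1 ?W u g" "\<And>\<phi> h \<tau>. H1 ?W \<phi> h \<Longrightarrow> has_trace ?W ?out \<phi> (\<lambda>_. 0) \<Longrightarrow> has_trace ?W ?in \<phi> \<tau> \<Longrightarrow>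
      (\<integral>z. g z \<bullet> h z \<partial>lebesgue_on ?W) = (\<integral>z. flux r2 a b z * \<tau> z \<partial>?in)"
    using u unfolding weak_solution_def by blast
  have T: "has_trace ?W ?out u (\<lambda>_. 0)" using u unfolding weak_solution_def by blast
  have key: "(\<integral>z. ?T (g (?T z)) \<bullet> h z \<partial>lebesgue_on ?W) = (\<integral>z. flux r2 a b z * \<tau> z \<partial>?in)"
    if \<phi>: "H1 ?W \<phi> h" "has_trace ?W ?out \<phi> (\<lambda>_. 0)" "has_trace ?W ?in \<phi> \<tau>" for \<phi> h \<tau>
  proof -
    have L: "L2 (lebesgue_on ?W) g" "L2 (lebesgue_on ?W) h" using g(1) \<phi>(1) by (auto simp: H1_def)
    have Th: "L2 (lebesgue_on ?W) (\<lambda>z. ?T (h (?T z)))"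
      by (rule L2_mirror_vector[OF st L2_measure_preserving[OF M L(2)]])
    have "(\<integral>z. ?T (g (?T z)) \<bullet> h z \<partial>lebesgue_on ?W) = (\<integral>z. g (?T z) \<bullet> ?T (h (?T (?T z))) \<partial>lebesgue_on ?W)"
      by (simp add: mirror_mirror[OF st] mirror_inner)
    also have "... = (\<integral>z. g z \<bullet> ?T (h (?T z)) \<partial>lebesgue_on ?W)"
      using L2_measurable[OF L(1)] L2_measurable[OF Th]
      by (intro integral_measure_preserving[OF M, of "\<lambda>z. g z \<bullet> ?T (h (?T z))"]) measurable
    also have "... = (\<integral>z. flux r2 a b z * \<tau> (?T z) \<partial>?in)"
    proof (rule g(2))
      show "H1 ?W (\<lambda>z. \<phi> (?T z)) (\<lambda>z. ?T (h (?T z)))" by (rule H1_mirror[OF st op inv \<phi>(1)])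
      show "has_trace ?W ?out (\<lambda>z. \<phi> (?T z)) (\<lambda>_. 0)"
        using has_trace_mirror[OF st op inv mirror_bdry_measure[OF st] \<phi>(2)] by simp
      show "has_trace ?W ?in (\<lambda>z. \<phi> (?T z)) (\<lambda>z. \<tau> (?T z))"
        by (rule has_trace_mirror[OF st op inv mirror_bdry_measure[OF st] \<phi>(3)])
    qed
    also have "... = (\<integral>z. flux r2 a b (?T z) * \<tau> (?T z) \<partial>?in)"
      using st by (simp add: flux_def mirror_def abs_mult)
    also have "... = (\<integral>z. flux r2 a b z * \<tau> z \<partial>?in)"
    proof (rule integral_measure_preserving[OF mirror_bdry_measure[OF st], of "\<lambda>z. flux r2 a b z * \<tau> z"])
      have "L2 ?in \<tau>" using \<phi>(3) unfolding has_trace_def L2_tendsto_def by blast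
      then have m1: "\<tau> \<in> borel_measurable ?in" by (rule L2_measurable)
      have "closed {z::real \<times> real. \<bar>snd z\<bar> = r2}"
        by (intro closed_Collect_eq continuous_intros)
      then have "{z::real \<times> real. \<bar>snd z\<bar> = r2} \<in> sets borel" by (rule borel_closed)
      then have "flux r2 a b \<in> borel_measurable borel"
        unfolding flux_def[abs_def] by (intro measurable_If) auto
      then have m2: "flux r2 a b \<in> borel_measurable ?in"
        using measurable_cong_sets[OF sets_bdry_measure refl] by blast
      show "(\<lambda>z. flux r2 a b z * \<tau> z) \<in> borel_measurable ?in" using m2 m1 by (rule borel_measurable_times)
    qed
    finally show ?thesis .
  qed
  show ?thesis
    unfolding weak_solution_def
  proof (intro conjI exI allI impI)
    show "has_trace ?W ?out (\<lambda>z. u (?T z)) (\<lambda>_. 0)"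
      using has_trace_mirror[OF st op inv mirror_bdry_measure[OF st] T] by simp
    show "H1 ?W (\<lambda>z. u (?T z)) (\<lambda>z. ?T (g (?T z)))" by (rule H1_mirror[OF st op inv g(1)])
  qed (use key in blast)
qed

subsection \<open>The weak equation in classical form\<close>

text \<open>The weak form of m' = n. With N a primitive of n, the function m - N is orthogonal to
  derivatives of test functions; if it took different values at x0 and x1, a test function that
  rises near x0 and falls near x1 would detect this.\<close>

lemma du_Bois_Reymond:
  fixes m n :: "real \<Rightarrow> real"
  assumes m: "continuous_on {l<..<u} m" and n: "continuous_on {l<..<u} n"
    and weak: "\<And>A A' p q. l < p \<Longrightarrow> p < q \<Longrightarrow> q < u \<Longrightarrow> smooth A \<Longrightarrow>
      (\<And>x. (A has_real_derivative A' x) (at x)) \<Longrightarrow> (\<And>x. x \<le> p \<or> q \<le> x \<Longrightarrow> A x = 0) \<Longrightarrow>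
      integral {p..q} (\<lambda>x. m x * A' x + n x * A x) = 0"
    and x: "l < x0" "x0 < x1" "x1 < u"
  shows "m x1 - m x0 = integral {x0..x1} n"
proof (rule ccontr)
  assume neq: "m x1 - m x0 \<noteq> integral {x0..x1} n"
  define l' u' where "l' = (l + x0) / 2" and "u' = (x1 + u) / 2"
  have lu: "l < l'" "l' < x0" "x1 < u'" "u' < u" using x by (auto simp: l'_def u'_def)
  have nc: "continuous_on {l'..u'} n" by (rule continuous_on_subset[OF n]) (use lu in auto)
  define N where "N = (\<lambda>x. integral {l'..x} n)"
  have N': "(N has_real_derivative n x) (at x)" if "l' < x" "x < u'" for x
  proof -
    have "(N has_real_derivative n x) (at x within {l'..u'})"
      unfolding N_def by (rule integral_has_real_derivative[OF nc]) (use that in auto)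
    then show ?thesis using that by (simp add: at_within_Icc_at)
  qed
  have Nc: "continuous_on {l'<..<u'} N"
    by (intro continuous_at_imp_continuous_on ballI DERIV_isCont[OF N']) auto
  have N01: "N x1 - N x0 = integral {x0..x1} n"
  proof -
    have "integral {l'..x0} n + integral {x0..x1} n = integral {l'..x1} n"
      using lu x by (intro Henstock_Kurzweil_Integration.integral_combine integrable_continuous_real continuous_on_subset[OF nc]) auto
    then show ?thesis by (simp add: N_def)
  qed
  define k where "k = (\<lambda>x. m x - N x)"
  have kc: "continuous_on {l'<..<u'} k"
    unfolding k_def using lu by (intro continuous_intros Nc continuous_on_subset[OF m]) auto
  \<comment> \<open>The two values are compared along simultaneous shifts. By continuity D keeps its
    sign on a small interval, so its integral against a bump cannot vanish.\<close>
  define D where "D = (\<lambda>t. k (x0 + t) - k (x1 + t))"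
  have D0: "D 0 \<noteq> 0" using neq N01 by (simp add: D_def k_def)
  define e1 where "e1 = Min {x0 - l', u' - x1}"
  have e1: "0 < e1" "e1 \<le> x0 - l'" "e1 \<le> u' - x1" using lu by (auto simp: e1_def)
  have Dc: "continuous_on {-e1<..<e1} D"
    unfolding D_def using e1 x by (intro continuous_intros continuous_on_compose2[OF kc]) auto
  then have "isCont D 0" using e1 by (simp add: continuous_on_eq_continuous_at)
  then have "eventually (\<lambda>t. dist (D t) (D 0) < \<bar>D 0\<bar> / 2) (at 0)"
    unfolding isCont_def by (rule tendstoD) (use D0 in simp)
  then obtain e2 where e2: "0 < e2" "\<And>t. t \<noteq> 0 \<Longrightarrow> dist t 0 < e2 \<Longrightarrow> dist (D t) (D 0) < \<bar>D 0\<bar> / 2"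
    by (auto simp: eventually_at)
  define e where "e = min e1 e2 / 2"
  have e: "0 < e" "e < e1" "e < e2" using e1 e2 by (auto simp: e_def)
  have Dn: "\<bar>D 0\<bar> / 2 \<le> sgn (D 0) * D t" if "t \<in> {-e..e}" for t
  proof -
    have "dist (D t) (D 0) < \<bar>D 0\<bar> / 2"
      using e2(2)[of t] that e D0 by (cases "t = 0") (auto simp: dist_real_def)
    then show ?thesis using D0 by (auto simp: dist_real_def sgn_if abs_if split: if_splits)
  qed
  define \<beta> where "\<beta> = bump (-e) e"
  have ee: "- e < e" using e by simp
  obtain S where S: "smooth S" "\<And>x. (S has_real_derivative bump (- e) e x) (at x)"
    "\<And>x. x \<le> - e \<Longrightarrow> S x = 0" "\<And>x. e \<le> x \<Longrightarrow> S x = S e" "0 < S e" "\<And>x. 0 \<le> S x"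
    "\<And>x y. x \<le> y \<Longrightarrow> S x \<le> S y"
    by (rule smooth_step_exists[OF ee]) (rule that; assumption)
  note S = S(1) S(2)[folded \<beta>_def] S(3-5)
  have \<beta>c: "continuous_on T \<beta>" for T by (simp add: \<beta>_def continuous_on_bump)
  \<comment> \<open>Up near x0 and down by the same amount near x1, so A vanishes outside [p, q] and
    A' is a difference of two bumps.\<close>
  define A where "A = (\<lambda>x. S (x - x0) - S (x - x1))"
  define A' where "A' = (\<lambda>x. \<beta> (x - x0) - \<beta> (x - x1))"
  define p q where "p = x0 - e" and "q = x1 + e"
  have pq: "l' < p" "p < q" "q < u'" using e e1 x by (auto simp: p_def q_def)
  have smA: "smooth A"
  proof -
    have "smooth (\<lambda>x. S (1 * x + - x0))" "smooth (\<lambda>x. S (1 * x + - x1))"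
      by (intro smooth_compose_affine S linear_times)+
    from smooth_diff[OF this] show ?thesis by (simp add: A_def)
  qed
  have dA: "(A has_real_derivative A' x) (at x)" for x
  proof -
    have "((\<lambda>x. S (x - c)) has_real_derivative \<beta> (x - c)) (at x)" for c
    proof -
      have "((\<lambda>x. x - c) has_real_derivative 1) (at x)" by (auto intro!: derivative_eq_intros)
      from DERIV_chain2[where f = S and g = "\<lambda>x. x - c", OF S(2) this] show ?thesis by simp
    qed
    then show ?thesis unfolding A_def A'_def by (intro DERIV_diff)
  qed
  have A0: "A x = 0" if "x \<le> p \<or> q \<le> x" for x
    using that S(3)[of "x - x0"] S(3)[of "x - x1"] S(4)[of "x - x0"] S(4)[of "x - x1"] x
    by (auto simp: A_def p_def q_def)
  have cA: "continuous_on T A" "continuous_on T A'" for T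
    using smooth_imp_continuous[OF smA] unfolding A'_def
    by (auto intro!: continuous_intros continuous_on_compose2[OF \<beta>c])
  have sub: "{p..q} \<subseteq> {l'<..<u'}" "{p..q} \<subseteq> {l<..<u}" using pq lu by auto
  have c: "continuous_on {p..q} m" "continuous_on {p..q} n" "continuous_on {p..q} N" "continuous_on {p..q} k"
    using continuous_on_subset[OF m sub(2)] continuous_on_subset[OF n sub(2)]
      continuous_on_subset[OF Nc sub(1)] continuous_on_subset[OF kc sub(1)] by auto
  have 1: "integral {p..q} (\<lambda>x. m x * A' x + n x * A x) = 0"
    by (rule weak[OF _ pq(2) _ smA dA A0]) (use pq lu in auto)
  have 2: "integral {p..q} (\<lambda>x. N x * A' x + n x * A x) = 0"
  proof -
    have "((\<lambda>x. N x * A' x + n x * A x) has_integral N q * A q - N p * A p) {p..q}"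
    proof (rule fundamental_theorem_of_calculus)
      fix x assume "x \<in> {p..q}"
      then have "l' < x" "x < u'" using pq by auto
      from DERIV_mult'[OF N'[OF this] dA]
      show "((\<lambda>x. N x * A x) has_vector_derivative N x * A' x + n x * A x) (at x within {p..q})"
        unfolding has_real_derivative_iff_has_vector_derivative[symmetric]
        by (rule has_field_derivative_at_within)
    qed (use pq in simp)
    then show ?thesis using A0[of p] A0[of q] by (simp add: integral_unique)
  qed
  have 3: "integral {p..q} (\<lambda>x. k x * A' x) = 0"
  proof -
    have "integral {p..q} (\<lambda>x. k x * A' x)
       = integral {p..q} (\<lambda>x. (m x * A' x + n x * A x) - (N x * A' x + n x * A x))"
      by (simp add: k_def algebra_simps)
    also have "... = 0"
      using 1 2 by (subst HK_integral_diff)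
        (auto intro!: integrable_continuous_real continuous_intros c cA)
    finally show ?thesis .
  qed
  have loc: "integral {p..q} (\<lambda>x. k x * \<beta> (x - c)) = integral {-e..e} (\<lambda>t. k (c + t) * \<beta> t)"
    if cc: "c = x0 \<or> c = x1" for c
  proof -
    have sub: "{c - e..c + e} \<subseteq> {p..q}" using cc x e by (auto simp: p_def q_def)
    have z: "k x * \<beta> (x - c) = 0" if "x \<notin> {c - e..c + e}" for x
      using that by (auto simp: \<beta>_def intro!: bump_eq_0)
    have "integral {p..q} (\<lambda>x. k x * \<beta> (x - c)) = integral {p..q} (\<lambda>x. if x \<in> {c - e..c + e} then k x * \<beta> (x - c) else 0)"
      using z by (intro HK_integral_cong) auto
    also have "... = integral {c - e..c + e} (\<lambda>x. k x * \<beta> (x - c))"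
      using sub by (simp only: integral_restrict_Int Int_absorb2)
    also have "... = integral {-e..e} ((\<lambda>x. k x * \<beta> (x - c)) \<circ> (+) c)"
      by (simp add: integral_shift_Icc_real add.commute)
    finally show ?thesis by (simp add: o_def)
  qed
  have "0 = integral {p..q} (\<lambda>x. k x * \<beta> (x - x0) - k x * \<beta> (x - x1))"
    using 3 by (simp add: A'_def right_diff_distrib)
  also have "... = integral {p..q} (\<lambda>x. k x * \<beta> (x - x0)) - integral {p..q} (\<lambda>x. k x * \<beta> (x - x1))"
    by (intro HK_integral_diff integrable_continuous_real continuous_intros c continuous_on_compose2[OF \<beta>c]) auto
  also have "... = integral {-e..e} (\<lambda>t. k (x0 + t) * \<beta> t) - integral {-e..e} (\<lambda>t. k (x1 + t) * \<beta> t)"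
    using loc by simp
  also have "... = integral {-e..e} (\<lambda>t. D t * \<beta> t)"
    using e e1 x unfolding D_def left_diff_distrib
    by (intro HK_integral_diff[symmetric] integrable_continuous_real continuous_intros \<beta>c continuous_on_compose2[OF kc]) auto
  finally have 4: "integral {-e..e} (\<lambda>t. D t * \<beta> t) = 0" by simp
  have Dce: "continuous_on {-e..e} D" by (rule continuous_on_subset[OF Dc]) (use e in auto)
  have "integral {-e..e} (\<lambda>t. \<bar>D 0\<bar> / 2 * \<beta> t) \<le> integral {-e..e} (\<lambda>t. sgn (D 0) * (D t * \<beta> t))"
  proof (rule integral_le)
    show "(\<lambda>t. \<bar>D 0\<bar> / 2 * \<beta> t) integrable_on {-e..e}" "(\<lambda>t. sgn (D 0) * (D t * \<beta> t)) integrable_on {-e..e}"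
      by (intro integrable_continuous_real continuous_intros \<beta>c Dce)+
    fix t assume "t \<in> {-e..e}"
    from mult_right_mono[OF Dn[OF this] bump_nonneg[of "-e" e t]]
    show "\<bar>D 0\<bar> / 2 * \<beta> t \<le> sgn (D 0) * (D t * \<beta> t)" by (simp add: \<beta>_def mult.assoc)
  qed
  then have "\<bar>D 0\<bar> / 2 * integral {-e..e} \<beta> \<le> 0" using 4 by simp
  moreover have "integral {-e..e} \<beta> = S e - S (-e)"
    using e S(2) by (intro integral_unique fundamental_theorem_of_calculus)
      (auto simp: has_real_derivative_iff_has_vector_derivative[symmetric] intro: has_field_derivative_at_within)
  ultimately show False using S(3)[of "-e"] S(5) D0 by (simp add: mult_le_0_iff)
qed

lemma continuous_on_slices:
  fixes g :: "real \<Rightarrow> real \<Rightarrow> real"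
  assumes "continuous_on (X \<times> Y) (\<lambda>(x, y). g x y)"
  shows "x \<in> X \<Longrightarrow> continuous_on Y (g x)" "y \<in> Y \<Longrightarrow> continuous_on X (\<lambda>x. g x y)"
proof -
  show "continuous_on Y (g x)" if "x \<in> X"
  proof -
    have p: "continuous_on Y (\<lambda>y. (x, y))" by (intro continuous_intros)
    have "continuous_on Y (\<lambda>y. case (x, y) of (x, y) \<Rightarrow> g x y)"
      by (rule continuous_on_compose2[OF assms p]) (use that in auto)
    then show ?thesis by simp
  qed
  show "continuous_on X (\<lambda>x. g x y)" if "y \<in> Y"
  proof -
    have p: "continuous_on X (\<lambda>x. (x, y))" by (intro continuous_intros)
    have "continuous_on X (\<lambda>x. case (x, y) of (x, y) \<Rightarrow> g x y)"
      by (rule continuous_on_compose2[OF assms p]) (use that in auto)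
    then show ?thesis by simp
  qed
qed

text \<open>\<open>du_Bois_Reymond\<close> in the x-direction for the integrals in y against a fixed
  weight B. The weight may be nonzero at an end of its interval; the constant k records the boundary
  flux that then appears.\<close>

lemma slab_identity:
  fixes g1 g2 :: "real \<Rightarrow> real \<Rightarrow> real"
  assumes g1: "continuous_on ({l1<..<u1} \<times> {p2..q2}) (\<lambda>(x, y). g1 x y)"
    and g2: "continuous_on ({l1<..<u1} \<times> {p2..q2}) (\<lambda>(x, y). g2 x y)"
    and B: "continuous_on UNIV B" "continuous_on UNIV B'"
    and weak: "\<And>A A' p1 q1. l1 < p1 \<Longrightarrow> p1 < q1 \<Longrightarrow> q1 < u1 \<Longrightarrow>
      smooth A \<Longrightarrow> (\<And>x. (A has_real_derivative A' x) (at x)) \<Longrightarrow> (\<And>x. x \<le> p1 \<or> q1 \<le> x \<Longrightarrow> A x = 0) \<Longrightarrow>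
      integral (cbox (p1, p2) (q1, q2)) (\<lambda>(x, y). g1 x y * (A' x * B y) + g2 x y * (A x * B' y)) = k * integral {p1..q1} A"
    and x: "l1 < x0" "x0 < x1" "x1 < u1"
  shows "integral {p2..q2} (\<lambda>y. (g1 x1 y - g1 x0 y) * B y)
    = integral {p2..q2} (\<lambda>y. integral {x0..x1} (\<lambda>x. g2 x y) * B' y) - k * (x1 - x0)"
proof -
  note g1x = continuous_on_slices(1)[OF g1] and g2x = continuous_on_slices(1)[OF g2]
  have Bc: "continuous_on T B" "continuous_on T B'" for T
    using B by (auto intro: continuous_on_subset)
  define m where "m = (\<lambda>x. integral {p2..q2} (\<lambda>y. g1 x y * B y))"
  define n where "n = (\<lambda>x. integral {p2..q2} (\<lambda>y. g2 x y * B' y) - k)"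
  have c1: "continuous_on ({l1<..<u1} \<times> {p2..q2}) (\<lambda>(x, y). g1 x y * B y)"
    and c2: "continuous_on ({l1<..<u1} \<times> {p2..q2}) (\<lambda>(x, y). g2 x y * B' y)"
    using g1 g2
    by (auto simp: case_prod_unfold intro!: continuous_intros continuous_on_compose2[OF B(1)] continuous_on_compose2[OF B(2)])
  have mc: "continuous_on {l1<..<u1} m" and nc: "continuous_on {l1<..<u1} n"
    using integral_continuous_on_param[of "{l1<..<u1}" p2 q2 "\<lambda>x y. g1 x y * B y"] c1
      integral_continuous_on_param[of "{l1<..<u1}" p2 q2 "\<lambda>x y. g2 x y * B' y"] c2
    by (auto simp: m_def n_def intro!: continuous_intros)
  have step1: "m x1 - m x0 = integral {x0..x1} n"
  proof (rule du_Bois_Reymond[OF mc nc _ x])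
    fix A A' :: "real \<Rightarrow> real" and p1 q1
    assume pq1: "l1 < p1" "p1 < q1" "q1 < u1" and A: "smooth A" "\<And>x. (A has_real_derivative A' x) (at x)"
      and A0: "\<And>x. x \<le> p1 \<or> q1 \<le> x \<Longrightarrow> A x = 0"
    note Ac = smooth_real_continuous[OF A]
    have sub: "cbox (p1, p2) (q1, q2) \<subseteq> {l1<..<u1} \<times> {p2..q2}" using pq1 by (auto simp: cbox_Pair_eq)
    let ?h = "\<lambda>x y. g1 x y * (A' x * B y) + g2 x y * (A x * B' y)"
    have cc: "continuous_on (cbox (p1, p2) (q1, q2)) (\<lambda>(x, y). ?h x y)"
      using continuous_on_subset[OF g1 sub] continuous_on_subset[OF g2 sub]
      by (auto simp: case_prod_unfold intro!: continuous_intros continuous_on_compose2[OF B(1)] continuous_on_compose2[OF B(2)]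
          continuous_on_compose2[OF Ac(1)[of UNIV]] continuous_on_compose2[OF Ac(2)[of UNIV]])
    have inner: "m x * A' x + n x * A x = integral {p2..q2} (?h x) - k * A x" if "x \<in> {p1..q1}" for x
    proof -
      have xx: "x \<in> {l1<..<u1}" using pq1 that by auto
      have i: "(\<lambda>y. g1 x y * B y) integrable_on {p2..q2}" "(\<lambda>y. g2 x y * B' y) integrable_on {p2..q2}"
        by (intro integrable_continuous_real continuous_intros Bc g1x[OF xx] g2x[OF xx])+
      have "integral {p2..q2} (?h x) = integral {p2..q2} (\<lambda>y. A' x * (g1 x y * B y) + A x * (g2 x y * B' y))"
        by (simp add: mult.left_commute)
      also have "... = integral {p2..q2} (\<lambda>y. A' x * (g1 x y * B y)) + integral {p2..q2} (\<lambda>y. A x * (g2 x y * B' y))"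
        using i by (intro HK_integral_add integrable_on_mult_right)
      also have "... = m x * A' x + (n x + k) * A x" by (simp add: m_def n_def mult.commute)
      finally show ?thesis by (simp add: algebra_simps)
    qed
    have ci: "continuous_on {p1..q1} (\<lambda>x. integral {p2..q2} (?h x))"
      using integral_continuous_on_param[of "{p1..q1}" p2 q2 ?h] cc by (simp add: cbox_Pair_eq)
    have "integral {p1..q1} (\<lambda>x. m x * A' x + n x * A x) = integral {p1..q1} (\<lambda>x. integral {p2..q2} (?h x) - k * A x)"
      by (rule HK_integral_cong) (rule inner)
    also have "... = integral {p1..q1} (\<lambda>x. integral {p2..q2} (?h x)) - integral {p1..q1} (\<lambda>x. k * A x)"
      by (intro HK_integral_diff integrable_continuous_real ci continuous_intros Ac)
    also have "integral {p1..q1} (\<lambda>x. integral {p2..q2} (?h x)) = integral (cbox (p1, p2) (q1, q2)) (\<lambda>(x, y). ?h x y)"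
      using integral_prod_continuous[OF cc] by simp
    also have "... = k * integral {p1..q1} A" by (rule weak[OF pq1 A A0])
    finally show "integral {p1..q1} (\<lambda>x. m x * A' x + n x * A x) = 0" by simp
  qed
  have i1: "(\<lambda>y. g1 x y * B y) integrable_on {p2..q2}" if "x \<in> {l1<..<u1}" for x
    by (intro integrable_continuous_real continuous_intros Bc g1x[OF that])
  have "m x1 - m x0 = integral {p2..q2} (\<lambda>y. g1 x1 y * B y - g1 x0 y * B y)"
    unfolding m_def using x by (intro HK_integral_diff[symmetric] i1) auto
  then have mm: "m x1 - m x0 = integral {p2..q2} (\<lambda>y. (g1 x1 y - g1 x0 y) * B y)"
    by (simp add: left_diff_distrib)
  have c3: "continuous_on (cbox (x0, p2) (x1, q2)) (\<lambda>(x, y). g2 x y * B' y)"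
    by (rule continuous_on_subset[OF c2]) (use x in \<open>auto simp: cbox_Pair_eq\<close>)
  have c4: "continuous_on {x0..x1} (\<lambda>x. integral {p2..q2} (\<lambda>y. g2 x y * B' y))"
    using integral_continuous_on_param[of "{x0..x1}" p2 q2 "\<lambda>x y. g2 x y * B' y"] c3 by (simp add: cbox_Pair_eq)
  have "integral {x0..x1} n = integral {x0..x1} (\<lambda>x. integral {p2..q2} (\<lambda>y. g2 x y * B' y)) - integral {x0..x1} (\<lambda>x. k)"
    unfolding n_def by (intro HK_integral_diff integrable_continuous_real c4 continuous_intros)
  also have "integral {x0..x1} (\<lambda>x. integral {p2..q2} (\<lambda>y. g2 x y * B' y)) = integral {p2..q2} (\<lambda>y. integral {x0..x1} (\<lambda>x. g2 x y) * B' y)"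
    using integral_swap_continuous[OF c3] by simp
  finally show ?thesis using x step1 mm by (simp add: mult.commute)
qed

text \<open>A second application of \<open>du_Bois_Reymond\<close>, now in y, to the result of
  \<open>slab_identity\<close>. The outcome is the divergence theorem on rectangles for a field that
  is merely continuous and weakly divergence free.\<close>

lemma rectangle_flux_zero:
  fixes g1 g2 :: "real \<Rightarrow> real \<Rightarrow> real"
  assumes g1: "continuous_on ({l1<..<u1} \<times> {l2<..<u2}) (\<lambda>(x, y). g1 x y)"
    and g2: "continuous_on ({l1<..<u1} \<times> {l2<..<u2}) (\<lambda>(x, y). g2 x y)"
    and weak: "\<And>A A' p1 q1 B B' p2 q2. l1 < p1 \<Longrightarrow> p1 < q1 \<Longrightarrow> q1 < u1 \<Longrightarrow> l2 < p2 \<Longrightarrow> p2 < q2 \<Longrightarrow> q2 < u2 \<Longrightarrow>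
      smooth A \<Longrightarrow> (\<And>x. (A has_real_derivative A' x) (at x)) \<Longrightarrow> (\<And>x. x \<le> p1 \<or> q1 \<le> x \<Longrightarrow> A x = 0) \<Longrightarrow>
      smooth B \<Longrightarrow> (\<And>x. (B has_real_derivative B' x) (at x)) \<Longrightarrow> (\<And>x. x \<le> p2 \<or> q2 \<le> x \<Longrightarrow> B x = 0) \<Longrightarrow>
      integral (cbox (p1, p2) (q1, q2)) (\<lambda>(x, y). g1 x y * (A' x * B y) + g2 x y * (A x * B' y)) = 0"
    and x: "l1 < x0" "x0 < x1" "x1 < u1" and y: "l2 < y0" "y0 < y1" "y1 < u2"
  shows "integral {x0..x1} (\<lambda>x. g2 x y1) - integral {x0..x1} (\<lambda>x. g2 x y0)
    = - integral {y0..y1} (\<lambda>y. g1 x1 y - g1 x0 y)"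
proof -
  note g1x = continuous_on_slices(1)[OF g1]
  define P where "P = (\<lambda>y. integral {x0..x1} (\<lambda>x. g2 x y))"
  define Q where "Q = (\<lambda>y. g1 x1 y - g1 x0 y)"
  have g2swap: "continuous_on ({l2<..<u2} \<times> {x0..x1}) (\<lambda>(y, x). g2 x y)"
  proof -
    have "continuous_on ({l2<..<u2} \<times> {x0..x1}) (\<lambda>z. case (snd z, fst z) of (x, y) \<Rightarrow> g2 x y)"
      by (rule continuous_on_compose2[OF g2]) (use x in \<open>auto intro!: continuous_intros\<close>)
    then show ?thesis by (simp add: case_prod_unfold)
  qed
  have Pc: "continuous_on {l2<..<u2} P"
    using integral_continuous_on_param[of "{l2<..<u2}" x0 x1 "\<lambda>y x. g2 x y"] g2swap by (simp add: P_def)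
  have Qc: "continuous_on {l2<..<u2} Q"
    unfolding Q_def using x by (intro continuous_intros g1x) auto
  \<comment> \<open>The slab identity says that P has weak derivative -Q, hence the sign in front of
    P.\<close>
  have "(- P) y1 - (- P) y0 = integral {y0..y1} Q"
  proof (rule du_Bois_Reymond[OF _ Qc _ y])
    show "continuous_on {l2<..<u2} (- P)" using Pc by (simp add: fun_Compl_def continuous_on_minus)
    fix B B' :: "real \<Rightarrow> real" and p2 q2
    assume pq2: "l2 < p2" "p2 < q2" "q2 < u2" and B: "smooth B" "\<And>x. (B has_real_derivative B' x) (at x)"
      and B0: "\<And>x. x \<le> p2 \<or> q2 \<le> x \<Longrightarrow> B x = 0"
    note Bc = smooth_real_continuous[OF B]
    have sub: "{l1<..<u1} \<times> {p2..q2} \<subseteq> {l1<..<u1} \<times> {l2<..<u2}" using pq2 by auto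
    have slab: "integral {p2..q2} (\<lambda>y. Q y * B y) = integral {p2..q2} (\<lambda>y. P y * B' y) - 0 * (x1 - x0)"
      unfolding P_def Q_def
      by (rule slab_identity[OF continuous_on_subset[OF g1 sub] continuous_on_subset[OF g2 sub] Bc _ x])
        (simp only: weak[OF _ _ _ pq2 _ _ _ B B0] mult_zero_left)
    have Pi: "(\<lambda>y. P y * B' y) integrable_on {p2..q2}" and Qi: "(\<lambda>y. Q y * B y) integrable_on {p2..q2}"
      using pq2 by (intro integrable_continuous_real continuous_intros Bc continuous_on_subset[OF Pc] continuous_on_subset[OF Qc]; auto)+
    have "integral {p2..q2} (\<lambda>y. (- P) y * B' y + Q y * B y) = integral {p2..q2} (\<lambda>y. Q y * B y - P y * B' y)"
      by (simp add: algebra_simps)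
    also have "... = 0" using HK_integral_diff[OF Qi Pi] slab by simp
    finally show "integral {p2..q2} (\<lambda>y. (- P) y * B' y + Q y * B y) = 0" .
  qed
  then show ?thesis by (simp add: P_def Q_def)
qed

lemma continuous_zero_of_integrals:
  fixes f :: "real \<Rightarrow> real"
  assumes f: "continuous_on {l<..<u} f" and int: "\<And>x0 x1. l < x0 \<Longrightarrow> x0 < x1 \<Longrightarrow> x1 < u \<Longrightarrow> integral {x0..x1} f = 0"
    and x: "l < x" "x < u"
  shows "f x = 0"
proof -
  define l' u' where "l' = (l + x) / 2" and "u' = (x + u) / 2"
  have lu: "l < l'" "l' < x" "x < u'" "u' < u" using x by (auto simp: l'_def u'_def)
  have "((\<lambda>x. integral {l'..x} f) has_real_derivative f x) (at x within {l'..u'})"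
    by (rule integral_has_real_derivative) (use lu in \<open>auto intro: continuous_on_subset[OF f]\<close>)
  then have d: "((\<lambda>x. integral {l'..x} f) has_real_derivative f x) (at x)"
    using lu by (simp add: at_within_Icc_at)
  have "((\<lambda>x. 0) has_real_derivative f x) (at x)"
    by (rule has_field_derivative_transform_within_open[OF d, of "{l'<..<u'}"]) (use lu int in auto)
  then show ?thesis using DERIV_unique[OF DERIV_const[of 0 "at x"]] by simp
qed

text \<open>Testing with functions that do not vanish on the side \<open>y = c\<close> yields the Neumann condition
  \<open>\<partial>\<^sub>y v = -\<kappa>\<close> there.\<close>

lemma neumann_condition:
  fixes g1 g2 :: "real \<Rightarrow> real \<Rightarrow> real"
  assumes g1: "continuous_on ({l1<..<u1} \<times> {c..<u2}) (\<lambda>(x, y). g1 x y)"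
    and g2: "continuous_on ({l1<..<u1} \<times> {c..<u2}) (\<lambda>(x, y). g2 x y)" and "c < u2"
    and flux: "\<And>x0 x1 y0 y1. l1 < x0 \<Longrightarrow> x0 < x1 \<Longrightarrow> x1 < u1 \<Longrightarrow> c < y0 \<Longrightarrow> y0 < y1 \<Longrightarrow> y1 < u2 \<Longrightarrow>
      integral {x0..x1} (\<lambda>x. g2 x y1) - integral {x0..x1} (\<lambda>x. g2 x y0) = - integral {y0..y1} (\<lambda>y. g1 x1 y - g1 x0 y)"
    and weak: "\<And>A A' p1 q1 B B' q2. l1 < p1 \<Longrightarrow> p1 < q1 \<Longrightarrow> q1 < u1 \<Longrightarrow> c < q2 \<Longrightarrow> q2 < u2 \<Longrightarrow>
      smooth A \<Longrightarrow> (\<And>x. (A has_real_derivative A' x) (at x)) \<Longrightarrow> (\<And>x. x \<le> p1 \<or> q1 \<le> x \<Longrightarrow> A x = 0) \<Longrightarrow>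
      smooth B \<Longrightarrow> (\<And>x. (B has_real_derivative B' x) (at x)) \<Longrightarrow> (\<And>x. x \<le> c - (q2 - c) \<or> q2 \<le> x \<Longrightarrow> B x = 0) \<Longrightarrow>
      integral (cbox (p1, c) (q1, q2)) (\<lambda>(x, y). g1 x y * (A' x * B y) + g2 x y * (A x * B' y)) = \<kappa> * B c * integral {p1..q1} A"
    and x: "l1 < x" "x < u1"
  shows "g2 x c = - \<kappa>"
proof -
  note g1x = continuous_on_slices(1)[OF g1]
  have g2c: "continuous_on {l1<..<u1} (\<lambda>x. g2 x c)"
    using \<open>c < u2\<close> by (intro continuous_on_slices(2)[OF g2]) auto
  have "g2 x c + \<kappa> = 0"
  proof (rule continuous_zero_of_integrals[OF _ _ x, of "\<lambda>x. g2 x c + \<kappa>"])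
    show "continuous_on {l1<..<u1} (\<lambda>x. g2 x c + \<kappa>)" by (intro continuous_intros g2c)
    fix x0 x1 assume x: "l1 < x0" "x0 < x1" "x1 < u1"
    define \<delta> where "\<delta> = (u2 - c) / 2"
    define q2 where "q2 = c + \<delta>"
    have \<delta>: "0 < \<delta>" "c < q2" "q2 < u2" using \<open>c < u2\<close> by (auto simp: \<delta>_def q2_def field_simps)
    \<comment> \<open>A bump centred at c is positive on the side, so the boundary term survives and
      can be divided by B c.\<close>
    define B where "B = bump (c - \<delta>) (c + \<delta>)"
    have smB: "smooth B" by (simp add: B_def smooth_bump)
    obtain B' where B': "\<And>x. GDERIV B x :> B' x" "continuous_on UNIV B'" using smooth_obtain_gderiv[OF smB] by blast
    then have dB: "(B has_real_derivative B' x) (at x)" for x by (simp add: GDERIV_real_iff)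
    have B0: "B x = 0" if "x \<le> c - (q2 - c) \<or> q2 \<le> x" for x
      using that unfolding B_def q2_def by (intro bump_eq_0) auto
    have Bc: "continuous_on T B" "continuous_on T B'" for T
      using smooth_imp_continuous[OF smB] continuous_on_subset[OF B'(2)] by auto
    have Bpos: "0 < B c" unfolding B_def using \<delta> by (intro bump_pos) auto
    define P where "P = (\<lambda>y. integral {x0..x1} (\<lambda>x. g2 x y))"
    define Q where "Q = (\<lambda>y. g1 x1 y - g1 x0 y)"
    have g2swap: "continuous_on ({c..<u2} \<times> {x0..x1}) (\<lambda>(y, x). g2 x y)"
    proof -
      have "continuous_on ({c..<u2} \<times> {x0..x1}) (\<lambda>z. case (snd z, fst z) of (x, y) \<Rightarrow> g2 x y)"
        by (rule continuous_on_compose2[OF g2]) (use x in \<open>auto intro!: continuous_intros\<close>)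
      then show ?thesis by (simp add: case_prod_unfold)
    qed
    have Pc: "continuous_on {c..<u2} P"
      using integral_continuous_on_param[of "{c..<u2}" x0 x1 "\<lambda>y x. g2 x y"] g2swap by (simp add: P_def)
    have Qc: "continuous_on {c..<u2} Q"
      unfolding Q_def using x by (intro continuous_intros g1x) auto
    \<comment> \<open>Away from the side, the flux identity exhibits P as a constant minus a
      primitive of Q.\<close>
    have dP: "(P has_real_derivative - Q y) (at y)" if y: "c < y" "y < u2" for y
    proof -
      define y0 y2 where "y0 = (c + y) / 2" and "y2 = (y + u2) / 2"
      have yy: "c < y0" "y0 < y" "y < y2" "y2 < u2" using y by (auto simp: y0_def y2_def)
      have "((\<lambda>t. integral {y0..t} Q) has_real_derivative Q y) (at y within {y0..y2})"
        by (rule integral_has_real_derivative) (use yy in \<open>auto intro: continuous_on_subset[OF Qc]\<close>)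
      then have "((\<lambda>t. integral {y0..t} Q) has_real_derivative Q y) (at y)"
        using yy by (simp add: at_within_Icc_at)
      then have "((\<lambda>t. P y0 - integral {y0..t} Q) has_real_derivative - Q y) (at y)"
        by (auto intro!: derivative_eq_intros)
      then show ?thesis
      proof (rule has_field_derivative_transform_within_open[of _ _ _ "{y0<..<y2}"])
        fix t assume "t \<in> {y0<..<y2}"
        then have "P t - P y0 = - integral {y0..t} Q"
          unfolding P_def Q_def using x yy by (intro flux) auto
        then show "P y0 - integral {y0..t} Q = P t" by simp
      qed (use yy in auto)
    qed
    have sub: "{l1<..<u1} \<times> {c..q2} \<subseteq> {l1<..<u1} \<times> {c..<u2}" using \<delta> by auto
    have slab: "integral {c..q2} (\<lambda>y. Q y * B y) = integral {c..q2} (\<lambda>y. P y * B' y) - \<kappa> * B c * (x1 - x0)"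
      unfolding P_def Q_def
      by (rule slab_identity[OF continuous_on_subset[OF g1 sub] continuous_on_subset[OF g2 sub] Bc _ x])
        (rule weak[OF _ _ _ \<delta>(2,3) _ _ _ smB dB B0])
    have Pi: "(\<lambda>y. P y * B' y) integrable_on {c..q2}" and Qi: "(\<lambda>y. Q y * B y) integrable_on {c..q2}"
      using \<delta> by (intro integrable_continuous_real continuous_intros Bc continuous_on_subset[OF Pc] continuous_on_subset[OF Qc]; auto)+
    \<comment> \<open>The integral of (P B)' from the side inwards leaves -P c B c. Comparison with
      the slab identity determines P c.\<close>
    have "((\<lambda>y. P y * B' y - Q y * B y) has_integral P q2 * B q2 - P c * B c) {c..q2}"
    proof (rule fundamental_theorem_of_calculus_interior)
      show "continuous_on {c..q2} (\<lambda>y. P y * B y)"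
        using \<delta> by (intro continuous_intros Bc continuous_on_subset[OF Pc]) auto
      fix y assume "y \<in> {c<..<q2}"
      then have "c < y" "y < u2" using \<delta> by auto
      from DERIV_mult'[OF dP[OF this] dB]
      show "((\<lambda>y. P y * B y) has_vector_derivative P y * B' y - Q y * B y) (at y)"
        unfolding has_real_derivative_iff_has_vector_derivative[symmetric] by simp
    qed (use \<delta> in simp)
    then have "integral {c..q2} (\<lambda>y. P y * B' y - Q y * B y) = - P c * B c"
      using B0[of q2] by (simp add: integral_unique)
    then have "integral {c..q2} (\<lambda>y. P y * B' y) - integral {c..q2} (\<lambda>y. Q y * B y) = - P c * B c"
      using HK_integral_diff[OF Pi Qi] by simp
    with slab have "\<kappa> * B c * (x1 - x0) = - P c * B c" by simp
    then have "B c * (P c + \<kappa> * (x1 - x0)) = 0" by (simp add: algebra_simps)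
    then have Pk: "P c + \<kappa> * (x1 - x0) = 0" using Bpos by simp
    have "integral {x0..x1} (\<lambda>x. g2 x c + \<kappa>) = integral {x0..x1} (\<lambda>x. g2 x c) + integral {x0..x1} (\<lambda>x. \<kappa>)"
      using x by (intro HK_integral_add integrable_continuous_real continuous_on_subset[OF g2c] continuous_intros) auto
    then show "integral {x0..x1} (\<lambda>x. g2 x c + \<kappa>) = 0" using Pk x by (simp add: P_def mult.commute)
  qed
  then show ?thesis by simp
qed

section \<open>Holomorphy of the complex gradient\<close>

definition cgrad :: "(real \<times> real \<Rightarrow> real \<times> real) \<Rightarrow> complex \<Rightarrow> complex" where
  "cgrad g z = Complex (fst (g (Re z, Im z))) (- snd (g (Re z, Im z)))"

lemma norm_cgrad: "norm (cgrad g z) = norm (g (Re z, Im z))"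
  by (simp add: cgrad_def cmod_def norm_prod_def)

text \<open>Vanishing flux makes the harmonic conjugate of v well defined by integration along the
  sides of rectangles. Then v plus \<i> times the conjugate is complex differentiable and
  \<open>cgrad g\<close> is its derivative, so no second derivatives of v have to be produced
  beforehand.\<close>

lemma holomorphic_cgrad_of_flux:
  fixes v :: "real \<times> real \<Rightarrow> real"
  assumes v: "\<And>z. z \<in> {l1<..<u1} \<times> {l2<..<u2} \<Longrightarrow> GDERIV v z :> g z"
    and g: "continuous_on ({l1<..<u1} \<times> {l2<..<u2}) g"
    and flux: "\<And>x0 x1 y0 y1. l1 < x0 \<Longrightarrow> x0 < x1 \<Longrightarrow> x1 < u1 \<Longrightarrow> l2 < y0 \<Longrightarrow> y0 < y1 \<Longrightarrow> y1 < u2 \<Longrightarrow>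
      integral {x0..x1} (\<lambda>x. snd (g (x, y1))) - integral {x0..x1} (\<lambda>x. snd (g (x, y0)))
        = - integral {y0..y1} (\<lambda>y. fst (g (x1, y)) - fst (g (x0, y)))"
    and p: "l1 < Re p" "Re p < u1" "l2 < Im p" "Im p < u2"
  shows "cgrad g field_differentiable at p"
proof -
  define x0 y0 where "x0 = (l1 + Re p) / 2" and "y0 = (l2 + Im p) / 2"
  have xy0: "l1 < x0" "x0 < Re p" "l2 < y0" "y0 < Im p" using p by (auto simp: x0_def y0_def)
  define X Y where "X = {x0<..<u1}" and "Y = {y0<..<u2}"
  define W where "W = {z. Re z \<in> X \<and> Im z \<in> Y}"
  have W: "open W"
  proof -
    have "W = {z. x0 < Re z} \<inter> {z. Re z < u1} \<inter> {z. y0 < Im z} \<inter> {z. Im z < u2}"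
      by (auto simp: W_def X_def Y_def)
    then show ?thesis
      by (simp add: open_Int open_halfspace_Re_gt open_halfspace_Re_lt open_halfspace_Im_gt open_halfspace_Im_lt)
  qed
  have pW: "p \<in> W" using p xy0 by (simp add: W_def X_def Y_def)
  define g1 g2 where "g1 = (\<lambda>x y. fst (g (x, y)))" and "g2 = (\<lambda>x y. snd (g (x, y)))"
  have g1c: "continuous_on ({l1<..<u1} \<times> {l2<..<u2}) (\<lambda>(x, y). g1 x y)"
    and g2c: "continuous_on ({l1<..<u1} \<times> {l2<..<u2}) (\<lambda>(x, y). g2 x y)"
    unfolding g1_def g2_def case_prod_unfold prod.collapse by (intro continuous_intros g)+
  note s1 = continuous_on_slices[OF g1c] and s2 = continuous_on_slices[OF g2c]
  \<comment> \<open>The conjugate along a path that first runs horizontally and then vertically;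
    \<open>V2\<close> is the other path. The first expression shows the y-derivative, the second the
    x-derivative.\<close>
  define V where "V = (\<lambda>x y. integral {y0..y} (g1 x) - integral {x0..x} (\<lambda>s. g2 s y0))"
  have V2: "V x y = integral {y0..y} (g1 x0) - integral {x0..x} (\<lambda>s. g2 s y)" if "x \<in> X" "y \<in> Y" for x y
  proof -
    have "integral {x0..x} (\<lambda>s. g2 s y) - integral {x0..x} (\<lambda>s. g2 s y0) = - integral {y0..y} (\<lambda>t. g1 x t - g1 x0 t)"
      unfolding g1_def g2_def using that xy0 by (intro flux) (auto simp: X_def Y_def)
    also have "integral {y0..y} (\<lambda>t. g1 x t - g1 x0 t) = integral {y0..y} (g1 x) - integral {y0..y} (g1 x0)"
      using that xy0 p
      by (intro HK_integral_diff integrable_continuous_real continuous_on_subset[OF s1(1)]) (auto simp: X_def Y_def)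
    finally show ?thesis by (simp add: V_def)
  qed
  have dV: "((\<lambda>(x, y). V x y) has_derivative (\<lambda>(tx, ty). - g2 x y * tx + blinfun_apply (g1 x y *\<^sub>R id_blinfun) ty)) (at (x, y) within X \<times> Y)"
    if xy: "x \<in> X" "y \<in> Y" for x y
  proof (rule has_derivative_partialsI)
    define x2 where "x2 = (x + u1) / 2"
    have x2: "x < x2" "x2 < u1" using xy by (auto simp: x2_def X_def)
    have "((\<lambda>x. integral {x0..x} (\<lambda>s. g2 s y)) has_real_derivative g2 x y) (at x within {x0..x2})"
      by (rule integral_has_real_derivative) (use xy xy0 x2 in \<open>auto simp: X_def Y_def intro!: continuous_on_subset[OF s2(2)]\<close>)
    then have "((\<lambda>x. integral {x0..x} (\<lambda>s. g2 s y)) has_real_derivative g2 x y) (at x)"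
      using xy x2 by (simp add: at_within_Icc_at X_def)
    then have "((\<lambda>x. integral {y0..y} (g1 x0) - integral {x0..x} (\<lambda>s. g2 s y)) has_real_derivative - g2 x y) (at x)"
      by (auto intro!: derivative_eq_intros)
    then have "((\<lambda>x. V x y) has_real_derivative - g2 x y) (at x)"
      by (rule has_field_derivative_transform_within_open[of _ _ _ X]) (use xy V2 in \<open>auto simp: X_def\<close>)
    then show "((\<lambda>x. V x y) has_derivative (*) (- g2 x y)) (at x within X)"
      unfolding has_field_derivative_def by (rule has_derivative_at_withinI)
  next
    fix x y assume xy: "x \<in> X" "y \<in> Y"
    define y2 where "y2 = (y + u2) / 2"
    have y2: "y < y2" "y2 < u2" using xy by (auto simp: y2_def Y_def)
    have "((\<lambda>y. integral {y0..y} (g1 x)) has_real_derivative g1 x y) (at y within {y0..y2})"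
      by (rule integral_has_real_derivative) (use xy xy0 y2 in \<open>auto simp: X_def Y_def intro!: continuous_on_subset[OF s1(1)]\<close>)
    then have "((\<lambda>y. integral {y0..y} (g1 x)) has_real_derivative g1 x y) (at y)"
      using xy y2 by (simp add: at_within_Icc_at Y_def)
    then have "((\<lambda>y. V x y) has_real_derivative g1 x y) (at y)"
      unfolding V_def by (auto intro!: derivative_eq_intros)
    then show "((\<lambda>y. V x y) has_derivative blinfun_apply (g1 x y *\<^sub>R id_blinfun)) (at y within Y)"
      by (auto simp: has_field_derivative_def scaleR_blinfun.rep_eq id_blinfun.rep_eq intro: has_derivative_at_withinI)
  next
    have "continuous_on (X \<times> Y) (\<lambda>(x, y). g1 x y)"
      by (rule continuous_on_subset[OF g1c]) (use xy0 in \<open>auto simp: X_def Y_def\<close>)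
    then have "continuous (at (x, y) within X \<times> Y) (\<lambda>(x, y). g1 x y)"
      using xy by (simp add: continuous_on_eq_continuous_within)
    then show "continuous (at (x, y) within X \<times> Y) (\<lambda>(x, y). g1 x y *\<^sub>R id_blinfun)"
      unfolding case_prod_unfold by (intro continuous_intros)
  qed (use xy in \<open>auto simp: Y_def\<close>)
  define F where "F = (\<lambda>z. of_real (v (Re z, Im z)) + \<i> * of_real (V (Re z) (Im z)))"
  have F: "(F has_field_derivative cgrad g z) (at z)" if z: "z \<in> W" for z
  proof -
    define x y where "x = Re z" and "y = Im z"
    have xy: "x \<in> X" "y \<in> Y" using z by (auto simp: W_def x_def y_def)
    have r: "((\<lambda>z. (Re z, Im z)) has_derivative (\<lambda>k. (Re k, Im k))) (at z)"
      by (auto intro!: derivative_eq_intros)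
    have dv: "((\<lambda>z. v (Re z, Im z)) has_derivative (\<lambda>k. (Re k, Im k) \<bullet> g (x, y))) (at z)"
    proof -
      have "GDERIV v (x, y) :> g (x, y)" using xy xy0 by (intro v) (auto simp: X_def Y_def)
      then have "(v has_derivative (\<lambda>h. h \<bullet> g (x, y))) (at (Re z, Im z))" by (simp add: gderiv_def x_def y_def)
      from diff_chain_at[OF r this] show ?thesis by (simp add: o_def)
    qed
    have "open (X \<times> Y)" by (simp add: X_def Y_def open_Times)
    then have e: "at (x, y) within X \<times> Y = at (x, y)" using xy by (intro at_within_open) auto
    have ap: "blinfun_apply (g1 x y *\<^sub>R id_blinfun) t = g1 x y * t" for t
      by (simp add: scaleR_blinfun.rep_eq)
    have "((\<lambda>(x, y). V x y) has_derivative (\<lambda>(tx, ty). - g2 x y * tx + g1 x y * ty)) (at (Re z, Im z))"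
      using dV[OF xy] unfolding e ap unfolding x_def y_def .
    from diff_chain_at[OF r this]
    have dV': "((\<lambda>z. V (Re z) (Im z)) has_derivative (\<lambda>k. - g2 x y * Re k + g1 x y * Im k)) (at z)"
      unfolding o_def prod.case .
    have "(F has_derivative (\<lambda>k. of_real ((Re k, Im k) \<bullet> g (x, y)) + \<i> * of_real (- g2 x y * Re k + g1 x y * Im k))) (at z)"
      unfolding F_def
      by (rule has_derivative_add[OF has_derivative_of_real[OF dv] has_derivative_mult_right[OF has_derivative_of_real[OF dV']]])
    also have "(\<lambda>k. of_real ((Re k, Im k) \<bullet> g (x, y)) + \<i> * of_real (- g2 x y * Re k + g1 x y * Im k)) = (*) (cgrad g z)"
      by (auto simp: fun_eq_iff complex_eq_iff cgrad_def g1_def g2_def x_def y_def inner_prod_def algebra_simps)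
    finally show ?thesis by (simp add: has_field_derivative_def)
  qed
  then have "F holomorphic_on W" using W by (auto simp: holomorphic_on_open)
  then have "deriv F holomorphic_on W" using W by (rule holomorphic_deriv)
  then have "cgrad g holomorphic_on W"
    by (rule holomorphic_transform) (use F DERIV_imp_deriv in blast)
  then show ?thesis using W pW holomorphic_on_imp_differentiable_at by blast
qed

section \<open>Product test functions and the outer trace on slices\<close>

lemma lebesgue_integral_eq_cbox:
  fixes f :: "'a::euclidean_space \<Rightarrow> real"
  assumes \<Omega>: "\<Omega> \<in> sets lebesgue" and sub: "box a b \<subseteq> \<Omega>" and c: "continuous_on (cbox a b) f"
    and zero: "\<And>x. x \<in> \<Omega> \<Longrightarrow> x \<notin> cbox a b \<Longrightarrow> f x = 0"
  shows "integral\<^sup>L (lebesgue_on \<Omega>) f = integral (cbox a b) f"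
proof -
  have "AE x in lebesgue. x \<notin> cbox a b - box a b"
    by (intro AE_not_in) (simp only: negligible_iff_null_sets[symmetric] negligible_frontier_interval)
  then have ae: "AE x in lebesgue. indicator (cbox a b) x * f x = indicator \<Omega> x * f x"
  proof eventually_elim
    case (elim x)
    then show ?case using sub zero[of x] by (cases "x \<in> cbox a b"; cases "x \<in> \<Omega>") auto
  qed
  have m: "(\<lambda>x. indicator (cbox a b) x * f x) \<in> borel_measurable lebesgue"
    using lebesgue_integral_cbox(1)[OF c] by (rule borel_measurable_integrable)
  have "integral\<^sup>L (lebesgue_on \<Omega>) f = (\<integral>x. indicator \<Omega> x * f x \<partial>lebesgue)"
    using \<Omega> by (simp add: integral_restrict_space)
  also have "... = (\<integral>x. indicator (cbox a b) x * f x \<partial>lebesgue)"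
  proof (rule integral_cong_AE)
    show "AE x in lebesgue. indicator \<Omega> x * f x = indicator (cbox a b) x * f x" using ae by eventually_elim (rule sym)
    show "(\<lambda>x. indicator \<Omega> x * f x) \<in> borel_measurable lebesgue"
      by (rule borel_measurable_AE[OF m ae])
  qed (rule m)
  also have "... = integral (cbox a b) f" by (rule lebesgue_integral_cbox(2)[OF c])
  finally show ?thesis .
qed

lemma L2_tendsto_const: "L2 M f \<Longrightarrow> L2_tendsto M (\<lambda>_. f) f"
  by (simp add: L2_tendsto_def)

lemma L2_continuous_bounded:
  fixes f :: "'a::euclidean_space \<Rightarrow> 'b::euclidean_space"
  assumes W: "open W" "bounded W" and f: "continuous_on UNIV f"
  shows "L2 (lebesgue_on W) f"
  unfolding L2_def
proof
  have Ls: "W \<in> sets lebesgue" using W by auto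
  show "f \<in> borel_measurable (lebesgue_on W)"
    by (rule continuous_imp_measurable_on_sets_lebesgue[OF continuous_on_subset[OF f subset_UNIV] Ls])
  obtain a where a: "W \<subseteq> cbox (-a) a" using bounded_subset_cbox_symmetric[OF W(2)] by blast
  have "continuous_on (cbox (-a) a) (\<lambda>x. (norm (f x))^2)"
    by (intro continuous_intros continuous_on_subset[OF f]) auto
  then have "integrable lebesgue (\<lambda>x. indicator (cbox (-a) a) x * (norm (f x))^2)"
    by (rule lebesgue_integral_cbox(1))
  then have "integrable lebesgue (\<lambda>x. indicator W x *\<^sub>R (indicator (cbox (-a) a) x * (norm (f x))^2))"
    using Ls by (intro integrable_mult_indicator)
  moreover have "(\<lambda>x. indicator W x *\<^sub>R (indicator (cbox (-a) a) x * (norm (f x))^2)) = (\<lambda>x. indicator W x *\<^sub>R (norm (f x))^2)"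
    using a by (auto simp: fun_eq_iff indicator_def)
  ultimately show "integrable (lebesgue_on W) (\<lambda>x. (norm (f x))^2)"
    using Ls by (simp add: integrable_restrict_space)
qed

lemma smooth_H1:
  fixes \<phi> :: "real \<times> real \<Rightarrow> real"
  assumes W: "open W" "bounded W" and \<phi>: "smooth \<phi>" "\<And>z. GDERIV \<phi> z :> d\<phi> z"
  shows "H1 W \<phi> d\<phi>"
  unfolding H1_def
proof (intro conjI allI impI)
  have c: "continuous_on UNIV \<phi>" "continuous_on UNIV d\<phi>"
    using smooth_imp_continuous[OF \<phi>(1)] smooth_continuous_gderiv[OF \<phi>] by auto
  show "L2 (lebesgue_on W) \<phi>" "L2 (lebesgue_on W) d\<phi>"
    by (intro L2_continuous_bounded W c)+
  fix \<eta> d\<eta> assume "test_function W \<eta> \<and> (\<forall>x. GDERIV \<eta> x :> d\<eta> x)"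
  then have \<eta>: "test_function W \<eta>" "\<And>x. GDERIV \<eta> x :> d\<eta> x" by auto
  show "(\<integral>x. \<phi> x *\<^sub>R d\<eta> x \<partial>lebesgue_on W) = - (\<integral>x. \<eta> x *\<^sub>R d\<phi> x \<partial>lebesgue_on W)"
    by (rule test_function_integration_by_parts(3)[OF W(1) \<phi>(2) continuous_on_subset[OF c(2) subset_UNIV] \<eta>])
qed

lemma smooth_has_trace:
  fixes \<phi> :: "real \<times> real \<Rightarrow> real"
  assumes W: "open W" "bounded W" and \<phi>: "smooth \<phi>"
  shows "has_trace W (bdry_measure r1 r2) \<phi> \<phi>"
    and "(\<And>t. \<phi> (t, r2) = 0) \<Longrightarrow> (\<And>t. \<phi> (t, - r2) = 0) \<Longrightarrow> (\<And>t. \<phi> (r1, t) = 0) \<Longrightarrow> (\<And>t. \<phi> (- r1, t) = 0) \<Longrightarrow>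
      has_trace W (bdry_measure r1 r2) \<phi> (\<lambda>_. 0)"
proof -
  obtain d\<phi> where d\<phi>: "\<And>z. GDERIV \<phi> z :> d\<phi> z" using smooth_obtain_gderiv[OF \<phi>] by blast
  have H: "H1 W \<phi> d\<phi>" by (rule smooth_H1[OF W \<phi> d\<phi>])
  have c: "continuous_on UNIV \<phi>" by (rule smooth_imp_continuous[OF \<phi>])
  have L: "L2 (lebesgue_on W) \<phi>" "L2 (lebesgue_on W) d\<phi>" "L2 (bdry_measure r1 r2) \<phi>"
    using H L2_bdry_measure_continuous[OF c] by (auto simp: H1_def)
  have t: "has_trace W (bdry_measure r1 r2) \<phi> \<tau>" if "L2_tendsto (bdry_measure r1 r2) (\<lambda>_. \<phi>) \<tau>" for \<tau>
    unfolding has_trace_def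
    by (rule exI[of _ d\<phi>], rule exI[of _ "\<lambda>_. \<phi>"], rule exI[of _ "\<lambda>_. d\<phi>"])
       (use H \<phi> d\<phi> L that in \<open>auto intro: L2_tendsto_const\<close>)
  show "has_trace W (bdry_measure r1 r2) \<phi> \<phi>" by (rule t[OF L2_tendsto_const[OF L(3)]])
  assume z: "\<And>t. \<phi> (t, r2) = 0" "\<And>t. \<phi> (t, - r2) = 0" "\<And>t. \<phi> (r1, t) = 0" "\<And>t. \<phi> (- r1, t) = 0"
  have "continuous_on UNIV (\<lambda>x. (norm (\<phi> x - 0))^2)" by (intro continuous_intros c)
  from integral_bdry_measure_continuous(2)[OF this, of r1 r2]
  have "(\<integral>x. (norm (\<phi> x - 0))^2 \<partial>bdry_measure r1 r2) = 0" by (simp add: z)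
  moreover have "L2 (bdry_measure r1 r2) (\<lambda>_. 0 :: real)"
    by (rule L2_bdry_measure_continuous) (rule continuous_on_const)
  ultimately have "L2_tendsto (bdry_measure r1 r2) (\<lambda>_. \<phi>) (\<lambda>_. 0)"
    using L(3) by (simp add: L2_tendsto_def)
  then show "has_trace W (bdry_measure r1 r2) \<phi> (\<lambda>_. 0)" by (rule t)
qed

lemma GDERIV_fst_mult_snd:
  assumes "\<And>x. (A has_real_derivative A' x) (at x)" "\<And>x. (B has_real_derivative B' x) (at x)"
  shows "GDERIV (\<lambda>z. A (fst z) * B (snd z)) z :> (A' (fst z) * B (snd z), A (fst z) * B' (snd z))"
proof -
  have 1: "((\<lambda>z. A (fst z)) has_derivative (\<lambda>h. A' (fst z) * fst h)) (at z)"
    using diff_chain_at[OF has_derivative_fst[OF has_derivative_ident] assms(1)[unfolded has_field_derivative_def]]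
    by (simp add: o_def)
  have 2: "((\<lambda>z. B (snd z)) has_derivative (\<lambda>h. B' (snd z) * snd h)) (at z)"
    using diff_chain_at[OF has_derivative_snd[OF has_derivative_ident] assms(2)[unfolded has_field_derivative_def]]
    by (simp add: o_def)
  have "(\<lambda>h. A (fst z) * (B' (snd z) * snd h) + A' (fst z) * fst h * B (snd z)) = (\<lambda>h. h \<bullet> (A' (fst z) * B (snd z), A (fst z) * B' (snd z)))"
    by (simp add: fun_eq_iff inner_prod_def algebra_simps)
  with has_derivative_mult[OF 1 2] show ?thesis by (simp add: gderiv_def)
qed

text \<open>Products A(x) B(y) are enough as test functions: the two-dimensional weak equation is
  later resolved by one-dimensional arguments, one for each variable. Zeros of A and B at the outer
  coordinates provide the vanishing outer trace.\<close>

lemma weak_product_identity: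
  assumes r: "0 < r1" "0 < r2" "1 < lam" and u: "weak_solution r1 r2 lam a b u"
    and eq: "AE x in lebesgue_on (annulus r1 r2 lam). u x = v x"
    and v: "\<And>z. z \<in> annulus r1 r2 lam \<Longrightarrow> GDERIV v z :> g z" and g: "continuous_on (annulus r1 r2 lam) g"
    and A: "smooth A" "\<And>x. (A has_real_derivative A' x) (at x)" "A (lam * r1) = 0" "A (- (lam * r1)) = 0"
    and B: "smooth B" "\<And>x. (B has_real_derivative B' x) (at x)" "B (lam * r2) = 0" "B (- (lam * r2)) = 0"
  shows "(\<integral>z. g z \<bullet> (A' (fst z) * B (snd z), A (fst z) * B' (snd z)) \<partial>lebesgue_on (annulus r1 r2 lam))
    = a * (B r2 + B (- r2)) * integral {-r1..r1} A + b * (A r1 + A (- r1)) * integral {-r2..r2} B"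
proof -
  let ?W = "annulus r1 r2 lam" and ?out = "bdry_measure (lam * r1) (lam * r2)" and ?in = "bdry_measure r1 r2"
  have op: "open ?W" using r by (intro open_annulus) simp
  have Ls: "?W \<in> sets lebesgue" using op by auto
  define \<phi> where "\<phi> = (\<lambda>z. A (fst z) * B (snd z))"
  define d\<phi> where "d\<phi> = (\<lambda>z. (A' (fst z) * B (snd z), A (fst z) * B' (snd z)))"
  have sm: "smooth \<phi>" unfolding \<phi>_def by (rule smooth_fst_mult_snd[OF A(1) B(1)])
  have d: "GDERIV \<phi> z :> d\<phi> z" for z unfolding \<phi>_def d\<phi>_def by (rule GDERIV_fst_mult_snd[OF A(2) B(2)])
  have \<phi>c: "continuous_on S \<phi>" for S by (rule smooth_imp_continuous[OF sm])
  obtain gw where gw: "H1 ?W u gw" "\<And>\<phi> h \<tau>. H1 ?W \<phi> h \<Longrightarrow> has_trace ?W ?out \<phi> (\<lambda>_. 0) \<Longrightarrow> has_trace ?W ?in \<phi> \<tau> \<Longrightarrow>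
      (\<integral>z. gw z \<bullet> h z \<partial>lebesgue_on ?W) = (\<integral>z. flux r2 a b z * \<tau> z \<partial>?in)"
    using u unfolding weak_solution_def by blast
  have ae: "AE x in lebesgue_on ?W. gw x = g x"
    by (rule weak_gradient_eq_gradient[OF op bounded_annulus gw(1) eq v g])
  have H: "H1 ?W \<phi> d\<phi>" by (rule smooth_H1[OF op bounded_annulus sm d])
  have "(\<integral>z. g z \<bullet> d\<phi> z \<partial>lebesgue_on ?W) = (\<integral>z. gw z \<bullet> d\<phi> z \<partial>lebesgue_on ?W)"
  proof (rule integral_cong_AE)
    have m: "g \<in> borel_measurable (lebesgue_on ?W)" "gw \<in> borel_measurable (lebesgue_on ?W)" "d\<phi> \<in> borel_measurable (lebesgue_on ?W)"
      using continuous_imp_measurable_on_sets_lebesgue[OF g Ls] gw(1) H by (auto simp: H1_def L2_def)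
    show "(\<lambda>z. g z \<bullet> d\<phi> z) \<in> borel_measurable (lebesgue_on ?W)" "(\<lambda>z. gw z \<bullet> d\<phi> z) \<in> borel_measurable (lebesgue_on ?W)"
      using m by (auto intro: borel_measurable_inner)
    show "AE z in lebesgue_on ?W. g z \<bullet> d\<phi> z = gw z \<bullet> d\<phi> z" using ae by eventually_elim simp
  qed
  also have "... = (\<integral>z. flux r2 a b z * \<phi> z \<partial>?in)"
  proof (rule gw(2)[OF H])
    show "has_trace ?W ?out \<phi> (\<lambda>_. 0)"
      by (rule smooth_has_trace(2)[OF op bounded_annulus sm]) (simp_all add: \<phi>_def A B)
    show "has_trace ?W ?in \<phi> \<phi>" by (rule smooth_has_trace(1)[OF op bounded_annulus sm])
  qed
  also have "... = integral {-r1..r1} (\<lambda>t. a * (A t * B r2)) + integral {-r1..r1} (\<lambda>t. a * (A t * B (- r2)))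
      + integral {-r2..r2} (\<lambda>t. b * (A r1 * B t)) + integral {-r2..r2} (\<lambda>t. b * (A (- r1) * B t))"
  proof (rule integral_bdry_measure(2))
    have "closed {z::real \<times> real. \<bar>snd z\<bar> = r2}" by (intro closed_Collect_eq continuous_intros)
    then have "{z::real \<times> real. \<bar>snd z\<bar> = r2} \<in> sets borel" by (rule borel_closed)
    then have "flux r2 a b \<in> borel_measurable borel"
      unfolding flux_def[abs_def] by (intro measurable_If) auto
    then show "(\<lambda>z. flux r2 a b z * \<phi> z) \<in> borel_measurable borel"
      by (rule borel_measurable_times[OF _ borel_measurable_continuous_onI[OF \<phi>c]])
    show "continuous_on {-r1..r1} (\<lambda>t. a * (A t * B r2))" "continuous_on {-r1..r1} (\<lambda>t. a * (A t * B (- r2)))"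
      "continuous_on {-r2..r2} (\<lambda>t. b * (A r1 * B t))" "continuous_on {-r2..r2} (\<lambda>t. b * (A (- r1) * B t))"
      by (intro continuous_intros smooth_imp_continuous A B)+
  qed (use r in \<open>auto simp: flux_def \<phi>_def\<close>)
  also have "... = a * (B r2 + B (- r2)) * integral {-r1..r1} A + b * (A r1 + A (- r1)) * integral {-r2..r2} B"
    by (simp add: algebra_simps)
  finally show ?thesis by (simp add: d\<phi>_def)
qed

lemma L2_tendsto_indicator:
  fixes F :: "nat \<Rightarrow> 'a \<Rightarrow> 'b::euclidean_space"
  assumes F: "L2_tendsto M F f" and A: "A \<inter> space M \<in> sets M"
  shows "L2_tendsto M (\<lambda>n x. indicator A x *\<^sub>R F n x) (\<lambda>x. indicator A x *\<^sub>R f x)"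
proof -
  have L: "L2 M (F n)" "L2 M f" for n using F by (auto simp: L2_tendsto_def)
  have i: "L2 M (\<lambda>x. indicator A x *\<^sub>R h x)" if h: "L2 M h" for h :: "'a \<Rightarrow> 'b"
    unfolding L2_def
  proof
    have mA: "indicat_real A \<in> borel_measurable M" using A by (simp add: borel_measurable_indicator_iff)
    show m: "(\<lambda>x. indicator A x *\<^sub>R h x) \<in> borel_measurable M"
      by (rule borel_measurable_scaleR[OF mA L2_measurable[OF h]])
    show "integrable M (\<lambda>x. (norm (indicator A x *\<^sub>R h x))^2)"
    proof (rule Bochner_Integration.integrable_bound[OF L2_integrable[OF h]])
      show "(\<lambda>x. (norm (indicator A x *\<^sub>R h x))^2) \<in> borel_measurable M" using m by measurable
    qed (auto simp: indicator_def)
  qed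
  have "(\<lambda>n. \<integral>x. (norm (indicator A x *\<^sub>R F n x - indicator A x *\<^sub>R f x))^2 \<partial>M) \<longlonglongrightarrow> 0"
  proof (rule tendsto_sandwich[OF _ _ tendsto_const])
    show "(\<lambda>n. \<integral>x. (norm (F n x - f x))^2 \<partial>M) \<longlonglongrightarrow> 0" using F by (simp add: L2_tendsto_def)
    show "eventually (\<lambda>n. (\<integral>x. (norm (indicator A x *\<^sub>R F n x - indicator A x *\<^sub>R f x))^2 \<partial>M) \<le> (\<integral>x. (norm (F n x - f x))^2 \<partial>M)) sequentially"
    proof (intro always_eventually allI integral_mono)
      fix n
      show "integrable M (\<lambda>x. (norm (F n x - f x))^2)" by (rule L2_integrable[OF L2_diff[OF L]])
      show "integrable M (\<lambda>x. (norm (indicator A x *\<^sub>R F n x - indicator A x *\<^sub>R f x))^2)"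
        by (rule L2_integrable[OF L2_diff[OF i[OF L(1)] i[OF L(2)]]])
    qed (auto simp: indicator_def)
    show "eventually (\<lambda>n. 0 \<le> (\<integral>x. (norm (indicator A x *\<^sub>R F n x - indicator A x *\<^sub>R f x))^2 \<partial>M)) sequentially"
      by (intro always_eventually allI integral_nonneg_AE) simp
  qed
  then show ?thesis using i[OF L(1)] i[OF L(2)] by (simp add: L2_tendsto_def)
qed

text \<open>The slice at R - s is compared with all slices between R - 2s and R - s. Averaging makes
  its mean square at most 18 E s, with 18 = 2 * 8 + 2 from the bounds on f and on its derivative.
  The strip stays off the level R, where f has no prescribed values.\<close>

lemma slice_integral_tendsto_0:
  fixes f f2 :: "real \<Rightarrow> real \<Rightarrow> real"
  assumes "0 < s0" "x0 < x1"
    and f: "continuous_on ({x0..x1} \<times> {R - 2 * s0<..<R}) (\<lambda>(x, t). f x t)"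
    and f2: "continuous_on ({x0..x1} \<times> {R - 2 * s0<..<R}) (\<lambda>(x, t). f2 x t)"
    and deriv: "\<And>x t. x \<in> {x0..x1} \<Longrightarrow> R - 2 * s0 < t \<Longrightarrow> t < R \<Longrightarrow> (f x has_real_derivative f2 x t) (at t)"
    and b1: "\<And>s. 0 < s \<Longrightarrow> s < s0 \<Longrightarrow> integral (cbox (x0, R - 2 * s) (x1, R - s)) (\<lambda>(x, t). (f x t)^2) \<le> 8 * s^2 * E"
    and b2: "\<And>s. 0 < s \<Longrightarrow> s < s0 \<Longrightarrow> integral (cbox (x0, R - 2 * s) (x1, R - s)) (\<lambda>(x, t). (f2 x t)^2) \<le> E"
  shows "((\<lambda>s. integral {x0..x1} (\<lambda>x. f x (R - s))) \<longlongrightarrow> 0) (at_right 0)"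
proof -
  note fs = continuous_on_slices[OF f] and f2s = continuous_on_slices[OF f2]
  have key: "\<bar>integral {x0..x1} (\<lambda>x. f x (R - s))\<bar> \<le> sqrt ((x1 - x0) * (18 * E * s))" if s: "0 < s" "s < s0" for s
  proof -
    define c d where "c = R - 2 * s" and "d = R - s"
    have cd: "R - 2 * s0 < c" "c < d" "d < R" "d - c = s" using s by (auto simp: c_def d_def)
    have sub: "{c..d} \<subseteq> {R - 2 * s0<..<R}" "{x0..x1} \<times> {c..d} \<subseteq> {x0..x1} \<times> {R - 2 * s0<..<R}" using cd by auto
    have sq: "continuous_on ({x0..x1} \<times> {c..d}) (\<lambda>(x, t). (f x t)^2)" "continuous_on ({x0..x1} \<times> {c..d}) (\<lambda>(x, t). (f2 x t)^2)"
      using continuous_on_subset[OF f sub(2)] continuous_on_subset[OF f2 sub(2)]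
      by (auto simp: case_prod_unfold intro!: continuous_intros)
    have ft: "continuous_on {c..d} (f x)" "continuous_on {c..d} (f2 x)" if "x \<in> {x0..x1}" for x
      using continuous_on_subset[OF fs(1)[OF that] sub(1)] continuous_on_subset[OF f2s(1)[OF that] sub(1)] by auto
    have fd: "continuous_on {x0..x1} (\<lambda>x. f x d)" using cd by (intro fs(2)) auto
    define e where "e = (\<lambda>x. integral {c..d} (\<lambda>t. (f2 x t)^2))"
    define k where "k = (\<lambda>x. integral {c..d} (\<lambda>t. (f x t)^2))"
    have ec: "continuous_on {x0..x1} e" and kc: "continuous_on {x0..x1} k"
      using integral_continuous_on_param[of "{x0..x1}" c d "\<lambda>x t. (f2 x t)^2"] sq(2)
        integral_continuous_on_param[of "{x0..x1}" c d "\<lambda>x t. (f x t)^2"] sq(1) by (simp_all add: e_def k_def)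
    have pt: "(f x d)^2 \<le> 2 * (f x t)^2 + 2 * (s * e x)" if x: "x \<in> {x0..x1}" and t: "t \<in> {c..d}" for x t
    proof -
      have "(f2 x has_integral f x d - f x t) {t..d}"
        using t cd deriv[OF x] by (intro fundamental_theorem_of_calculus)
          (auto simp: has_real_derivative_iff_has_vector_derivative[symmetric] intro: has_field_derivative_at_within)
      then have I: "f x d - f x t = integral {t..d} (f2 x)" by (simp add: integral_unique)
      have c2: "continuous_on {t..d} (f2 x)" by (rule continuous_on_subset[OF ft(2)[OF x]]) (use t in auto)
      have "(f x d - f x t)^2 \<le> (d - t) * integral {t..d} (\<lambda>y. (f2 x y)^2)"
        unfolding I using t by (intro integral_square_le c2) auto
      also have "... \<le> s * e x"
      proof (rule mult_mono)
        show "integral {t..d} (\<lambda>y. (f2 x y)^2) \<le> e x"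
          unfolding e_def using t
          by (intro integral_subset_le integrable_continuous_real continuous_intros c2 ft(2)[OF x]) auto
        show "0 \<le> integral {t..d} (\<lambda>y. (f2 x y)^2)"
          by (intro HK_integral_nonneg integrable_continuous_real continuous_intros c2) auto
      qed (use t cd s in auto)
      finally have 1: "(f x d - f x t)^2 \<le> s * e x" .
      have "(f x d)^2 \<le> 2 * (f x t)^2 + 2 * (f x d - f x t)^2"
        using norm_diff_square_le[of "f x t" "f x t - f x d"] by (simp add: power2_commute)
      with 1 show ?thesis by linarith
    qed
    have ptx: "s * (f x d)^2 \<le> 2 * k x + 2 * s^2 * e x" if x: "x \<in> {x0..x1}" for x
    proof -
      have "s * (f x d)^2 = integral {c..d} (\<lambda>t. (f x d)^2)" using cd by simp
      also have "... \<le> integral {c..d} (\<lambda>t. 2 * (f x t)^2 + 2 * (s * e x))"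
        by (intro integral_le integrable_continuous_real continuous_intros ft(1)[OF x] pt[OF x])
      also have "... = integral {c..d} (\<lambda>t. 2 * (f x t)^2) + integral {c..d} (\<lambda>t. 2 * (s * e x))"
        by (intro HK_integral_add integrable_continuous_real continuous_intros ft(1)[OF x])
      also have "... = 2 * k x + 2 * s^2 * e x" using cd by (simp add: k_def power2_eq_square)
      finally show ?thesis .
    qed
    have K: "integral {x0..x1} k \<le> 8 * s^2 * E"
      using b1[OF s] integral_prod_continuous[of x0 c x1 d "\<lambda>(x, t). (f x t)^2"] sq(1)
      by (simp add: k_def c_def d_def cbox_Pair_eq)
    have E: "integral {x0..x1} e \<le> E"
      using b2[OF s] integral_prod_continuous[of x0 c x1 d "\<lambda>(x, t). (f2 x t)^2"] sq(2)
      by (simp add: e_def c_def d_def cbox_Pair_eq)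
    have "s * integral {x0..x1} (\<lambda>x. (f x d)^2) = integral {x0..x1} (\<lambda>x. s * (f x d)^2)" by simp
    also have "... \<le> integral {x0..x1} (\<lambda>x. 2 * k x + 2 * s^2 * e x)"
      by (intro integral_le integrable_continuous_real continuous_intros fd kc ec ptx)
    also have "... = integral {x0..x1} (\<lambda>x. 2 * k x) + integral {x0..x1} (\<lambda>x. 2 * s^2 * e x)"
      by (intro HK_integral_add integrable_continuous_real continuous_intros kc ec)
    also have "... = 2 * integral {x0..x1} k + 2 * s^2 * integral {x0..x1} e" by simp
    also have "... \<le> 2 * (8 * s^2 * E) + 2 * s^2 * E"
      using K E by (intro add_mono mult_left_mono) auto
    also have "... = s * (18 * E * s)" by (simp add: power2_eq_square)
    finally have I2: "integral {x0..x1} (\<lambda>x. (f x d)^2) \<le> 18 * E * s" using s by simp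
    have "(integral {x0..x1} (\<lambda>x. f x d))^2 \<le> (x1 - x0) * integral {x0..x1} (\<lambda>x. (f x d)^2)"
      using \<open>x0 < x1\<close> by (intro integral_square_le fd) auto
    also have "... \<le> (x1 - x0) * (18 * E * s)" using I2 \<open>x0 < x1\<close> by (intro mult_left_mono) auto
    finally show ?thesis unfolding d_def by (rule real_le_rsqrt[of "\<bar>_\<bar>", simplified])
  qed
  have "((\<lambda>s. sqrt ((x1 - x0) * (18 * E * s))) \<longlongrightarrow> sqrt ((x1 - x0) * (18 * E * 0))) (at_right 0)"
    by (intro tendsto_intros)
  then have l: "((\<lambda>s. sqrt ((x1 - x0) * (18 * E * s))) \<longlongrightarrow> 0) (at_right 0)" by simp
  show ?thesis
  proof (rule Lim_null_comparison[OF _ l])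
    have "eventually (\<lambda>s. s \<in> {0<..<s0}) (at_right 0)"
      using \<open>0 < s0\<close> by (rule eventually_at_right_real)
    then show "eventually (\<lambda>s. norm (integral {x0..x1} (\<lambda>x. f x (R - s))) \<le> sqrt ((x1 - x0) * (18 * E * s))) (at_right 0)"
      by eventually_elim (use key in auto)
  qed
qed

section \<open>From the weak equation to the boundary value problem\<close>

lemma deriv_zero_outside:
  fixes A :: "real \<Rightarrow> real"
  assumes "\<And>x. (A has_real_derivative A' x) (at x)" "\<And>x. x \<le> p \<or> q \<le> x \<Longrightarrow> A x = 0"
    and x: "x < p \<or> q < x"
  shows "A' x = 0"
proof -
  define S where "S = (if x < p then {..<p} else {q<..})"
  have "((\<lambda>x. 0) has_real_derivative A' x) (at x)"
    by (rule has_field_derivative_transform_within_open[OF assms(1), of S]) (use x assms(2) in \<open>auto simp: S_def split: if_splits\<close>)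
  then show ?thesis using DERIV_unique[OF DERIV_const[of 0 "at x"]] by simp
qed

lemma integral_support:
  fixes A :: "real \<Rightarrow> real"
  assumes "{p..q} \<subseteq> {l..u}" "\<And>x. x \<le> p \<or> q \<le> x \<Longrightarrow> A x = 0"
  shows "integral {l..u} A = integral {p..q} A"
proof -
  have "integral {l..u} (\<lambda>x. if x \<in> {p..q} then A x else 0) = integral {p..q} A"
    using assms(1) by (simp only: integral_restrict_Int Int_absorb2)
  moreover have "(\<lambda>x. if x \<in> {p..q} then A x else 0) = A" using assms(2) by (auto simp: fun_eq_iff)
  ultimately show ?thesis by simp
qed

lemma AE_eq_imp_eq_on_open:
  fixes f h :: "'a::euclidean_space \<Rightarrow> real"
  assumes \<Omega>: "open \<Omega>" and c: "continuous_on \<Omega> f" "continuous_on \<Omega> h"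
    and ae: "AE x in lebesgue_on \<Omega>. f x = h x" and z: "z \<in> \<Omega>"
  shows "f z = h z"
proof (rule ccontr)
  assume neq: "f z \<noteq> h z"
  define N where "N = (\<lambda>x. f x - h x) -` (- {0}) \<inter> \<Omega>"
  have oN: "open N"
  proof -
    have "continuous_on \<Omega> (\<lambda>x. f x - h x)" by (intro continuous_intros c)
    then show ?thesis unfolding N_def using \<Omega> continuous_on_open_vimage[OF \<Omega>] by blast
  qed
  have "AE x in lebesgue. x \<in> \<Omega> \<longrightarrow> f x = h x" using ae \<Omega> by (simp add: AE_restrict_space_iff)
  then have "AE x in lebesgue. x \<notin> N" by eventually_elim (auto simp: N_def)
  then have "N \<in> null_sets lebesgue" using oN by (simp add: AE_iff_null_sets)
  then have "negligible N" by (simp add: negligible_iff_null_sets)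
  moreover have "z \<in> N" using neq z by (simp add: N_def)
  ultimately show False using open_not_negligible[OF oN] by blast
qed

text \<open>The interface between the Sobolev part and the complex-analytic part. The outer
  Dirichlet condition appears only through integrals over slices, and the energy only through the
  decay of the gradient times the size of a square. The list is invariant under exchange of the
  coordinates together with that of a and b, as \<open>swapped\<close> shows.\<close>

locale annulus_solution = annulus_geometry +
  fixes a b :: real and v :: "real \<times> real \<Rightarrow> real" and g :: "real \<times> real \<Rightarrow> real \<times> real"
  assumes ab: "0 < a" "0 < b"
    and grad: "z \<in> \<Omega> \<Longrightarrow> GDERIV v z :> g z"
    and differentiable: "(Re p, Im p) \<in> \<Omega> \<Longrightarrow> cgrad g field_differentiable at p"
    and decay: "0 < e \<Longrightarrow> \<exists>\<delta>>0. \<forall>x y d. 0 < d \<and> cbox (x - d, y - d) (x + d, y + d) \<subseteq> \<Omega> \<inter> ball c \<delta> \<longrightarrow>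
      norm (g (x, y)) * d \<le> e"
    and sym: "z \<in> \<Omega> \<Longrightarrow> \<bar>s\<bar> = 1 \<Longrightarrow> \<bar>t\<bar> = 1 \<Longrightarrow> v (mirror s t z) = v z"
    and trace_top: "- R1 < x0 \<Longrightarrow> x0 < x1 \<Longrightarrow> x1 < R1 \<Longrightarrow>
      ((\<lambda>s. integral {x0..x1} (\<lambda>x. v (x, R2 - s))) \<longlongrightarrow> 0) (at_right 0)"
    and trace_right: "- R2 < x0 \<Longrightarrow> x0 < x1 \<Longrightarrow> x1 < R2 \<Longrightarrow>
      ((\<lambda>s. integral {x0..x1} (\<lambda>y. v (R1 - s, y))) \<longlongrightarrow> 0) (at_right 0)"
    and cont_v: "continuous_on (\<Omega> \<union> top_side r1 r2 \<union> right_side r1 r2) v"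
    and cont_g: "continuous_on (\<Omega> \<union> top_side r1 r2 \<union> right_side r1 r2) g"
    and neumann_top: "z \<in> top_side r1 r2 \<Longrightarrow> snd (g z) = - a"
    and neumann_right: "z \<in> right_side r1 r2 \<Longrightarrow> fst (g z) = - b"

locale weak_C1_solution = annulus_geometry +
  fixes a b :: real and u v :: "real \<times> real \<Rightarrow> real" and g :: "real \<times> real \<Rightarrow> real \<times> real"
  assumes ab: "0 < a" "0 < b"
    and weak: "weak_solution r1 r2 lam a b u"
    and ext: "C1_extension \<Omega> (\<Omega> \<union> top_side r1 r2 \<union> right_side r1 r2) u v g"
begin

lemma AE_u_v: "AE x in lebesgue_on \<Omega>. u x = v x"
  and dv: "z \<in> \<Omega> \<Longrightarrow> GDERIV v z :> g z"
  and gc: "continuous_on \<Omega> g" and vc: "continuous_on \<Omega> v"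
  using ext by (auto simp: C1_extension_def intro: continuous_on_subset)

text \<open>The support rectangle with corners p and q may protrude into the hole; the box with
  corners c and d is the part over which the integral really extends. This covers interior
  rectangles as well as rectangles that straddle an inner side.\<close>

lemma product_identity_cbox:
  assumes A: "smooth A" "\<And>x. (A has_real_derivative A' x) (at x)" "\<And>x. x \<le> p1 \<or> q1 \<le> x \<Longrightarrow> A x = 0"
    and B: "smooth B" "\<And>x. (B has_real_derivative B' x) (at x)" "\<And>x. x \<le> p2 \<or> q2 \<le> x \<Longrightarrow> B x = 0"
    and bd: "- R1 \<le> p1" "q1 \<le> R1" "- R2 \<le> p2" "q2 \<le> R2"
    and box: "box (c1, c2) (d1, d2) \<subseteq> \<Omega>" "continuous_on (cbox (c1, c2) (d1, d2)) g"
    and sub: "\<Omega> \<inter> cbox (p1, p2) (q1, q2) \<subseteq> cbox (c1, c2) (d1, d2)"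
  shows "integral (cbox (c1, c2) (d1, d2)) (\<lambda>(x, y). fst (g (x, y)) * (A' x * B y) + snd (g (x, y)) * (A x * B' y))
    = a * (B r2 + B (- r2)) * integral {-r1..r1} A + b * (A r1 + A (- r1)) * integral {-r2..r2} B"
proof -
  note Ac = smooth_real_continuous[OF A(1,2)] and Bc = smooth_real_continuous[OF B(1,2)]
  define f where "f = (\<lambda>z. g z \<bullet> (A' (fst z) * B (snd z), A (fst z) * B' (snd z)))"
  have z: "A R1 = 0" "A (- R1) = 0" "B R2 = 0" "B (- R2) = 0"
    using A(3) B(3) bd by auto
  have fz: "f z = 0" if "z \<notin> cbox (p1, p2) (q1, q2)" for z
  proof -
    have "(fst z < p1 \<or> q1 < fst z) \<or> (snd z < p2 \<or> q2 < snd z)"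
      using that by (cases z) (auto simp: cbox_Pair_eq)
    then show ?thesis
    proof
      assume 1: "fst z < p1 \<or> q1 < fst z"
      then have "A (fst z) = 0" "A' (fst z) = 0" using A(3) deriv_zero_outside[OF A(2,3) 1] by auto
      then show ?thesis by (simp add: f_def inner_prod_def)
    next
      assume 1: "snd z < p2 \<or> q2 < snd z"
      then have "B (snd z) = 0" "B' (snd z) = 0" using B(3) deriv_zero_outside[OF B(2,3) 1] by auto
      then show ?thesis by (simp add: f_def inner_prod_def)
    qed
  qed
  have fc: "continuous_on (cbox (c1, c2) (d1, d2)) f"
    unfolding f_def
    by (intro continuous_intros box(2) continuous_on_compose2[OF Ac(1)[of UNIV]] continuous_on_compose2[OF Ac(2)[of UNIV]]
        continuous_on_compose2[OF Bc(1)[of UNIV]] continuous_on_compose2[OF Bc(2)[of UNIV]]) auto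
  have "integral (cbox (c1, c2) (d1, d2)) (\<lambda>(x, y). fst (g (x, y)) * (A' x * B y) + snd (g (x, y)) * (A x * B' y))
      = integral (cbox (c1, c2) (d1, d2)) f"
    by (rule arg_cong[of _ _ "integral _"]) (auto simp: f_def inner_prod_def fun_eq_iff)
  also have "... = integral\<^sup>L (lebesgue_on \<Omega>) f"
  proof (rule lebesgue_integral_eq_cbox[OF Ls box(1) fc, symmetric])
    fix z assume "z \<in> \<Omega>" "z \<notin> cbox (c1, c2) (d1, d2)"
    then show "f z = 0" using sub by (intro fz) blast
  qed
  also have "... = a * (B r2 + B (- r2)) * integral {-r1..r1} A + b * (A r1 + A (- r1)) * integral {-r2..r2} B"
    unfolding f_def by (rule weak_product_identity[OF r weak AE_u_v dv gc A(1,2) z(1,2)[unfolded R1_def] B(1,2) z(3,4)[unfolded R2_def]])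
  finally show ?thesis .
qed

lemma flux_box:
  assumes bx: "{l1<..<u1} \<times> {l2<..<u2} \<subseteq> \<Omega>"
    and x: "l1 < x0" "x0 < x1" "x1 < u1" "l2 < y0" "y0 < y1" "y1 < u2"
  shows "integral {x0..x1} (\<lambda>x. snd (g (x, y1))) - integral {x0..x1} (\<lambda>x. snd (g (x, y0)))
        = - integral {y0..y1} (\<lambda>y. fst (g (x1, y)) - fst (g (x0, y)))"
proof (rule rectangle_flux_zero[of l1 u1 l2 u2 "\<lambda>x y. fst (g (x, y))" "\<lambda>x y. snd (g (x, y))", OF _ _ _ x])
  show "continuous_on ({l1<..<u1} \<times> {l2<..<u2}) (\<lambda>(x, y). fst (g (x, y)))"
    "continuous_on ({l1<..<u1} \<times> {l2<..<u2}) (\<lambda>(x, y). snd (g (x, y)))"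
    unfolding case_prod_unfold prod.collapse by (intro continuous_intros continuous_on_subset[OF gc bx])+
  fix A A' B B' :: "real \<Rightarrow> real" and p1 q1 p2 q2
  assume p: "l1 < p1" "p1 < q1" "q1 < u1" "l2 < p2" "p2 < q2" "q2 < u2"
    and A: "smooth A" "\<And>x. (A has_real_derivative A' x) (at x)" "\<And>x. x \<le> p1 \<or> q1 \<le> x \<Longrightarrow> A x = 0"
    and B: "smooth B" "\<And>x. (B has_real_derivative B' x) (at x)" "\<And>x. x \<le> p2 \<or> q2 \<le> x \<Longrightarrow> B x = 0"
  have cb: "cbox (p1, p2) (q1, q2) \<subseteq> \<Omega>" using bx p by (force simp: cbox_Pair_eq)
  have "(p1, p2) \<in> \<Omega>" "(q1, q2) \<in> \<Omega>" using cb p by (auto simp: cbox_Pair_eq)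
  then have bd: "- R1 \<le> p1" "q1 \<le> R1" "- R2 \<le> p2" "q2 \<le> R2" unfolding mem by auto
  have bo: "box (p1, p2) (q1, q2) \<subseteq> \<Omega>" using cb box_subset_cbox by blast
  have "integral (cbox (p1, p2) (q1, q2)) (\<lambda>(x, y). fst (g (x, y)) * (A' x * B y) + snd (g (x, y)) * (A x * B' y))
    = a * (B r2 + B (- r2)) * integral {-r1..r1} A + b * (A r1 + A (- r1)) * integral {-r2..r2} B"
    by (rule product_identity_cbox[OF A B bd bo continuous_on_subset[OF gc cb]]) auto
  \<comment> \<open>A rectangle inside the annulus misses the hole: if its x-range meets [-r1, r1],
    then its y-range misses [-r2, r2] and B vanishes there; otherwise A vanishes on
    [-r1, r1].\<close>
  also have "... = 0"
  proof (cases "\<exists>x\<in>{p1..q1}. \<bar>x\<bar> \<le> r1")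
    case True
    then obtain x where x: "x \<in> {p1..q1}" "\<bar>x\<bar> \<le> r1" by blast
    have "B y = 0" if "\<bar>y\<bar> \<le> r2" for y
    proof (rule ccontr)
      assume "B y \<noteq> 0"
      then have "y \<in> {p2..q2}" using B(3)[of y] by (meson atLeastAtMost_iff nle_le)
      then have "(x, y) \<in> \<Omega>" using cb x by (auto simp: cbox_Pair_eq)
      then show False using x that by (simp add: mem)
    qed
    moreover from this have "integral {-r2..r2} B = integral {-r2..r2} (\<lambda>_. 0)"
      by (intro HK_integral_cong) auto
    ultimately show ?thesis using r by simp
  next
    case False
    have "A x = 0" if "\<bar>x\<bar> \<le> r1" for x
    proof (rule ccontr)
      assume "A x \<noteq> 0"
      then have "x \<in> {p1..q1}" using A(3)[of x] by (meson atLeastAtMost_iff nle_le)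
      then show False using False that by blast
    qed
    moreover from this have "integral {-r1..r1} A = integral {-r1..r1} (\<lambda>_. 0)"
      by (intro HK_integral_cong) auto
    ultimately show ?thesis using r by simp
  qed
  finally show "integral (cbox (p1, p2) (q1, q2)) (\<lambda>(x, y). fst (g (x, y)) * (A' x * B y) + snd (g (x, y)) * (A x * B' y)) = 0" .
qed

lemma cgrad_differentiable:
  assumes "(Re p, Im p) \<in> \<Omega>"
  shows "cgrad g field_differentiable at p"
proof -
  obtain e where e: "0 < e" "ball (Re p, Im p) e \<subseteq> \<Omega>" using op assms openE by blast
  have bx: "{Re p - e / 2<..<Re p + e / 2} \<times> {Im p - e / 2<..<Im p + e / 2} \<subseteq> \<Omega>"
  proof (rule order_trans[OF _ e(2)], rule subsetI)
    fix z assume z: "z \<in> {Re p - e / 2<..<Re p + e / 2} \<times> {Im p - e / 2<..<Im p + e / 2}"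
    have "dist (Re p, Im p) z \<le> \<bar>Re p - fst z\<bar> + \<bar>Im p - snd z\<bar>"
      using sqrt_sum_squares_le_sum_abs[of "Re p - fst z" "Im p - snd z"] by (simp add: dist_prod_def dist_real_def)
    also have "... < e" using z by (auto simp: abs_if)
    finally show "z \<in> ball (Re p, Im p) e" by simp
  qed
  show ?thesis
    by (rule holomorphic_cgrad_of_flux[OF _ continuous_on_subset[OF gc bx] flux_box[OF bx]])
       (use e bx dv in auto)
qed

lemma neumann_t:
  assumes "\<bar>x\<bar> < r1"
  shows "snd (g (x, r2)) = - a"
proof -
  \<comment> \<open>The cap 2 * r2 keeps the mirrored lower end of the support of B above 0, so
    neither the bottom side nor the part of the annulus below the hole is touched.\<close>
  define w where "w = min R2 (2 * r2)"
  have w: "r2 < w" "w \<le> R2" "w \<le> 2 * r2" using R r by (auto simp: w_def)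
  have sub: "{-r1<..<r1} \<times> {r2..<w} \<subseteq> \<Omega> \<union> top_side r1 r2 \<union> right_side r1 r2"
  proof clarify
    fix x y assume xy: "x \<in> {-r1<..<r1}" "y \<in> {r2..<w}" "(x, y) \<notin> right_side r1 r2" "(x, y) \<notin> top_side r1 r2"
    then have "y \<noteq> r2" by (auto simp: top_side_def)
    then show "(x, y) \<in> \<Omega>" using xy w R r by (auto simp: mem abs_less_iff)
  qed
  have gcT: "continuous_on ({-r1<..<r1} \<times> {r2..<w}) g"
    using ext sub by (auto simp: C1_extension_def intro: continuous_on_subset)
  have bx: "{-r1<..<r1} \<times> {r2<..<w} \<subseteq> \<Omega>" using w R r by (auto simp: mem abs_less_iff)
  show ?thesis
  proof (rule neumann_condition[of "-r1" r1 r2 w "\<lambda>x y. fst (g (x, y))" "\<lambda>x y. snd (g (x, y))" a x])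
    show "continuous_on ({-r1<..<r1} \<times> {r2..<w}) (\<lambda>(x, y). fst (g (x, y)))"
      "continuous_on ({-r1<..<r1} \<times> {r2..<w}) (\<lambda>(x, y). snd (g (x, y)))"
      unfolding case_prod_unfold prod.collapse by (intro continuous_intros gcT)+
    show "integral {x0..x1} (\<lambda>x. snd (g (x, y1))) - integral {x0..x1} (\<lambda>x. snd (g (x, y0)))
        = - integral {y0..y1} (\<lambda>y. fst (g (x1, y)) - fst (g (x0, y)))"
      if "- r1 < x0" "x0 < x1" "x1 < r1" "r2 < y0" "y0 < y1" "y1 < w" for x0 x1 y0 y1
      by (rule flux_box[OF bx that])
    fix A A' B B' :: "real \<Rightarrow> real" and p1 q1 q2
    assume p: "-r1 < p1" "p1 < q1" "q1 < r1" "r2 < q2" "q2 < w"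
      and A: "smooth A" "\<And>x. (A has_real_derivative A' x) (at x)" "\<And>x. x \<le> p1 \<or> q1 \<le> x \<Longrightarrow> A x = 0"
      and B: "smooth B" "\<And>x. (B has_real_derivative B' x) (at x)" "\<And>x. x \<le> r2 - (q2 - r2) \<or> q2 \<le> x \<Longrightarrow> B x = 0"
    have cb: "cbox (p1, r2) (q1, q2) \<subseteq> {-r1<..<r1} \<times> {r2..<w}" using p by (auto simp: cbox_Pair_eq)
    have bd: "- R1 \<le> p1" "q1 \<le> R1" "- R2 \<le> r2 - (q2 - r2)" "q2 \<le> R2"
      using p w R r by (auto)
    have bo: "box (p1, r2) (q1, q2) \<subseteq> \<Omega>"
    proof (rule order_trans[OF _ bx], rule subsetI)
      fix z assume "z \<in> box (p1, r2) (q1, q2)"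
      then show "z \<in> {- r1<..<r1} \<times> {r2<..<w}" using p by (cases z) (auto simp: mem_box Basis_prod_def)
    qed
    have "integral (cbox (p1, r2) (q1, q2)) (\<lambda>(x, y). fst (g (x, y)) * (A' x * B y) + snd (g (x, y)) * (A x * B' y))
      = a * (B r2 + B (- r2)) * integral {-r1..r1} A + b * (A r1 + A (- r1)) * integral {-r2..r2} B"
    proof (rule product_identity_cbox[OF A B bd bo continuous_on_subset[OF gcT cb]])
      show "\<Omega> \<inter> cbox (p1, r2 - (q2 - r2)) (q1, q2) \<subseteq> cbox (p1, r2) (q1, q2)"
        using p w r by (auto simp: cbox_Pair_eq mem abs_le_iff)
    qed
    also have "B (- r2) = 0" using p w by (intro B(3)) auto
    also have "A r1 = 0" using p by (intro A(3)) auto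
    also have "A (- r1) = 0" using p by (intro A(3)) auto
    also have "integral {-r1..r1} A = integral {p1..q1} A"
      using p A(3) by (intro integral_support) auto
    finally show "integral (cbox (p1, r2) (q1, q2)) (\<lambda>(x, y). fst (g (x, y)) * (A' x * B y) + snd (g (x, y)) * (A x * B' y))
       = a * B r2 * integral {p1..q1} A" by simp
  qed (use w assms in auto)
qed

lemma neumann_r:
  assumes "\<bar>y\<bar> < r2"
  shows "fst (g (r1, y)) = - b"
proof -
  define w where "w = min R1 (2 * r1)"
  have w: "r1 < w" "w \<le> R1" "w \<le> 2 * r1" using R r by (auto simp: w_def)
  have sub: "{r1..<w} \<times> {-r2<..<r2} \<subseteq> \<Omega> \<union> top_side r1 r2 \<union> right_side r1 r2"
  proof clarify
    fix x y assume xy: "y \<in> {-r2<..<r2}" "x \<in> {r1..<w}" "(x, y) \<notin> right_side r1 r2" "(x, y) \<notin> top_side r1 r2"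
    then have "x \<noteq> r1" by (auto simp: right_side_def)
    then show "(x, y) \<in> \<Omega>" using xy w R r by (auto simp: mem abs_less_iff)
  qed
  have gcT: "continuous_on ({r1..<w} \<times> {-r2<..<r2}) g"
    using ext sub by (auto simp: C1_extension_def intro: continuous_on_subset)
  have gcS: "continuous_on ({-r2<..<r2} \<times> {r1..<w}) (\<lambda>z. g (snd z, fst z))"
    by (rule continuous_on_compose2[OF gcT]) (auto intro!: continuous_intros)
  have bx: "{r1<..<w} \<times> {-r2<..<r2} \<subseteq> \<Omega>" using w R r by (auto simp: mem abs_less_iff)
  show ?thesis
  \<comment> \<open>The roles of the coordinates are exchanged: y runs along the side and x is the
    normal direction.\<close>
  proof (rule neumann_condition[of "-r2" r2 r1 w "\<lambda>y x. snd (g (x, y))" "\<lambda>y x. fst (g (x, y))" b y])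
    show "continuous_on ({-r2<..<r2} \<times> {r1..<w}) (\<lambda>(y, x). snd (g (x, y)))"
      "continuous_on ({-r2<..<r2} \<times> {r1..<w}) (\<lambda>(y, x). fst (g (x, y)))"
      unfolding case_prod_unfold by (intro continuous_intros gcS)+
    show "integral {y0..y1} (\<lambda>y. fst (g (x1, y))) - integral {y0..y1} (\<lambda>y. fst (g (x0, y)))
        = - integral {x0..x1} (\<lambda>x. snd (g (x, y1)) - snd (g (x, y0)))"
      if y: "- r2 < y0" "y0 < y1" "y1 < r2" and x: "r1 < x0" "x0 < x1" "x1 < w" for x0 x1 y0 y1
    proof -
      have c: "continuous_on {y0..y1} (\<lambda>y. fst (g (k, y)))" if "k \<in> {x0, x1}" for k
        using that x y bx by (intro continuous_intros continuous_on_compose2[OF gc]) force+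
      have c': "continuous_on {x0..x1} (\<lambda>x. snd (g (x, k)))" if "k \<in> {y0, y1}" for k
        using that x y bx by (intro continuous_intros continuous_on_compose2[OF gc]) force+
      have "integral {x0..x1} (\<lambda>x. snd (g (x, y1)) - snd (g (x, y0)))
         = integral {x0..x1} (\<lambda>x. snd (g (x, y1))) - integral {x0..x1} (\<lambda>x. snd (g (x, y0)))"
        by (intro HK_integral_diff integrable_continuous_real c') auto
      moreover have "integral {y0..y1} (\<lambda>y. fst (g (x1, y)) - fst (g (x0, y)))
         = integral {y0..y1} (\<lambda>y. fst (g (x1, y))) - integral {y0..y1} (\<lambda>y. fst (g (x0, y)))"
        by (intro HK_integral_diff integrable_continuous_real c) auto
      ultimately show ?thesis using flux_box[OF bx x y] by simp
    qed
    fix A A' B B' :: "real \<Rightarrow> real" and p1 q1 q2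
    assume p: "-r2 < p1" "p1 < q1" "q1 < r2" "r1 < q2" "q2 < w"
      and A: "smooth A" "\<And>x. (A has_real_derivative A' x) (at x)" "\<And>x. x \<le> p1 \<or> q1 \<le> x \<Longrightarrow> A x = 0"
      and B: "smooth B" "\<And>x. (B has_real_derivative B' x) (at x)" "\<And>x. x \<le> r1 - (q2 - r1) \<or> q2 \<le> x \<Longrightarrow> B x = 0"
    note Ac = smooth_real_continuous[OF A(1,2)] and Bc = smooth_real_continuous[OF B(1,2)]
    have cb: "cbox (r1, p1) (q2, q1) \<subseteq> {r1..<w} \<times> {-r2<..<r2}" using p by (auto simp: cbox_Pair_eq)
    have bd: "- R1 \<le> r1 - (q2 - r1)" "q2 \<le> R1" "- R2 \<le> p1" "q1 \<le> R2"
      using p w R r by (auto)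
    have bo: "box (r1, p1) (q2, q1) \<subseteq> \<Omega>"
    proof (rule order_trans[OF _ bx], rule subsetI)
      fix z assume "z \<in> box (r1, p1) (q2, q1)"
      then show "z \<in> {r1<..<w} \<times> {- r2<..<r2}" using p by (cases z) (auto simp: mem_box Basis_prod_def)
    qed
    have e1: "integral (cbox (r1, p1) (q2, q1)) (\<lambda>(x, y). fst (g (x, y)) * (B' x * A y) + snd (g (x, y)) * (B x * A' y))
      = a * (A r2 + A (- r2)) * integral {-r1..r1} B + b * (B r1 + B (- r1)) * integral {-r2..r2} A"
    proof (rule product_identity_cbox[OF B A bd bo continuous_on_subset[OF gcT cb]])
      show "\<Omega> \<inter> cbox (r1 - (q2 - r1), p1) (q2, q1) \<subseteq> cbox (r1, p1) (q2, q1)"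
        using p w r by (auto simp: cbox_Pair_eq mem abs_le_iff)
    qed
    have z: "B (- r1) = 0" "A r2 = 0" "A (- r2) = 0" using p w by (auto intro!: A(3) B(3))
    have i: "integral {-r2..r2} A = integral {p1..q1} A"
      using p A(3) by (intro integral_support) auto
    have gcc: "continuous_on (cbox (r1, p1) (q2, q1)) g" by (rule continuous_on_subset[OF gcT cb])
    have cc: "continuous_on (cbox (r1, p1) (q2, q1)) (\<lambda>(x, y). fst (g (x, y)) * (B' x * A y) + snd (g (x, y)) * (B x * A' y))"
      unfolding case_prod_unfold prod.collapse
      by (intro continuous_intros gcc continuous_on_compose2[OF Ac(1)[of UNIV]] continuous_on_compose2[OF Ac(2)[of UNIV]]
        continuous_on_compose2[OF Bc(1)[of UNIV]] continuous_on_compose2[OF Bc(2)[of UNIV]]) auto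
    have "integral (cbox (p1, r1) (q1, q2)) (\<lambda>(y, x). snd (g (x, y)) * (A' y * B x) + fst (g (x, y)) * (A y * B' x))
       = integral (cbox (p1, r1) (q1, q2)) (\<lambda>(y, x). fst (g (x, y)) * (B' x * A y) + snd (g (x, y)) * (B x * A' y))"
      by (rule arg_cong[of _ _ "integral _"]) (auto simp: fun_eq_iff algebra_simps)
    also have "... = integral (cbox (r1, p1) (q2, q1)) (\<lambda>(x, y). fst (g (x, y)) * (B' x * A y) + snd (g (x, y)) * (B x * A' y))"
      by (rule integral_swap_2dim[OF cc, symmetric])
    finally show "integral (cbox (p1, r1) (q1, q2)) (\<lambda>(y, x). snd (g (x, y)) * (A' y * B x) + fst (g (x, y)) * (A y * B' x))
       = b * B r1 * integral {p1..q1} A"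
      using e1 z i by simp
  qed (use w assms in auto)
qed

text \<open>The reflected function is again a weak solution, so uniqueness gives equality almost
  everywhere, and continuity gives it everywhere.\<close>

lemma symmetric_v:
  assumes z: "z \<in> \<Omega>" and st: "\<bar>s\<bar> = 1" "\<bar>t\<bar> = 1"
  shows "v (mirror s t z) = v z"
proof -
  have inv: "mirror s t z \<in> \<Omega> \<longleftrightarrow> z \<in> \<Omega>" for z by (rule mirror_annulus[OF r st])
  note M = mirror_lebesgue_on[OF st Ls inv]
  have "AE x in distr (lebesgue_on \<Omega>) (lebesgue_on \<Omega>) (mirror s t). u x = v x"
    unfolding M(2) by (rule AE_u_v)
  then have 1: "AE x in lebesgue_on \<Omega>. u (mirror s t x) = v (mirror s t x)"
    by (rule AE_distrD[OF M(1)])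
  have 2: "AE x in lebesgue_on \<Omega>. u x = u (mirror s t x)"
    by (rule weak_solution_unique[OF r weak weak_solution_mirror[OF r st weak]])
  have "AE x in lebesgue_on \<Omega>. v (mirror s t x) = v x"
    using 1 2 AE_u_v by eventually_elim simp
  moreover have "continuous_on \<Omega> (\<lambda>x. v (mirror s t x))"
    by (rule continuous_on_compose2[OF vc continuous_mirror]) (use inv in auto)
  ultimately show ?thesis using AE_eq_imp_eq_on_open[OF op _ vc _ z] by blast
qed

definition "energy = (\<integral>z. (norm (g z))^2 \<partial>lebesgue_on \<Omega>)"

lemma bdd: "bounded \<Omega>" by (rule bounded_annulus)

lemma gradient_AE:
  assumes "H1 \<Omega> u gw"
  shows "AE x in lebesgue_on \<Omega>. gw x = g x"
  by (rule weak_gradient_eq_gradient[OF op bdd assms AE_u_v dv gc])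

lemma integrable_g: "integrable (lebesgue_on \<Omega>) (\<lambda>z. (norm (g z))^2)"
proof -
  obtain gw where gw: "H1 \<Omega> u gw" using weak unfolding weak_solution_def by blast
  then have "integrable (lebesgue_on \<Omega>) (\<lambda>z. (norm (gw z))^2)" by (simp add: H1_def L2_def)
  moreover have "g \<in> borel_measurable (lebesgue_on \<Omega>)" by (rule continuous_imp_measurable_on_sets_lebesgue[OF gc Ls])
  then have "(\<lambda>z. (norm (g z))^2) \<in> borel_measurable (lebesgue_on \<Omega>)" by measurable
  moreover have "AE z in lebesgue_on \<Omega>. (norm (gw z))^2 = (norm (g z))^2"
    using gradient_AE[OF gw] by eventually_elim simp
  ultimately show ?thesis using integrable_cong_AE_imp by blast
qed

lemma energy_cbox:
  assumes "cbox p q \<subseteq> \<Omega>" "\<And>z. (f z)^2 \<le> (norm (g z))^2" "continuous_on \<Omega> f"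
  shows "integral (cbox p q) (\<lambda>z. (f z)^2) \<le> energy"
proof -
  have b: "box p q \<subseteq> \<Omega>" using assms(1) box_subset_cbox by blast
  note c = continuous_on_subset[OF gc assms(1)] continuous_on_subset[OF assms(3,1)]
  have "integral (cbox p q) (\<lambda>z. (f z)^2) \<le> integral (cbox p q) (\<lambda>z. (norm (g z))^2)"
    by (intro integral_le integrable_continuous assms(2) continuous_intros c)
  also have "... \<le> energy" unfolding energy_def
    by (rule integral_cbox_le_lebesgue_integral[OF Ls b _ _ integrable_g]) (auto intro!: continuous_intros c)
  finally show ?thesis .
qed

text \<open>The energy in small balls about c tends to 0, since a point is a null set and the energy
  is finite. The mean value inequality on squares turns this into smallness of the gradient times
  the half-side.\<close>

lemma decay_g:
  assumes e: "0 < e"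
  shows "\<exists>\<delta>>0. \<forall>x y d. 0 < d \<and> cbox (x - d, y - d) (x + d, y + d) \<subseteq> \<Omega> \<inter> ball c \<delta> \<longrightarrow> norm (g (x, y)) * d \<le> e"
proof -
  define h where "h = (\<lambda>z. (norm (g z))^2)"
  note hi = integrable_g[folded h_def]
  define B where "B = (\<lambda>n. ball c (1 / real (Suc n)))"
  have "(\<lambda>n. \<integral>z. indicator (B n) z * h z \<partial>lebesgue_on \<Omega>) \<longlonglongrightarrow> (\<integral>z. 0 \<partial>lebesgue_on \<Omega>)"
  proof (rule integral_dominated_convergence[OF _ _ hi])
    have "AE z in lebesgue. z \<noteq> c" using AE_not_in[of "{c}" lebesgue] by simp
    then have "AE z in lebesgue_on \<Omega>. z \<noteq> c"
      using Ls by (auto simp: AE_restrict_space_iff elim!: eventually_mono)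
    then show "AE z in lebesgue_on \<Omega>. (\<lambda>n. indicator (B n) z * h z) \<longlonglongrightarrow> 0"
    proof eventually_elim
      fix z assume "z \<noteq> c"
      then have "eventually (\<lambda>n. 1 / real (Suc n) < dist c z) sequentially"
        using order_tendstoD(2)[OF LIMSEQ_inverse_real_of_nat, of "dist c z"] by (simp add: inverse_eq_divide)
      then have "eventually (\<lambda>n. indicator (B n) z * h z = 0) sequentially"
        by eventually_elim (simp add: B_def)
      then show "(\<lambda>n. indicator (B n) z * h z) \<longlonglongrightarrow> 0" by (rule tendsto_eventually)
    qed
    have hm: "h \<in> borel_measurable (lebesgue_on \<Omega>)" using hi by blast
    have "B n \<inter> \<Omega> \<in> sets (lebesgue_on \<Omega>)" for n
      using Ls unfolding B_def by (auto simp: sets_restrict_space)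
    then have "indicat_real (B n) \<in> borel_measurable (lebesgue_on \<Omega>)" for n
      by (simp add: borel_measurable_indicator_iff)
    then show "(\<lambda>z. indicator (B n) z * h z) \<in> borel_measurable (lebesgue_on \<Omega>)" for n
      using hm by (rule borel_measurable_times)
    show "AE z in lebesgue_on \<Omega>. norm (indicator (B n) z * h z) \<le> h z" for n
      by (intro AE_I2) (auto simp: h_def split: split_indicator)
  qed simp
  then have "(\<lambda>n. \<integral>z. indicator (B n) z * h z \<partial>lebesgue_on \<Omega>) \<longlonglongrightarrow> 0" by simp
  \<comment> \<open>The threshold matches the mean value inequality on half-side d/2: pi (d/2)^2
    |g|^2 is at most twice the energy, and pi \<ge> 2.\<close>
  then have "eventually (\<lambda>n. (\<integral>z. indicator (B n) z * h z \<partial>lebesgue_on \<Omega>) < e^2 / 4) sequentially"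
    using e by (intro order_tendstoD(2)) auto
  then obtain n where n: "(\<integral>z. indicator (B n) z * h z \<partial>lebesgue_on \<Omega>) < e^2 / 4"
    unfolding eventually_sequentially by blast
  have Bs: "\<Omega> \<inter> B n \<in> sets lebesgue" using Ls by (auto simp: B_def)
  have eqI: "(\<integral>z. h z \<partial>lebesgue_on (\<Omega> \<inter> B n)) = (\<integral>z. indicator (B n) z * h z \<partial>lebesgue_on \<Omega>)"
    using Bs Ls by (simp add: integral_restrict_space indicator_inter_arith mult.assoc)
  have hiB: "integrable (lebesgue_on (\<Omega> \<inter> B n)) h"
    using set_integrable_subset[of lebesgue \<Omega> h "\<Omega> \<inter> B n"] hi Bs Ls
    by (simp add: integrable_restrict_space set_integrable_def)
  show ?thesis
  proof (intro exI[of _ "1 / real (Suc n)"] conjI allI impI)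
    fix x y d assume d: "0 < d \<and> cbox (x - d, y - d) (x + d, y + d) \<subseteq> \<Omega> \<inter> ball c (1 / real (Suc n))"
    define S where "S = box (Complex x y - Complex d d) (Complex x y + Complex d d)"
    have "(Re z, Im z) \<in> cbox (x - d, y - d) (x + d, y + d)" if "z \<in> S" for z
      using that by (auto simp: S_def in_box_complex_iff cbox_Pair_eq)
    then have "cgrad g field_differentiable at z" if "z \<in> S" for z
      using that d by (intro cgrad_differentiable) blast
    then have hol: "cgrad g holomorphic_on S"
      by (auto simp: holomorphic_on_def intro: field_differentiable_at_within)
    have sub: "cbox (x - d / 2, y - d / 2) (x + d / 2, y + d / 2) \<subseteq> cbox (x - d, y - d) (x + d, y + d)"
      using d by (auto simp: cbox_Pair_eq)
    have sub2: "cbox (x - d / 2, y - d / 2) (x + d / 2, y + d / 2) \<subseteq> \<Omega> \<inter> B n"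
      using sub d unfolding B_def by blast
    have "pi * (d / 2)^2 * (norm (cgrad g (Complex x y)))^2 \<le> 2 * integral
       (cbox (Re (Complex x y) - d / 2, Im (Complex x y) - d / 2) (Re (Complex x y) + d / 2, Im (Complex x y) + d / 2))
       (\<lambda>z. (norm (cgrad g (Complex (fst z) (snd z))))^2)"
    proof (rule square_mean_square_bound[OF _ _ hol])
      show "open S" "convex S" unfolding S_def by (rule open_box convex_box)+
      show "cbox (Complex x y - Complex (d / 2) (d / 2)) (Complex x y + Complex (d / 2) (d / 2)) \<subseteq> S"
        using d by (auto simp: S_def in_box_complex_iff in_cbox_complex_iff)
    qed (use d in simp)
    also have "... = 2 * integral (cbox (x - d / 2, y - d / 2) (x + d / 2, y + d / 2)) h"
      by (simp add: norm_cgrad h_def)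
    also have "integral (cbox (x - d / 2, y - d / 2) (x + d / 2, y + d / 2)) h \<le> (\<integral>z. h z \<partial>lebesgue_on (\<Omega> \<inter> B n))"
    proof (rule integral_cbox_le_lebesgue_integral[OF Bs _ _ _ hiB])
      show "box (x - d / 2, y - d / 2) (x + d / 2, y + d / 2) \<subseteq> \<Omega> \<inter> B n" using sub2 box_subset_cbox by blast
      show "continuous_on (cbox (x - d / 2, y - d / 2) (x + d / 2, y + d / 2)) h"
        unfolding h_def by (intro continuous_intros continuous_on_subset[OF gc]) (use sub2 in blast)
    qed (simp add: h_def)
    finally have 1: "pi * (d / 2)^2 * (norm (g (x, y)))^2 \<le> 2 * (e^2 / 4)"
      using n unfolding eqI by (simp add: norm_cgrad)
    have "2 * (d / 2)^2 * (norm (g (x, y)))^2 \<le> pi * (d / 2)^2 * (norm (g (x, y)))^2"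
      using pi_ge_two by (intro mult_right_mono) auto
    moreover have "2 * (d / 2)^2 * (norm (g (x, y)))^2 = (norm (g (x, y)) * d)^2 / 2"
      by (simp only: power2_eq_square) simp
    ultimately have "(norm (g (x, y)) * d)^2 \<le> e^2" using 1 by linarith
    then show "norm (g (x, y)) * d \<le> e" by (rule power2_le_imp_le) (use e in simp)
  qed simp
qed

text \<open>The strip estimates hold for smooth functions. Along the sequence that defines the zero
  outer trace, the boundary term tends to 0 and the energies converge, so only the term quadratic in
  m survives for v.\<close>

lemma strip_limit:
  assumes sub: "cbox p q \<subseteq> \<Omega>" "cbox p q \<subseteq> cbox P Q"
    and bound: "\<And>\<psi> d\<psi>. smooth \<psi> \<Longrightarrow> (\<And>z. GDERIV \<psi> z :> d\<psi> z) \<Longrightarrow> L2 (lebesgue_on \<Omega>) d\<psi> \<Longrightarrow>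
      integral (cbox P Q) (\<lambda>z. (\<psi> z)^2) \<le> m * (2 * (\<integral>z. (\<psi> z)^2 \<partial>bdry_measure R1 R2) + 2 * m * (\<integral>z. (norm (d\<psi> z))^2 \<partial>lebesgue_on \<Omega>))"
  shows "integral (cbox p q) (\<lambda>z. (v z)^2) \<le> 2 * m^2 * energy"
proof -
  have tr: "has_trace \<Omega> (bdry_measure R1 R2) u (\<lambda>_. 0)"
    using weak unfolding weak_solution_def R1_def R2_def by (rule conjunct1)
  obtain gt \<psi> d\<psi> where T: "H1 \<Omega> u gt" "\<And>n. smooth (\<psi> n)" "\<And>n x. GDERIV (\<psi> n) x :> d\<psi> n x"
    "L2_tendsto (lebesgue_on \<Omega>) \<psi> u" "L2_tendsto (lebesgue_on \<Omega>) d\<psi> gt"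
    "L2_tendsto (bdry_measure R1 R2) \<psi> (\<lambda>_. 0)"
    using tr unfolding has_trace_def by blast
  let ?i = "\<lambda>f z. indicator (cbox p q) z *\<^sub>R f z :: real"
  have L: "(\<integral>z. (norm (?i f z))^2 \<partial>lebesgue_on \<Omega>) = integral (cbox p q) (\<lambda>z. (f z)^2)" if c: "continuous_on (cbox p q) f" for f
  proof -
    have "(\<integral>z. (norm (?i f z))^2 \<partial>lebesgue_on \<Omega>) = integral (cbox p q) (\<lambda>z. (norm (?i f z))^2)"
    proof (rule lebesgue_integral_eq_cbox[OF Ls])
      show "box p q \<subseteq> \<Omega>" using sub box_subset_cbox by blast
      have "continuous_on (cbox p q) (\<lambda>z. (f z)^2)" by (intro continuous_intros c)
      then show "continuous_on (cbox p q) (\<lambda>z. (norm (?i f z))^2)"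
        by (rule continuous_on_eq) simp
    qed simp
    also have "... = integral (cbox p q) (\<lambda>z. (f z)^2)" by (intro HK_integral_cong) simp
    finally show ?thesis .
  qed
  have \<psi>c: "continuous_on S (\<psi> n)" for S n by (rule smooth_imp_continuous[OF T(2)])
  have "cbox p q \<inter> \<Omega> \<in> sets lebesgue" using sub(1) by (simp add: Int_absorb2)
  then have Im: "cbox p q \<inter> space (lebesgue_on \<Omega>) \<in> sets (lebesgue_on \<Omega>)"
    using Ls by (simp add: sets_restrict_space_iff)
  have "(\<lambda>n. \<integral>z. (norm (?i (\<psi> n) z))^2 \<partial>lebesgue_on \<Omega>) \<longlonglongrightarrow> (\<integral>z. (norm (?i u z))^2 \<partial>lebesgue_on \<Omega>)"
    by (rule L2_tendsto_norm, rule L2_tendsto_indicator[OF T(4) Im])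
  moreover have "(\<integral>z. (norm (?i u z))^2 \<partial>lebesgue_on \<Omega>) = (\<integral>z. (norm (?i v z))^2 \<partial>lebesgue_on \<Omega>)"
  proof (rule integral_cong_AE)
    have Lu: "L2 (lebesgue_on \<Omega>) u" using T(1) by (simp add: H1_def)
    have i: "indicat_real (cbox p q) \<in> borel_measurable (lebesgue_on \<Omega>)"
      using Im by (simp only: borel_measurable_indicator_iff)
    show "(\<lambda>z. (norm (?i u z))^2) \<in> borel_measurable (lebesgue_on \<Omega>)"
      using i L2_measurable[OF Lu] by measurable
    show "(\<lambda>z. (norm (?i v z))^2) \<in> borel_measurable (lebesgue_on \<Omega>)"
      using i continuous_imp_measurable_on_sets_lebesgue[OF vc Ls] by measurable
    show "AE z in lebesgue_on \<Omega>. (norm (?i u z))^2 = (norm (?i v z))^2"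
      using AE_u_v by eventually_elim simp
  qed
  ultimately have lim: "(\<lambda>n. integral (cbox p q) (\<lambda>z. (\<psi> n z)^2)) \<longlonglongrightarrow> integral (cbox p q) (\<lambda>z. (v z)^2)"
    unfolding L[OF \<psi>c] L[OF continuous_on_subset[OF vc sub(1)]] by simp
  have "(\<lambda>n. \<integral>z. (norm (\<psi> n z))^2 \<partial>bdry_measure R1 R2) \<longlonglongrightarrow> 0" using L2_tendsto_norm[OF T(6)] by simp
  then have lb: "(\<lambda>n. \<integral>z. (\<psi> n z)^2 \<partial>bdry_measure R1 R2) \<longlonglongrightarrow> 0" by simp
  have "(\<integral>z. (norm (gt z))^2 \<partial>lebesgue_on \<Omega>) = energy"
    unfolding energy_def
  proof (rule integral_cong_AE)
    have "L2 (lebesgue_on \<Omega>) gt" using T(1) by (simp add: H1_def)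
    then show "(\<lambda>z. (norm (gt z))^2) \<in> borel_measurable (lebesgue_on \<Omega>)" by (intro borel_measurable_integrable L2_integrable)
    show "(\<lambda>z. (norm (g z))^2) \<in> borel_measurable (lebesgue_on \<Omega>)" by (rule borel_measurable_integrable[OF integrable_g])
    show "AE z in lebesgue_on \<Omega>. (norm (gt z))^2 = (norm (g z))^2"
      using gradient_AE[OF T(1)] by eventually_elim simp
  qed
  then have le: "(\<lambda>n. \<integral>z. (norm (d\<psi> n z))^2 \<partial>lebesgue_on \<Omega>) \<longlonglongrightarrow> energy" using L2_tendsto_norm[OF T(5)] by simp
  have "(\<lambda>n. m * (2 * (\<integral>z. (\<psi> n z)^2 \<partial>bdry_measure R1 R2) + 2 * m * (\<integral>z. (norm (d\<psi> n z))^2 \<partial>lebesgue_on \<Omega>)))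
    \<longlonglongrightarrow> m * (2 * 0 + 2 * m * energy)"
    by (intro tendsto_intros lb le)
  then have "integral (cbox p q) (\<lambda>z. (v z)^2) \<le> m * (2 * 0 + 2 * m * energy)"
  proof (rule LIMSEQ_le[OF lim], intro exI allI impI)
    fix n :: nat
    have Ld: "L2 (lebesgue_on \<Omega>) (d\<psi> n)" using T(5) by (simp add: L2_tendsto_def)
    have "integral (cbox p q) (\<lambda>z. (\<psi> n z)^2) \<le> integral (cbox P Q) (\<lambda>z. (\<psi> n z)^2)"
      by (intro integral_subset_le sub integrable_continuous continuous_intros \<psi>c) auto
    also note bound[OF T(2,3) Ld]
    finally show "integral (cbox p q) (\<lambda>z. (\<psi> n z)^2) \<le> m * (2 * (\<integral>z. (\<psi> n z)^2 \<partial>bdry_measure R1 R2) + 2 * m * (\<integral>z. (norm (d\<psi> n z))^2 \<partial>lebesgue_on \<Omega>))" .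
  qed
  then show ?thesis by (simp add: power2_eq_square mult_ac)
qed

lemma trace_t:
  assumes x: "- R1 < x0" "x0 < x1" "x1 < R1"
  shows "((\<lambda>s. integral {x0..x1} (\<lambda>x. v (x, R2 - s))) \<longlongrightarrow> 0) (at_right 0)"
proof (rule slice_integral_tendsto_0[where ?s0.0 = "(R2 - r2) / 2" and E = energy and ?f2.0 = "\<lambda>x t. snd (g (x, t))", OF _ x(2)])
  have sub: "{x0..x1} \<times> {R2 - 2 * ((R2 - r2) / 2)<..<R2} \<subseteq> \<Omega>" using x R r by (auto simp: mem abs_less_iff field_simps)
  show "continuous_on ({x0..x1} \<times> {R2 - 2 * ((R2 - r2) / 2)<..<R2}) (\<lambda>(x, t). v (x, t))"
    "continuous_on ({x0..x1} \<times> {R2 - 2 * ((R2 - r2) / 2)<..<R2}) (\<lambda>(x, t). snd (g (x, t)))"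
    unfolding case_prod_unfold prod.collapse by (intro continuous_intros continuous_on_subset[OF gc sub] continuous_on_subset[OF vc sub])+
  show "((\<lambda>t. v (x, t)) has_real_derivative snd (g (x, t))) (at t)"
    if "x \<in> {x0..x1}" "R2 - 2 * ((R2 - r2) / 2) < t" "t < R2" for x t
    by (rule GDERIV_partial_snd[OF dv]) (use sub that in auto)
  fix s assume s: "0 < s" "s < (R2 - r2) / 2"
  have cb: "cbox (x0, R2 - 2 * s) (x1, R2 - s) \<subseteq> \<Omega>"
    by (rule order_trans[OF _ sub]) (use s in \<open>auto simp: cbox_Pair_eq field_simps\<close>)
  \<comment> \<open>The strip reaching from R2 - 2s to the outer side has width 2s, which produces
    the 8 s^2 demanded by \<open>slice_integral_tendsto_0\<close>.\<close>
  have "integral (cbox (x0, R2 - 2 * s) (x1, R2 - s)) (\<lambda>z. (v z)^2) \<le> 2 * (R2 - (R2 - 2 * s))^2 * energy"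
    by (rule strip_limit[OF cb _ outer_strip_bounds(2)]) (use s x in \<open>auto simp: cbox_Pair_eq\<close>)
  then show "integral (cbox (x0, R2 - 2 * s) (x1, R2 - s)) (\<lambda>(x, t). (v (x, t))^2) \<le> 8 * s^2 * energy"
    by (simp add: case_prod_unfold power_mult_distrib)
  show "integral (cbox (x0, R2 - 2 * s) (x1, R2 - s)) (\<lambda>(x, t). (snd (g (x, t)))^2) \<le> energy"
    unfolding case_prod_unfold prod.collapse
    by (rule energy_cbox[OF cb]) (auto simp: norm_prod_def intro!: continuous_intros gc)
qed (use R in simp)

lemma trace_r:
  assumes y: "- R2 < y0" "y0 < y1" "y1 < R2"
  shows "((\<lambda>s. integral {y0..y1} (\<lambda>y. v (R1 - s, y))) \<longlongrightarrow> 0) (at_right 0)"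
proof (rule slice_integral_tendsto_0[where ?s0.0 = "(R1 - r1) / 2" and E = energy and f = "\<lambda>y x. v (x, y)" and ?f2.0 = "\<lambda>y x. fst (g (x, y))", OF _ y(2)])
  have sub: "{R1 - 2 * ((R1 - r1) / 2)<..<R1} \<times> {y0..y1} \<subseteq> \<Omega>" using y R r by (auto simp: mem abs_less_iff field_simps)
  show "continuous_on ({y0..y1} \<times> {R1 - 2 * ((R1 - r1) / 2)<..<R1}) (\<lambda>(x, t). v (t, x))"
    "continuous_on ({y0..y1} \<times> {R1 - 2 * ((R1 - r1) / 2)<..<R1}) (\<lambda>(x, t). fst (g (t, x)))"
    unfolding case_prod_unfold
    by (intro continuous_intros continuous_on_compose2[OF gc] continuous_on_compose2[OF vc]; use sub in auto)+
  show "((\<lambda>t. v (t, x)) has_real_derivative fst (g (t, x))) (at t)"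
    if "x \<in> {y0..y1}" "R1 - 2 * ((R1 - r1) / 2) < t" "t < R1" for x t
    by (rule GDERIV_partial_fst[OF dv]) (use sub that in auto)
  fix s assume s: "0 < s" "s < (R1 - r1) / 2"
  have cb: "cbox (R1 - 2 * s, y0) (R1 - s, y1) \<subseteq> \<Omega>"
    by (rule order_trans[OF _ sub]) (use s in \<open>auto simp: cbox_Pair_eq field_simps\<close>)
  have swap: "integral (cbox (y0, R1 - 2 * s) (y1, R1 - s)) (\<lambda>(x, t). f (t, x)) = integral (cbox (R1 - 2 * s, y0) (R1 - s, y1)) f"
    if "continuous_on \<Omega> f" for f :: "real \<times> real \<Rightarrow> real"
    using integral_swap_2dim[of "R1 - 2 * s" y0 "R1 - s" y1 "\<lambda>x y. f (x, y)"] continuous_on_subset[OF that cb] by simp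
  have "integral (cbox (R1 - 2 * s, y0) (R1 - s, y1)) (\<lambda>z. (v z)^2) \<le> 2 * (R1 - (R1 - 2 * s))^2 * energy"
    by (rule strip_limit[OF cb _ outer_strip_bounds(4)]) (use s y in \<open>auto simp: cbox_Pair_eq\<close>)
  moreover have "continuous_on \<Omega> (\<lambda>z. (v z)^2)" by (intro continuous_intros vc)
  ultimately show "integral (cbox (y0, R1 - 2 * s) (y1, R1 - s)) (\<lambda>(x, t). (v (t, x))^2) \<le> 8 * s^2 * energy"
    using swap[of "\<lambda>z. (v z)^2"] by (simp add: power_mult_distrib)
  have "integral (cbox (R1 - 2 * s, y0) (R1 - s, y1)) (\<lambda>z. (fst (g z))^2) \<le> energy"
    by (rule energy_cbox[OF cb]) (auto simp: norm_prod_def intro!: continuous_intros gc)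
  moreover have "continuous_on \<Omega> (\<lambda>z. (fst (g z))^2)" by (intro continuous_intros gc)
  ultimately show "integral (cbox (y0, R1 - 2 * s) (y1, R1 - s)) (\<lambda>(x, t). (fst (g (t, x)))^2) \<le> energy"
    using swap[of "\<lambda>z. (fst (g z))^2"] by simp
qed (use R in simp)

lemma annulus_solution: "annulus_solution r1 r2 lam a b v g"
proof unfold_locales
  show "snd (g z) = - a" if "z \<in> top_side r1 r2" for z
    using that neumann_t by (auto simp: top_side_def)
  show "fst (g z) = - b" if "z \<in> right_side r1 r2" for z
    using that neumann_r by (auto simp: right_side_def)
  show "continuous_on (\<Omega> \<union> top_side r1 r2 \<union> right_side r1 r2) v"
    "continuous_on (\<Omega> \<union> top_side r1 r2 \<union> right_side r1 r2) g"
    using ext by (auto simp: C1_extension_def)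
qed (fact ab dv cgrad_differentiable decay_g symmetric_v trace_t trace_r)+

end

section \<open>Extension by limits, maximum principles and symmetries\<close>

lemma continuous_extension_by_limits:
  fixes f :: "'a::metric_space \<Rightarrow> 'b::metric_space"
  assumes ST: "S \<subseteq> T" "T \<subseteq> closure S" and f: "continuous_on S f"
    and lim: "\<And>x. x \<in> T \<Longrightarrow> x \<notin> S \<Longrightarrow> \<exists>l. (f \<longlongrightarrow> l) (at x within S)"
  obtains F where "continuous_on T F" "\<And>x. x \<in> S \<Longrightarrow> F x = f x" "\<And>x. x \<in> T \<Longrightarrow> (f \<longlongrightarrow> F x) (at x within S)"
proof -
  obtain L where L: "\<And>x. x \<in> T \<Longrightarrow> x \<notin> S \<Longrightarrow> (f \<longlongrightarrow> L x) (at x within S)" using lim by metis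
  define F where "F = (\<lambda>x. if x \<in> S then f x else L x)"
  have FS: "F x = f x" if "x \<in> S" for x using that by (simp add: F_def)
  have lim: "(f \<longlongrightarrow> F x) (at x within S)" if "x \<in> T" for x
    using L[OF that] f by (auto simp: F_def continuous_on_def)
  have near: "\<exists>\<delta>>0. \<forall>y\<in>S. dist y x < \<delta> \<longrightarrow> dist (f y) (F x) < e" if xe: "x \<in> T" "0 < e" for x e
  proof -
    obtain \<delta> where "0 < \<delta>" "\<And>y. y \<in> S \<Longrightarrow> y \<noteq> x \<Longrightarrow> dist y x < \<delta> \<Longrightarrow> dist (f y) (F x) < e"
      using tendstoD[OF lim[OF xe(1)] xe(2)] by (auto simp: eventually_at)
    moreover have "dist (f x) (F x) < e" if "x \<in> S" using that FS \<open>0 < e\<close> by simp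
    ultimately show ?thesis by metis
  qed
  have "continuous_on T F"
    unfolding continuous_on_iff
  proof (intro ballI allI impI)
    fix x and e :: real assume x: "x \<in> T" "0 < e"
    obtain \<delta> where \<delta>: "0 < \<delta>" "\<And>y. y \<in> S \<Longrightarrow> dist y x < \<delta> \<Longrightarrow> dist (f y) (F x) < e / 2"
      using near[of x "e / 2"] x by auto
    show "\<exists>d>0. \<forall>x'\<in>T. dist x' x < d \<longrightarrow> dist (F x') (F x) < e"
    proof (intro exI[of _ "\<delta> / 2"] conjI ballI impI)
      fix y assume y: "y \<in> T" "dist y x < \<delta> / 2"
      obtain \<eta> where \<eta>: "0 < \<eta>" "\<And>z. z \<in> S \<Longrightarrow> dist z y < \<eta> \<Longrightarrow> dist (f z) (F y) < e / 2"
        using near[of y "e / 2"] y x by auto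
      have "y \<in> closure S" using y ST by blast
      then obtain s where s: "s \<in> S" "dist s y < min \<eta> (\<delta> / 2)"
        using closure_approachable[of y S] \<eta> \<delta> by (metis half_gt_zero min_less_iff_conj)
      have "dist s x < \<delta>" using dist_triangle[of s x y] s y by simp
      then have "dist (f s) (F x) < e / 2" "dist (f s) (F y) < e / 2" using \<delta> \<eta> s by auto
      then show "dist (F y) (F x) < e" using dist_triangle2[of "F y" "F x" "f s"] by (simp add: dist_commute)
    qed (use \<delta> in simp)
  qed
  then show ?thesis using that FS lim by blast
qed

text \<open>The modulus of exp F is exp (Re F), so the maximum modulus principle for exp F is the
  maximum principle for Re F.\<close>

lemma real_part_max_imp_constant:
  assumes "F holomorphic_on ball z e" "\<And>w. w \<in> ball z e \<Longrightarrow> Re (F w) \<le> Re (F z)" and w: "w \<in> ball z e"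
  shows "Re (F w) = Re (F z)"
proof -
  have z: "z \<in> ball z e" using w by (metis centre_in_ball ball_eq_empty empty_iff not_le)
  have "(\<lambda>w. exp (F w)) constant_on ball z e"
    by (rule maximum_modulus_principle[of _ _ "ball z e" z]) (use assms z in \<open>auto intro!: holomorphic_intros\<close>)
  then have "exp (F w) = exp (F z)" using z w by (auto simp: constant_on_def)
  then have "norm (exp (F w)) = norm (exp (F z))" by simp
  then show ?thesis by simp
qed

text \<open>Since f is real on the diameter, Schwarz reflection turns the boundary maximum at 0 into
  an interior one. This replaces Hopf's boundary lemma.\<close>

lemma half_disc_real_part_max:
  assumes hol: "f holomorphic_on (ball 0 e \<inter> {z. 0 < Im z})" and cont: "continuous_on (ball 0 e \<inter> {z. 0 \<le> Im z}) f"
    and real: "\<And>z. z \<in> ball 0 e \<Longrightarrow> Im z = 0 \<Longrightarrow> Im (f z) = 0"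
    and le: "\<And>z. z \<in> ball 0 e \<Longrightarrow> 0 \<le> Im z \<Longrightarrow> Re (f z) \<le> Re (f 0)"
    and w: "w \<in> ball 0 e" "0 \<le> Im w"
  shows "Re (f w) = Re (f 0)"
proof -
  define F where "F = (\<lambda>z. if 0 \<le> Im z then f z else cnj (f (cnj z)))"
  have "F holomorphic_on ball 0 e"
    unfolding F_def
    by (rule Schwarz_reflection[OF open_ball _ hol cont]) (use real in \<open>auto simp: complex_is_Real_iff\<close>)
  moreover have "Re (F z) \<le> Re (F 0)" if "z \<in> ball 0 e" for z
    using le[of z] le[of "cnj z"] that by (auto simp: F_def)
  ultimately have "Re (F w) = Re (F 0)" using w by (intro real_part_max_imp_constant)
  then show ?thesis using w by (simp add: F_def)
qed

context annulus_geometry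
begin

lemma closure_iff: "(x, y) \<in> closure \<Omega> \<longleftrightarrow> \<bar>x\<bar> \<le> R1 \<and> \<bar>y\<bar> \<le> R2 \<and> \<not> (\<bar>x\<bar> < r1 \<and> \<bar>y\<bar> < r2)"
proof
  have "closed {z :: real \<times> real. \<bar>fst z\<bar> \<le> R1 \<and> \<bar>snd z\<bar> \<le> R2 \<and> (r1 \<le> \<bar>fst z\<bar> \<or> r2 \<le> \<bar>snd z\<bar>)}"
    by (intro closed_Collect_conj closed_Collect_disj closed_Collect_le continuous_intros)
  moreover have "\<Omega> \<subseteq> {z. \<bar>fst z\<bar> \<le> R1 \<and> \<bar>snd z\<bar> \<le> R2 \<and> (r1 \<le> \<bar>fst z\<bar> \<or> r2 \<le> \<bar>snd z\<bar>)}"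
    by (auto simp: mem)
  ultimately have "closure \<Omega> \<subseteq> {z. \<bar>fst z\<bar> \<le> R1 \<and> \<bar>snd z\<bar> \<le> R2 \<and> (r1 \<le> \<bar>fst z\<bar> \<or> r2 \<le> \<bar>snd z\<bar>)}"
    by (rule closure_minimal[rotated])
  then show "(x, y) \<in> closure \<Omega> \<Longrightarrow> \<bar>x\<bar> \<le> R1 \<and> \<bar>y\<bar> \<le> R2 \<and> \<not> (\<bar>x\<bar> < r1 \<and> \<bar>y\<bar> < r2)" by force
next
  assume K: "\<bar>x\<bar> \<le> R1 \<and> \<bar>y\<bar> \<le> R2 \<and> \<not> (\<bar>x\<bar> < r1 \<and> \<bar>y\<bar> < r2)"
  \<comment> \<open>The gauge of the inner rectangle: the annulus is the region 1 < N < lam, and the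
    claim concerns points with 1 \<le> N \<le> lam.\<close>
  define N where "N = (\<lambda>(x, y). max (\<bar>x\<bar> / r1) (\<bar>y\<bar> / r2))"
  define m where "m = N (x, y)"
  have mem_N: "z \<in> \<Omega> \<longleftrightarrow> 1 < N z \<and> N z < lam" for z
    using r by (cases z) (auto simp: N_def mem R1_def R2_def less_max_iff_disj not_le field_simps)
  have m: "1 \<le> m" "m \<le> lam"
    using K r by (auto simp: m_def N_def R1_def R2_def le_max_iff_disj not_less field_simps)
  \<comment> \<open>A radial motion along which the gauge changes linearly from m to the middle
    value (1 + lam) / 2, and so enters the annulus at once.\<close>
  define p where "p = (\<lambda>t. (1 + t * ((1 + lam) / (2 * m) - 1)) *\<^sub>R (x, y))"
  have "N (c *\<^sub>R (x, y)) = c * m" if "0 \<le> c" for c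
    using that by (simp add: N_def m_def abs_mult max_mult_distrib_left)
  moreover have e: "(1 + t * ((1 + lam) / (2 * m) - 1)) * m = (1 - t) * m + t * ((1 + lam) / 2)" for t
    using m by (simp add: field_simps)
  moreover have "0 \<le> 1 + t * ((1 + lam) / (2 * m) - 1)" if t: "0 < t" "t < 1" for t
  proof -
    have "0 \<le> t * ((1 + lam) / (2 * m))" using m r t by simp
    then show ?thesis using t by (simp add: algebra_simps)
  qed
  ultimately have Np: "N (p t) = (1 - t) * m + t * ((1 + lam) / 2)" if "0 < t" "t < 1" for t
    using that unfolding p_def by metis
  have "p t \<in> \<Omega>" if t: "0 < t" "t < 1" for t
  proof -
    have "(1 - t) * 1 \<le> (1 - t) * m" "(1 - t) * m \<le> (1 - t) * lam" using t m by (auto intro!: mult_left_mono)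
    moreover have "t * 1 < t * ((1 + lam) / 2)" "t * ((1 + lam) / 2) < t * lam" using t r by (intro mult_strict_left_mono; simp)+
    ultimately have "1 < (1 - t) * m + t * ((1 + lam) / 2)" "(1 - t) * m + t * ((1 + lam) / 2) < lam"
      by (simp only: left_diff_distrib; linarith)+
    then show ?thesis unfolding mem_N Np[OF t] by simp
  qed
  then have "eventually (\<lambda>t. p t \<in> closure \<Omega>) (at_right 0)"
    using closure_subset[of \<Omega>] by (intro eventually_at_rightI[of 0 1]) auto
  moreover have "(p \<longlongrightarrow> (1 + 0 * ((1 + lam) / (2 * m) - 1)) *\<^sub>R (x, y)) (at_right 0)"
    unfolding p_def by (intro tendsto_intros)
  ultimately show "(x, y) \<in> closure \<Omega>"
    using Lim_in_closed_set[OF closed_closure, of p \<Omega> "at_right 0" "(x, y)"] by simp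
qed

end

context annulus_solution
begin

lemma sym_g:
  assumes z: "z \<in> \<Omega>" and st: "\<bar>s\<bar> = 1" "\<bar>t\<bar> = 1"
  shows "g (mirror s t z) = mirror s t (g z)"
proof -
  have "mirror s t z \<in> \<Omega>" using z mirror_annulus[OF r st] by simp
  then have "GDERIV (\<lambda>z. v (mirror s t z)) z :> mirror s t (g (mirror s t z))" by (intro GDERIV_mirror grad)
  then have "GDERIV v z :> mirror s t (g (mirror s t z))"
    by (rule GDERIV_transform_within_open[OF _ op z]) (rule sym[OF _ st])
  then have "g z = mirror s t (g (mirror s t z))" by (rule GDERIV_unique[OF grad[OF z]])
  then show ?thesis by (simp add: mirror_mirror[OF st])
qed

text \<open>Reflection in the diagonal exchanges top and right sides and the data a and b. Every
  statement about the right side is thereby reduced to one about the top side.\<close>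

lemma swapped: "annulus_solution r2 r1 lam b a (\<lambda>z. v (prod.swap z)) (\<lambda>z. prod.swap (g (prod.swap z)))"
proof -
  interpret S: annulus_geometry r2 r1 lam using r by unfold_locales
  have SR: "S.R1 = R2" "S.R2 = R1" by (simp_all add: S.R1_def S.R2_def R1_def R2_def)
  have mem_swap: "z \<in> S.\<Omega> \<longleftrightarrow> prod.swap z \<in> \<Omega>" for z by (cases z) (auto simp: mem S.mem SR)
  have csw: "continuous_on A (prod.swap :: real \<times> real \<Rightarrow> _)" for A by (simp add: prod.swap_def continuous_intros)
  have "z \<in> S.\<Omega> \<union> top_side r2 r1 \<union> right_side r2 r1 \<Longrightarrow> prod.swap z \<in> \<Omega> \<union> top_side r1 r2 \<union> right_side r1 r2" for z
    using mem_swap by (auto simp: top_side_def right_side_def)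
  then have im: "prod.swap ` (S.\<Omega> \<union> top_side r2 r1 \<union> right_side r2 r1) \<subseteq> \<Omega> \<union> top_side r1 r2 \<union> right_side r1 r2" by blast
  show ?thesis
  proof unfold_locales
    show "GDERIV (\<lambda>z. v (prod.swap z)) z :> prod.swap (g (prod.swap z))" if "z \<in> S.\<Omega>" for z
    proof -
      have "(prod.swap has_derivative prod.swap) (at z)"
        unfolding prod.swap_def by (auto intro!: derivative_eq_intros)
      from diff_chain_at[OF this grad[unfolded gderiv_def], OF that[unfolded mem_swap]] show ?thesis
        by (simp add: gderiv_def o_def inner_prod_def prod.swap_def add.commute)
    qed
    show "cgrad (\<lambda>z. prod.swap (g (prod.swap z))) field_differentiable at p" if "(Re p, Im p) \<in> S.\<Omega>" for p
    proof -
      \<comment> \<open>In complex notation the swap is z \<mapsto> \<i> cnj z, and the new complex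
        gradient is -\<i> times the conjugate of the old one after this map, hence again
        holomorphic.\<close>
      have "(Re (\<i> * cnj p), Im (\<i> * cnj p)) \<in> \<Omega>" using that by (simp add: mem_swap)
      from differentiable[OF this] obtain D where D: "(cgrad g has_field_derivative D) (at (\<i> * cnj p))"
        by (auto simp: field_differentiable_def)
      have "((\<lambda>w. cgrad g (\<i> * w)) has_field_derivative D * \<i>) (at (cnj p))"
        by (rule DERIV_chain2[of "cgrad g" D "\<lambda>w. \<i> * w" "cnj p", OF D]) (auto intro!: derivative_eq_intros)
      from has_field_derivative_cnj_cnj[OF this]
      have "((\<lambda>w. - \<i> * cnj (cgrad g (\<i> * cnj w))) has_field_derivative - \<i> * cnj (D * \<i>)) (at p)"
        unfolding o_def by (rule DERIV_cmult)
      moreover have "(\<lambda>w. - \<i> * cnj (cgrad g (\<i> * cnj w))) = cgrad (\<lambda>z. prod.swap (g (prod.swap z)))"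
        by (auto simp: fun_eq_iff cgrad_def complex_eq_iff)
      ultimately show ?thesis by (auto simp: field_differentiable_def)
    qed
    show "\<exists>\<delta>>0. \<forall>x y d. 0 < d \<and> cbox (x - d, y - d) (x + d, y + d) \<subseteq> S.\<Omega> \<inter> ball c \<delta> \<longrightarrow>
      norm (prod.swap (g (prod.swap (x, y)))) * d \<le> e" if e: "0 < e" for e c
    proof -
      obtain \<delta> where \<delta>: "\<delta> > 0" "\<And>x y d. 0 < d \<and> cbox (x - d, y - d) (x + d, y + d) \<subseteq> \<Omega> \<inter> ball (prod.swap c) \<delta> \<Longrightarrow> norm (g (x, y)) * d \<le> e"
        using decay[OF e, of "prod.swap c"] by blast
      have n: "norm (prod.swap w) = norm w" for w :: "real \<times> real" by (simp add: norm_prod_def add.commute)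
      show ?thesis
      proof (intro exI[of _ \<delta>] conjI allI impI \<delta>(1))
        fix x y d assume d: "0 < d \<and> cbox (x - d, y - d) (x + d, y + d) \<subseteq> S.\<Omega> \<inter> ball c \<delta>"
        have "cbox (y - d, x - d) (y + d, x + d) \<subseteq> \<Omega> \<inter> ball (prod.swap c) \<delta>"
        proof
          fix z assume "z \<in> cbox (y - d, x - d) (y + d, x + d)"
          then have "prod.swap z \<in> cbox (x - d, y - d) (x + d, y + d)" by (auto simp: cbox_Pair_eq)
          then have "prod.swap z \<in> S.\<Omega> \<inter> ball c \<delta>" using d by blast
          moreover have "dist (prod.swap c) z = dist c (prod.swap z)"
            by (simp add: dist_prod_def add.commute)
          ultimately show "z \<in> \<Omega> \<inter> ball (prod.swap c) \<delta>" by (simp add: mem_swap)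
        qed
        then show "norm (prod.swap (g (prod.swap (x, y)))) * d \<le> e" using \<delta>(2)[of d y x] d by (simp add: n)
      qed
    qed
    show "v (prod.swap (mirror s t z)) = v (prod.swap z)" if "z \<in> S.\<Omega>" "\<bar>s\<bar> = 1" "\<bar>t\<bar> = 1" for z s t
      using sym[of "prod.swap z" t s] that by (simp add: mem_swap mirror_def)
    show "continuous_on (S.\<Omega> \<union> top_side r2 r1 \<union> right_side r2 r1) (\<lambda>z. v (prod.swap z))"
      by (rule continuous_on_compose2[OF cont_v csw im])
    show "continuous_on (S.\<Omega> \<union> top_side r2 r1 \<union> right_side r2 r1) (\<lambda>z. prod.swap (g (prod.swap z)))"
      by (rule continuous_on_compose2[OF csw[of UNIV] continuous_on_compose2[OF cont_g csw im]]) simp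
    show "snd (prod.swap (g (prod.swap z))) = - b" if "z \<in> top_side r2 r1" for z
      using that neumann_right[of "prod.swap z"] by (auto simp: top_side_def right_side_def)
    show "fst (prod.swap (g (prod.swap z))) = - a" if "z \<in> right_side r2 r1" for z
      using that neumann_top[of "prod.swap z"] by (auto simp: top_side_def right_side_def)
  qed (use ab trace_top trace_right in \<open>simp_all add: SR\<close>)
qed

end

subsection \<open>Behaviour near the sides and corners\<close>

lemma tendsto_at_within_compose:
  assumes f: "(f \<longlongrightarrow> l) (at c within A)" and \<sigma>: "isCont \<sigma> c'" "\<sigma> c' = c"
    and A: "\<And>z. z \<in> A' \<Longrightarrow> \<sigma> z \<in> A" "\<And>z. z \<in> A' \<Longrightarrow> z \<noteq> c' \<Longrightarrow> \<sigma> z \<noteq> c"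
  shows "((\<lambda>z. f (\<sigma> z)) \<longlongrightarrow> l) (at c' within A')"
proof (rule filterlim_compose[OF f])
  have "(\<sigma> \<longlongrightarrow> c) (at c' within A')"
    using continuous_at_imp_continuous_at_within[OF \<sigma>(1)] \<sigma>(2) by (simp add: continuous_within)
  moreover have "eventually (\<lambda>z. \<sigma> z \<in> A \<and> \<sigma> z \<noteq> c) (at c' within A')"
    using A by (auto simp: eventually_at_filter)
  ultimately show "filterlim \<sigma> (at c within A) (at c' within A')" by (simp add: filterlim_at)
qed

text \<open>The branch cut is the negative imaginary axis.\<close>

definition quadrant_sqrt :: "complex \<Rightarrow> complex" where
  "quadrant_sqrt z = csqrt \<i> * csqrt (- \<i> * z)"

lemma quadrant_sqrt_power2 [simp]: "(quadrant_sqrt z)^2 = z"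
  unfolding quadrant_sqrt_def power_mult_distrib power2_csqrt by simp

lemma norm_quadrant_sqrt: "(norm (quadrant_sqrt z))^2 = norm z"
  unfolding norm_power[symmetric] by simp

lemma Im_quadrant_sqrt_power2: "Im z = 2 * Re (quadrant_sqrt z) * Im (quadrant_sqrt z)"
  using arg_cong[OF quadrant_sqrt_power2[of z], of Im] unfolding Im_power2 by (rule sym)

lemma quadrant_sqrt_eq_0_iff [simp]: "quadrant_sqrt z = 0 \<longleftrightarrow> z = 0"
  by (simp add: quadrant_sqrt_def del: csqrt_ii)

text \<open>For z in the closed upper half-plane, -\<i> z lies in the right half-plane and its
  principal root w in the sector |Im w| \<le> Re w. The factor \<open>csqrt \<i>\<close>, a rotation
  by pi/4, moves this sector onto the first quadrant.\<close>

lemma quadrant_sqrt_nonneg: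
  assumes "0 \<le> Im z"
  shows "0 \<le> Re (quadrant_sqrt z)" "0 \<le> Im (quadrant_sqrt z)"
proof -
  define w where "w = csqrt (- \<i> * z)"
  have "w^2 = - \<i> * z" unfolding w_def by (rule power2_csqrt)
  from arg_cong[OF this, of Re] have "(Re w)^2 - (Im w)^2 = Im z" unfolding Re_power2 by simp
  then have "(Im w)^2 \<le> (Re w)^2" using assms by simp
  then have "\<bar>Im w\<bar> \<le> Re w" using Re_csqrt[of "- \<i> * z"] by (simp add: abs_le_square_iff[symmetric] w_def)
  moreover have "quadrant_sqrt z = Complex ((Re w - Im w) / sqrt 2) ((Re w + Im w) / sqrt 2)"
    unfolding quadrant_sqrt_def w_def[symmetric] by (simp add: complex_eq_iff diff_divide_distrib add_divide_distrib)
  ultimately show "0 \<le> Re (quadrant_sqrt z)" "0 \<le> Im (quadrant_sqrt z)" by simp_all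
qed

lemma quadrant_sqrt_of_power2:
  assumes q: "0 \<le> Re q" "0 \<le> Im q"
  shows "quadrant_sqrt (q^2) = q"
proof -
  have "0 \<le> Im (q^2)" unfolding Im_power2 using q by simp
  note n = quadrant_sqrt_nonneg[OF this]
  have "quadrant_sqrt (q^2) = q \<or> quadrant_sqrt (q^2) = - q" by (simp flip: power2_eq_iff)
  moreover have "q = 0" if "quadrant_sqrt (q^2) = - q" using n q that by (simp add: complex_eq_iff)
  ultimately show ?thesis by auto
qed

lemma quadrant_sqrt_holomorphic: "quadrant_sqrt holomorphic_on {z. 0 < Im z}"
  and quadrant_sqrt_continuous: "continuous_on {z. 0 \<le> Im z \<and> z \<noteq> 0} quadrant_sqrt"
proof -
  have n: "- \<i> * z \<notin> \<real>\<^sub>\<le>\<^sub>0" if "0 \<le> Im z" "z \<noteq> 0" for z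
    using that by (auto simp: complex_nonpos_Reals_iff complex_eq_iff)
  show "quadrant_sqrt holomorphic_on {z. 0 < Im z}"
    unfolding quadrant_sqrt_def by (intro holomorphic_on_mult holomorphic_on_const holomorphic_on_csqrt' holomorphic_on_ident n) auto
  have "continuous_on {z. 0 \<le> Im z \<and> z \<noteq> 0} (\<lambda>z. csqrt (- \<i> * z))"
  proof (rule continuous_on_compose2[OF continuous_on_csqrt])
    show "(\<lambda>z. - \<i> * z) ` {z. 0 \<le> Im z \<and> z \<noteq> 0} \<subseteq> - \<real>\<^sub>\<le>\<^sub>0"
      by (rule image_subsetI) (use n in blast)
  qed (intro continuous_intros)
  then show "continuous_on {z. 0 \<le> Im z \<and> z \<noteq> 0} quadrant_sqrt"
    unfolding quadrant_sqrt_def by (intro continuous_on_mult continuous_on_const)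
qed

text \<open>\<open>holomorphic_corner_expansion\<close> in the variable \<zeta> = q^2, which maps
  the quadrant to the half-plane. The weight 2 Re q Im q is Im \<zeta>, and the error of order
  |\<zeta>| becomes one of order |q|^2.\<close>

lemma quadrant_corner_expansion:
  fixes F :: "complex \<Rightarrow> complex"
  assumes s: "0 < s"
    and hol: "F holomorphic_on {q. norm q < s \<and> 0 < Re q \<and> 0 < Im q}"
    and cont: "continuous_on {q. norm q < s \<and> 0 \<le> Re q \<and> 0 \<le> Im q \<and> q \<noteq> 0} F"
    and real: "\<And>q. norm q < s \<Longrightarrow> 0 \<le> Re q \<Longrightarrow> 0 \<le> Im q \<Longrightarrow> Re q = 0 \<or> Im q = 0 \<Longrightarrow> q \<noteq> 0 \<Longrightarrow> Im (F q) = 0"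
    and small: "\<And>e. 0 < e \<Longrightarrow> \<exists>t>0. \<forall>q. norm q < t \<and> 0 < Re q \<and> 0 < Im q \<longrightarrow> norm (F q) * (2 * Re q * Im q) \<le> e"
  obtains l :: real and C t where "0 < t" "t \<le> s"
    "\<And>q. norm q < t \<Longrightarrow> 0 \<le> Re q \<Longrightarrow> 0 \<le> Im q \<Longrightarrow> q \<noteq> 0 \<Longrightarrow> norm (F q - of_real l) \<le> C * (norm q)^2"
proof -
  have q: "norm (quadrant_sqrt \<zeta>) < t" if "norm \<zeta> < t^2" "0 < t" for \<zeta> t
    using that norm_quadrant_sqrt[of \<zeta>] by (simp add: power2_less_imp_less)
  have qpos: "0 < Re (quadrant_sqrt \<zeta>)" "0 < Im (quadrant_sqrt \<zeta>)" if "0 < Im \<zeta>" for \<zeta>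
    using quadrant_sqrt_nonneg[of \<zeta>] Im_quadrant_sqrt_power2[of \<zeta>] that by (auto simp: less_le)
  obtain l C \<delta> where X: "0 < \<delta>" "\<delta> \<le> s^2"
    "\<And>\<zeta>. norm \<zeta> < \<delta> \<Longrightarrow> 0 \<le> Im \<zeta> \<Longrightarrow> \<zeta> \<noteq> 0 \<Longrightarrow> norm (F (quadrant_sqrt \<zeta>) - of_real l) \<le> C * norm \<zeta>"
  proof (rule holomorphic_corner_expansion[of "s^2" "\<lambda>\<zeta>. F (quadrant_sqrt \<zeta>)"])
    show "(\<lambda>\<zeta>. F (quadrant_sqrt \<zeta>)) holomorphic_on {\<zeta>. norm \<zeta> < s^2 \<and> 0 < Im \<zeta>}"
    proof (rule holomorphic_on_compose_gen[OF _ hol, unfolded o_def])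
      show "quadrant_sqrt holomorphic_on {\<zeta>. norm \<zeta> < s^2 \<and> 0 < Im \<zeta>}"
        by (rule holomorphic_on_subset[OF quadrant_sqrt_holomorphic]) blast
      show "quadrant_sqrt ` {\<zeta>. norm \<zeta> < s^2 \<and> 0 < Im \<zeta>} \<subseteq> {q. norm q < s \<and> 0 < Re q \<and> 0 < Im q}"
        by (rule image_subsetI) (simp add: q[OF _ s] qpos)
    qed
    show "continuous_on {\<zeta>. norm \<zeta> < s^2 \<and> 0 \<le> Im \<zeta> \<and> \<zeta> \<noteq> 0} (\<lambda>\<zeta>. F (quadrant_sqrt \<zeta>))"
    proof (rule continuous_on_compose2[OF cont])
      show "continuous_on {\<zeta>. norm \<zeta> < s^2 \<and> 0 \<le> Im \<zeta> \<and> \<zeta> \<noteq> 0} quadrant_sqrt"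
        by (rule continuous_on_subset[OF quadrant_sqrt_continuous]) blast
      show "quadrant_sqrt ` {\<zeta>. norm \<zeta> < s^2 \<and> 0 \<le> Im \<zeta> \<and> \<zeta> \<noteq> 0} \<subseteq> {q. norm q < s \<and> 0 \<le> Re q \<and> 0 \<le> Im q \<and> q \<noteq> 0}"
        by (rule image_subsetI) (simp add: q[OF _ s] quadrant_sqrt_nonneg)
    qed
    show "Im (F (quadrant_sqrt \<zeta>)) = 0" if "norm \<zeta> < s^2" "Im \<zeta> = 0" "\<zeta> \<noteq> 0" for \<zeta>
      using that Im_quadrant_sqrt_power2[of \<zeta>] by (intro real q s quadrant_sqrt_nonneg) auto
    show "\<exists>\<delta>>0. \<forall>\<zeta>. norm \<zeta> < \<delta> \<and> 0 < Im \<zeta> \<longrightarrow> norm (F (quadrant_sqrt \<zeta>)) * Im \<zeta> \<le> e" if e: "0 < e" for e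
    proof -
      obtain t where t: "0 < t \<and> (\<forall>q. norm q < t \<and> 0 < Re q \<and> 0 < Im q \<longrightarrow> norm (F q) * (2 * Re q * Im q) \<le> e)"
        using small[OF e] ..
      have "norm (F (quadrant_sqrt \<zeta>)) * Im \<zeta> \<le> e" if "norm \<zeta> < t^2 \<and> 0 < Im \<zeta>" for \<zeta>
      proof -
        have "norm (quadrant_sqrt \<zeta>) < t" "0 < Re (quadrant_sqrt \<zeta>)" "0 < Im (quadrant_sqrt \<zeta>)"
          using q[of \<zeta> t] qpos[of \<zeta>] that t by blast+
        then show ?thesis using t by (subst Im_quadrant_sqrt_power2) blast
      qed
      then show ?thesis using conjunct1[OF t] by (intro exI[of _ "t^2"]) simp
    qed
    show "0 < s^2" using s by simp
  qed (rule that; assumption)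
  show ?thesis
  proof (rule that[of "sqrt \<delta>" l C])
    show "0 < sqrt \<delta>" "sqrt \<delta> \<le> s" using X(1,2) s by (simp_all add: real_le_lsqrt)
    fix q :: complex assume h: "norm q < sqrt \<delta>" "0 \<le> Re q" "0 \<le> Im q" "q \<noteq> 0"
    have "(norm q)^2 < (sqrt \<delta>)^2" using h(1) by (intro power_strict_mono) auto
    then have "norm (q^2) < \<delta>" using X(1) by (simp add: norm_power)
    moreover have "0 \<le> Im (q^2)" unfolding Im_power2 using h by simp
    ultimately show "norm (F q - of_real l) \<le> C * (norm q)^2"
      using X(3)[of "q^2"] h(4) by (simp add: quadrant_sqrt_of_power2[OF h(2,3)] norm_power)
  qed
qed

text \<open>Outside the open fourth quadrant the argument, taken in [0, 2pi), is at most 3pi/2 (for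
  w \<noteq> 0), so a third of it lies in [0, pi/2].\<close>

lemma quadrant_cube_root:
  assumes w: "\<not> (0 < Re w \<and> Im w < 0)"
  obtains q where "0 \<le> Re q" "0 \<le> Im q" "q ^ 3 = w" "norm q = root 3 (norm w)"
proof -
  define \<theta> where "\<theta> = Arg2pi w"
  have \<theta>: "0 \<le> \<theta>" "\<theta> < 2 * pi" using Arg2pi[of w] by (auto simp: \<theta>_def)
  have weq: "w = of_real (norm w) * cis \<theta>"
    using Arg2pi_eq[of w] by (simp add: \<theta>_def cis_conv_exp)
  define q where "q = of_real (root 3 (norm w)) * cis (\<theta> / 3)"
  have "of_real (root 3 (norm w)) ^ 3 = (of_real (norm w) :: complex)"
    unfolding of_real_power[symmetric] by simp
  moreover have "cis (\<theta> / 3) ^ 3 = cis \<theta>" using Complex.DeMoivre[of "\<theta> / 3" 3] by simp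
  ultimately have q3: "q ^ 3 = w" using weq by (simp add: q_def power_mult_distrib)
  have "w = 0 \<or> \<theta> \<le> 3 * pi / 2"
  proof (rule ccontr)
    assume "\<not> (w = 0 \<or> \<theta> \<le> 3 * pi / 2)"
    then have a: "w \<noteq> 0" "3 * pi / 2 < \<theta>" by auto
    have "0 < cos (\<theta> - 2 * pi)" by (rule cos_gt_zero_pi) (use a \<theta> in simp_all)
    moreover have "0 < sin (2 * pi - \<theta>)" by (rule sin_gt_zero) (use a \<theta> in simp_all)
    ultimately have "0 < cos \<theta>" "sin \<theta> < 0" by (simp_all add: cos_diff sin_diff)
    then have "0 < norm w * cos \<theta>" "norm w * sin \<theta> < 0" using a by (simp_all add: mult_pos_neg)
    then show False using w cos_Arg2pi[of w] sin_Arg2pi[of w] by (simp add: \<theta>_def)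
  qed
  moreover have "0 \<le> cos (\<theta> / 3)" "0 \<le> sin (\<theta> / 3)" if "\<theta> \<le> 3 * pi / 2"
    using that \<theta> by (auto intro: cos_ge_zero sin_ge_zero)
  ultimately have "0 \<le> Re q" "0 \<le> Im q" by (auto simp: q_def)
  then show ?thesis using q3 by (intro that[of q]) (auto simp: q_def norm_mult)
qed

context annulus_solution
begin

lemma closure_not_bot: "c \<in> closure \<Omega> \<Longrightarrow> c \<notin> \<Omega> \<Longrightarrow> at c within \<Omega> \<noteq> bot"
  by (simp add: trivial_limit_within closure_def)

lemma holomorphic_cgrad: "cgrad g holomorphic_on {z. (Re z, Im z) \<in> \<Omega>}"
  unfolding holomorphic_on_def
  by (rule ballI, rule field_differentiable_at_within, rule differentiable) simp

text \<open>The point reflection \<zeta> = z0 - z places the domain near the side into the upper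
  half-plane. Then \<open>holomorphic_extension_across_zero_set\<close> extends the complex gradient
  across the side, and its vanishing real part there is the vanishing tangential derivative.\<close>

lemma limit_outer_top:
  assumes x: "\<bar>x\<bar> < R1"
  shows "\<exists>l. (g \<longlongrightarrow> l) (at (x, R2) within \<Omega>) \<and> fst l = 0"
proof -
  \<comment> \<open>A straight side calls for a bound on the gradient times the distance, not for
    its decay; hence the value 1.\<close>
  obtain \<delta>0 where \<delta>0: "\<delta>0 > 0" "\<And>p q d. 0 < d \<and> cbox (p - d, q - d) (p + d, q + d) \<subseteq> \<Omega> \<inter> ball (x, R2) \<delta>0 \<Longrightarrow> norm (g (p, q)) * d \<le> 1"
    using decay[of 1 "(x, R2)"] by auto
  define \<rho> where "\<rho> = min (\<delta>0 / 4) (min ((R1 - \<bar>x\<bar>) / 2) ((R2 - r2) / 2))"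
  have \<rho>: "0 < \<rho>" "4 * \<rho> \<le> \<delta>0" "2 * \<rho> \<le> R1 - \<bar>x\<bar>" "2 * \<rho> \<le> R2 - r2"
    using \<delta>0 x R by (auto simp: \<rho>_def min_def)
  define D where "D = {z. \<bar>Re z\<bar> < \<rho> \<and> 0 < Im z \<and> Im z < \<rho>}"
  define z0 where "z0 = Complex x R2"
  define H where "H = (\<lambda>\<zeta>. - cgrad g (z0 - \<zeta>))"
  define V where "V = (\<lambda>\<zeta>. v (x - Re \<zeta>, R2 - Im \<zeta>))"
  have DO: "(x - Re \<zeta>, R2 - Im \<zeta>) \<in> \<Omega>" if "\<zeta> \<in> D" for \<zeta>
    using that \<rho> r by (auto simp: D_def mem abs_less_iff)
  have lim: "((\<lambda>s. integral {x0..x1} (\<lambda>\<xi>. V (Complex \<xi> s))) \<longlongrightarrow> 0) (at_right 0)" if "-\<rho> < x0" "x0 < x1" "x1 < \<rho>" for x0 x1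
  proof -
    have "integral {x0..x1} (\<lambda>\<xi>. V (Complex \<xi> s)) = integral {x - x1..x - x0} (\<lambda>t. v (t, R2 - s))" for s
      using Henstock_Kurzweil_Integration.integral_reflect_real[of "-x0" "-x1" "(\<lambda>t. v (t, R2 - s)) \<circ> (+) x"]
        integral_shift_Icc_real[of "-x1" "-x0" "\<lambda>t. v (t, R2 - s)" x]
      by (simp add: V_def algebra_simps)
    then show ?thesis using trace_top[of "x - x1" "x - x0"] that \<rho> by (simp add: abs_less_iff)
  qed
  have bound: "norm (H \<zeta>) * Im \<zeta> \<le> 2" if \<zeta>: "\<zeta> \<in> D" for \<zeta>
  proof -
    \<comment> \<open>Half the distance to the side, so that the closed square about the point stays
      inside the annulus; this gives the constant 2 in the bound.\<close>
    define p q d where "p = x - Re \<zeta>" and "q = R2 - Im \<zeta>" and "d = Im \<zeta> / 2"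
    have "cbox (p - d, q - d) (p + d, q + d) \<subseteq> \<Omega> \<inter> ball (x, R2) \<delta>0"
    proof (rule subrelI)
      fix s t assume st: "(s, t) \<in> cbox (p - d, q - d) (p + d, q + d)"
      then have 1: "\<bar>s - x\<bar> < 3 * \<rho> / 2" "t < R2" "R2 - t < 3 * \<rho> / 2"
        using \<zeta> by (auto simp: cbox_Pair_eq p_def q_def d_def D_def abs_if split: if_splits)
      have "dist (x, R2) (s, t) \<le> \<bar>x - s\<bar> + \<bar>R2 - t\<bar>"
        using sqrt_sum_squares_le_sum_abs[of "x - s" "R2 - t"] by (simp add: dist_prod_def dist_real_def)
      also have "... < \<delta>0" using 1 \<rho> by linarith
      finally have "dist (x, R2) (s, t) < \<delta>0" .
      moreover have "\<bar>s\<bar> < R1" "\<bar>t\<bar> < R2" "r2 < \<bar>t\<bar>" using 1 \<rho> r by linarith+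
      ultimately show "(s, t) \<in> \<Omega> \<inter> ball (x, R2) \<delta>0" by (simp add: mem)
    qed
    then have "norm (g (p, q)) * d \<le> 1" using \<delta>0(2)[of d p q] \<zeta> by (auto simp: d_def D_def)
    then show ?thesis by (simp add: H_def norm_cgrad z0_def p_def q_def d_def)
  qed
  have hol: "H holomorphic_on D"
      unfolding holomorphic_on_def
    proof
      fix \<zeta> assume "\<zeta> \<in> D"
      then have "cgrad g field_differentiable at (z0 - \<zeta>)" using DO by (intro differentiable) (simp add: z0_def)
      then obtain d where "(cgrad g has_field_derivative d) (at (z0 - \<zeta>))" by (auto simp: field_differentiable_def)
      then have "((\<lambda>\<zeta>. cgrad g (z0 - \<zeta>)) has_field_derivative d * (- 1)) (at \<zeta>)"
        by (rule DERIV_chain2) (auto intro!: derivative_eq_intros)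
      then have "(H has_field_derivative - (d * (- 1))) (at \<zeta>)" unfolding H_def by (rule DERIV_minus)
      then show "H field_differentiable at \<zeta> within D" by (auto simp: field_differentiable_def intro: has_field_derivative_at_within)
    qed
  have vd: "(V has_derivative (\<lambda>k. Re (H \<zeta> * k))) (at \<zeta>)" if "\<zeta> \<in> D" for \<zeta>
  proof -
    note d = grad[OF DO[OF that], unfolded gderiv_def]
    have "((\<lambda>\<zeta>. (x - Re \<zeta>, R2 - Im \<zeta>)) has_derivative (\<lambda>k. (- Re k, - Im k))) (at \<zeta>)"
      by (auto intro!: derivative_eq_intros)
    from diff_chain_at[OF this d] show ?thesis
      by (simp add: V_def H_def o_def inner_prod_def cgrad_def z0_def algebra_simps)
  qed
  obtain \<delta> K where K: "0 < \<delta>" "K holomorphic_on ball 0 \<delta>" "\<And>z. z \<in> ball 0 \<delta> \<Longrightarrow> 0 < Im z \<Longrightarrow> K z = H z"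
    "\<And>z. z \<in> ball 0 \<delta> \<Longrightarrow> Im z = 0 \<Longrightarrow> Re (K z) = 0"
    by (rule holomorphic_extension_across_zero_set[OF \<rho>(1) D_def hol vd bound lim]; (assumption)?) (rule that; assumption)
  have Kc: "isCont K 0"
    by (intro field_differentiable_imp_continuous_at holomorphic_on_imp_differentiable_at[OF K(2) open_ball])
      (use K(1) in simp)
  define w where "w = (\<lambda>z. z0 - Complex (fst z) (snd z))"
  have "(w \<longlongrightarrow> z0 - Complex (fst (x, R2)) (snd (x, R2))) (at (x, R2) within \<Omega>)"
    unfolding w_def by (intro tendsto_intros)
  then have "((\<lambda>z. K (w z)) \<longlongrightarrow> K 0) (at (x, R2) within \<Omega>)"
    by (intro isCont_tendsto_compose[OF Kc]) (simp add: z0_def)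
  then have "((\<lambda>z. (- Re (K (w z)), Im (K (w z)))) \<longlongrightarrow> (- Re (K 0), Im (K 0))) (at (x, R2) within \<Omega>)"
    by (intro tendsto_intros)
  moreover have "eventually (\<lambda>z. (- Re (K (w z)), Im (K (w z))) = g z) (at (x, R2) within \<Omega>)"
    unfolding eventually_at
  proof (intro exI[of _ \<delta>] conjI ballI impI K(1))
    fix z assume z: "z \<in> \<Omega>" "z \<noteq> (x, R2) \<and> dist z (x, R2) < \<delta>"
    have "norm (w z) = dist z (x, R2)"
      by (cases z) (simp add: w_def z0_def dist_prod_def dist_real_def cmod_def power2_commute)
    then have "w z \<in> ball 0 \<delta>" using z by simp
    moreover have "0 < Im (w z)" using z(1) by (cases z) (auto simp: mem w_def z0_def)
    ultimately have "K (w z) = - cgrad g (Complex (fst z) (snd z))" using K(3) by (simp add: H_def w_def)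
    then show "(- Re (K (w z)), Im (K (w z))) = g z" by (simp add: cgrad_def)
  qed
  ultimately have "(g \<longlongrightarrow> (- Re (K 0), Im (K 0))) (at (x, R2) within \<Omega>)"
    by (rule Lim_transform_eventually)
  moreover have "Re (K 0) = 0" using K(4)[of 0] K(1) by simp
  ultimately show ?thesis by (intro exI[of _ "(- Re (K 0), Im (K 0))"]) simp
qed

lemma limit_outer_right:
  assumes y: "\<bar>y\<bar> < R2"
  shows "\<exists>l. (g \<longlongrightarrow> l) (at (R1, y) within \<Omega>) \<and> snd l = 0"
proof -
  interpret S: annulus_solution r2 r1 lam b a "\<lambda>z. v (prod.swap z)" "\<lambda>z. prod.swap (g (prod.swap z))" by (rule swapped)
  have SR: "S.R1 = R2" "S.R2 = R1" by (simp_all add: S.R1_def S.R2_def R1_def R2_def)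
  obtain l where l: "((\<lambda>z. prod.swap (g (prod.swap z))) \<longlongrightarrow> l) (at (y, R1) within S.\<Omega>)" "fst l = 0"
    using S.limit_outer_top[of y] y unfolding SR by blast
  have "((\<lambda>z. prod.swap (g (prod.swap (prod.swap z)))) \<longlongrightarrow> l) (at (R1, y) within \<Omega>)"
  proof (rule tendsto_at_within_compose[OF l(1)])
    show "isCont prod.swap (R1, y)" unfolding prod.swap_def by (intro continuous_intros)
    show "prod.swap z \<in> S.\<Omega>" if "z \<in> \<Omega>" for z using that by (cases z) (auto simp: mem S.mem SR)
  qed (auto simp: prod_eq_iff)
  then have "((\<lambda>z. prod.swap (g z)) \<longlongrightarrow> l) (at (R1, y) within \<Omega>)" by (simp only: swap_swap)
  then have "((\<lambda>z. (snd (prod.swap (g z)), fst (prod.swap (g z)))) \<longlongrightarrow> (snd l, fst l)) (at (R1, y) within \<Omega>)"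
    by (intro tendsto_intros)
  then show ?thesis using l(2) by (intro exI[of _ "(snd l, fst l)"]) simp
qed

lemma limit_eq_outer_top:
  assumes "\<bar>x\<bar> < R1" "(g \<longlongrightarrow> l) (at (x, R2) within \<Omega>)"
  shows "fst l = 0"
proof -
  have "(x, R2) \<in> closure \<Omega>" "(x, R2) \<notin> \<Omega>" using assms(1) R r by (auto simp: closure_iff mem)
  then show ?thesis using limit_outer_top[OF assms(1)] tendsto_unique[OF closure_not_bot assms(2)] by blast
qed

lemma limit_eq_outer_right:
  assumes "\<bar>y\<bar> < R2" "(g \<longlongrightarrow> l) (at (R1, y) within \<Omega>)"
  shows "snd l = 0"
proof -
  have "(R1, y) \<in> closure \<Omega>" "(R1, y) \<notin> \<Omega>" using assms(1) R r by (auto simp: closure_iff mem)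
  then show ?thesis using limit_outer_right[OF assms(1)] tendsto_unique[OF closure_not_bot assms(2)] by blast
qed

lemma continuous_cgrad:
  assumes "continuous_on T G"
  shows "continuous_on {z. (Re z, Im z) \<in> T} (cgrad G)"
proof -
  have "continuous_on {z. (Re z, Im z) \<in> T} (\<lambda>z. (Re z, Im z))" by (intro continuous_intros)
  then have "continuous_on {z. (Re z, Im z) \<in> T} (\<lambda>z. G (Re z, Im z))" by (rule continuous_on_compose2[OF assms]) blast
  then show ?thesis unfolding cgrad_def by (intro continuous_on_Complex continuous_intros)
qed

text \<open>\<open>(R1, R2) - q\<close> with \<open>q\<close> in the first quadrant parametrises the neighbourhood of the corner,
  and \<open>F q\<close> is the derivative of the solution pulled back to a half-disc by \<open>q^2\<close>.\<close>

lemma limit_outer_corner: "(g \<longlongrightarrow> 0) (at (R1, R2) within \<Omega>)"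
proof -
  \<comment> \<open>The annulus with the open top and right outer sides. The corner is left out:
    continuity there is the claim.\<close>
  define T where "T = \<Omega> \<union> {-R1<..<R1} \<times> {R2} \<union> {R1} \<times> {-R2<..<R2}"
  have TK: "T \<subseteq> closure \<Omega>" using R r by (auto simp: T_def closure_iff abs_less_iff intro: closure_subset[THEN subsetD])
  obtain G where G: "continuous_on T G" "\<And>z. z \<in> \<Omega> \<Longrightarrow> G z = g z" "\<And>z. z \<in> T \<Longrightarrow> (g \<longlongrightarrow> G z) (at z within \<Omega>)"
  proof (rule continuous_extension_by_limits[OF _ TK, of g])
    show "\<Omega> \<subseteq> T" by (auto simp: T_def)
    show "continuous_on \<Omega> g" by (rule continuous_on_subset[OF cont_g]) blast
    show "\<exists>l. (g \<longlongrightarrow> l) (at z within \<Omega>)" if "z \<in> T" "z \<notin> \<Omega>" for z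
    proof -
      have "(\<exists>x. z = (x, R2) \<and> \<bar>x\<bar> < R1) \<or> (\<exists>y. z = (R1, y) \<and> \<bar>y\<bar> < R2)"
        using that by (auto simp: T_def abs_less_iff)
      then show ?thesis using limit_outer_top limit_outer_right by blast
    qed
  qed (rule that; assumption)
  have top0: "fst (G (x, R2)) = 0" if "\<bar>x\<bar> < R1" for x
    by (rule limit_eq_outer_top[OF that G(3)]) (use that in \<open>auto simp: T_def\<close>)
  have right0: "snd (G (R1, y)) = 0" if "\<bar>y\<bar> < R2" for y
    by (rule limit_eq_outer_right[OF that G(3)]) (use that in \<open>auto simp: T_def\<close>)
  define s where "s = min (R1 - r1) (R2 - r2) / 2"
  have s: "0 < s" "2 * s \<le> R1 - r1" "2 * s \<le> R2 - r2" using R by (auto simp: s_def)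
  define c0 where "c0 = Complex R1 R2"
  \<comment> \<open>For z = c0 - q the derivative dz/d(q^2) is -1/(2q). On the outer sides the
    tangential derivative is zero, so the complex gradient times dz is imaginary along the boundary;
    the factor \<i> makes F real there.\<close>
  define F where "F = (\<lambda>q. - \<i> * cgrad G (c0 - q) / (2 * q))"
  have in\<Omega>: "(R1 - \<alpha>, R2 - \<beta>) \<in> \<Omega>" if "0 < \<alpha>" "0 < \<beta>" "\<alpha> < 2 * s" "\<beta> < 2 * s" for \<alpha> \<beta>
    using that s r by (auto simp: mem abs_less_iff)
  have inT: "(R1 - \<alpha>, R2 - \<beta>) \<in> T" if "0 \<le> \<alpha>" "0 \<le> \<beta>" "\<alpha> < 2 * s" "\<beta> < 2 * s" "\<not> (\<alpha> = 0 \<and> \<beta> = 0)" for \<alpha> \<beta>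
    using in\<Omega>[of \<alpha> \<beta>] that s r by (auto simp: T_def less_le)
  have qs: "Re q < s" "Im q < s" if "norm q < s" for q
    using that abs_Re_le_cmod[of q] abs_Im_le_cmod[of q] by auto
  have holG: "cgrad G holomorphic_on {z. (Re z, Im z) \<in> \<Omega>}"
    by (rule holomorphic_transform[OF holomorphic_cgrad]) (simp add: cgrad_def G(2))
  obtain l C t where X: "0 < t" "t \<le> s" "\<And>q. norm q < t \<Longrightarrow> 0 \<le> Re q \<Longrightarrow> 0 \<le> Im q \<Longrightarrow> q \<noteq> 0 \<Longrightarrow> norm (F q - of_real l) \<le> C * (norm q)^2"
  proof (rule quadrant_corner_expansion[OF s(1), of F])
    let ?O = "{q. norm q < s \<and> 0 < Re q \<and> 0 < Im q}"
    have "(\<lambda>q. cgrad G (c0 - q)) holomorphic_on ?O"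
    proof (rule holomorphic_on_compose_gen[OF _ holG, unfolded o_def])
      show "(\<lambda>q. c0 - q) ` ?O \<subseteq> {z. (Re z, Im z) \<in> \<Omega>}"
      proof clarify
        fix q :: complex assume q: "norm q < s" "0 < Re q" "0 < Im q"
        have "(R1 - Re q, R2 - Im q) \<in> \<Omega>" using q qs[OF q(1)] s(1) by (intro in\<Omega>) auto
        then show "(Re (c0 - q), Im (c0 - q)) \<in> \<Omega>" by (simp add: c0_def)
      qed
    qed (intro holomorphic_intros)
    then show "F holomorphic_on ?O"
      unfolding F_def by (intro holomorphic_on_divide holomorphic_on_mult holomorphic_on_const holomorphic_on_ident) auto
    let ?C = "{q. norm q < s \<and> 0 \<le> Re q \<and> 0 \<le> Im q \<and> q \<noteq> 0}"
    have "continuous_on ?C (\<lambda>q. cgrad G (c0 - q))"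
    proof (rule continuous_on_compose2[OF continuous_cgrad[OF G(1)]])
      show "(\<lambda>q. c0 - q) ` ?C \<subseteq> {z. (Re z, Im z) \<in> T}"
      proof clarify
        fix q :: complex assume q: "norm q < s" "0 \<le> Re q" "0 \<le> Im q" "q \<noteq> 0"
        have "(R1 - Re q, R2 - Im q) \<in> T"
          using q qs[OF q(1)] s(1) by (intro inT) (auto simp: complex_eq_iff)
        then show "(Re (c0 - q), Im (c0 - q)) \<in> T" by (simp add: c0_def)
      qed
    qed (intro continuous_intros)
    then show "continuous_on ?C F"
      unfolding F_def by (intro continuous_on_divide continuous_on_mult continuous_on_const continuous_on_id) auto
    show "Im (F q) = 0" if q: "norm q < s" "0 \<le> Re q" "0 \<le> Im q" "Re q = 0 \<or> Im q = 0" "q \<noteq> 0" for q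
    proof -
      obtain \<alpha> \<beta> where Q: "q = Complex \<alpha> \<beta>" by (cases q)
      have ab: "0 \<le> \<alpha>" "0 \<le> \<beta>" "\<alpha> < s" "\<beta> < s" "\<alpha> = 0 \<or> \<beta> = 0" "\<not> (\<alpha> = 0 \<and> \<beta> = 0)"
        using q qs[OF q(1)] by (auto simp: Q complex_eq_iff)
      have "\<bar>R1 - \<alpha>\<bar> < R1" if "0 < \<alpha>" using that ab s r by (auto simp: abs_less_iff)
      moreover have "\<bar>R2 - \<beta>\<bar> < R2" if "0 < \<beta>" using that ab s r by (auto simp: abs_less_iff)
      ultimately show ?thesis
        using ab top0[of "R1 - \<alpha>"] right0[of "R2 - \<beta>"] by (auto simp: F_def Q c0_def cgrad_def Im_divide)
    qed
    show "\<exists>t>0. \<forall>q. norm q < t \<and> 0 < Re q \<and> 0 < Im q \<longrightarrow> norm (F q) * (2 * Re q * Im q) \<le> e" if "0 < e" for e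
    proof -
      obtain \<delta>0 where \<delta>0: "\<delta>0 > 0" "\<And>x y d. 0 < d \<and> cbox (x - d, y - d) (x + d, y + d) \<subseteq> \<Omega> \<inter> ball (R1, R2) \<delta>0 \<Longrightarrow> norm (g (x, y)) * d \<le> e / 2"
        using decay[of "e / 2" "(R1, R2)"] \<open>0 < e\<close> by auto
      define t where "t = min s (\<delta>0 / 4)"
      have t: "0 < t" "t \<le> s" "4 * t \<le> \<delta>0" using s \<delta>0 by (auto simp: t_def)
      show ?thesis
      proof (intro exI[of _ t] conjI allI impI t(1))
        fix q :: complex assume q: "norm q < t \<and> 0 < Re q \<and> 0 < Im q"
        define \<alpha> \<beta> N where "\<alpha> = Re q" and "\<beta> = Im q" and "N = norm q"
        \<comment> \<open>Half the distance to the nearer of the two sides. The product of the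
          coordinates divided by |q| is at most 2d, because the larger coordinate is at most
          |q|.\<close>
        define d where "d = min \<alpha> \<beta> / 2"
        have ab: "0 < \<alpha>" "0 < \<beta>" "\<alpha> \<le> N" "\<beta> \<le> N" "N < t"
          using q abs_Re_le_cmod[of q] abs_Im_le_cmod[of q] by (auto simp: \<alpha>_def \<beta>_def N_def)
        have d: "0 < d" "2 * d \<le> \<alpha>" "2 * d \<le> \<beta>" using ab by (auto simp: d_def)
        have "cbox (R1 - \<alpha> - d, R2 - \<beta> - d) (R1 - \<alpha> + d, R2 - \<beta> + d) \<subseteq> \<Omega> \<inter> ball (R1, R2) \<delta>0"
        proof (rule subrelI)
          fix x y assume "(x, y) \<in> cbox (R1 - \<alpha> - d, R2 - \<beta> - d) (R1 - \<alpha> + d, R2 - \<beta> + d)"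
          then have 1: "0 < R1 - x" "0 < R2 - y" "R1 - x < 2 * t" "R2 - y < 2 * t" using ab d by (auto simp: cbox_Pair_eq)
          then have "(x, y) \<in> \<Omega>" using in\<Omega>[of "R1 - x" "R2 - y"] t by simp
          moreover have "dist (R1, R2) (x, y) \<le> \<bar>R1 - x\<bar> + \<bar>R2 - y\<bar>"
            using sqrt_sum_squares_le_sum_abs[of "R1 - x" "R2 - y"] by (simp add: dist_prod_def dist_real_def)
          moreover have "\<bar>R1 - x\<bar> + \<bar>R2 - y\<bar> < \<delta>0" using 1 t by linarith
          ultimately show "(x, y) \<in> \<Omega> \<inter> ball (R1, R2) \<delta>0" by simp
        qed
        then have g: "norm (g (R1 - \<alpha>, R2 - \<beta>)) * d \<le> e / 2" using \<delta>0(2)[of d "R1 - \<alpha>" "R2 - \<beta>"] d by simp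
        have "(R1 - \<alpha>, R2 - \<beta>) \<in> \<Omega>" using ab t by (intro in\<Omega>) auto
        then have "norm (cgrad G (c0 - q)) = norm (g (R1 - \<alpha>, R2 - \<beta>))"
          by (simp add: norm_cgrad c0_def G(2) flip: \<alpha>_def \<beta>_def)
        then have "norm (F q) * (2 * Re q * Im q) = norm (g (R1 - \<alpha>, R2 - \<beta>)) * (\<alpha> * \<beta> / N)"
          by (simp add: F_def norm_divide norm_mult flip: N_def \<alpha>_def \<beta>_def)
        also have "\<alpha> * \<beta> / N \<le> 2 * d"
        proof -
          have "\<alpha> * \<beta> = min \<alpha> \<beta> * max \<alpha> \<beta>" by (simp add: min_def max_def)
          also have "... \<le> min \<alpha> \<beta> * N" using ab by (intro mult_left_mono) auto
          finally show ?thesis using ab by (simp add: d_def field_simps)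
        qed
        then have "norm (g (R1 - \<alpha>, R2 - \<beta>)) * (\<alpha> * \<beta> / N) \<le> norm (g (R1 - \<alpha>, R2 - \<beta>)) * (2 * d)"
          by (rule mult_left_mono) simp
        also have "... \<le> e" using g by simp
        finally show "norm (F q) * (2 * Re q * Im q) \<le> e" .
      qed
    qed
  qed (rule that; assumption)
  \<comment> \<open>Since |g| = 2 |q| |F|, boundedness of F alone forces the gradient to vanish at
    the corner, whatever l is. The radius is at most 1 so that |q|^2 \<le> 1.\<close>
  have "eventually (\<lambda>z. norm (g z) \<le> 2 * (\<bar>l\<bar> + \<bar>C\<bar>) * norm (z - (R1, R2))) (at (R1, R2) within \<Omega>)"
    unfolding eventually_at
  proof (intro exI[of _ "min 1 t"] conjI ballI impI)
    fix z assume z: "z \<in> \<Omega>" "z \<noteq> (R1, R2) \<and> dist z (R1, R2) < min 1 t"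
    define q where "q = Complex (R1 - fst z) (R2 - snd z)"
    have nq: "norm q = norm (z - (R1, R2))" by (cases z) (simp add: q_def cmod_def norm_prod_def power2_commute)
    have qp: "0 < Re q" "0 < Im q" using z(1) by (cases z; auto simp: q_def mem)+
    have cq: "c0 - q = Complex (fst z) (snd z)" by (simp add: c0_def q_def complex_eq_iff)
    have q0: "q \<noteq> 0" using qp by auto
    have qt: "norm q < t" "norm q < 1" using z(2) by (simp_all add: nq dist_norm)
    then have "norm (F q - of_real l) \<le> C * (norm q)^2" using X(3)[of q] qp q0 by simp
    also have "... \<le> \<bar>C\<bar> * 1"
      by (rule mult_mono) (use qt in \<open>auto intro!: power_le_one\<close>)
    finally have "norm (F q) \<le> \<bar>l\<bar> + \<bar>C\<bar>" using norm_triangle_sub[of "F q" "of_real l"] by simp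
    then have "norm (F q) * (2 * norm q) \<le> (\<bar>l\<bar> + \<bar>C\<bar>) * (2 * norm q)" by (intro mult_right_mono) auto
    moreover have "norm (F q) * (2 * norm q) = norm (g z)"
      using z(1) q0 by (simp add: F_def cq norm_divide norm_mult norm_cgrad G(2))
    ultimately show "norm (g z) \<le> 2 * (\<bar>l\<bar> + \<bar>C\<bar>) * norm (z - (R1, R2))" by (simp add: nq algebra_simps)
  qed (use X(1) in simp)
  then show ?thesis
  proof (rule Lim_null_comparison)
    have "((\<lambda>z. 2 * (\<bar>l\<bar> + \<bar>C\<bar>) * norm (z - (R1, R2))) \<longlongrightarrow> 2 * (\<bar>l\<bar> + \<bar>C\<bar>) * norm ((R1, R2) - (R1, R2))) (at (R1, R2) within \<Omega>)"
      by (intro tendsto_intros)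
    then show "((\<lambda>z. 2 * (\<bar>l\<bar> + \<bar>C\<bar>) * norm (z - (R1, R2))) \<longlongrightarrow> 0) (at (R1, R2) within \<Omega>)"
      by (simp only: diff_self norm_zero mult_zero_right)
  qed
qed

section \<open>Maximum principle for a gradient continuous up to the boundary\<close>

lemma swapped_closure:
  assumes gcl: "continuous_on (closure \<Omega>) g"
  shows "continuous_on (closure (annulus r2 r1 lam)) (\<lambda>z. prod.swap (g (prod.swap z)))"
proof -
  interpret S: annulus_geometry r2 r1 lam using r by unfold_locales
  have SR: "S.R1 = R2" "S.R2 = R1" by (simp_all add: S.R1_def S.R2_def R1_def R2_def)
  have csw: "continuous_on A (prod.swap :: real \<times> real \<Rightarrow> _)" for A by (simp add: prod.swap_def continuous_intros)
  have "prod.swap z \<in> closure \<Omega>" if "z \<in> closure S.\<Omega>" for z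
    using that by (cases z) (auto simp: closure_iff S.closure_iff SR)
  then have "prod.swap ` closure S.\<Omega> \<subseteq> closure \<Omega>" by blast
  then show ?thesis
    by (intro continuous_on_compose2[OF csw[of UNIV] continuous_on_compose2[OF gcl csw]]) auto
qed

lemma tendsto_of_continuous_closure:
  assumes "continuous_on (closure \<Omega>) g" "z \<in> closure \<Omega>"
  shows "(g \<longlongrightarrow> g z) (at z within \<Omega>)"
  using assms closure_subset by (auto simp: continuous_on_def intro: tendsto_within_subset)

lemma gradient_outer_top:
  assumes gcl: "continuous_on (closure \<Omega>) g" and x: "\<bar>x\<bar> \<le> R1"
  shows "fst (g (x, R2)) = 0"
proof -
  define S where "S = {-R1<..<R1} \<times> {R2}"
  have cS: "closure S = {-R1..R1} \<times> {R2}" using R r by (simp add: S_def closure_Times)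
  have "closure S \<subseteq> closure \<Omega>" using R r by (auto simp: cS closure_iff)
  then have "continuous_on (closure S) (\<lambda>z. fst (g z))" by (intro continuous_intros continuous_on_subset[OF gcl])
  moreover have "fst (g z) = 0" if "z \<in> S" for z
  proof -
    obtain x where z: "z = (x, R2)" "\<bar>x\<bar> < R1" using \<open>z \<in> S\<close> by (auto simp: S_def abs_less_iff)
    then have "z \<in> closure \<Omega>" using R r by (auto simp: closure_iff)
    then show ?thesis using limit_eq_outer_top[OF z(2)] tendsto_of_continuous_closure[OF gcl] z(1) by blast
  qed
  ultimately show ?thesis by (rule continuous_constant_on_closure) (use x in \<open>auto simp: cS\<close>)
qed

lemma gradient_inner_right:
  assumes gcl: "continuous_on (closure \<Omega>) g" and y: "\<bar>y\<bar> \<le> r2"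
  shows "fst (g (r1, y)) = - b"
proof -
  define S where "S = {r1} \<times> {-r2<..<r2}"
  have cS: "closure S = {r1} \<times> {-r2..r2}" using r by (simp add: S_def closure_Times)
  have "closure S \<subseteq> closure \<Omega>" using R r by (auto simp: cS closure_iff)
  then have "continuous_on (closure S) (\<lambda>z. fst (g z))" by (intro continuous_intros continuous_on_subset[OF gcl])
  moreover have "fst (g z) = - b" if "z \<in> S" for z
    using that by (intro neumann_right) (auto simp: S_def right_side_def)
  ultimately show ?thesis by (rule continuous_constant_on_closure) (use y in \<open>auto simp: cS\<close>)
qed

lemma gradient_outer_right:
  assumes gcl: "continuous_on (closure \<Omega>) g" and y: "\<bar>y\<bar> < R2"
  shows "snd (g (R1, y)) = 0"
  by (rule limit_eq_outer_right[OF y tendsto_of_continuous_closure[OF gcl]]) (use y R r in \<open>auto simp: closure_iff\<close>)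

lemma sym_g_closure:
  assumes gcl: "continuous_on (closure \<Omega>) g" and z: "z \<in> closure \<Omega>" and st: "\<bar>s\<bar> = 1" "\<bar>t\<bar> = 1"
  shows "mirror s t z \<in> closure \<Omega>" "g (mirror s t z) = mirror s t (g z)"
proof -
  have cl: "mirror s t w \<in> closure \<Omega>" if "w \<in> closure \<Omega>" for w
    using that st by (cases w) (simp add: closure_iff mirror_def abs_mult)
  show "mirror s t z \<in> closure \<Omega>" by (rule cl[OF z])
  have "continuous_on (closure \<Omega>) (\<lambda>w. g (mirror s t w) - mirror s t (g w))"
    using cl by (intro continuous_intros continuous_on_compose2[OF gcl continuous_mirror]
      continuous_on_compose2[OF continuous_mirror[of UNIV] gcl]) auto
  then have "g (mirror s t z) - mirror s t (g z) = 0"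
    by (rule continuous_constant_on_closure[OF _ _ z]) (simp add: sym_g[OF _ st])
  then show "g (mirror s t z) = mirror s t (g z)" by simp
qed

text \<open>The maximum principle for \<open>fst (g z)\<close> on the right half of the annulus. It is harmonic, vanishes on
  the axis \<open>x = 0\<close> and on the outer horizontal sides, is negative on the inner vertical side, and can be
  reflected across the remaining sides; a positive maximum could therefore be moved upwards for ever.\<close>

lemma fst_gradient_nonpos:
  assumes gcl: "continuous_on (closure \<Omega>) g" and z: "z \<in> closure \<Omega>" "0 \<le> fst z"
  shows "fst (g z) \<le> 0"
proof (rule ccontr)
  assume neg: "\<not> fst (g z) \<le> 0"
  define S where "S = closure \<Omega> \<inter> {z. 0 \<le> fst z}"
  have "closed {z :: real \<times> real. 0 \<le> fst z}" by (intro closed_Collect_le continuous_intros)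
  moreover have "compact (closure \<Omega>)" using bounded_annulus by (simp add: compact_closure)
  ultimately have cS: "compact S" unfolding S_def by (intro compact_Int_closed)
  have gS: "continuous_on S (\<lambda>z. fst (g z))" by (intro continuous_intros continuous_on_subset[OF gcl]) (auto simp: S_def)
  obtain zm where zm: "zm \<in> S" "\<And>w. w \<in> S \<Longrightarrow> fst (g w) \<le> fst (g zm)"
  proof -
    have "S \<noteq> {}" using z by (auto simp: S_def)
    from continuous_attains_sup[OF cS this gS] show ?thesis using that by blast
  qed
  define m where "m = fst (g zm)"
  have "z \<in> S" using z by (simp add: S_def)
  then have m: "0 < m" "w \<in> S \<Longrightarrow> fst (g w) \<le> m" for w
    using zm(2)[of z] zm(2)[of w] neg by (auto simp: m_def)
  define T where "T = S \<inter> (\<lambda>w. fst (g w)) -` {m}"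
  have "closed T" unfolding T_def by (rule continuous_closed_preimage[OF gS compact_imp_closed[OF cS]]) simp
  then have "compact (S \<inter> T)" using cS by (rule compact_Int_closed[rotated])
  then have cT: "compact T" by (simp add: T_def Int_absorb1 Int_absorb2)
  have "zm \<in> T" using zm by (simp add: T_def m_def)
  \<comment> \<open>Among all maximum points a highest one is chosen; any further maximum point
    above it is a contradiction, recorded as \<open>up\<close>.\<close>
  then obtain p where p: "p \<in> T" "\<And>w. w \<in> T \<Longrightarrow> snd w \<le> snd p"
  proof -
    have "T \<noteq> {}" using \<open>zm \<in> T\<close> by blast
    from continuous_attains_sup[OF cT this continuous_on_snd[OF continuous_on_id]] show ?thesis using that by blast
  qed
  obtain x y where xy: "p = (x, y)" by fastforce
  have pK: "(x, y) \<in> closure \<Omega>" "0 \<le> x" "fst (g (x, y)) = m" using p(1) by (auto simp: xy T_def S_def)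
  have up: "False" if "(x', y') \<in> closure \<Omega>" "0 \<le> x'" "fst (g (x', y')) = m" "y < y'" for x' y'
    using p(2)[of "(x', y')"] that by (auto simp: T_def S_def xy)
  have le: "fst (g (x', y')) \<le> m" if "(x', y') \<in> closure \<Omega>" "0 \<le> x'" for x' y'
    using m(2) that by (auto simp: S_def)
  have sub: "\<Omega> \<subseteq> closure \<Omega>" by (rule closure_subset)
  have y0: "0 \<le> y"
    using sym_g_closure[OF gcl pK(1), of 1 "-1"] up[of x "-y"] pK(2,3) by (force simp: mirror_def not_le)
  have "x \<noteq> 0"
    using sym_g_closure(2)[OF gcl pK(1), of "-1" 1] pK(3) m(1) by (auto simp: mirror_def prod_eq_iff)
  then have x0: "0 < x" using pK by simp
  have "y \<noteq> R2" using gradient_outer_top[OF gcl, of x] pK m(1) by (auto simp: closure_iff)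
  then have y2: "y < R2" using pK(1) y0 by (simp add: closure_iff)
  have inner: "\<not> (x = r1 \<and> y \<le> r2)"
    using gradient_inner_right[OF gcl, of y] pK(3) y0 m(1) ab by auto
  \<comment> \<open>A common form of the boundary cases. The factor u rotates a half-disc into the
    domain at the point, k is the constant imaginary part of the complex gradient along the
    diameter, and w is a point of the half-disc that ends up higher.\<close>
  have step: False
    if e: "0 < e" and w: "w \<in> ball 0 e" "0 \<le> Im w" "y < Im (Complex x y + u * w)"
      and O: "\<And>w. w \<in> ball 0 e \<Longrightarrow> 0 < Im w \<Longrightarrow> (Re (Complex x y + u * w), Im (Complex x y + u * w)) \<in> \<Omega>"
      and K: "\<And>w. w \<in> ball 0 e \<Longrightarrow> 0 \<le> Im w \<Longrightarrow> (Re (Complex x y + u * w), Im (Complex x y + u * w)) \<in> closure \<Omega> \<and> 0 \<le> Re (Complex x y + u * w)"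
      and real: "\<And>w. w \<in> ball 0 e \<Longrightarrow> Im w = 0 \<Longrightarrow> Im (cgrad g (Complex x y + u * w)) = k"
    for e :: real and u w :: complex and k :: real
  proof -
    define f where "f = (\<lambda>\<zeta>. cgrad g (Complex x y + u * \<zeta>) - \<i> * of_real k)"
    have "Re (f w) = Re (f 0)"
    proof (rule half_disc_real_part_max[of f e])
      have "(\<lambda>\<zeta>. cgrad g (Complex x y + u * \<zeta>)) holomorphic_on (ball 0 e \<inter> {z. 0 < Im z})"
      proof (rule holomorphic_on_compose_gen[OF _ holomorphic_cgrad, unfolded o_def])
        show "(\<lambda>\<zeta>. Complex x y + u * \<zeta>) ` (ball 0 e \<inter> {z. 0 < Im z}) \<subseteq> {z. (Re z, Im z) \<in> \<Omega>}" using O by blast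
      qed (intro holomorphic_intros)
      then show "f holomorphic_on (ball 0 e \<inter> {z. 0 < Im z})" unfolding f_def by (intro holomorphic_intros)
      have "continuous_on (ball 0 e \<inter> {z. 0 \<le> Im z}) (\<lambda>\<zeta>. cgrad g (Complex x y + u * \<zeta>))"
      proof (rule continuous_on_compose2[OF continuous_cgrad[OF gcl]])
        show "(\<lambda>\<zeta>. Complex x y + u * \<zeta>) ` (ball 0 e \<inter> {z. 0 \<le> Im z}) \<subseteq> {z. (Re z, Im z) \<in> closure \<Omega>}" using K by blast
      qed (intro continuous_intros)
      then show "continuous_on (ball 0 e \<inter> {z. 0 \<le> Im z}) f" unfolding f_def by (intro continuous_intros)
      show "Im (f z) = 0" if "z \<in> ball 0 e" "Im z = 0" for z using real[OF that] by (simp add: f_def)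
      show "Re (f z) \<le> Re (f 0)" if "z \<in> ball 0 e" "0 \<le> Im z" for z
        using le K[OF that] pK(3) by (simp add: f_def cgrad_def)
    qed (rule w)+
    moreover have "Re (f w) = fst (g (Re (Complex x y + u * w), Im (Complex x y + u * w)))" "Re (f 0) = m"
      using pK(3) by (simp_all add: f_def cgrad_def)
    ultimately have "fst (g (Re (Complex x y + u * w), Im (Complex x y + u * w))) = m" by (simp only:)
    then show False by (rule up[OF conjunct1[OF K[OF w(1,2)]] conjunct2[OF K[OF w(1,2)]] _ w(3)])
  qed
  \<comment> \<open>The axis, the outer top side and the inner right side with its corner are
    already excluded. There remain interior points, the inner top side and the outer right
    side.\<close>
  consider "(x, y) \<in> \<Omega>" | "y = r2" "x < r1" | "x = R1"
  proof -
    have "(x, y) \<in> \<Omega> \<or> (y = r2 \<and> x < r1) \<or> x = R1"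
      using pK(1) inner x0 y0 y2 unfolding closure_iff mem by (smt (verit))
    then show ?thesis using that by blast
  qed
  then show False
  proof cases
    case 1
    have "open (\<Omega> \<inter> {z. 0 < fst z})" using op by (intro open_Int open_Collect_less continuous_intros)
    then obtain e where e: "0 < e" "ball (x, y) e \<subseteq> \<Omega> \<inter> {z. 0 < fst z}" using 1 x0 by (auto elim: openE)
    have b: "(Re w, Im w) \<in> \<Omega> \<and> 0 < Re w" if "w \<in> ball (Complex x y) e" for w
    proof -
      have "(Re w, Im w) \<in> ball (x, y) e" using that by (simp add: dist_prod_def dist_real_def dist_complex_def cmod_def)
      then show ?thesis using e(2) by auto
    qed
    have "Re (cgrad g (Complex x (y + e / 2))) = Re (cgrad g (Complex x y))"
    proof (rule real_part_max_imp_constant[OF holomorphic_on_subset[OF holomorphic_cgrad]])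
      show "Re (cgrad g w) \<le> Re (cgrad g (Complex x y))" if "w \<in> ball (Complex x y) e" for w
        using le[of "Re w" "Im w"] b[OF that] sub pK(3) by (auto simp: cgrad_def)
    qed (use b e(1) in \<open>auto simp: dist_complex_def cmod_def\<close>)
    then show False
      using up[of x "y + e / 2"] b[of "Complex x (y + e / 2)"] e(1) sub pK by (auto simp: cgrad_def dist_complex_def cmod_def)
  next
    case 2
    define e where "e = min x (min (r1 - x) (R2 - r2))"
    have e: "0 < e" "e \<le> x" "e \<le> r1 - x" "e \<le> R2 - r2" using 2 x0 R by (auto simp: e_def)
    have bd: "\<bar>Re w\<bar> < e" "\<bar>Im w\<bar> < e" if "w \<in> ball 0 e" for w
      using that abs_Re_le_cmod[of w] abs_Im_le_cmod[of w] by (auto simp: dist_norm)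
    show False
    proof (rule step[of e "Complex 0 (e / 2)" 1 a])
      fix w :: complex assume w: "w \<in> ball 0 e"
      show "(Re (Complex x y + 1 * w), Im (Complex x y + 1 * w)) \<in> \<Omega>" if "0 < Im w"
        using bd[OF w] that e R r 2 by (auto simp: mem abs_less_iff)
      show "(Re (Complex x y + 1 * w), Im (Complex x y + 1 * w)) \<in> closure \<Omega> \<and> 0 \<le> Re (Complex x y + 1 * w)" if "0 \<le> Im w"
        using bd[OF w] that e R r 2 by (auto simp: closure_iff abs_less_iff)
      show "Im (cgrad g (Complex x y + 1 * w)) = a" if "Im w = 0"
      proof -
        have "(x + Re w, r2) \<in> top_side r1 r2" using bd[OF w] e by (auto simp: top_side_def abs_less_iff)
        then show ?thesis using neumann_top that 2 by (simp add: cgrad_def)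
      qed
    qed (use e in \<open>auto simp: cmod_def\<close>)
  next
    case 3
    define e where "e = min (R1 - r1) (R2 - y)"
    have e: "0 < e" "e \<le> R1 - r1" "e \<le> R2 - y" using y2 R by (auto simp: e_def)
    have bd: "\<bar>Re w\<bar> < e" "\<bar>Im w\<bar> < e" if "w \<in> ball 0 e" for w
      using that abs_Re_le_cmod[of w] abs_Im_le_cmod[of w] by (auto simp: dist_norm)
    show False
    proof (rule step[of e "Complex (e / 2) 0" \<i> 0])
      fix w :: complex assume w: "w \<in> ball 0 e"
      show "(Re (Complex x y + \<i> * w), Im (Complex x y + \<i> * w)) \<in> \<Omega>" if "0 < Im w"
        using bd[OF w] that e y0 R r 3 by (auto simp: mem abs_less_iff)
      show "(Re (Complex x y + \<i> * w), Im (Complex x y + \<i> * w)) \<in> closure \<Omega> \<and> 0 \<le> Re (Complex x y + \<i> * w)" if "0 \<le> Im w"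
        using bd[OF w] that e y0 R r 3 by (auto simp: closure_iff abs_less_iff)
      show "Im (cgrad g (Complex x y + \<i> * w)) = 0" if "Im w = 0"
      proof -
        have "\<bar>y + Re w\<bar> < R2" using bd[OF w] e y0 by (auto simp: abs_less_iff)
        then show ?thesis using gradient_outer_right[OF gcl] that 3 by (simp add: cgrad_def)
      qed
    qed (use e in \<open>auto simp: cmod_def\<close>)
  qed
qed

lemma sign_top:
  assumes gcl: "continuous_on (closure \<Omega>) g" and z: "z \<in> top_side r1 r2"
  shows "fst z * fst (g z) \<le> 0"
proof -
  have zK: "z \<in> closure \<Omega>" using z R r by (auto simp: top_side_def closure_iff)
  show ?thesis
  proof (cases "0 \<le> fst z")
    case True
    then show ?thesis using fst_gradient_nonpos[OF gcl zK] by (simp add: mult_nonneg_nonpos)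
  next
    case False
    then have "fst (g (mirror (-1) 1 z)) \<le> 0"
      using fst_gradient_nonpos[OF gcl sym_g_closure(1)[OF gcl zK, of "-1" 1]] by (simp add: mirror_def)
    then have "0 \<le> fst (g z)" using sym_g_closure(2)[OF gcl zK, of "-1" 1] by (simp add: mirror_def)
    then show ?thesis using False by (simp add: mult_nonpos_nonneg)
  qed
qed

lemma sign_right:
  assumes gcl: "continuous_on (closure \<Omega>) g" and z: "z \<in> right_side r1 r2"
  shows "snd z * snd (g z) \<le> 0"
proof -
  interpret S: annulus_solution r2 r1 lam b a "\<lambda>z. v (prod.swap z)" "\<lambda>z. prod.swap (g (prod.swap z))" by (rule swapped)
  have "prod.swap z \<in> top_side r2 r1" using z by (auto simp: top_side_def right_side_def)
  from S.sign_top[OF swapped_closure[OF gcl] this] show ?thesis by simp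
qed

end

section \<open>The inner corner\<close>

lemma cube_parts:
  fixes q :: complex
  shows "Re (q ^ 3) = Re q * ((Re q)^2 - 3 * (Im q)^2)" "Im (q ^ 3) = Im q * (3 * (Re q)^2 - (Im q)^2)"
  by (simp_all add: power3_eq_cube power2_eq_square algebra_simps)

context annulus_solution
begin

text \<open>The domain near \<open>c = (r1, r2)\<close> is parametrised by \<open>c - \<i> q^3\<close> with \<open>q\<close> in the first quadrant. The inner
  Neumann conditions make \<open>F\<close> real on both edges, and the signs of the tangential derivatives force
  its value at the corner to be zero.\<close>

lemma limit_inner_corner:
  assumes top: "\<And>z. z \<in> top_side r1 r2 \<Longrightarrow> fst z * fst (g z) \<le> 0"
    and right: "\<And>z. z \<in> right_side r1 r2 \<Longrightarrow> snd z * snd (g z) \<le> 0"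
  shows "(g \<longlongrightarrow> (- b, - a)) (at (r1, r2) within \<Omega>)"
proof -
  define T where "T = \<Omega> \<union> top_side r1 r2 \<union> right_side r1 r2"
  define \<eta> where "\<eta> = min (min r1 r2) (min (R1 - r1) (R2 - r2)) / 2"
  have \<eta>: "0 < \<eta>" "2 * \<eta> \<le> r1" "2 * \<eta> \<le> r2" "2 * \<eta> \<le> R1 - r1" "2 * \<eta> \<le> R2 - r2" using R r by (auto simp: \<eta>_def)
  define s where "s = min 1 \<eta>"
  have s: "0 < s" "s \<le> 1" "s \<le> \<eta>" using \<eta> by (auto simp: s_def)
  \<comment> \<open>Real and imaginary part of -\<i> q^3, the displacement from the corner.\<close>
  define X Y where "X = (\<lambda>q. Im q * (3 * (Re q)^2 - (Im q)^2))" and "Y = (\<lambda>q. Re q * (3 * (Im q)^2 - (Re q)^2))"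
  define c0 where "c0 = Complex r1 r2"
  \<comment> \<open>Minus the complex gradient prescribed at the corner by the two Neumann
    conditions.\<close>
  define \<kappa> where "\<kappa> = Complex b (- a)"
  define P where "P = (\<lambda>q. cgrad g (c0 - \<i> * q ^ 3))"
  \<comment> \<open>The last factor is dz/d(q^2) for z = c0 - \<i> q^3. Along each edge it rotates
    the unknown tangential component to the real axis, while adding \<open>\<kappa>\<close> cancels
    the known normal component.\<close>
  define F where "F = (\<lambda>q. (P q + \<kappa>) * (- (3 * \<i> / 2) * q))"
  have zq: "Re (c0 - \<i> * q ^ 3) = r1 + X q" "Im (c0 - \<i> * q ^ 3) = r2 + Y q" for q
    by (simp_all add: c0_def cube_parts X_def Y_def algebra_simps)
  have Pc: "P q = Complex (fst (g (r1 + X q, r2 + Y q))) (- snd (g (r1 + X q, r2 + Y q)))" for q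
    by (simp only: P_def cgrad_def zq)
  have nP: "norm (P q) = norm (g (r1 + X q, r2 + Y q))" for q
    by (simp only: P_def norm_cgrad zq)
  have XYle: "\<bar>X q\<bar> \<le> norm q ^ 3" "\<bar>Y q\<bar> \<le> norm q ^ 3" for q
    using abs_Im_le_cmod[of "q ^ 3"] abs_Re_le_cmod[of "q ^ 3"] by (simp_all add: cube_parts X_def Y_def norm_power abs_mult abs_minus_commute)
  have cube: "norm q ^ 3 \<le> norm q" if "norm q < s" for q :: complex
    using power_decreasing[of 1 3 "norm q"] that s by simp
  have XY: "\<bar>X q\<bar> < \<eta>" "\<bar>Y q\<bar> < \<eta>" if "norm q < s" for q
    using XYle[of q] cube[OF that] that s by auto
  \<comment> \<open>If both displacements were nonpositive, then (Im q)^2 \<ge> 3 (Re q)^2 and (Re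
    q)^2 \<ge> 3 (Im q)^2, which is impossible in the open quadrant.\<close>
  have pos: "0 < X q \<or> 0 < Y q" if "0 < Re q" "0 < Im q" for q
  proof (cases "(Im q)^2 < 3 * (Re q)^2")
    case False
    then have "(Re q)^2 < 3 * (Im q)^2" using that zero_less_power[of "Re q" 2] by linarith
    then show ?thesis using that by (simp add: Y_def)
  qed (use that in \<open>simp add: X_def\<close>)
  have in\<Omega>: "(r1 + x, r2 + y) \<in> \<Omega>" if "\<bar>x\<bar> < 2 * \<eta>" "\<bar>y\<bar> < 2 * \<eta>" "0 < x \<or> 0 < y" for x y
  proof -
    have "\<bar>r1 + x\<bar> = r1 + x" "\<bar>r2 + y\<bar> = r2 + y" "r1 + x < R1" "r2 + y < R2" using that \<eta> by linarith+
    then show ?thesis using that(3) by (auto simp: mem)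
  qed
  have in_right: "(r1, r2 + y) \<in> right_side r1 r2" if "\<bar>y\<bar> < \<eta>" "y < 0" for y
    using that \<eta> by (auto simp: right_side_def)
  have in_top: "(r1 + x, r2) \<in> top_side r1 r2" if "\<bar>x\<bar> < \<eta>" "x < 0" for x
    using that \<eta> by (auto simp: top_side_def)
  have edge: "X q = 0 \<and> Y q = - (Re q ^ 3)" if "Im q = 0" for q
    using that by (simp add: X_def Y_def power2_eq_square power3_eq_cube)
  have edge': "Y q = 0 \<and> X q = - (Im q ^ 3)" if "Re q = 0" for q
    using that by (simp add: X_def Y_def power2_eq_square power3_eq_cube)
  have P\<Omega>: "(r1 + X q, r2 + Y q) \<in> \<Omega>" if "0 < Re q" "0 < Im q" "norm q < s" for q
    using in\<Omega>[of "X q" "Y q"] XY[OF that(3)] pos[OF that(1,2)] \<eta>(1) by simp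
  have Pright: "(r1, r2 + Y q) \<in> right_side r1 r2" if "0 < Re q" "Im q = 0" "norm q < s" for q
    using XY[OF that(3)] edge[OF that(2)] that(1) by (intro in_right) auto
  have Ptop: "(r1 + X q, r2) \<in> top_side r1 r2" if "Re q = 0" "0 < Im q" "norm q < s" for q
    using XY[OF that(3)] edge'[OF that(1)] that(2) by (intro in_top) auto
  have PT: "(r1 + X q, r2 + Y q) \<in> T" if pq: "0 \<le> Re q" "0 \<le> Im q" "\<not> (Re q = 0 \<and> Im q = 0)" "norm q < s" for q
  proof -
    consider "0 < Re q" "0 < Im q" | "0 < Re q" "Im q = 0" | "Re q = 0" "0 < Im q" using pq by linarith
    then show ?thesis
    proof cases
      case 1 then show ?thesis using P\<Omega> pq unfolding T_def by blast
    next
      case 2 then show ?thesis using Pright[of q] edge[of q] pq by (simp add: T_def)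
    next
      case 3 then show ?thesis using Ptop[of q] edge'[of q] pq by (simp add: T_def)
    qed
  qed
  have F_right: "F q = of_real (- (3 / 2) * Re q * (snd (g (r1, r2 + Y q)) + a))"
    if "0 < Re q" "Im q = 0" "norm q < s" for q
    using neumann_right[OF Pright[OF that]] edge[OF that(2)] that(2)
    by (simp add: F_def Pc \<kappa>_def complex_eq_iff algebra_simps)
  have F_top: "F q = of_real (3 / 2 * Im q * (fst (g (r1 + X q, r2)) + b))"
    if "Re q = 0" "0 < Im q" "norm q < s" for q
    using neumann_top[OF Ptop[OF that]] edge'[OF that(1)] that(1)
    by (simp add: F_def Pc \<kappa>_def complex_eq_iff algebra_simps)
  obtain l C t where t: "0 < t" "t \<le> s"
    and E: "\<And>q. norm q < t \<Longrightarrow> 0 \<le> Re q \<Longrightarrow> 0 \<le> Im q \<Longrightarrow> q \<noteq> 0 \<Longrightarrow> norm (F q - of_real l) \<le> C * (norm q)^2"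
  proof (rule quadrant_corner_expansion[OF s(1), of F])
    let ?O = "{q. norm q < s \<and> 0 < Re q \<and> 0 < Im q}" and ?C = "{q. norm q < s \<and> 0 \<le> Re q \<and> 0 \<le> Im q \<and> q \<noteq> 0}"
    have "P holomorphic_on ?O"
      unfolding P_def
    proof (rule holomorphic_on_compose_gen[OF _ holomorphic_cgrad, unfolded o_def])
      show "(\<lambda>q. c0 - \<i> * q ^ 3) ` ?O \<subseteq> {z. (Re z, Im z) \<in> \<Omega>}"
        by (rule image_subsetI, unfold mem_Collect_eq zq) (intro P\<Omega>; simp)
    qed (intro holomorphic_intros)
    then show "F holomorphic_on ?O"
      unfolding F_def by (intro holomorphic_on_add holomorphic_on_mult holomorphic_on_const holomorphic_on_ident)
    have "continuous_on ?C P"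
      unfolding P_def
    proof (rule continuous_on_compose2[OF continuous_cgrad[OF cont_g[folded T_def]]])
      show "(\<lambda>q. c0 - \<i> * q ^ 3) ` ?C \<subseteq> {z. (Re z, Im z) \<in> T}"
        by (rule image_subsetI, unfold mem_Collect_eq zq) (intro PT; simp add: complex_eq_iff)
    qed (intro continuous_intros)
    then show "continuous_on ?C F"
      unfolding F_def by (intro continuous_on_add continuous_on_mult continuous_on_const continuous_on_id)
    show "Im (F q) = 0" if q: "norm q < s" "0 \<le> Re q" "0 \<le> Im q" "Re q = 0 \<or> Im q = 0" "q \<noteq> 0" for q
    proof -
      have "0 < Re q \<and> Im q = 0 \<or> Re q = 0 \<and> 0 < Im q" using q by (auto simp: complex_eq_iff)
      then show ?thesis
      proof (elim disjE conjE)
        assume h: "0 < Re q" "Im q = 0"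
        show ?thesis unfolding F_right[OF h q(1)] by (rule Im_complex_of_real)
      next
        assume h: "Re q = 0" "0 < Im q"
        show ?thesis unfolding F_top[OF h q(1)] by (rule Im_complex_of_real)
      qed
    qed
    show "\<exists>t>0. \<forall>q. norm q < t \<and> 0 < Re q \<and> 0 < Im q \<longrightarrow> norm (F q) * (2 * Re q * Im q) \<le> e" if e: "0 < e" for e
    proof -
      obtain \<delta>0 where \<delta>0: "\<delta>0 > 0" "\<And>x y d. 0 < d \<and> cbox (x - d, y - d) (x + d, y + d) \<subseteq> \<Omega> \<inter> ball (r1, r2) \<delta>0 \<Longrightarrow> norm (g (x, y)) * d \<le> e / 12"
        using decay[of "e / 12" "(r1, r2)"] e by auto
      define M where "M = norm \<kappa>"
      have M: "0 \<le> M" by (simp add: M_def)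
      \<comment> \<open>The last bound keeps the contribution of the constant
        \<open>\<kappa>\<close>, whose norm is M, below e/2; the decay with e/12 accounts for the
        other half.\<close>
      define t where "t = min s (min (\<delta>0 / 4) (e / (6 * (M + 1))))"
      have t: "0 < t" "t \<le> s" "4 * t \<le> \<delta>0" "t \<le> e / (6 * (M + 1))" using s \<delta>0 e M by (auto simp: t_def)
      show ?thesis
      proof (intro exI[of _ t] conjI allI impI t(1))
        fix p :: complex assume z: "norm p < t \<and> 0 < Re p \<and> 0 < Im p"
        define \<alpha> \<beta> N where "\<alpha> = Re p" and "\<beta> = Im p" and "N = norm p"
        have ab: "0 < \<alpha>" "0 < \<beta>" "N \<le> \<alpha> + \<beta>" "N < t"
          using z cmod_le[of p] by (auto simp: \<alpha>_def \<beta>_def N_def)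
        have Ns: "norm p < s" using ab(4) t(2) by (simp add: N_def)
        \<comment> \<open>Half of the larger displacement: in a square of this half-side the larger
          coordinate stays beyond the corner, so the square avoids the hole even when the other
          displacement is negative.\<close>
        define d where "d = max (X p) (Y p) / 2"
        have d: "0 < d" using pos[of p] ab by (auto simp: d_def \<alpha>_def \<beta>_def less_max_iff_disj)
        have XN: "\<bar>X p\<bar> \<le> N" "\<bar>Y p\<bar> \<le> N" using XYle[of p] cube[OF Ns] by (auto simp: N_def)
        have d2: "2 * d \<le> N" using XN by (auto simp: d_def)
        \<comment> \<open>Case split at the diagonal of the quadrant: there the larger of Re q and
          Im q dominates, |q| is at most twice it, and the corresponding displacement is bounded
          below.\<close>
        have key: "\<alpha> * \<beta> * N \<le> 2 * d"
        proof (cases "\<beta> \<le> \<alpha>")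
          case True
          have "\<alpha> * \<beta> * N \<le> \<alpha> * \<beta> * (2 * \<alpha>)" using ab True by (intro mult_left_mono) auto
          also have "... = \<beta> * (3 * \<alpha>^2 - \<alpha>^2)" by (simp add: power2_eq_square)
          also have "... \<le> \<beta> * (3 * \<alpha>^2 - \<beta>^2)" using ab True by (intro mult_left_mono) (auto intro: power_mono)
          also have "... = X p" by (simp add: X_def \<alpha>_def \<beta>_def)
          finally show ?thesis by (simp add: d_def)
        next
          case False
          have "\<alpha> * \<beta> * N \<le> \<alpha> * \<beta> * (2 * \<beta>)" using ab False by (intro mult_left_mono) auto
          also have "... = \<alpha> * (3 * \<beta>^2 - \<beta>^2)" by (simp add: power2_eq_square)
          also have "... \<le> \<alpha> * (3 * \<beta>^2 - \<alpha>^2)" using ab False by (intro mult_left_mono) (auto intro: power_mono)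
          also have "... = Y p" by (simp add: Y_def \<alpha>_def \<beta>_def)
          finally show ?thesis by (simp add: d_def)
        qed
        have "cbox (r1 + X p - d, r2 + Y p - d) (r1 + X p + d, r2 + Y p + d) \<subseteq> \<Omega> \<inter> ball (r1, r2) \<delta>0"
        proof (rule subrelI)
          fix x y assume "(x, y) \<in> cbox (r1 + X p - d, r2 + Y p - d) (r1 + X p + d, r2 + Y p + d)"
          then have 1: "\<bar>x - r1 - X p\<bar> \<le> d" "\<bar>y - r2 - Y p\<bar> \<le> d" by (auto simp: cbox_Pair_eq abs_le_iff)
          have 2: "\<bar>x - r1\<bar> < 2 * t" "\<bar>y - r2\<bar> < 2 * t" using 1 XN d2 ab by linarith+
          have "d = X p / 2 \<or> d = Y p / 2" by (simp add: d_def max_def)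
          then have "0 < x - r1 \<or> 0 < y - r2" using 1 d by linarith
          then have "(r1 + (x - r1), r2 + (y - r2)) \<in> \<Omega>" using 2 t s by (intro in\<Omega>) auto
          moreover have "dist (r1, r2) (x, y) \<le> \<bar>x - r1\<bar> + \<bar>y - r2\<bar>"
            using sqrt_sum_squares_le_sum_abs[of "r1 - x" "r2 - y"] by (simp add: dist_prod_def dist_real_def)
          moreover have "\<bar>x - r1\<bar> + \<bar>y - r2\<bar> < \<delta>0" using 2 t by linarith
          ultimately show "(x, y) \<in> \<Omega> \<inter> ball (r1, r2) \<delta>0" by simp
        qed
        then have "norm (g (r1 + X p, r2 + Y p)) * d \<le> e / 12" using \<delta>0(2) d by blast
        then have g: "norm (P p) * d \<le> e / 12" by (simp only: nP)
        have "M * (6 * t) \<le> (M + 1) * (6 * (e / (6 * (M + 1))))" using M t by (intro mult_mono) auto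
        also have "... = e" using M by (simp add: field_simps)
        finally have Mt: "M * (6 * t) \<le> e" .
        have "norm (F p) * (2 * Re p * Im p) = norm (P p + \<kappa>) * (3 * (\<alpha> * \<beta> * N))"
          by (simp add: F_def norm_mult N_def \<alpha>_def \<beta>_def)
        also have "... \<le> (norm (P p) + M) * (3 * (2 * d))"
        proof (rule mult_mono)
          show "norm (P p + \<kappa>) \<le> norm (P p) + M" unfolding M_def by (rule norm_triangle_ineq)
          show "0 \<le> 3 * (\<alpha> * \<beta> * N)" using ab by (simp add: N_def)
          show "3 * (\<alpha> * \<beta> * N) \<le> 3 * (2 * d)" using key by (rule mult_left_mono) simp
        qed (use M in simp)
        also have "... = 6 * (norm (P p) * d) + M * (6 * d)" by (simp add: algebra_simps)
        also have "M * (6 * d) \<le> M * (6 * t) / 2"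
        proof -
          have "M * (6 * d) \<le> M * (3 * t)" using M d2 ab by (intro mult_left_mono) auto
          then show ?thesis by simp
        qed
        finally show "norm (F p) * (2 * Re p * Im p) \<le> e" using g Mt by linarith
      qed
    qed
  qed (rule that; assumption)
  have lim0: "((\<lambda>x. 3 / 2 * x * k + C * x^2) \<longlongrightarrow> 0) (at_right 0)" for k :: real
  proof -
    have "((\<lambda>x. 3 / 2 * x * k + C * x^2) \<longlongrightarrow> 3 / 2 * 0 * k + C * 0^2) (at_right 0)" by (intro tendsto_intros)
    then show ?thesis by simp
  qed
  \<comment> \<open>The imaginary q-axis runs along the top side, where Berg's inequality makes the
    tangential derivative nonpositive. What remains of the upper bound for l tends to 0 with
    x.\<close>
  have "l \<le> 0"
  proof (rule tendsto_lowerbound[OF lim0[of b] eventually_at_rightI[OF _ t(1)] trivial_limit_at_right_real])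
    fix x assume x: "x \<in> {0<..<t}"
    define p where "p = Complex 0 x"
    have p: "Re p = 0" "0 < Im p" "norm p < s" "norm p = x" "p \<noteq> 0" using x t by (auto simp: p_def cmod_def complex_eq_iff)
    have "norm (of_real (3 / 2 * x * (fst (g (r1 + X p, r2)) + b)) - (of_real l :: complex)) \<le> C * x^2"
      using E[of p] p x unfolding F_top[OF p(1-3)] by (simp add: p_def)
    then have "\<bar>3 / 2 * x * (fst (g (r1 + X p, r2)) + b) - l\<bar> \<le> C * x^2" unfolding of_real_diff[symmetric] norm_of_real .
    moreover have "0 < r1 + X p" using XY[OF p(3)] \<eta> by linarith
    then have "fst (g (r1 + X p, r2)) \<le> 0" using top[OF Ptop[OF p(1-3)]] by (simp add: mult_le_0_iff)
    then have "3 / 2 * x * (fst (g (r1 + X p, r2)) + b) \<le> 3 / 2 * x * b" using x by (intro mult_left_mono) auto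
    ultimately show "l \<le> 3 / 2 * x * b + C * x^2" by linarith
  qed
  \<comment> \<open>The real q-axis runs along the right side. There the tangential derivative
    enters F with the opposite sign, so the same inequality bounds -l.\<close>
  moreover have "- l \<le> 0"
  proof (rule tendsto_lowerbound[OF lim0[of a] eventually_at_rightI[OF _ t(1)] trivial_limit_at_right_real])
    fix x assume x: "x \<in> {0<..<t}"
    define p where "p = Complex x 0"
    have p: "0 < Re p" "Im p = 0" "norm p < s" "norm p = x" "p \<noteq> 0" using x t by (auto simp: p_def cmod_def complex_eq_iff)
    have "norm (of_real (- (3 / 2) * x * (snd (g (r1, r2 + Y p)) + a)) - (of_real l :: complex)) \<le> C * x^2"
      using E[of p] p x unfolding F_right[OF p(1-3)] by (simp add: p_def)
    then have "\<bar>- (3 / 2) * x * (snd (g (r1, r2 + Y p)) + a) - l\<bar> \<le> C * x^2" unfolding of_real_diff[symmetric] norm_of_real .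
    moreover have "0 < r2 + Y p" using XY[OF p(3)] \<eta> by linarith
    then have "snd (g (r1, r2 + Y p)) \<le> 0" using right[OF Pright[OF p(1-3)]] by (simp add: mult_le_0_iff)
    then have "3 / 2 * x * (snd (g (r1, r2 + Y p)) + a) \<le> 3 / 2 * x * a" using x by (intro mult_left_mono) auto
    ultimately show "- l \<le> 3 / 2 * x * a + C * x^2" by linarith
  qed
  ultimately have l: "l = 0" by simp
  \<comment> \<open>With l = 0 the expansion gives |F| \<le> C |q|^2, and dividing by 3|q|/2 leaves
    a multiple of |q|, the cube root of the distance to the corner. Hence also the radius
    t^3.\<close>
  have "eventually (\<lambda>z. norm (g z - (- b, - a)) \<le> 2 / 3 * \<bar>C\<bar> * root 3 (norm (z - (r1, r2)))) (at (r1, r2) within \<Omega>)"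
    unfolding eventually_at
  proof (intro exI[of _ "min \<eta> (t ^ 3)"] conjI ballI impI)
    show "0 < min \<eta> (t ^ 3)" using \<eta> t by simp
    fix z assume z: "z \<in> \<Omega>" "z \<noteq> (r1, r2) \<and> dist z (r1, r2) < min \<eta> (t ^ 3)"
    obtain x y where xy: "z = (x, y)" by fastforce
    have n: "norm (Complex x y - c0) = norm (z - (r1, r2))" by (simp add: xy c0_def cmod_def norm_prod_def)
    have zs: "norm (z - (r1, r2)) < \<eta>" "norm (z - (r1, r2)) < t ^ 3" using z by (simp_all add: dist_norm)
    have "\<bar>x - r1\<bar> < \<eta>" "\<bar>y - r2\<bar> < \<eta>"
      using zs(1) abs_Re_le_cmod[of "Complex x y - c0"] abs_Im_le_cmod[of "Complex x y - c0"] unfolding n[symmetric] by (auto simp: c0_def)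
    then have "0 \<le> x" "0 \<le> y" using \<eta> by linarith+
    \<comment> \<open>Multiplication by \<i> carries the removed quadrant x < r1, y < r2 to the open
      fourth quadrant.\<close>
    then have w: "\<not> (0 < Re (\<i> * (Complex x y - c0)) \<and> Im (\<i> * (Complex x y - c0)) < 0)"
      using z(1) by (auto simp: xy mem c0_def)
    obtain p where p: "0 \<le> Re p" "0 \<le> Im p" "p ^ 3 = \<i> * (Complex x y - c0)" "norm p = root 3 (norm (\<i> * (Complex x y - c0)))"
      by (rule quadrant_cube_root[OF w]) (rule that; assumption)
    have np: "norm p = root 3 (norm (z - (r1, r2)))" using p(4) by (simp add: norm_mult n)
    have p0: "p \<noteq> 0" using z(2) p(4) by (auto simp: norm_mult n)
    have "norm p < root 3 (t ^ 3)" unfolding np using zs(2) by simp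
    then have pt: "norm p < t" using t(1) by (simp add: real_root_pos2)
    have "c0 - \<i> * p ^ 3 = Complex x y" unfolding p(3) by (simp add: algebra_simps flip: mult.assoc)
    then have Pp: "P p = cgrad g (Complex x y)" by (simp add: P_def)
    have "norm (P p + \<kappa>) * (3 / 2 * norm p) \<le> C * (norm p)^2"
      using E[OF pt p(1,2) p0] by (simp add: l F_def norm_mult)
    also have "... \<le> \<bar>C\<bar> * (norm p)^2" by (intro mult_right_mono) auto
    finally have "norm (P p + \<kappa>) \<le> 2 / 3 * \<bar>C\<bar> * norm p" using p0 by (simp add: power2_eq_square field_simps)
    moreover have "norm (P p + \<kappa>) = norm (g z - (- b, - a))"
      unfolding Pp by (simp add: xy \<kappa>_def cgrad_def cmod_def norm_prod_def power2_commute) (simp add: add.commute)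
    ultimately show "norm (g z - (- b, - a)) \<le> 2 / 3 * \<bar>C\<bar> * root 3 (norm (z - (r1, r2)))" by (simp add: np)
  qed
  then have "((\<lambda>z. g z - (- b, - a)) \<longlongrightarrow> 0) (at (r1, r2) within \<Omega>)"
  proof (rule Lim_null_comparison)
    have "((\<lambda>z. 2 / 3 * \<bar>C\<bar> * root 3 (norm (z - (r1, r2)))) \<longlongrightarrow> 2 / 3 * \<bar>C\<bar> * root 3 (norm ((r1, r2) - (r1, r2)))) (at (r1, r2) within \<Omega>)"
      by (intro tendsto_intros)
    then show "((\<lambda>z. 2 / 3 * \<bar>C\<bar> * root 3 (norm (z - (r1, r2)))) \<longlongrightarrow> 0) (at (r1, r2) within \<Omega>)"
      by (simp only: diff_self norm_zero mult_zero_right real_root_zero)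
  qed
  then show ?thesis by (rule Lim_null[THEN iffD2])
qed

section \<open>Extension to the closed annulus\<close>

lemma gradient_limit_exists:
  assumes top: "\<And>z. z \<in> top_side r1 r2 \<Longrightarrow> fst z * fst (g z) \<le> 0"
    and right: "\<And>z. z \<in> right_side r1 r2 \<Longrightarrow> snd z * snd (g z) \<le> 0"
    and z: "z \<in> closure \<Omega>" "z \<notin> \<Omega>"
  shows "\<exists>l. (g \<longlongrightarrow> l) (at z within \<Omega>)"
proof -
  have quadrant: "\<exists>l. (g \<longlongrightarrow> l) (at (x, y) within \<Omega>)"
    if xy: "(x, y) \<in> closure \<Omega>" "(x, y) \<notin> \<Omega>" "0 \<le> x" "0 \<le> y" for x y
  proof -
    have "(y = R2 \<and> \<bar>x\<bar> < R1) \<or> (x = R1 \<and> \<bar>y\<bar> < R2) \<or> (x = R1 \<and> y = R2) \<or> (x = r1 \<and> y = r2)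
      \<or> (x = r1 \<and> y < r2) \<or> (y = r2 \<and> x < r1)"
      using xy unfolding closure_iff mem by (smt (verit))
    then consider "y = R2" "\<bar>x\<bar> < R1" | "x = R1" "\<bar>y\<bar> < R2" | "x = R1" "y = R2" | "x = r1" "y = r2"
      | "(x, y) \<in> top_side r1 r2 \<union> right_side r1 r2"
      using xy r by (auto simp: top_side_def right_side_def)
    then show ?thesis
    proof cases
      case 5
      then have "(g \<longlongrightarrow> g (x, y)) (at (x, y) within (\<Omega> \<union> top_side r1 r2 \<union> right_side r1 r2))"
        using cont_g by (auto simp: continuous_on_def)
      then show ?thesis using tendsto_within_subset[of g _ _ _ \<Omega>] by blast
    qed (use limit_outer_top limit_outer_right limit_outer_corner limit_inner_corner[OF top right] in blast)+
  qed
  \<comment> \<open>The reflection that moves z into the closed first quadrant; the gradient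
    commutes with it by \<open>sym_g\<close>.\<close>
  define s t :: real where "s = (if fst z < 0 then -1 else 1)" and "t = (if snd z < 0 then -1 else 1)"
  have st: "\<bar>s\<bar> = 1" "\<bar>t\<bar> = 1" by (auto simp: s_def t_def)
  obtain x y where xy: "z = (x, y)" by fastforce
  have m: "mirror s t z = (\<bar>x\<bar>, \<bar>y\<bar>)" by (auto simp: mirror_def s_def t_def xy)
  have "(\<bar>x\<bar>, \<bar>y\<bar>) \<in> closure \<Omega>" "(\<bar>x\<bar>, \<bar>y\<bar>) \<notin> \<Omega>" using z by (simp_all add: xy closure_iff mem)
  then obtain l where l: "(g \<longlongrightarrow> l) (at (mirror s t z) within \<Omega>)" using quadrant unfolding m by force
  have "((\<lambda>w. g (mirror s t w)) \<longlongrightarrow> l) (at z within \<Omega>)"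
  proof (rule tendsto_at_within_compose[OF l])
    show "isCont (mirror s t) z" unfolding mirror_def by (intro continuous_intros)
    show "mirror s t w \<in> \<Omega>" if "w \<in> \<Omega>" for w using mirror_annulus[OF r st] that by simp
    show "mirror s t w \<noteq> mirror s t z" if "w \<noteq> z" for w using mirror_mirror[OF st] that by metis
  qed simp
  then have "((\<lambda>w. mirror s t (g (mirror s t w))) \<longlongrightarrow> mirror s t l) (at z within \<Omega>)"
    unfolding mirror_def by (intro tendsto_intros)
  moreover have "eventually (\<lambda>w. mirror s t (g (mirror s t w)) = g w) (at z within \<Omega>)"
    using sym_g[OF _ st] mirror_mirror[OF st] by (auto simp: eventually_at_filter)
  ultimately show ?thesis using Lim_transform_eventually by blast
qed

lemma lipschitz_of_bounded_gradient:
  assumes M: "\<And>z. z \<in> \<Omega> \<Longrightarrow> norm (g z) \<le> M" and z: "z \<in> \<Omega>" "w \<in> \<Omega>"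
  shows "\<bar>v z - v w\<bar> \<le> 2 * M * dist z w"
proof -
  have M0: "0 \<le> M" using M[OF z(1)] norm_ge_zero order_trans by blast
  have gle: "\<bar>fst (g z)\<bar> \<le> M" "\<bar>snd (g z)\<bar> \<le> M" if "z \<in> \<Omega>" for z
    proof -
    have "\<bar>fst (g z)\<bar> \<le> norm (g z)" "\<bar>snd (g z)\<bar> \<le> norm (g z)" by (simp_all add: norm_prod_def)
    then show "\<bar>fst (g z)\<bar> \<le> M" "\<bar>snd (g z)\<bar> \<le> M" using M[OF that] by linarith+
  qed
  have quadrant_step: "\<bar>v (X, Y) - v (x, y)\<bar> \<le> M * (X - x + (Y - y))"
    if xy: "(x, y) \<in> \<Omega>" "0 \<le> x" "0 \<le> y" and XY: "x \<le> X" "y \<le> Y" "X < R1" "Y < R2" for x y X Y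
  proof -
    have in\<Omega>: "(p, q) \<in> \<Omega>" if "x \<le> p" "p \<le> X" "y \<le> q" "q \<le> Y" for p q
      using xy XY that by (auto simp: mem)
    have h: "\<bar>v (X, y) - v (x, y)\<bar> \<le> M * (X - x)"
    proof (cases "x = X")
      case False
      have "((\<lambda>p. v (p, y)) has_real_derivative fst (g (p, y))) (at p)" if "x \<le> p" "p \<le> X" for p
        by (rule GDERIV_partial_fst[OF grad[OF in\<Omega>]]) (use that XY in auto)
      then obtain p where "x < p" "p < X" "v (X, y) - v (x, y) = (X - x) * fst (g (p, y))"
        using MVT2[of x X "\<lambda>p. v (p, y)"] False XY by fastforce
      then show ?thesis using gle(1)[OF in\<Omega>[of p y]] XY by (simp add: abs_mult mult.commute mult_right_mono)
    qed simp
    have "\<bar>v (X, Y) - v (X, y)\<bar> \<le> M * (Y - y)"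
    proof (cases "y = Y")
      case False
      have "((\<lambda>q. v (X, q)) has_real_derivative snd (g (X, q))) (at q)" if "y \<le> q" "q \<le> Y" for q
        by (rule GDERIV_partial_snd[OF grad[OF in\<Omega>]]) (use that XY in auto)
      then obtain q where "y < q" "q < Y" "v (X, Y) - v (X, y) = (Y - y) * snd (g (X, q))"
        using MVT2[of y Y "\<lambda>q. v (X, q)"] False XY by fastforce
      then show ?thesis using gle(2)[OF in\<Omega>[of X q]] XY by (simp add: abs_mult mult.commute mult_right_mono)
    qed simp
    then show ?thesis using h by (simp add: distrib_left)
  qed
  have fold: "(\<bar>fst z\<bar>, \<bar>snd z\<bar>) \<in> \<Omega> \<and> v (\<bar>fst z\<bar>, \<bar>snd z\<bar>) = v z" if "z \<in> \<Omega>" for z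
  proof -
    define s t :: real where "s = (if fst z < 0 then -1 else 1)" and "t = (if snd z < 0 then -1 else 1)"
    have "mirror s t z = (\<bar>fst z\<bar>, \<bar>snd z\<bar>)" by (simp add: mirror_def s_def t_def)
    moreover have "\<bar>s\<bar> = 1" "\<bar>t\<bar> = 1" by (auto simp: s_def t_def)
    ultimately show ?thesis using sym[OF that, of s t] mirror_annulus[OF r, of s t z] that by simp
  qed
  define x y x' y' where "x = \<bar>fst z\<bar>" and "y = \<bar>snd z\<bar>" and "x' = \<bar>fst w\<bar>" and "y' = \<bar>snd w\<bar>"
  define X Y where "X = max x x'" and "Y = max y y'"
  have O: "(x, y) \<in> \<Omega>" "(x', y') \<in> \<Omega>" "v (x, y) = v z" "v (x', y') = v w"
    using fold[OF z(1)] fold[OF z(2)] by (auto simp: x_def y_def x'_def y'_def)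
  have XR: "X < R1" "Y < R2" using O(1,2) by (auto simp: X_def Y_def mem)
  have 1: "\<bar>v (X, Y) - v z\<bar> \<le> M * (X - x + (Y - y))"
    unfolding O(3)[symmetric] by (rule quadrant_step[OF O(1) _ _ _ _ XR]) (auto simp: x_def y_def X_def Y_def)
  have 2: "\<bar>v (X, Y) - v w\<bar> \<le> M * (X - x' + (Y - y'))"
    unfolding O(4)[symmetric] by (rule quadrant_step[OF O(2) _ _ _ _ XR]) (auto simp: x'_def y'_def X_def Y_def)
  have "\<bar>fst z - fst w\<bar> \<le> dist z w" "\<bar>snd z - snd w\<bar> \<le> dist z w"
    using dist_fst_le[of z w] dist_snd_le[of z w] by (simp_all add: dist_real_def)
  then have "X - x + (X - x') \<le> dist z w" "Y - y + (Y - y') \<le> dist z w"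
    by (auto simp: X_def Y_def x_def x'_def y_def y'_def)
  then have "X - x + (Y - y) + (X - x' + (Y - y')) \<le> 2 * dist z w" by linarith
  then have "M * (X - x + (Y - y) + (X - x' + (Y - y'))) \<le> M * (2 * dist z w)" using M0 by (rule mult_left_mono)
  then have "M * (X - x + (Y - y)) + M * (X - x' + (Y - y')) \<le> 2 * M * dist z w" by (simp only: distrib_left mult_ac)
  moreover have "\<bar>v z - v w\<bar> \<le> \<bar>v (X, Y) - v z\<bar> + \<bar>v (X, Y) - v w\<bar>" by linarith
  ultimately show ?thesis using 1 2 by linarith
qed

text \<open>The limits of the gradient make it bounded, hence v Lipschitz and uniformly continuous,
  and so v extends to the closure together with its gradient.\<close>

lemma C1_closure_of_signs:
  assumes top: "\<And>z. z \<in> top_side r1 r2 \<Longrightarrow> fst z * fst (g z) \<le> 0"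
    and right: "\<And>z. z \<in> right_side r1 r2 \<Longrightarrow> snd z * snd (g z) \<le> 0"
    and u: "AE z in lebesgue_on \<Omega>. u z = v z"
  shows "C1_closure \<Omega> u"
proof -
  have gc: "continuous_on \<Omega> g" by (rule continuous_on_subset[OF cont_g]) blast
  obtain G where G: "continuous_on (closure \<Omega>) G" "\<And>z. z \<in> \<Omega> \<Longrightarrow> G z = g z"
    using continuous_extension_by_limits[OF closure_subset order_refl gc gradient_limit_exists[OF top right]] by metis
  have "compact (closure \<Omega>)" using bounded_annulus by (simp add: compact_closure)
  then have "bounded (G ` closure \<Omega>)" using G(1) compact_continuous_image compact_imp_bounded by blast
  then obtain M where M: "\<And>z. z \<in> closure \<Omega> \<Longrightarrow> norm (G z) \<le> M" unfolding bounded_iff by blast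
  have M': "norm (g z) \<le> M" if "z \<in> \<Omega>" for z
    using M[of z] G(2)[OF that] that closure_subset[of \<Omega>] by auto
  have "uniformly_continuous_on \<Omega> v"
    unfolding uniformly_continuous_on_def
  proof (intro allI impI)
    fix e :: real assume e: "0 < e"
    define d where "d = e / (2 * \<bar>M\<bar> + 1)"
    have "0 < d" using e by (simp add: d_def add_nonneg_pos)
    moreover have "dist (v w) (v z) < e" if zw: "z \<in> \<Omega>" "w \<in> \<Omega>" "dist w z < d" for z w
    proof -
      have "\<bar>v w - v z\<bar> \<le> 2 * M * dist w z" by (rule lipschitz_of_bounded_gradient[OF M' zw(2,1)])
      also have "... \<le> 2 * \<bar>M\<bar> * dist w z" by (intro mult_right_mono) auto
      also have "... \<le> 2 * \<bar>M\<bar> * d" using zw(3) by (intro mult_left_mono) auto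
      also have "... < (2 * \<bar>M\<bar> + 1) * d" using \<open>0 < d\<close> by simp
      also have "... = e" by (simp add: d_def)
      finally show ?thesis by (simp add: dist_real_def)
    qed
    ultimately show "\<exists>d>0. \<forall>z\<in>\<Omega>. \<forall>w\<in>\<Omega>. dist w z < d \<longrightarrow> dist (v w) (v z) < e" by blast
  qed
  then obtain V where V: "uniformly_continuous_on (closure \<Omega>) V" "\<And>z. z \<in> \<Omega> \<Longrightarrow> v z = V z"
    by (rule uniformly_continuous_on_extension_on_closure) blast
  have "C1_extension \<Omega> (closure \<Omega>) u V G"
    unfolding C1_extension_def
  proof (intro conjI ballI)
    show "AE z in lebesgue_on \<Omega>. u z = V z"
      using u AE_space by eventually_elim (simp add: V(2))
    show "GDERIV V z :> G z" if "z \<in> \<Omega>" for z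
      using GDERIV_transform_within_open[OF grad[OF that] op that V(2)] G(2)[OF that] by simp
    show "continuous_on (closure \<Omega>) V" by (rule uniformly_continuous_imp_continuous[OF V(1)])
  qed (rule G(1))
  then show ?thesis unfolding C1_closure_def by blast
qed

end

section \<open>The equivalence\<close>

theorem theorem1p1:
  fixes r1 r2 lam a b :: real and u :: "real \<times> real \<Rightarrow> real"
  assumes "0 < r1" and "0 < r2" and "1 < lam" and "0 < a" and "0 < b"
    and "weak_solution r1 r2 lam a b u"
  shows "bergs_effect r1 r2 lam a b \<longleftrightarrow> C1_closure (annulus r1 r2 lam) u"
proof
  interpret annulus_geometry r1 r2 lam by unfold_locales (fact assms)+
  assume "bergs_effect r1 r2 lam a b"
  then obtain w v g where w: "weak_solution r1 r2 lam a b w" "C1_extension \<Omega> (\<Omega> \<union> top_side r1 r2 \<union> right_side r1 r2) w v g"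
    and top: "\<And>z. z \<in> top_side r1 r2 \<Longrightarrow> fst z * fst (g z) \<le> 0"
    and right: "\<And>z. z \<in> right_side r1 r2 \<Longrightarrow> snd z * snd (g z) \<le> 0"
    unfolding bergs_effect_def by blast
  interpret W: weak_C1_solution r1 r2 lam a b w v g by unfold_locales (fact assms w)+
  \<comment> \<open>\<open>bergs_effect\<close> may supply a different weak solution; uniqueness
    identifies its class with that of u.\<close>
  have "AE z in lebesgue_on \<Omega>. u z = w z" by (rule weak_solution_unique[OF r assms(6) w(1)])
  then have "AE z in lebesgue_on \<Omega>. u z = v z" using W.AE_u_v by eventually_elim simp
  with top right show "C1_closure \<Omega> u" by (rule annulus_solution.C1_closure_of_signs[OF W.annulus_solution])
next
  interpret annulus_geometry r1 r2 lam by unfold_locales (fact assms)+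
  assume "C1_closure \<Omega> u"
  then obtain v g where ext: "C1_extension \<Omega> (closure \<Omega>) u v g" unfolding C1_closure_def by blast
  have "top_side r1 r2 \<subseteq> closure \<Omega>" "right_side r1 r2 \<subseteq> closure \<Omega>"
    using R r by (auto simp: top_side_def right_side_def closure_iff)
  then have "\<Omega> \<union> top_side r1 r2 \<union> right_side r1 r2 \<subseteq> closure \<Omega>" using closure_subset by blast
  then have ext': "C1_extension \<Omega> (\<Omega> \<union> top_side r1 r2 \<union> right_side r1 r2) u v g"
    using ext by (auto simp: C1_extension_def intro: continuous_on_subset)
  interpret W: weak_C1_solution r1 r2 lam a b u v g by unfold_locales (fact assms ext')+
  have gcl: "continuous_on (closure \<Omega>) g" using ext by (simp add: C1_extension_def)
  show "bergs_effect r1 r2 lam a b"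
    unfolding bergs_effect_def
    using assms(6) ext' annulus_solution.sign_top[OF W.annulus_solution gcl] annulus_solution.sign_right[OF W.annulus_solution gcl]
    by blast
qed

end
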